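(* Let $t,s>0$ satisfy $t+s>1$, let $K\in(\Sigma_t^s)'(\mathbf R^{2d})$, and let $\mathscr K:\Sigma_t^s(\mathbf R^d)\to(\Sigma_t^s)'(\mathbf R^d)$ be the continuous linear operator with Schwartz kernel $K$, defined by $(\mathscr K f,g)=(K,g\otimes\overline f)$ for $f,g\in\Sigma_t^s(\mathbf R^d)$. Suppose that $\mathrm{WF}_1^{t,s}(K)=\mathrm{WF}_2^{t,s}(K)=\emptyset$. Then $\mathscr K$ is continuous on $\Sigma_t^s(\mathbf R^d)$, extends uniquely to a continuous operator on $(\Sigma_t^s)'(\mathbf R^d)$, and for every $u\in(\Sigma_t^s)'(\mathbf R^d)$ we have $$\mathrm{WF}^{t,s}(\mathscr K u)\subseteq \mathrm{WF}^{t,s}(K)'\circ \mathrm{WF}^{t,s}(u).$$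
   Context: Gelfand--Shilov spaces. For $s,t,h>0$ let $\mathcal S_{t,h}^s(\mathbf R^d)$ be the Banach space of $f\in C^\infty(\mathbf R^d)$ with $\|f\|_{\mathcal S_{t,h}^s}=\sup_{x\in\mathbf R^d,\ \alpha,\beta\in\mathbf N^d}\frac{|x^\alpha D^\beta f(x)|}{h^{|\alpha+\beta|}\alpha!^t\beta!^s}<\infty$. Then $\Sigma_t^s(\mathbf R^d)=\bigcap_{h>0}\mathcal S_{t,h}^s(\mathbf R^d)$ with the Fréchet topology given by the seminorms $\|\cdot\|_{\mathcal S_{t,h}^s}$, $h>0$ (nontrivial iff $t+s>1$), and $(\Sigma_t^s)'(\mathbf R^d)$ is its topological dual, equipped with the weak$^*$ topology. The pairing $(u,f)$ of $u\in(\Sigma_t^s)'$ and $f\in\Sigma_t^s$ is conjugate linear in $f$, consistent with the $L^2$ inner product (conjugate linear in the second argument). Short-time Fourier transform. For $\psi\in\Sigma_t^s(\mathbf R^d)\setminus 0$ and $u\in(\Sigma_t^s)'(\mathbf R^d)$, $V_\psi u(x,\xi)=(2\pi)^{-d/2}(u,M_\xi T_x\psi)$, $x,\xi\in\mathbf R^d$, where $T_x f(y)=f(y-x)$ and $M_\xi f(y)=e^{i\langle y,\xi\rangle}f(y)$. Wave front set. $T^*\mathbf R^d\setminus 0$ means $\mathbf R^{2d}\setminus\{0\}$. For $t,s>0$ with $t+s>1$, $u\in(\Sigma_t^s)'(\mathbf R^d)$ and $\psi\in\Sigma_t^s(\mathbf R^d)\setminus 0$, the set $\mathrm{WF}^{t,s}(u)\subseteq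 T^*\mathbf R^d\setminus 0$ is defined by: $(x_0,\xi_0)\notin\mathrm{WF}^{t,s}(u)$ iff there is an open set $U\subseteq T^*\mathbf R^d\setminus 0$ containing $(x_0,\xi_0)$ such that $\sup_{\lambda>0,\,(x,\xi)\in U}e^{r\lambda}|V_\psi u(\lambda^t x,\lambda^s\xi)|<\infty$ for all $r>0$. It does not depend on $\psi$. The same definition with $2d$ in place of $d$ is used for $K$; points of $T^*\mathbf R^{2d}$ are written $(x,y,\xi,\eta)$ with space variables $(x,y)$ and frequency variables $(\xi,\eta)$. Set $\mathrm{WF}_1^{t,s}(K)=\{(x,\xi)\in T^*\mathbf R^d:\ (x,0,\xi,0)\in\mathrm{WF}^{t,s}(K)\}$ and $\mathrm{WF}_2^{t,s}(K)=\{(y,\eta)\in T^*\mathbf R^d:\ (0,y,0,-\eta)\in\mathrm{WF}^{t,s}(K)\}$. For $A\subseteq T^*\mathbf R^{2d}$ and $B\subseteq T^*\mathbf R^d$: $A'\circ B=\{(x,\xi)\in\mathbf R^{2d}:\ \exists (y,\eta)\in B,\ (x,y,\xi,-\eta)\in A\}$. *)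

theory Defs
  imports "HOL-Analysis.Analysis"
begin

text \<open>
  The space $\mathbf R^d$ is an arbitrary Euclidean space \<open>'a\<close>, with coordinates \<open>x \<bullet> b\<close>
  for \<open>b \<in> Basis\<close> and \<open>d = DIM('a)\<close>; then $\mathbf R^{2d}$ is \<open>'a \<times> 'a\<close>.
  Multi-indices are functions \<open>'a \<Rightarrow> nat\<close>, of which only the values on \<open>Basis\<close> are ever used.
\<close>

section \<open>Smooth functions and multi-index notation\<close>

definition pderivative :: "'a::euclidean_space \<Rightarrow> ('a \<Rightarrow> complex) \<Rightarrow> 'a \<Rightarrow> complex" where
  "pderivative b f = (\<lambda>x. frechet_derivative f (at x) b)"

fun C_k :: "nat \<Rightarrow> ('a::euclidean_space \<Rightarrow> complex) \<Rightarrow> bool" where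
  "C_k 0 f \<longleftrightarrow> continuous_on UNIV f"
| "C_k (Suc k) f \<longleftrightarrow> (\<forall>x. f differentiable (at x)) \<and> (\<forall>b\<in>Basis. C_k k (pderivative b f))"

definition C_infinity :: "('a::euclidean_space \<Rightarrow> complex) set" where
  "C_infinity = {f. \<forall>k. C_k k f}"

definition mi_size :: "('a::euclidean_space \<Rightarrow> nat) \<Rightarrow> nat" where
  "mi_size \<alpha> = (\<Sum>b\<in>Basis. \<alpha> b)"

definition mi_fact :: "('a::euclidean_space \<Rightarrow> nat) \<Rightarrow> real" where
  "mi_fact \<alpha> = (\<Prod>b\<in>Basis. fact (\<alpha> b))"

definition mi_power :: "'a::euclidean_space \<Rightarrow> ('a \<Rightarrow> nat) \<Rightarrow> real" where
  "mi_power x \<alpha> = (\<Prod>b\<in>Basis. (x \<bullet> b) ^ \<alpha> b)"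

text \<open>
  The operator \<open>D\<^sub>b = -\<i> \<partial>\<^sub>b\<close>. The powers of these operators are composed along a fixed enumeration
  of the basis; by symmetry of second derivatives the order is immaterial for smooth functions.
\<close>

definition Dop :: "'a::euclidean_space \<Rightarrow> ('a \<Rightarrow> complex) \<Rightarrow> 'a \<Rightarrow> complex" where
  "Dop b f = (\<lambda>x. - \<i> * pderivative b f x)"

definition basis_enum :: "'a::euclidean_space list" where
  "basis_enum = (SOME bs. distinct bs \<and> set bs = Basis)"

definition mi_D :: "('a::euclidean_space \<Rightarrow> nat) \<Rightarrow> ('a \<Rightarrow> complex) \<Rightarrow> 'a \<Rightarrow> complex" where
  "mi_D \<beta> f = foldr (\<lambda>b g. (Dop b ^^ \<beta> b) g) basis_enum f"

section \<open>Gelfand--Shilov spaces and their duals\<close>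

definition GS_quot ::
    "real \<Rightarrow> real \<Rightarrow> real \<Rightarrow> ('a::euclidean_space \<Rightarrow> complex) \<Rightarrow> 'a \<times> ('a \<Rightarrow> nat) \<times> ('a \<Rightarrow> nat) \<Rightarrow> real" where
  "GS_quot t s h f = (\<lambda>(x, \<alpha>, \<beta>).
     cmod (of_real (mi_power x \<alpha>) * mi_D \<beta> f x)
       / (h ^ mi_size (\<lambda>b. \<alpha> b + \<beta> b) * mi_fact \<alpha> powr t * mi_fact \<beta> powr s))"

definition GS_banach :: "real \<Rightarrow> real \<Rightarrow> real \<Rightarrow> ('a::euclidean_space \<Rightarrow> complex) set" where
  "GS_banach t s h = {f \<in> C_infinity. bdd_above (range (GS_quot t s h f))}"

definition GS_norm :: "real \<Rightarrow> real \<Rightarrow> real \<Rightarrow> ('a::euclidean_space \<Rightarrow> complex) \<Rightarrow> real" where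
  "GS_norm t s h f = (SUP z. GS_quot t s h f z)"

definition GS :: "real \<Rightarrow> real \<Rightarrow> ('a::euclidean_space \<Rightarrow> complex) set" where
  "GS t s = (\<Inter>h\<in>{0<..}. GS_banach t s h)"

definition GS_topology :: "real \<Rightarrow> real \<Rightarrow> ('a::euclidean_space \<Rightarrow> complex) topology" where
  "GS_topology t s = topology_generated_by
     {{g \<in> GS t s. GS_norm t s h (\<lambda>x. g x - f x) < \<epsilon>} | f h \<epsilon>. f \<in> GS t s \<and> h > 0 \<and> \<epsilon> > 0}"

definition clinear_on :: "('p \<Rightarrow> complex) set \<Rightarrow> (('p \<Rightarrow> complex) \<Rightarrow> ('q \<Rightarrow> complex)) \<Rightarrow> bool" where
  "clinear_on S T \<longleftrightarrow> (\<forall>f\<in>S. \<forall>g\<in>S. \<forall>a b.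
     T (\<lambda>x. a * f x + b * g x) = (\<lambda>y. a * T f y + b * T g y))"

definition clinear_functional_on :: "('p \<Rightarrow> complex) set \<Rightarrow> (('p \<Rightarrow> complex) \<Rightarrow> complex) \<Rightarrow> bool" where
  "clinear_functional_on S u \<longleftrightarrow> (\<forall>f\<in>S. \<forall>g\<in>S. \<forall>a b.
     u (\<lambda>x. a * f x + b * g x) = a * u f + b * u g)"

text \<open>
  An element of the dual is a continuous linear functional on \<open>GS t s\<close>; it is set to \<open>0\<close> outside
  \<open>GS t s\<close>, so that equality of functionals is equality of HOL functions.
\<close>

definition GS_dual :: "real \<Rightarrow> real \<Rightarrow> (('a::euclidean_space \<Rightarrow> complex) \<Rightarrow> complex) set" where
  "GS_dual t s = {u. clinear_functional_on (GS t s) u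
      \<and> continuous_map (GS_topology t s) euclidean u
      \<and> (\<forall>\<phi>. \<phi> \<notin> GS t s \<longrightarrow> u \<phi> = 0)}"

definition GS_dual_topology :: "real \<Rightarrow> real \<Rightarrow> (('a::euclidean_space \<Rightarrow> complex) \<Rightarrow> complex) topology" where
  "GS_dual_topology t s = topology_generated_by
     {{v \<in> GS_dual t s. cmod (v \<phi> - u \<phi>) < \<epsilon>} | u \<phi> \<epsilon>. u \<in> GS_dual t s \<and> \<phi> \<in> GS t s \<and> \<epsilon> > 0}"

text \<open>The pairing \<open>(u, f)\<close>, conjugate linear in \<open>f\<close>.\<close>

definition GS_pair :: "(('a::euclidean_space \<Rightarrow> complex) \<Rightarrow> complex) \<Rightarrow> ('a \<Rightarrow> complex) \<Rightarrow> complex" where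
  "GS_pair u f = u (\<lambda>x. cnj (f x))"

text \<open>
  The inclusion of \<open>GS t s\<close> into its dual: for \<open>f\<close>, \<open>g\<close> in \<open>GS t s\<close> one has
  \<open>GS_pair (GS_embed t s f) g = \<integral> f x * cnj (g x) dx\<close>.
\<close>

definition GS_embed ::
    "real \<Rightarrow> real \<Rightarrow> ('a::euclidean_space \<Rightarrow> complex) \<Rightarrow> ('a \<Rightarrow> complex) \<Rightarrow> complex" where
  "GS_embed t s f = (\<lambda>\<phi>. if \<phi> \<in> GS t s then (LINT x|lborel. f x * \<phi> x) else 0)"

section \<open>Short-time Fourier transform and wave front set\<close>

definition translation :: "'a::euclidean_space \<Rightarrow> ('a \<Rightarrow> complex) \<Rightarrow> 'a \<Rightarrow> complex" where
  "translation x f = (\<lambda>y. f (y - x))"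

definition modulation :: "'a::euclidean_space \<Rightarrow> ('a \<Rightarrow> complex) \<Rightarrow> 'a \<Rightarrow> complex" where
  "modulation \<xi> f = (\<lambda>y. exp (\<i> * of_real (y \<bullet> \<xi>)) * f y)"

definition STFT ::
    "('a::euclidean_space \<Rightarrow> complex) \<Rightarrow> (('a \<Rightarrow> complex) \<Rightarrow> complex) \<Rightarrow> 'a \<Rightarrow> 'a \<Rightarrow> complex" where
  "STFT \<psi> u x \<xi> =
     of_real ((2 * pi) powr (- real DIM('a) / 2)) * GS_pair u (modulation \<xi> (translation x \<psi>))"

text \<open>
  The wave front set computed with the window \<open>\<psi>\<close>, a nonzero element of \<open>GS t s\<close>. It does not depend
  on \<open>\<psi>\<close>; the window is kept as a parameter so that no particular one has to be chosen.
\<close>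

definition WF ::
    "real \<Rightarrow> real \<Rightarrow> ('a::euclidean_space \<Rightarrow> complex) \<Rightarrow> (('a \<Rightarrow> complex) \<Rightarrow> complex) \<Rightarrow> ('a \<times> 'a) set" where
  "WF t s \<psi> u = {z. z \<noteq> 0 \<and> \<not> (\<exists>U. open U \<and> U \<subseteq> - {0} \<and> z \<in> U \<and>
      (\<forall>r>0. bdd_above {exp (r * \<mu>) * cmod (STFT \<psi> u ((\<mu> powr t) *\<^sub>R x) ((\<mu> powr s) *\<^sub>R \<xi>)) | \<mu> x \<xi>.
                 \<mu> > 0 \<and> (x, \<xi>) \<in> U}))}"

text \<open>
  For kernels \<open>K\<close> on \<open>'a \<times> 'a\<close> the point $(x,y,\xi,\eta)$ is \<open>((x, y), (\<xi>, \<eta>))\<close>.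
\<close>

definition WF1 ::
    "real \<Rightarrow> real \<Rightarrow> ('a::euclidean_space \<times> 'a \<Rightarrow> complex) \<Rightarrow> (('a \<times> 'a \<Rightarrow> complex) \<Rightarrow> complex) \<Rightarrow> ('a \<times> 'a) set" where
  "WF1 t s \<Psi> K = {(x, \<xi>). ((x, 0), (\<xi>, 0)) \<in> WF t s \<Psi> K}"

definition WF2 ::
    "real \<Rightarrow> real \<Rightarrow> ('a::euclidean_space \<times> 'a \<Rightarrow> complex) \<Rightarrow> (('a \<times> 'a \<Rightarrow> complex) \<Rightarrow> complex) \<Rightarrow> ('a \<times> 'a) set" where
  "WF2 t s \<Psi> K = {(y, \<eta>). ((0, y), (0, - \<eta>)) \<in> WF t s \<Psi> K}"

text \<open>The set $A' \circ B$.\<close>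

definition twisted_comp ::
    "(('a::euclidean_space \<times> 'a) \<times> ('a \<times> 'a)) set \<Rightarrow> ('a \<times> 'a) set \<Rightarrow> ('a \<times> 'a) set" where
  "twisted_comp A B = {(x, \<xi>). \<exists>(y, \<eta>)\<in>B. ((x, y), (\<xi>, - \<eta>)) \<in> A}"

section \<open>Operators with kernel in the dual\<close>

definition tensor :: "('a \<Rightarrow> complex) \<Rightarrow> ('a \<Rightarrow> complex) \<Rightarrow> 'a \<times> 'a \<Rightarrow> complex" where
  "tensor g f = (\<lambda>(x, y). g x * f y)"

text \<open>
  The operator with kernel \<open>K\<close>. Its defining identity
  \<open>(\<K> f, g) = (K, g \<otimes> cnj f)\<close> is \<open>kernel_op_pair\<close> below.
\<close>

definition kernel_op ::
    "real \<Rightarrow> real \<Rightarrow> (('a::euclidean_space \<times> 'a \<Rightarrow> complex) \<Rightarrow> complex) \<Rightarrow> ('a \<Rightarrow> complex) \<Rightarrow> ('a \<Rightarrow> complex) \<Rightarrow> complex" where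
  "kernel_op t s K f = (\<lambda>\<phi>. if \<phi> \<in> GS t s
     then GS_pair K (tensor (\<lambda>x. cnj (\<phi> x)) (\<lambda>y. cnj (f y))) else 0)"

lemma pderivative_cnj:
  assumes "f differentiable (at x)"
  shows "pderivative b (\<lambda>x. cnj (f x)) x = cnj (pderivative b f x)"
proof -
  have "(f has_derivative frechet_derivative f (at x)) (at x)"
    using assms by (simp add: frechet_derivative_works)
  then have "((\<lambda>x. cnj (f x)) has_derivative (\<lambda>h. cnj (frechet_derivative f (at x) h))) (at x)"
    by (rule has_derivative_cnj)
  then show ?thesis
    unfolding pderivative_def by (metis frechet_derivative_at)
qed

lemma C_k_cnj: "C_k k f \<Longrightarrow> C_k k (\<lambda>x. cnj (f x))"
proof (induction k arbitrary: f)
  case 0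
  then show ?case by (auto intro: continuous_on_cnj)
next
  case (Suc k)
  then have d: "\<And>x. f differentiable (at x)" by simp
  then have "(\<lambda>x. cnj (f x)) differentiable (at x)" for x
    unfolding differentiable_def using has_derivative_cnj by blast
  moreover have "pderivative b (\<lambda>x. cnj (f x)) = (\<lambda>x. cnj (pderivative b f x))" for b
    using d pderivative_cnj by blast
  ultimately show ?case using Suc.IH Suc.prems by simp
qed

lemma C_k_cmult: "C_k k f \<Longrightarrow> C_k k (\<lambda>x. c * f x)"
proof (induction k arbitrary: f)
  case 0
  then show ?case by (auto intro: continuous_intros)
next
  case (Suc k)
  then have d: "\<And>x. f differentiable (at x)" by simp
  have h: "((\<lambda>x. c * f x) has_derivative (\<lambda>h. c * frechet_derivative f (at x) h)) (at x)" for x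
    using d by (intro has_derivative_mult_right) (simp add: frechet_derivative_works[symmetric])
  then have "\<And>x. (\<lambda>x. c * f x) differentiable (at x)"
    unfolding differentiable_def by blast
  moreover have "pderivative b (\<lambda>x. c * f x) = (\<lambda>x. c * pderivative b f x)" for b
    unfolding pderivative_def using h by (metis frechet_derivative_at)
  ultimately show ?case using Suc.IH Suc.prems by simp
qed

lemma Dop_C_infinity:
  assumes "b \<in> Basis" "f \<in> C_infinity"
  shows "Dop b f \<in> C_infinity"
proof -
  have "C_k k (pderivative b f)" for k
    using assms C_k.simps(2)[of k f] unfolding C_infinity_def by blast
  then show ?thesis
    unfolding C_infinity_def Dop_def by (blast intro: C_k_cmult)
qed

lemma Dop_cnj:
  assumes "f \<in> C_infinity"
  shows "Dop b (\<lambda>x. cnj (f x)) = (\<lambda>x. - cnj (Dop b f x))"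
proof -
  have "\<And>x. f differentiable (at x)"
    using assms C_k.simps(2)[of 0 f] unfolding C_infinity_def by blast
  then show ?thesis by (simp add: Dop_def pderivative_cnj)
qed

lemma Dop_uminus:
  assumes "f \<in> C_infinity"
  shows "Dop b (\<lambda>x. - f x) = (\<lambda>x. - Dop b f x)"
proof -
  have d: "\<And>x. f differentiable (at x)"
    using assms C_k.simps(2)[of 0 f] unfolding C_infinity_def by blast
  have "((\<lambda>x. - f x) has_derivative (\<lambda>h. - frechet_derivative f (at x) h)) (at x)" for x
    using d by (intro has_derivative_minus) (simp add: frechet_derivative_works[symmetric])
  then have "pderivative b (\<lambda>x. - f x) x = - pderivative b f x" for x
    unfolding pderivative_def by (metis frechet_derivative_at)
  then show ?thesis by (simp add: Dop_def)
qed

lemma C_infinity_cnj: "f \<in> C_infinity \<Longrightarrow> (\<lambda>x. cnj (f x)) \<in> C_infinity"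
  unfolding C_infinity_def by (simp add: C_k_cnj)

definition cnj_related :: "('a::euclidean_space \<Rightarrow> complex) \<Rightarrow> ('a \<Rightarrow> complex) \<Rightarrow> bool" where
  "cnj_related f g \<longleftrightarrow> f \<in> C_infinity \<and> (g = (\<lambda>x. cnj (f x)) \<or> g = (\<lambda>x. - cnj (f x)))"

lemma cnj_related_Dop: 
  assumes "b \<in> Basis" "cnj_related f g" shows "cnj_related (Dop b f) (Dop b g)"
proof -
  have f: "f \<in> C_infinity" using assms(2) unfolding cnj_related_def by blast
  show ?thesis
    using assms(2) Dop_C_infinity[OF assms(1) f] Dop_cnj[OF f, of b]
      Dop_uminus[OF C_infinity_cnj[OF f], of b]
    unfolding cnj_related_def by auto
qed

lemma set_basis_enum: "set (basis_enum :: 'a::euclidean_space list) = Basis"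
proof -
  have "\<exists>bs::'a::euclidean_space list. distinct bs \<and> set bs = Basis"
    using finite_distinct_list[OF finite_Basis] by blast
  from someI_ex[OF this] show ?thesis unfolding basis_enum_def by blast
qed

lemma cnj_related_mi_D:
  assumes "cnj_related f g" shows "cnj_related (mi_D \<beta> f) (mi_D \<beta> g)"
proof -
  have p: "cnj_related ((Dop b ^^ n) f) ((Dop b ^^ n) g)"
    if "b \<in> Basis" "cnj_related f g" for b n and f g :: "'a \<Rightarrow> complex"
    using that by (induction n) (auto intro: cnj_related_Dop)
  have "cnj_related (foldr (\<lambda>b g. (Dop b ^^ \<beta> b) g) bs f) (foldr (\<lambda>b g. (Dop b ^^ \<beta> b) g) bs g)"
    if "set bs \<subseteq> Basis" for bs
    using that assms by (induction bs) (auto intro: p)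
  then show ?thesis unfolding mi_D_def by (simp add: set_basis_enum)
qed

lemma GS_cnj:
  assumes "f \<in> GS t s" shows "(\<lambda>x. cnj (f x)) \<in> GS t s"
proof -
  have f: "f \<in> C_infinity"
    using assms unfolding GS_def GS_banach_def by (auto dest: bspec[where x = 1])
  then have "cnj_related (mi_D \<beta> f) (mi_D \<beta> (\<lambda>x. cnj (f x)))" for \<beta>
    by (intro cnj_related_mi_D) (simp add: cnj_related_def)
  then have "mi_D \<beta> (\<lambda>x. cnj (f x)) = (\<lambda>x. cnj (mi_D \<beta> f x)) \<or>
      mi_D \<beta> (\<lambda>x. cnj (f x)) = (\<lambda>x. - cnj (mi_D \<beta> f x))" for \<beta>
    unfolding cnj_related_def by blast
  then have "cmod (mi_D \<beta> (\<lambda>x. cnj (f x)) x) = cmod (mi_D \<beta> f x)" for \<beta> x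
    by (metis complex_mod_cnj norm_minus_cancel)
  then have "GS_quot t s h (\<lambda>x. cnj (f x)) = GS_quot t s h f" for h
    unfolding GS_quot_def by (simp add: norm_mult)
  then show ?thesis
    using assms f C_infinity_cnj unfolding GS_def GS_banach_def by auto
qed

lemma kernel_op_pair:
  assumes "g \<in> GS t s"
  shows "GS_pair (kernel_op t s K f) g = GS_pair K (tensor g (\<lambda>y. cnj (f y)))"
  using GS_cnj[OF assms] by (simp add: GS_pair_def kernel_op_def)

text \<open>
  Continuity of \<open>\<K>\<close> on \<open>GS t s\<close> means that \<open>\<K>\<close>, a priori with values in the dual,
  takes values in (the image of) \<open>GS t s\<close> and is continuous for its topology.
\<close>

definition continuous_operator_on_GS ::
    "real \<Rightarrow> real \<Rightarrow> (('a::euclidean_space \<Rightarrow> complex) \<Rightarrow> ('a \<Rightarrow> complex) \<Rightarrow> complex) \<Rightarrow> bool" where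
  "continuous_operator_on_GS t s T \<longleftrightarrow>
     (\<exists>T0. clinear_on (GS t s) T0 \<and> continuous_map (GS_topology t s) (GS_topology t s) T0
         \<and> (\<forall>f\<in>GS t s. T f = GS_embed t s (T0 f)))"

definition continuous_dual_extension ::
    "real \<Rightarrow> real \<Rightarrow> (('a::euclidean_space \<Rightarrow> complex) \<Rightarrow> ('a \<Rightarrow> complex) \<Rightarrow> complex)
      \<Rightarrow> ((('a \<Rightarrow> complex) \<Rightarrow> complex) \<Rightarrow> ('a \<Rightarrow> complex) \<Rightarrow> complex) \<Rightarrow> bool" where
  "continuous_dual_extension t s T E \<longleftrightarrow>
     clinear_on (GS_dual t s) E
     \<and> continuous_map (GS_dual_topology t s) (GS_dual_topology t s) E
     \<and> (\<forall>f\<in>GS t s. E (GS_embed t s f) = T f)"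

end

theory Submission
  imports Defs "HOL-Probability.Probability"
begin

text \<open>
  The proof works with the coefficients of functions and functionals with respect to time-frequency
  atoms \<open>M\<^sub>\<xi> T\<^sub>x \<psi>\<close>, that is, with the short-time Fourier transform, and measures their size in terms of the
  weight \<open>rho (x, \<xi>) = |x|\<^sup>1\<^sup>/\<^sup>t + |\<xi>|\<^sup>1\<^sup>/\<^sup>s\<close>. It is homogeneous of degree one under the anisotropic dilations
  \<open>(x, \<xi>) \<mapsto> (\<mu>\<^sup>t x, \<mu>\<^sup>s \<xi>)\<close> from the definition of the wave front set.

  Three facts turn the statement into one about coefficients. The coefficients of a test function
  decay faster than \<open>exp (- r rho)\<close> for every \<open>r\<close> (\<open>atom_decay\<close>), and those of a functional grow at most
  like some \<open>exp (R rho)\<close> (\<open>bfun_family_bound\<close>). A test function is the superposition of the atoms with its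
  coefficients as weights, by Fourier inversion (\<open>atom_inversion\<close>). Conversely a superposition with
  rapidly decaying weights is a test function, and functionals commute with it (\<open>synthesis\<close>): such a superposition
  is approximated by finite sums that stay bounded and converge pointwise, and in a Montel space
  functionals are continuous along such sequences (\<open>bfun_tendsto\<close>). All estimates use
  a description of the seminorms by stretched exponential decay of derivatives (\<open>GSB\<close>).

  In these terms the operator with kernel \<open>K\<close> is an infinite matrix indexed by two points \<open>z\<close>, \<open>w\<close> of phase
  space: its entries are the coefficients of \<open>K\<close> itself at the point \<open>kernel_point z w\<close>, for a tensor product
  window (\<open>tensor_atom\<close>). The wave front set does not depend on the window (\<open>regular_at_window\<close>), and so
  the hypothesis that \<open>WF1\<close> is empty says that the matrix decays along the points \<open>(z, 0)\<close>; by compactness and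
  dilation it decays in a cone \<open>rho w \<le> \<epsilon> rho z\<close> (\<open>cone_decay\<close>). Outside of this cone the rapid decay of the
  coefficients of a test function at \<open>w\<close> compensates the growth of the matrix. The operator therefore maps test
  functions to test functions, continuously (\<open>gframe_operator\<close>). Emptiness of \<open>WF2\<close> gives the same for the
  transposed operator \<open>T'\<close>, and \<open>u \<mapsto> u \<circ> T'\<close> is a weakly continuous extension to the dual
  (\<open>transpose_continuous\<close>). It is unique because test functions are weakly dense
  (\<open>interpolation\<close>, \<open>continuous_dual_extension_unique\<close>).

  For the inclusion of wave front sets, a coefficient of \<open>\<K> u\<close> is an integral over \<open>w\<close> of the
  matrix against the coefficients of \<open>u\<close>. Dilate \<open>z\<close> and \<open>w\<close> by \<open>\<mu>\<close>. Then the points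
  \<open>w\<close> far out contribute little, since the matrix decays in the cone that belongs to \<open>WF2\<close>. On the remaining compact set, if \<open>z\<close> is
  outside the composed set, near each \<open>w\<close> one of the two factors decays faster than every \<open>exp (- r \<mu>)\<close>
  while the other one grows at most exponentially in \<open>\<mu>\<close> (\<open>regular_at_composition\<close>).
\<close>

section \<open>Multi-index calculus for smooth functions\<close>

definition mi_inc :: "'a \<Rightarrow> ('a \<Rightarrow> nat) \<Rightarrow> 'a \<Rightarrow> nat" where
  "mi_inc b \<beta> = \<beta>(b := Suc (\<beta> b))"

lemma mi_size_inc [simp]: "b \<in> Basis \<Longrightarrow> mi_size (mi_inc b \<beta>) = Suc (mi_size \<beta>)"
  by (simp add: mi_size_def mi_inc_def sum.remove[of Basis b])

lemma mi_power_inc: "b \<in> Basis \<Longrightarrow> mi_power x (mi_inc b \<beta>) = (x \<bullet> b) * mi_power x \<beta>"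
  by (simp add: mi_power_def mi_inc_def prod.remove[of Basis b])

lemma mi_fact_pos: "mi_fact \<beta> > 0"
  by (simp add: mi_fact_def prod_pos)

lemma mi_fact_add: "mi_fact \<beta> * mi_fact \<gamma> \<le> mi_fact (\<lambda>b. \<beta> b + \<gamma> b)"
proof -
  have "fact m * fact n \<le> (fact (m + n) :: real)" for m n
  proof -
    have "fact m * fact n \<le> (fact (m + n) :: nat)"
      by (rule dvd_imp_le[OF fact_fact_dvd_fact]) simp
    then show ?thesis by (metis of_nat_fact of_nat_le_iff of_nat_mult)
  qed
  then show ?thesis by (simp add: mi_fact_def prod.distrib[symmetric] prod_mono)
qed

lemma mi_size_add: "mi_size (\<lambda>b. \<beta> b + \<gamma> b) = mi_size \<beta> + mi_size \<gamma>"
  by (simp add: mi_size_def sum.distrib)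

lemma mi_induct [case_names zero inc]:
  fixes P :: "('a::euclidean_space \<Rightarrow> nat) \<Rightarrow> bool"
  assumes "\<And>\<beta>. (\<And>b. b \<in> Basis \<Longrightarrow> \<beta> b = 0) \<Longrightarrow> P \<beta>"
    and "\<And>\<beta> b. b \<in> Basis \<Longrightarrow> P \<beta> \<Longrightarrow> P (mi_inc b \<beta>)"
  shows "P \<beta>"
proof (induction "mi_size \<beta>" arbitrary: \<beta>)
  case 0
  then show ?case by (intro assms(1)) (simp add: mi_size_def)
next
  case (Suc n)
  then obtain b where b: "b \<in> Basis" "\<beta> b > 0"
    unfolding mi_size_def by (metis bot_nat_0.not_eq_extremum nat.distinct(1) sum.neutral)
  define \<gamma> where "\<gamma> = \<beta>(b := \<beta> b - 1)"
  have \<beta>: "\<beta> = mi_inc b \<gamma>" using b by (auto simp: \<gamma>_def mi_inc_def)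
  have "n = mi_size \<gamma>" using Suc(2) b unfolding \<beta> by simp
  then have "P \<gamma>" by (rule Suc(1))
  then show ?case unfolding \<beta> using b assms(2) by blast
qed

subsection \<open>Jets\<close>

text \<open>
  A jet is a family \<open>g\<close> of functions that is closed under differentiation in the way in which the
  derivatives \<open>D\<^sup>\<beta> f\<close> of a smooth function are. To show that a function is smooth and to compute
  its derivatives it then suffices to guess the whole family and to check first derivatives; the
  order in which partial derivatives are taken is absorbed by the symmetric indexing.
\<close>

definition jet :: "(('a::euclidean_space \<Rightarrow> nat) \<Rightarrow> 'a \<Rightarrow> complex) \<Rightarrow> bool" where
  "jet g \<longleftrightarrow> (\<forall>\<beta> x. (g \<beta> has_derivative
     (\<lambda>v. \<Sum>b\<in>Basis. of_real (v \<bullet> b) * (\<i> * g (mi_inc b \<beta>) x))) (at x))"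

lemma sum_Basis_delta:
  fixes b :: "'a::euclidean_space" and f :: "'a \<Rightarrow> complex"
  assumes "b \<in> Basis" shows "(\<Sum>c\<in>Basis. of_real (b \<bullet> c) * f c) = f b"
proof -
  have "(\<Sum>c\<in>Basis. of_real (b \<bullet> c) * f c) = (\<Sum>c\<in>Basis. if c = b then f c else 0)"
    using assms by (intro sum.cong) (auto simp: inner_Basis)
  then show ?thesis using assms by simp
qed

lemma jet_pderivative:
  assumes "jet g" "b \<in> Basis"
  shows "pderivative b (g \<beta>) = (\<lambda>x. \<i> * g (mi_inc b \<beta>) x)"
proof
  fix x
  have "(g \<beta> has_derivative (\<lambda>v. \<Sum>b\<in>Basis. of_real (v \<bullet> b) * (\<i> * g (mi_inc b \<beta>) x))) (at x)"
    using assms(1) unfolding jet_def by blast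
  from frechet_derivative_at[OF this, symmetric] show "pderivative b (g \<beta>) x = \<i> * g (mi_inc b \<beta>) x"
    by (simp add: pderivative_def sum_Basis_delta[OF assms(2)])
qed

lemma jet_Dop: "jet g \<Longrightarrow> b \<in> Basis \<Longrightarrow> Dop b (g \<beta>) = g (mi_inc b \<beta>)"
  by (rule ext) (simp add: Dop_def jet_pderivative mult.assoc[symmetric])

lemma jet_C_infinity:
  assumes "jet g" shows "g \<beta> \<in> C_infinity"
proof -
  have "C_k k (g \<beta>)" for k
  proof (induction k arbitrary: \<beta>)
    case 0
    then show ?case
      using assms unfolding jet_def C_k.simps continuous_on_eq_continuous_at[OF open_UNIV]
      by (meson has_derivative_continuous)
  next
    case (Suc k)
    then show ?case using assms
      by (auto simp: jet_pderivative jet_def differentiable_def intro!: C_k_cmult)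
  qed
  then show ?thesis by (simp add: C_infinity_def)
qed

lemma distinct_basis_enum: "distinct (basis_enum :: 'a::euclidean_space list)"
proof -
  have "\<exists>bs::'a::euclidean_space list. distinct bs \<and> set bs = Basis"
    using finite_distinct_list[OF finite_Basis] by blast
  from someI_ex[OF this] show ?thesis unfolding basis_enum_def by blast
qed

text \<open>
  A multi-index \<open>\<beta>\<close> matters only on \<open>Basis\<close>, but a jet may be indexed by functions that differ elsewhere;
  this picks the representative that iterated differentiation arrives at.
\<close>

definition on_Basis :: "('a::euclidean_space \<Rightarrow> nat) \<Rightarrow> 'a \<Rightarrow> nat" where
  "on_Basis \<beta> = (\<lambda>b. if b \<in> Basis then \<beta> b else 0)"

lemma jet_mi_D:
  assumes "jet g"
  shows "mi_D \<gamma> (g (\<lambda>_. 0)) = g (on_Basis \<gamma>)"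
proof -
  have p: "(Dop b ^^ n) (g \<beta>) = g (\<beta>(b := n + \<beta> b))" if "b \<in> Basis" for b n \<beta>
    by (induction n) (auto simp: jet_Dop[OF assms that] mi_inc_def intro!: arg_cong[where f = g])
  have "foldr (\<lambda>b g. (Dop b ^^ \<gamma> b) g) bs (g (\<lambda>_. 0)) = g (\<lambda>b. if b \<in> set bs then \<gamma> b else 0)"
    if "distinct bs" "set bs \<subseteq> Basis" for bs
    using that
  proof (induction bs)
    case (Cons a bs)
    then show ?case by (auto simp: p intro!: arg_cong[where f = g])
  qed simp
  from this[OF distinct_basis_enum] show ?thesis
    by (simp add: mi_D_def set_basis_enum on_Basis_def)
qed

lemma mi_D_cong: "(\<And>b. b \<in> Basis \<Longrightarrow> \<beta> b = \<gamma> b) \<Longrightarrow> mi_D \<beta> f = mi_D \<gamma> f"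
  unfolding mi_D_def by (rule foldr_cong) (auto simp: set_basis_enum)

lemma mi_D_on_Basis [simp]: "mi_D (on_Basis \<beta>) f = mi_D \<beta> f"
  by (rule mi_D_cong) (simp add: on_Basis_def)

lemma mi_D_zero: "(\<And>b. b \<in> Basis \<Longrightarrow> \<beta> b = 0) \<Longrightarrow> mi_D \<beta> f = f"
proof -
  assume "\<And>b. b \<in> Basis \<Longrightarrow> \<beta> b = 0"
  then have "mi_D \<beta> f = mi_D (\<lambda>_. 0) f" by (intro mi_D_cong)
  also have "\<dots> = f"
  proof -
    have "foldr (\<lambda>b a. a) bs f = f" for bs :: "'a list" by (induction bs) auto
    then show ?thesis by (simp add: mi_D_def)
  qed
  finally show ?thesis .
qed

lemma mi_D_0 [simp]: "mi_D (\<lambda>_. 0) f = f"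
  by (simp add: mi_D_zero)

subsection \<open>Symmetry of second derivatives\<close>

lemma C_infinity_differentiable: "f \<in> C_infinity \<Longrightarrow> f differentiable (at x)"
  using C_k.simps(2)[of 0 f] unfolding C_infinity_def by blast

lemma C_infinity_continuous: "f \<in> C_infinity \<Longrightarrow> continuous_on UNIV f"
  using C_k.simps(1)[of f] unfolding C_infinity_def by blast

lemma pderivative_C_infinity: "f \<in> C_infinity \<Longrightarrow> b \<in> Basis \<Longrightarrow> pderivative b f \<in> C_infinity"
  unfolding C_infinity_def using C_k.simps(2) by blast

lemma C_infinity_has_derivative:
  assumes "f \<in> C_infinity"
  shows "(f has_derivative (\<lambda>v. \<Sum>b\<in>Basis. of_real (v \<bullet> b) * (\<i> * Dop b f x))) (at x)"
proof -
  have D: "(f has_derivative frechet_derivative f (at x)) (at x)"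
    using C_infinity_differentiable[OF assms] by (simp add: frechet_derivative_works)
  interpret bounded_linear "frechet_derivative f (at x)"
    by (rule has_derivative_bounded_linear[OF D])
  have "frechet_derivative f (at x) = (\<lambda>v. \<Sum>b\<in>Basis. of_real (v \<bullet> b) * (\<i> * Dop b f x))"
  proof
    fix v
    have "frechet_derivative f (at x) v = frechet_derivative f (at x) (\<Sum>b\<in>Basis. (v \<bullet> b) *\<^sub>R b)"
      by (simp add: euclidean_representation)
    also have "\<dots> = (\<Sum>b\<in>Basis. (v \<bullet> b) *\<^sub>R frechet_derivative f (at x) b)"
      by (simp add: sum scaleR)
    also have "\<dots> = (\<Sum>b\<in>Basis. of_real (v \<bullet> b) * (\<i> * Dop b f x))"
      by (simp add: Dop_def pderivative_def scaleR_conv_of_real mult.assoc[symmetric])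
    finally show "frechet_derivative f (at x) v = (\<Sum>b\<in>Basis. of_real (v \<bullet> b) * (\<i> * Dop b f x))" .
  qed
  with D show ?thesis by simp
qed

lemma C_infinity_line_derivative:
  assumes "f \<in> C_infinity"
  shows "((\<lambda>\<tau>. f (x + \<tau> *\<^sub>R b)) has_vector_derivative pderivative b f (x + \<tau> *\<^sub>R b)) (at \<tau>)"
proof -
  have D: "(f has_derivative frechet_derivative f (at (x + \<tau> *\<^sub>R b))) (at (x + \<tau> *\<^sub>R b))"
    using C_infinity_differentiable[OF assms] by (simp add: frechet_derivative_works)
  have "((\<lambda>\<tau>. x + \<tau> *\<^sub>R b) has_derivative (\<lambda>\<sigma>. \<sigma> *\<^sub>R b)) (at \<tau>)"
    by (auto intro!: derivative_eq_intros)
  from has_derivative_compose[OF this D] have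
    "((\<lambda>\<tau>. f (x + \<tau> *\<^sub>R b)) has_derivative (\<lambda>\<sigma>. frechet_derivative f (at (x + \<tau> *\<^sub>R b)) (\<sigma> *\<^sub>R b))) (at \<tau>)" .
  then show ?thesis
    unfolding has_vector_derivative_def pderivative_def
    using linear_frechet_derivative[OF C_infinity_differentiable[OF assms]]
    by (simp add: linear_cmul)
qed

lemma vector_derivative_bound:
  fixes f :: "real \<Rightarrow> complex"
  assumes "\<tau> \<ge> 0" "\<And>r. 0 \<le> r \<Longrightarrow> r \<le> \<tau> \<Longrightarrow> (f has_vector_derivative f' r) (at r)"
    and "\<And>r. 0 \<le> r \<Longrightarrow> r \<le> \<tau> \<Longrightarrow> norm (f' r) \<le> B"
  shows "norm (f \<tau> - f 0) \<le> B * \<tau>"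
proof -
  have "norm (f \<tau> - f 0) \<le> B * norm (\<tau> - 0)"
  proof (rule differentiable_bound[where S = "{0..\<tau>}" and f' = "\<lambda>r h. h *\<^sub>R f' r"])
    fix r assume r: "r \<in> {0..\<tau>}"
    then show "(f has_derivative (\<lambda>h. h *\<^sub>R f' r)) (at r within {0..\<tau>})"
      using assms(2)[of r] unfolding has_vector_derivative_def
      by (auto intro: has_derivative_at_withinI)
    show "onorm (\<lambda>h. h *\<^sub>R f' r) \<le> B"
      using r assms(3)[of r] by (intro onorm_le) (auto simp: mult.commute[of _ "norm (f' r)"] intro: mult_right_mono)
  qed (use assms(1) in auto)
  then show ?thesis using assms(1) by simp
qed

text \<open>
  Two applications of the mean value inequality, one in each direction, compare the second
  difference with the mixed derivative in nearby points, which is continuous.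
\<close>

lemma second_difference:
  assumes f: "f \<in> C_infinity" and b: "b \<in> Basis" and c: "c \<in> Basis" and e: "\<epsilon> > 0"
  shows "\<exists>\<delta>>0. \<forall>\<tau>. 0 < \<tau> \<and> \<tau> < \<delta> \<longrightarrow>
    norm (f (x + \<tau> *\<^sub>R b + \<tau> *\<^sub>R c) - f (x + \<tau> *\<^sub>R b) - f (x + \<tau> *\<^sub>R c) + f x
      - of_real (\<tau>^2) * pderivative c (pderivative b f) x) \<le> \<epsilon> * \<tau>^2"
proof -
  let ?p = "pderivative b f" and ?q = "pderivative c (pderivative b f)"
  have p: "?p \<in> C_infinity" using f b by (rule pderivative_C_infinity)
  have q: "?q \<in> C_infinity" using p c by (rule pderivative_C_infinity)
  have "continuous (at x) ?q"
    using C_infinity_continuous[OF q] by (simp add: continuous_on_eq_continuous_at)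
  then obtain d where d: "d > 0" "\<And>z. dist z x < d \<Longrightarrow> dist (?q z) (?q x) < \<epsilon>"
    unfolding continuous_at_eps_delta using e by blast
  have nb: "norm b = 1" "norm c = 1" using b c by auto
  show ?thesis
  proof (intro exI[of _ "d/2"] conjI allI impI)
    fix \<tau> :: real assume \<tau>: "0 < \<tau> \<and> \<tau> < d/2"
    have close: "norm (?q (x + \<sigma> *\<^sub>R b + \<rho> *\<^sub>R c) - ?q x) \<le> \<epsilon>"
      if "0 \<le> \<sigma>" "\<sigma> \<le> \<tau>" "0 \<le> \<rho>" "\<rho> \<le> \<tau>" for \<sigma> \<rho>
    proof -
      have "dist (x + \<sigma> *\<^sub>R b + \<rho> *\<^sub>R c) x \<le> norm (\<sigma> *\<^sub>R b) + norm (\<rho> *\<^sub>R c)"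
        by (metis add.assoc add_diff_cancel_left' dist_norm norm_triangle_ineq)
      also have "\<dots> < d" using that \<tau> nb by simp
      finally show ?thesis using d(2) by (metis dist_norm less_imp_le)
    qed
    have inner: "norm (?p (x + \<sigma> *\<^sub>R b + \<tau> *\<^sub>R c) - ?p (x + \<sigma> *\<^sub>R b) - \<tau> *\<^sub>R ?q x) \<le> \<epsilon> * \<tau>"
      if "0 \<le> \<sigma>" "\<sigma> \<le> \<tau>" for \<sigma>
    proof -
      have "norm ((?p (x + \<sigma> *\<^sub>R b + \<tau> *\<^sub>R c) - \<tau> *\<^sub>R ?q x)
          - (?p (x + \<sigma> *\<^sub>R b + 0 *\<^sub>R c) - 0 *\<^sub>R ?q x)) \<le> \<epsilon> * \<tau>"
      proof (rule vector_derivative_bound)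
        fix \<rho> assume \<rho>: "0 \<le> \<rho>" "\<rho> \<le> \<tau>"
        show "((\<lambda>\<rho>. ?p (x + \<sigma> *\<^sub>R b + \<rho> *\<^sub>R c) - \<rho> *\<^sub>R ?q x) has_vector_derivative
            ?q (x + \<sigma> *\<^sub>R b + \<rho> *\<^sub>R c) - ?q x) (at \<rho>)"
          by (intro has_vector_derivative_diff C_infinity_line_derivative[OF p])
            (auto simp: has_vector_derivative_def intro!: derivative_eq_intros)
        show "norm (?q (x + \<sigma> *\<^sub>R b + \<rho> *\<^sub>R c) - ?q x) \<le> \<epsilon>" using close that \<rho> by blast
      qed (use \<tau> in auto)
      then show ?thesis by (simp add: algebra_simps)
    qed
    have "norm ((f ((x + \<tau> *\<^sub>R c) + \<tau> *\<^sub>R b) - f (x + \<tau> *\<^sub>R b) - \<tau> *\<^sub>R (\<tau> *\<^sub>R ?q x))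
        - (f ((x + \<tau> *\<^sub>R c) + 0 *\<^sub>R b) - f (x + 0 *\<^sub>R b) - 0 *\<^sub>R (\<tau> *\<^sub>R ?q x))) \<le> (\<epsilon> * \<tau>) * \<tau>"
    proof (rule vector_derivative_bound)
      fix \<sigma> assume \<sigma>: "0 \<le> \<sigma>" "\<sigma> \<le> \<tau>"
      show "((\<lambda>\<sigma>. f ((x + \<tau> *\<^sub>R c) + \<sigma> *\<^sub>R b) - f (x + \<sigma> *\<^sub>R b) - \<sigma> *\<^sub>R (\<tau> *\<^sub>R ?q x)) has_vector_derivative
          ?p ((x + \<tau> *\<^sub>R c) + \<sigma> *\<^sub>R b) - ?p (x + \<sigma> *\<^sub>R b) - \<tau> *\<^sub>R ?q x) (at \<sigma>)"
        by (intro has_vector_derivative_diff C_infinity_line_derivative[OF f])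
          (auto simp: has_vector_derivative_def intro!: derivative_eq_intros)
      show "norm (?p ((x + \<tau> *\<^sub>R c) + \<sigma> *\<^sub>R b) - ?p (x + \<sigma> *\<^sub>R b) - \<tau> *\<^sub>R ?q x) \<le> \<epsilon> * \<tau>"
        using inner[OF \<sigma>] by (simp add: algebra_simps)
    qed (use \<tau> in auto)
    then show "norm (f (x + \<tau> *\<^sub>R b + \<tau> *\<^sub>R c) - f (x + \<tau> *\<^sub>R b) - f (x + \<tau> *\<^sub>R c) + f x
      - of_real (\<tau>^2) * ?q x) \<le> \<epsilon> * \<tau>^2"
      by (simp add: power2_eq_square scaleR_conv_of_real algebra_simps)
  qed (use d in auto)
qed

text \<open>
  Both mixed derivatives are limits of the same second difference quotient, which is symmetric in
  the two directions.
\<close>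

lemma pderivative_commute:
  assumes f: "f \<in> C_infinity" and b: "b \<in> Basis" and c: "c \<in> Basis"
  shows "pderivative b (pderivative c f) = pderivative c (pderivative b f)"
proof
  fix x
  let ?A = "pderivative c (pderivative b f) x" and ?B = "pderivative b (pderivative c f) x"
  have "norm (?A - ?B) \<le> 0 + \<epsilon>" if e: "\<epsilon> > 0" for \<epsilon>
  proof -
    obtain d1 where d1: "d1 > 0" "\<And>\<tau>. 0 < \<tau> \<and> \<tau> < d1 \<Longrightarrow>
      norm (f (x + \<tau> *\<^sub>R b + \<tau> *\<^sub>R c) - f (x + \<tau> *\<^sub>R b) - f (x + \<tau> *\<^sub>R c) + f x - of_real (\<tau>^2) * ?A) \<le> \<epsilon>/2 * \<tau>^2"
      using second_difference[OF f b c, of "\<epsilon>/2" x] e by auto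
    obtain d2 where d2: "d2 > 0" "\<And>\<tau>. 0 < \<tau> \<and> \<tau> < d2 \<Longrightarrow>
      norm (f (x + \<tau> *\<^sub>R c + \<tau> *\<^sub>R b) - f (x + \<tau> *\<^sub>R c) - f (x + \<tau> *\<^sub>R b) + f x - of_real (\<tau>^2) * ?B) \<le> \<epsilon>/2 * \<tau>^2"
      using second_difference[OF f c b, of "\<epsilon>/2" x] e by auto
    define \<tau> where "\<tau> = min d1 d2 / 2"
    have \<tau>: "\<tau> > 0" "\<tau> < d1" "\<tau> < d2" using d1(1) d2(1) by (auto simp: \<tau>_def)
    define \<Delta> where "\<Delta> = f (x + \<tau> *\<^sub>R b + \<tau> *\<^sub>R c) - f (x + \<tau> *\<^sub>R b) - f (x + \<tau> *\<^sub>R c) + f x"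
    have "norm (\<Delta> - of_real (\<tau>^2) * ?A) \<le> \<epsilon>/2 * \<tau>^2" "norm (\<Delta> - of_real (\<tau>^2) * ?B) \<le> \<epsilon>/2 * \<tau>^2"
      using d1(2)[of \<tau>] d2(2)[of \<tau>] \<tau> by (simp_all add: \<Delta>_def algebra_simps)
    then have "norm ((\<Delta> - of_real (\<tau>^2) * ?B) - (\<Delta> - of_real (\<tau>^2) * ?A)) \<le> \<epsilon> * \<tau>^2"
      by (intro order_trans[OF norm_triangle_ineq4]) (simp add: algebra_simps)
    also have "(\<Delta> - of_real (\<tau>^2) * ?B) - (\<Delta> - of_real (\<tau>^2) * ?A) = of_real (\<tau>^2) * (?A - ?B)"
      by (simp add: algebra_simps)
    finally show ?thesis using \<tau>(1) by (simp add: norm_mult norm_power mult.commute)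
  qed
  then have "norm (?A - ?B) \<le> 0" by (rule field_le_epsilon)
  then show "?B = ?A" by simp
qed

lemma Dop_commute:
  assumes f: "f \<in> C_infinity" and b: "b \<in> Basis" and c: "c \<in> Basis"
  shows "Dop b (Dop c f) = Dop c (Dop b f)"
proof -
  have "Dop b (Dop c f) = (\<lambda>x. (- \<i>) * ((- \<i>) * pderivative b (pderivative c f) x))"
    if "b \<in> Basis" "c \<in> Basis" for b c
  proof -
    have d: "pderivative c f differentiable (at x)" for x
      by (rule C_infinity_differentiable[OF pderivative_C_infinity[OF f that(2)]])
    have "((\<lambda>x. - \<i> * pderivative c f x) has_derivative
        (\<lambda>h. - \<i> * frechet_derivative (pderivative c f) (at x) h)) (at x)" for x
      using d by (intro has_derivative_mult_right) (simp add: frechet_derivative_works[symmetric])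
    then have "pderivative b (\<lambda>x. - \<i> * pderivative c f x) x = - \<i> * pderivative b (pderivative c f) x" for x
      unfolding pderivative_def by (metis frechet_derivative_at)
    then show ?thesis by (simp add: Dop_def)
  qed
  then show ?thesis using b c pderivative_commute[OF f b c] by simp
qed

lemma mi_D_C_infinity_aux:
  assumes "set bs \<subseteq> Basis" "f \<in> C_infinity"
  shows "foldr (\<lambda>b g. (Dop b ^^ \<beta> b) g) bs f \<in> C_infinity"
proof -
  have p: "(Dop b ^^ n) f \<in> C_infinity" if "b \<in> Basis" "f \<in> C_infinity" for b n f
    using that by (induction n) (auto intro: Dop_C_infinity)
  show ?thesis using assms by (induction bs) (auto intro: p)
qed

lemma mi_D_C_infinity: "f \<in> C_infinity \<Longrightarrow> mi_D \<beta> f \<in> C_infinity"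
  unfolding mi_D_def by (rule mi_D_C_infinity_aux) (simp_all add: set_basis_enum)

lemma mi_D_inc:
  assumes f: "f \<in> C_infinity" and b: "b \<in> Basis"
  shows "mi_D (mi_inc b \<beta>) f = Dop b (mi_D \<beta> f)"
proof -
  have p: "(Dop a ^^ n) (Dop b f) = Dop b ((Dop a ^^ n) f) \<and> (Dop a ^^ n) f \<in> C_infinity"
    if "a \<in> Basis" "f \<in> C_infinity" for a n f
    using that by (induction n) (auto simp: Dop_commute b intro: Dop_C_infinity)
  have "foldr (\<lambda>b g. (Dop b ^^ mi_inc b' \<beta> b) g) bs f =
      (if b' \<in> set bs then Dop b' (foldr (\<lambda>b g. (Dop b ^^ \<beta> b) g) bs f)
       else foldr (\<lambda>b g. (Dop b ^^ \<beta> b) g) bs f)"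
    if "distinct bs" "set bs \<subseteq> Basis" "b' = b" for bs b'
    using that
  proof (induction bs)
    case (Cons a bs)
    then have "foldr (\<lambda>b g. (Dop b ^^ \<beta> b) g) bs f \<in> C_infinity"
      using f by (intro mi_D_C_infinity_aux) auto
    with Cons show ?case using p by (auto simp: mi_inc_def)
  qed simp
  from this[OF distinct_basis_enum _ refl] show ?thesis
    using b by (simp add: mi_D_def set_basis_enum)
qed

lemma jet_mi_D_family:
  assumes "f \<in> C_infinity" shows "jet (\<lambda>\<beta>. mi_D \<beta> f)"
  unfolding jet_def
proof (intro allI)
  fix \<beta> x
  have "(mi_D \<beta> f has_derivative (\<lambda>v. \<Sum>b\<in>Basis. of_real (v \<bullet> b) * (\<i> * Dop b (mi_D \<beta> f) x))) (at x)"
    by (rule C_infinity_has_derivative[OF mi_D_C_infinity[OF assms]])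
  also have "(\<lambda>v. \<Sum>b\<in>Basis. of_real (v \<bullet> b) * (\<i> * Dop b (mi_D \<beta> f) x))
      = (\<lambda>v. \<Sum>b\<in>Basis. of_real (v \<bullet> b) * (\<i> * mi_D (mi_inc b \<beta>) f x))"
    by (simp add: mi_D_inc[OF assms])
  finally show "(mi_D \<beta> f has_derivative
      (\<lambda>v. \<Sum>b\<in>Basis. of_real (v \<bullet> b) * (\<i> * mi_D (mi_inc b \<beta>) f x))) (at x)" .
qed

lemmas mi_D_has_derivative = jet_mi_D_family[unfolded jet_def, rule_format]

lemma mi_D_inc':
  assumes f: "f \<in> C_infinity" and b: "b \<in> Basis"
  shows "mi_D (mi_inc b \<beta>) f = mi_D \<beta> (Dop b f)"
proof -
  have "jet (\<lambda>\<beta>. mi_D (mi_inc b \<beta>) f)"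
    unfolding jet_def
  proof (intro allI)
    fix \<beta> x
    have "mi_inc c (mi_inc b \<beta>) = mi_inc b (mi_inc c \<beta>)" for c by (auto simp: mi_inc_def)
    then show "(mi_D (mi_inc b \<beta>) f has_derivative
      (\<lambda>v. \<Sum>c\<in>Basis. of_real (v \<bullet> c) * (\<i> * mi_D (mi_inc b (mi_inc c \<beta>)) f x))) (at x)"
      using mi_D_has_derivative[OF f, of "mi_inc b \<beta>" x] by simp
  qed
  moreover have "mi_D (mi_inc b (on_Basis \<beta>)) f = mi_D (mi_inc b \<beta>) f"
    by (rule mi_D_cong) (auto simp: mi_inc_def on_Basis_def)
  ultimately show ?thesis
    using jet_mi_D[of "\<lambda>\<beta>. mi_D (mi_inc b \<beta>) f" \<beta>] mi_D_inc[OF f b, of "\<lambda>_. 0"] by simp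
qed

subsection \<open>Operations on smooth functions\<close>

lemma mi_D_lincomb:
  assumes "f \<in> C_infinity" "g \<in> C_infinity"
  shows "(\<lambda>x. a * f x + b * g x) \<in> C_infinity"
    and "mi_D \<beta> (\<lambda>x. a * f x + b * g x) = (\<lambda>x. a * mi_D \<beta> f x + b * mi_D \<beta> g x)"
proof -
  have j: "jet (\<lambda>\<beta> x. a * mi_D \<beta> f x + b * mi_D \<beta> g x)"
    unfolding jet_def
  proof (intro allI)
    fix \<beta> x
    have "((\<lambda>x. a * mi_D \<beta> f x + b * mi_D \<beta> g x) has_derivative
        (\<lambda>v. a * (\<Sum>c\<in>Basis. of_real (v \<bullet> c) * (\<i> * mi_D (mi_inc c \<beta>) f x))
           + b * (\<Sum>c\<in>Basis. of_real (v \<bullet> c) * (\<i> * mi_D (mi_inc c \<beta>) g x)))) (at x)"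
      by (intro has_derivative_add has_derivative_mult_right mi_D_has_derivative assms)
    also have "(\<lambda>v. a * (\<Sum>c\<in>Basis. of_real (v \<bullet> c) * (\<i> * mi_D (mi_inc c \<beta>) f x))
           + b * (\<Sum>c\<in>Basis. of_real (v \<bullet> c) * (\<i> * mi_D (mi_inc c \<beta>) g x))) =
        (\<lambda>v. \<Sum>c\<in>Basis. of_real (v \<bullet> c)
          * (\<i> * (a * mi_D (mi_inc c \<beta>) f x + b * mi_D (mi_inc c \<beta>) g x)))"
      by (simp add: sum_distrib_left sum.distrib[symmetric] algebra_simps)
    finally show "((\<lambda>x. a * mi_D \<beta> f x + b * mi_D \<beta> g x) has_derivative
        (\<lambda>v. \<Sum>c\<in>Basis. of_real (v \<bullet> c)
          * (\<i> * (a * mi_D (mi_inc c \<beta>) f x + b * mi_D (mi_inc c \<beta>) g x)))) (at x)" .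
  qed
  show "(\<lambda>x. a * f x + b * g x) \<in> C_infinity"
    using jet_C_infinity[OF j, of "\<lambda>_. 0"] by simp
  show "mi_D \<beta> (\<lambda>x. a * f x + b * g x) = (\<lambda>x. a * mi_D \<beta> f x + b * mi_D \<beta> g x)"
    using jet_mi_D[OF j, of \<beta>] by simp
qed

lemma mi_D_translation:
  assumes "f \<in> C_infinity"
  shows "translation x f \<in> C_infinity"
    and "mi_D \<beta> (translation x f) = translation x (mi_D \<beta> f)"
proof -
  have j: "jet (\<lambda>\<beta>. translation x (mi_D \<beta> f))"
    unfolding jet_def translation_def
  proof (intro allI)
    fix \<beta> y
    have "((\<lambda>y. y - x) has_derivative (\<lambda>v. v)) (at y)" by (auto intro!: derivative_eq_intros)
    from has_derivative_compose[OF this mi_D_has_derivative[OF assms]]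
    show "((\<lambda>y. mi_D \<beta> f (y - x)) has_derivative
      (\<lambda>v. \<Sum>c\<in>Basis. of_real (v \<bullet> c) * (\<i> * mi_D (mi_inc c \<beta>) f (y - x)))) (at y)" .
  qed
  show "translation x f \<in> C_infinity"
    using jet_C_infinity[OF j, of "\<lambda>_. 0"] by simp
  show "mi_D \<beta> (translation x f) = translation x (mi_D \<beta> f)"
    using jet_mi_D[OF j, of \<beta>] by simp
qed

definition plane_wave :: "'a::euclidean_space \<Rightarrow> 'a \<Rightarrow> complex" where
  "plane_wave \<xi> = (\<lambda>y. exp (\<i> * of_real (y \<bullet> \<xi>)))"

lemma norm_plane_wave [simp]: "norm (plane_wave \<xi> y) = 1"
  by (simp add: plane_wave_def)

lemma mi_D_plane_wave:
  shows "plane_wave \<xi> \<in> C_infinity"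
    and "mi_D \<beta> (plane_wave \<xi>) = (\<lambda>y. of_real (mi_power \<xi> \<beta>) * plane_wave \<xi> y)"
proof -
  have j: "jet (\<lambda>\<beta> y. of_real (mi_power \<xi> \<beta>) * plane_wave \<xi> y)"
    unfolding jet_def
  proof (intro allI)
    fix \<beta> and y :: 'a
    have "((\<lambda>y. \<i> * of_real (y \<bullet> \<xi>)) has_derivative (\<lambda>v. \<i> * of_real (v \<bullet> \<xi>))) (at y)"
      by (auto intro!: derivative_eq_intros)
    from has_derivative_compose[OF this DERIV_exp[unfolded has_field_derivative_def]]
    have "(plane_wave \<xi> has_derivative (\<lambda>v. plane_wave \<xi> y * (\<i> * of_real (v \<bullet> \<xi>)))) (at y)"
      unfolding plane_wave_def .
    then have "((\<lambda>y. of_real (mi_power \<xi> \<beta>) * plane_wave \<xi> y) has_derivative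
       (\<lambda>v. of_real (mi_power \<xi> \<beta>) * (plane_wave \<xi> y * (\<i> * of_real (v \<bullet> \<xi>))))) (at y)"
      by (rule has_derivative_mult_right)
    also have "(\<lambda>v. of_real (mi_power \<xi> \<beta>) * (plane_wave \<xi> y * (\<i> * of_real (v \<bullet> \<xi>)))) =
       (\<lambda>v. \<Sum>c\<in>Basis. of_real (v \<bullet> c) * (\<i> * (of_real (mi_power \<xi> (mi_inc c \<beta>)) * plane_wave \<xi> y)))"
    proof
      fix v
      have "(\<Sum>c\<in>Basis. of_real (v \<bullet> c) * (\<i> * (of_real (mi_power \<xi> (mi_inc c \<beta>)) * plane_wave \<xi> y)))
        = (\<Sum>c\<in>Basis. of_real (mi_power \<xi> \<beta>) * plane_wave \<xi> y * \<i> * of_real ((v \<bullet> c) * (\<xi> \<bullet> c)))"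
        by (intro sum.cong refl) (simp add: mi_power_inc mult_ac)
      also have "\<dots> = of_real (mi_power \<xi> \<beta>) * (plane_wave \<xi> y * (\<i> * of_real (v \<bullet> \<xi>)))"
        by (simp add: sum_distrib_left[symmetric] euclidean_inner[of v \<xi>] mult.assoc)
      finally show "of_real (mi_power \<xi> \<beta>) * (plane_wave \<xi> y * (\<i> * of_real (v \<bullet> \<xi>))) =
        (\<Sum>c\<in>Basis. of_real (v \<bullet> c) * (\<i> * (of_real (mi_power \<xi> (mi_inc c \<beta>)) * plane_wave \<xi> y)))" by simp
    qed
    finally show "((\<lambda>y. of_real (mi_power \<xi> \<beta>) * plane_wave \<xi> y) has_derivative
       (\<lambda>v. \<Sum>c\<in>Basis. of_real (v \<bullet> c)
          * (\<i> * (of_real (mi_power \<xi> (mi_inc c \<beta>)) * plane_wave \<xi> y)))) (at y)" .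
  qed
  have 0: "mi_power \<xi> (\<lambda>_. 0) = 1" "mi_power \<xi> (on_Basis \<beta>) = mi_power \<xi> \<beta>"
    by (simp_all add: mi_power_def on_Basis_def)
  show "plane_wave \<xi> \<in> C_infinity"
    using jet_C_infinity[OF j, of "\<lambda>_. 0"] by (simp add: 0)
  show "mi_D \<beta> (plane_wave \<xi>) = (\<lambda>y. of_real (mi_power \<xi> \<beta>) * plane_wave \<xi> y)"
    using jet_mi_D[OF j, of \<beta>] by (simp add: 0)
qed

lemma C_k_Suc: "C_k (Suc k) f \<Longrightarrow> C_k k f"
proof (induction k arbitrary: f)
  case 0
  then show ?case
    by (simp add: continuous_on_eq_continuous_at differentiable_imp_continuous_within)
qed auto

lemma pderivative_add:
  assumes "f differentiable (at x)" "g differentiable (at x)"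
  shows "pderivative b (\<lambda>x. f x + g x) x = pderivative b f x + pderivative b g x"
proof -
  have "((\<lambda>x. f x + g x) has_derivative
      (\<lambda>h. frechet_derivative f (at x) h + frechet_derivative g (at x) h)) (at x)"
    using assms by (intro has_derivative_add) (simp_all add: frechet_derivative_works[symmetric])
  from frechet_derivative_at[OF this, symmetric] show ?thesis by (simp add: pderivative_def)
qed

lemma pderivative_mult:
  assumes "f differentiable (at x)" "g differentiable (at x)"
  shows "pderivative b (\<lambda>x. f x * g x) x = f x * pderivative b g x + pderivative b f x * g x"
proof -
  have "((\<lambda>x. f x * g x) has_derivative
      (\<lambda>h. f x * frechet_derivative g (at x) h + frechet_derivative f (at x) h * g x)) (at x)"
    using assms by (intro has_derivative_mult) (simp_all add: frechet_derivative_works[symmetric])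
  from frechet_derivative_at[OF this, symmetric] show ?thesis by (simp add: pderivative_def)
qed

lemma C_k_add: "C_k k f \<Longrightarrow> C_k k g \<Longrightarrow> C_k k (\<lambda>x. f x + g x)"
proof (induction k arbitrary: f g)
  case (Suc k)
  then have "pderivative b (\<lambda>x. f x + g x) = (\<lambda>x. pderivative b f x + pderivative b g x)" for b
    by (auto simp: pderivative_add)
  with Suc show ?case by auto
qed (auto intro: continuous_intros)

lemma C_k_mult: "C_k k f \<Longrightarrow> C_k k g \<Longrightarrow> C_k k (\<lambda>x. f x * g x)"
proof (induction k arbitrary: f g)
  case (Suc k)
  then have "pderivative b (\<lambda>x. f x * g x) = (\<lambda>x. f x * pderivative b g x + pderivative b f x * g x)" for b
    by (auto simp: pderivative_mult)
  moreover have "C_k k f" "C_k k g" using Suc.prems by (blast intro: C_k_Suc)+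
  ultimately show ?case using Suc by (simp add: C_k_add)
qed (auto intro: continuous_intros)

lemma C_infinity_mult: "f \<in> C_infinity \<Longrightarrow> g \<in> C_infinity \<Longrightarrow> (\<lambda>x. f x * g x) \<in> C_infinity"
  by (simp add: C_infinity_def C_k_mult)

lemma Dop_mult:
  assumes "f \<in> C_infinity" "g \<in> C_infinity"
  shows "Dop b (\<lambda>x. f x * g x) = (\<lambda>x. f x * Dop b g x + Dop b f x * g x)"
  using assms by (auto simp: Dop_def pderivative_mult C_infinity_differentiable algebra_simps)

lemma mi_D_mult_inc:
  assumes "f \<in> C_infinity" "g \<in> C_infinity" "b \<in> Basis"
  shows "mi_D (mi_inc b \<beta>) (\<lambda>x. f x * g x) x =
    mi_D \<beta> (\<lambda>x. f x * Dop b g x) x + mi_D \<beta> (\<lambda>x. Dop b f x * g x) x"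
proof -
  have "mi_D (mi_inc b \<beta>) (\<lambda>x. f x * g x) = mi_D \<beta> (\<lambda>x. 1 * (f x * Dop b g x) + 1 * (Dop b f x * g x))"
    unfolding mi_D_inc'[OF C_infinity_mult[OF assms(1,2)] assms(3)] Dop_mult[OF assms(1,2)] by simp
  also have "\<dots> = (\<lambda>x. 1 * mi_D \<beta> (\<lambda>x. f x * Dop b g x) x + 1 * mi_D \<beta> (\<lambda>x. Dop b f x * g x) x)"
    using assms by (intro mi_D_lincomb C_infinity_mult Dop_C_infinity)
  finally show ?thesis by simp
qed

text \<open>
  A crude form of the Leibniz rule: each of the \<open>|\<beta>|\<close> differentiations falls on one of the two factors,
  which makes \<open>2 ^ |\<beta>|\<close> terms, and \<open>\<gamma>! \<delta>! \<le> (\<gamma> + \<delta>)!\<close> bounds each of them. Gevrey type bounds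
  absorb the factor \<open>2 ^ |\<beta>|\<close>, so that no binomial coefficients have to be handled.
\<close>

lemma mi_D_mult_bound:
  assumes f: "f \<in> C_infinity" and g: "g \<in> C_infinity" and s: "s > 0" and m: "m \<ge> 0"
    and A: "A \<ge> 0" "\<And>\<gamma>. norm (mi_D \<gamma> f y) \<le> A * m ^ mi_size \<gamma> * mi_fact \<gamma> powr s"
    and B: "\<And>\<gamma>. norm (mi_D \<gamma> g y) \<le> B * m ^ mi_size \<gamma> * mi_fact \<gamma> powr s"
  shows "norm (mi_D \<beta> (\<lambda>x. f x * g x) y) \<le> A * B * (2 * m) ^ mi_size \<beta> * mi_fact \<beta> powr s"
proof -
  have "norm (mi_D \<beta> (\<lambda>x. mi_D \<gamma> f x * mi_D \<delta> g x) y) \<le>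
      A * B * 2 ^ mi_size \<beta> * m ^ (mi_size \<beta> + mi_size \<gamma> + mi_size \<delta>)
        * mi_fact (\<lambda>b. \<beta> b + \<gamma> b + \<delta> b) powr s" for \<gamma> \<delta>
  proof (induction \<beta> arbitrary: \<gamma> \<delta> rule: mi_induct)
    case (zero \<beta>)
    then have z: "mi_size \<beta> = 0" "mi_fact (\<lambda>b. \<beta> b + \<gamma> b + \<delta> b) = mi_fact (\<lambda>b. \<gamma> b + \<delta> b)"
      by (simp_all add: mi_size_def mi_fact_def)
    have "norm (mi_D \<gamma> f y) * norm (mi_D \<delta> g y) \<le>
       (A * m ^ mi_size \<gamma> * mi_fact \<gamma> powr s) * (B * m ^ mi_size \<delta> * mi_fact \<delta> powr s)"
      using A m by (intro mult_mono A B) auto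
    also have "\<dots> = A * B * m ^ (mi_size \<gamma> + mi_size \<delta>) * (mi_fact \<gamma> * mi_fact \<delta>) powr s"
      by (simp add: power_add powr_mult mi_fact_pos less_imp_le mult_ac)
    also have "\<dots> \<le> A * B * m ^ (mi_size \<gamma> + mi_size \<delta>) * mi_fact (\<lambda>b. \<gamma> b + \<delta> b) powr s"
    proof (intro mult_left_mono powr_mono2 mi_fact_add)
      have "B \<ge> 0"
        using order_trans[OF norm_ge_zero B[of "\<lambda>_. 0"]] by (simp add: mi_size_def mi_fact_def)
      then show "0 \<le> A * B * m ^ (mi_size \<gamma> + mi_size \<delta>)" using A m by simp
      show "0 \<le> mi_fact \<gamma> * mi_fact \<delta>"
        using mi_fact_pos[of \<gamma>] mi_fact_pos[of \<delta>] by simp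
    qed (use s in auto)
    finally show ?case using zero z by (simp add: mi_D_zero norm_mult)
  next
    case (inc \<beta> b)
    let ?F = "mi_fact (\<lambda>c. mi_inc b \<beta> c + \<gamma> c + \<delta> c) powr s"
    have eq: "(\<lambda>c. mi_inc b \<beta> c + \<gamma> c + \<delta> c) = (\<lambda>c. \<beta> c + \<gamma> c + mi_inc b \<delta> c)"
      "(\<lambda>c. mi_inc b \<beta> c + \<gamma> c + \<delta> c) = (\<lambda>c. \<beta> c + mi_inc b \<gamma> c + \<delta> c)"
      by (auto simp: mi_inc_def)
    have 1: "norm (mi_D \<beta> (\<lambda>x. mi_D \<gamma> f x * mi_D (mi_inc b \<delta>) g x) y) \<le>
      A * B * 2 ^ mi_size \<beta> * m ^ (mi_size \<beta> + mi_size \<gamma> + mi_size (mi_inc b \<delta>)) * ?F"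
      unfolding eq(1) by (rule inc(2))
    have 2: "norm (mi_D \<beta> (\<lambda>x. mi_D (mi_inc b \<gamma>) f x * mi_D \<delta> g x) y) \<le>
      A * B * 2 ^ mi_size \<beta> * m ^ (mi_size \<beta> + mi_size (mi_inc b \<gamma>) + mi_size \<delta>) * ?F"
      unfolding eq(2) by (rule inc(2))
    have "norm (mi_D (mi_inc b \<beta>) (\<lambda>x. mi_D \<gamma> f x * mi_D \<delta> g x) y) \<le>
      norm (mi_D \<beta> (\<lambda>x. mi_D \<gamma> f x * mi_D (mi_inc b \<delta>) g x) y)
      + norm (mi_D \<beta> (\<lambda>x. mi_D (mi_inc b \<gamma>) f x * mi_D \<delta> g x) y)"
      using inc(1) by (simp add: mi_D_mult_inc mi_D_C_infinity f g mi_D_inc norm_triangle_ineq)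
    also have "\<dots> \<le> A * B * 2 ^ mi_size (mi_inc b \<beta>) * m ^ (mi_size (mi_inc b \<beta>) + mi_size \<gamma> + mi_size \<delta>) * ?F"
      using 1 2 inc(1) by (simp add: algebra_simps)
    finally show ?case .
  qed
  from this[of "\<lambda>_. 0" "\<lambda>_. 0"] show ?thesis
    by (simp add: mi_size_def power_mult_distrib mult_ac)
qed

subsection \<open>Tensor products\<close>

definition mi_fst :: "('a::euclidean_space \<times> 'b::euclidean_space \<Rightarrow> nat) \<Rightarrow> 'a \<Rightarrow> nat" where
  "mi_fst \<beta> = (\<lambda>b. \<beta> (b, 0))"

definition mi_snd :: "('a::euclidean_space \<times> 'b::euclidean_space \<Rightarrow> nat) \<Rightarrow> 'b \<Rightarrow> nat" where
  "mi_snd \<beta> = (\<lambda>b. \<beta> (0, b))"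

lemma sum_Basis_prod:
  "(\<Sum>b\<in>Basis. f b) = (\<Sum>b\<in>Basis. f (b::'a::euclidean_space, 0)) + (\<Sum>b\<in>Basis. f (0, b::'b::euclidean_space))"
  unfolding Basis_prod_def
  by (subst sum.union_disjoint) (auto simp: sum.reindex inj_on_def)

lemma prod_Basis_prod:
  "(\<Prod>b\<in>Basis. f b) = (\<Prod>b\<in>Basis. f (b::'a::euclidean_space, 0)) * (\<Prod>b\<in>Basis. f (0, b::'b::euclidean_space))"
  unfolding Basis_prod_def
  by (subst prod.union_disjoint) (auto simp: prod.reindex inj_on_def)

lemma mi_prod_split:
  shows "mi_size \<beta> = mi_size (mi_fst \<beta>) + mi_size (mi_snd \<beta>)"
    and "mi_fact \<beta> = mi_fact (mi_fst \<beta>) * mi_fact (mi_snd \<beta>)"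
    and "mi_power (x, y) \<beta> = mi_power x (mi_fst \<beta>) * mi_power y (mi_snd \<beta>)"
  by (simp_all add: mi_size_def mi_fact_def mi_power_def sum_Basis_prod prod_Basis_prod
      mi_fst_def mi_snd_def)

text \<open>
  The products of the derivatives of the two factors form a jet.
\<close>

lemma mi_D_tensor:
  fixes f g :: "'a::euclidean_space \<Rightarrow> complex"
  assumes f: "f \<in> C_infinity" and g: "g \<in> C_infinity"
  shows "tensor f g \<in> C_infinity"
    and "mi_D \<beta> (tensor f g) = tensor (mi_D (mi_fst \<beta>) f) (mi_D (mi_snd \<beta>) g)"
proof -
  let ?T = "\<lambda>\<beta>. tensor (mi_D (mi_fst \<beta>) f) (mi_D (mi_snd \<beta>) g)"
  have j: "jet ?T"
    unfolding jet_def
  proof (intro allI)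
    fix \<beta> :: "'a \<times> 'a \<Rightarrow> nat" and z :: "'a \<times> 'a"
    have 1: "mi_fst (mi_inc (b, 0) \<beta>) = mi_inc b (mi_fst \<beta>)"
      "mi_snd (mi_inc (0, b) \<beta>) = mi_inc b (mi_snd \<beta>)" for b
      by (auto simp: mi_fst_def mi_snd_def mi_inc_def)
    have 2: "mi_fst (mi_inc (0, b) \<beta>) = mi_fst \<beta>" "mi_snd (mi_inc (b, 0) \<beta>) = mi_snd \<beta>"
      if "b \<in> Basis" for b
      using that nonzero_Basis[OF that] by (auto simp: mi_fst_def mi_snd_def mi_inc_def)
    note D = has_derivative_compose[OF has_derivative_fst[OF has_derivative_ident] mi_D_has_derivative[OF f]]
      has_derivative_compose[OF has_derivative_snd[OF has_derivative_ident] mi_D_has_derivative[OF g]]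
    show "(?T \<beta> has_derivative (\<lambda>v. \<Sum>b\<in>Basis. of_real (v \<bullet> b) * (\<i> * ?T (mi_inc b \<beta>) z))) (at z)"
      unfolding tensor_def case_prod_beta
      by (rule has_derivative_eq_rhs[OF has_derivative_mult[OF D]])
        (auto simp: fun_eq_iff sum_Basis_prod 1 2 sum_distrib_left sum_distrib_right mult_ac
          intro!: sum.cong arg_cong2[where f = "(+)"])
  qed
  have 0: "mi_fst (\<lambda>_. 0) = (\<lambda>_. 0)" "mi_snd (\<lambda>_. 0) = (\<lambda>_. 0)"
    by (simp_all add: mi_fst_def mi_snd_def)
  show "tensor f g \<in> C_infinity"
    using jet_C_infinity[OF j, of "\<lambda>_. 0"] by (simp add: 0)
  have "mi_D (mi_fst (on_Basis \<beta>)) f = mi_D (mi_fst \<beta>) f" "mi_D (mi_snd (on_Basis \<beta>)) g = mi_D (mi_snd \<beta>) g"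
    by (auto intro!: mi_D_cong simp: mi_fst_def mi_snd_def on_Basis_def Basis_prod_def)
  then show "mi_D \<beta> (tensor f g) = ?T \<beta>"
    using jet_mi_D[OF j, of \<beta>] by (simp add: 0)
qed

section \<open>Gelfand--Shilov seminorms as pointwise bounds\<close>

text \<open>
  The seminorms of the space compare \<open>f\<close> with all monomials at once. It is equivalent, and much more
  convenient, to ask for stretched exponential decay of each derivative. The one-dimensional
  lemmas \<open>power_le_exp_root\<close> and \<open>decay_of_powers\<close> translate between \<open>sup\<^sub>n x ^ n / (h ^ n n!\<^sup>t)\<close> and \<open>exp (r x\<^sup>1\<^sup>/\<^sup>t)\<close>; both come from the
  exponential series of \<open>(x / h)\<^sup>1\<^sup>/\<^sup>t\<close>.
\<close>

lemma power_over_fact_le_exp: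
  assumes "(q::real) \<ge> 0" shows "q ^ n \<le> fact n * exp q"
proof -
  have "(\<Sum>k\<in>{n}. q ^ k /\<^sub>R fact k) \<le> exp q"
    unfolding exp_def using assms
    by (intro sum_le_suminf summable_exp_generic) auto
  then show ?thesis by (simp add: field_simps)
qed

lemma power_le_exp_root:
  assumes "(x::real) \<ge> 0" "h > 0" "t > 0"
  shows "x ^ n \<le> h ^ n * fact n powr t * exp (t * (x / h) powr (1 / t))"
proof (cases "x = 0")
  case False
  define q where "q = (x / h) powr (1 / t)"
  have q: "q > 0" "q powr t = x / h" using assms False by (auto simp: q_def powr_powr)
  have "(q ^ n) powr t \<le> (fact n * exp q) powr t"
    using q assms by (intro powr_mono2 power_over_fact_le_exp) auto
  also have "(q ^ n) powr t = (x / h) ^ n"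
    using q by (simp add: powr_realpow[symmetric] powr_powr mult.commute flip: q(2))
  also have "(fact n * exp q) powr t = fact n powr t * exp (t * q)"
    by (subst powr_mult) (simp_all add: powr_def[of "exp q"])
  finally show ?thesis using assms by (simp add: q_def power_divide field_simps)
qed (use assms in \<open>cases n; simp\<close>)

lemma decay_of_powers:
  assumes X: "(X::real) \<ge> 0" and x: "x \<ge> 0" and h: "h > 0" and t: "t > 0" and M: "M \<ge> 0"
    and le: "\<And>n. x ^ n * X \<le> M * h ^ n * fact n powr t"
  shows "X \<le> M * 2 powr t * exp (- (t / 2) * (x / h) powr (1 / t))"
proof (cases "M = 0")
  case True
  then show ?thesis using le[of 0] X by simp
next
  case False
  then have M: "M > 0" using M by simp
  define q where "q = (x / h) powr (1 / t)"
  define Y where "Y = (X / M) powr (1 / t)"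
  have q: "q \<ge> 0" and Y: "Y \<ge> 0" "Y powr t = X / M"
    using t X M by (auto simp: q_def Y_def powr_powr)
  have qY: "q ^ n * Y \<le> fact n" for n
  proof -
    have "(x / h) ^ n * (X / M) \<le> fact n powr t"
      using le[of n] M h by (simp add: power_divide field_simps)
    then have "((x / h) ^ n * (X / M)) powr (1 / t) \<le> (fact n powr t) powr (1 / t)"
      using t x h X M by (intro powr_mono2) auto
    moreover have "((x / h) ^ n) powr (1 / t) = q ^ n"
    proof (cases "x = 0")
      case True
      then show ?thesis using t by (cases n) (auto simp: q_def)
    next
      case False
      then show ?thesis using x h
        by (simp add: q_def powr_realpow[symmetric] powr_powr mult.commute del: powr_realpow)
    qed
    ultimately show ?thesis
      using t unfolding Y_def by (subst (asm) powr_mult) (simp_all add: powr_powr)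
  qed
  \<comment> \<open>Sum the bounds on \<open>q ^ n Y / n!\<close> against \<open>2 ^ (- n)\<close>; this is where half of the rate \<open>q\<close> is lost.\<close>
  have "exp (q / 2) * Y \<le> 2"
  proof -
    have 1: "(\<lambda>n. ((q / 2) ^ n /\<^sub>R fact n) * Y) sums (exp (q / 2) * Y)"
      by (intro sums_mult2 exp_converges)
    have 2: "(\<lambda>n. (1/2::real) ^ n) sums (1 / (1 - 1/2))" by (rule geometric_sums) simp
    have 3: "((q / 2) ^ n /\<^sub>R fact n) * Y \<le> (1/2) ^ n" for n
      using qY[of n] by (simp add: power_divide field_simps)
    from sums_le[OF 3 1 2] show ?thesis by simp
  qed
  then have "Y \<le> 2 * exp (- (q / 2))"
    by (simp add: exp_minus field_simps)
  then have "Y powr t \<le> (2 * exp (- (q / 2))) powr t"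
    using Y t by (intro powr_mono2) auto
  also have "\<dots> = 2 powr t * exp (- (t / 2) * q)"
    by (subst powr_mult) (simp_all add: powr_def[of "exp _"])
  finally show ?thesis using Y M by (simp add: q_def field_simps)
qed

text \<open>
  Here \<open>M\<close> plays the part of a norm: derivatives grow as in the Gevrey class of order \<open>s\<close>, with radius
  \<open>h\<close>, and each of them decays like \<open>exp (- r |y|\<^sup>1\<^sup>/\<^sup>t)\<close>.
\<close>

definition GSB :: "real \<Rightarrow> real \<Rightarrow> real \<Rightarrow> real \<Rightarrow> ('a::euclidean_space \<Rightarrow> complex) \<Rightarrow> real \<Rightarrow> bool" where
  "GSB t s r h f M \<longleftrightarrow> (\<forall>\<beta> y. norm (mi_D \<beta> f y)
     \<le> M * h ^ mi_size \<beta> * mi_fact \<beta> powr s * exp (- r * norm y powr (1 / t)))"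

lemma mi_fact_nonzero [simp]: "mi_fact \<beta> \<noteq> 0"
  using mi_fact_pos[of \<beta>] by simp

lemma GSB_nonneg: "GSB t s r h f M \<Longrightarrow> M \<ge> 0"
  unfolding GSB_def
  by (drule spec[of _ "\<lambda>_. 0"], drule spec[of _ 0], drule order_trans[OF norm_ge_zero])
    (simp add: mi_size_def mi_fact_def)

lemma GSB_mono:
  assumes "GSB t s r h f M" "r' \<le> r" "0 < h" "h \<le> h'" "M \<le> M'"
  shows "GSB t s r' h' f M'"
  unfolding GSB_def
proof (intro allI)
  fix \<beta> y
  have "norm (mi_D \<beta> f y) \<le> M * h ^ mi_size \<beta> * mi_fact \<beta> powr s * exp (- r * norm y powr (1 / t))"
    using assms(1) unfolding GSB_def by blast
  also have "\<dots> \<le> M' * h' ^ mi_size \<beta> * mi_fact \<beta> powr s * exp (- r' * norm y powr (1 / t))"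
    using assms GSB_nonneg[OF assms(1)]
    by (intro mult_mono power_mono) (auto intro!: mult_nonneg_nonneg mult_right_mono)
  finally show "norm (mi_D \<beta> f y) \<le> M' * h' ^ mi_size \<beta> * mi_fact \<beta> powr s * exp (- r' * norm y powr (1 / t))" .
qed

lemma GSB_D: "GSB t s r h f M \<Longrightarrow> norm (mi_D \<beta> f y)
     \<le> M * h ^ mi_size \<beta> * mi_fact \<beta> powr s * exp (- r * norm y powr (1 / t))"
  unfolding GSB_def by blast

lemma GSB_bound: "GSB t s r h f M \<Longrightarrow> norm (f y) \<le> M * exp (- r * norm y powr (1 / t))"
  using GSB_D[of t s r h f M "\<lambda>_. 0" y] by (simp add: mi_size_def mi_fact_def)

lemma mi_power_le:
  fixes y :: "'a::euclidean_space" and t h :: real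
  assumes t: "t > 0" and h: "h > 0"
  shows "\<bar>mi_power y \<alpha>\<bar> \<le> h ^ mi_size \<alpha> * mi_fact \<alpha> powr t
    * exp (t * DIM('a) * h powr (- (1 / t)) * norm y powr (1 / t))"
proof -
  have "\<bar>mi_power y \<alpha>\<bar> = (\<Prod>b\<in>Basis. \<bar>y \<bullet> b\<bar> ^ \<alpha> b)"
    by (simp add: mi_power_def abs_prod power_abs)
  also have "\<dots> \<le> (\<Prod>b\<in>Basis. h ^ \<alpha> b * fact (\<alpha> b) powr t * exp (t * h powr (- (1 / t)) * norm y powr (1 / t)))"
  proof (intro prod_mono conjI)
    fix b :: 'a assume b: "b \<in> Basis"
    have "(\<bar>y \<bullet> b\<bar> / h) powr (1 / t) \<le> h powr (- (1 / t)) * norm y powr (1 / t)"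
      using b h t by (simp add: powr_divide powr_minus field_simps powr_mono2 Basis_le_norm)
    then have "t * (\<bar>y \<bullet> b\<bar> / h) powr (1 / t) \<le> t * h powr (- (1 / t)) * norm y powr (1 / t)"
      using t by (simp add: mult.assoc)
    then have "h ^ \<alpha> b * fact (\<alpha> b) powr t * exp (t * (\<bar>y \<bullet> b\<bar> / h) powr (1 / t))
      \<le> h ^ \<alpha> b * fact (\<alpha> b) powr t * exp (t * h powr (- (1 / t)) * norm y powr (1 / t))"
      using h by (intro mult_left_mono) auto
    then show "\<bar>y \<bullet> b\<bar> ^ \<alpha> b \<le> h ^ \<alpha> b * fact (\<alpha> b) powr t * exp (t * h powr (- (1 / t)) * norm y powr (1 / t))"
      using power_le_exp_root[of "\<bar>y \<bullet> b\<bar>" h t "\<alpha> b"] h t by linarith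
  qed simp
  also have "\<dots> = h ^ mi_size \<alpha> * mi_fact \<alpha> powr t
    * exp (t * DIM('a) * h powr (- (1 / t)) * norm y powr (1 / t))"
    by (simp add: prod.distrib power_sum[symmetric] mi_size_def mi_fact_def prod_powr_distrib
        exp_of_nat_mult[symmetric] mult_ac)
  finally show ?thesis .
qed

lemma GS_quot_le:
  fixes f :: "'a::euclidean_space \<Rightarrow> complex" and t h :: real
  assumes t: "t > 0" and h: "h > 0" and r: "r \<ge> t * DIM('a) * h powr (- (1 / t))"
    and f: "GSB t s r h f M"
  shows "GS_quot t s h f z \<le> M"
proof -
  obtain y \<alpha> \<beta> where z: "z = (y, \<alpha>, \<beta>)" by (cases z)
  let ?E = "exp (r * norm y powr (1 / t))"
  have "\<bar>mi_power y \<alpha>\<bar> * norm (mi_D \<beta> f y) \<le> (h ^ mi_size \<alpha> * mi_fact \<alpha> powr t * ?E)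
      * (M * h ^ mi_size \<beta> * mi_fact \<beta> powr s * exp (- r * norm y powr (1 / t)))"
  proof (intro mult_mono GSB_D[OF f])
    have "h ^ mi_size \<alpha> * mi_fact \<alpha> powr t * exp (t * DIM('a) * h powr (- (1 / t)) * norm y powr (1 / t))
      \<le> h ^ mi_size \<alpha> * mi_fact \<alpha> powr t * ?E"
      using h r by (intro mult_left_mono) (auto intro!: mult_right_mono)
    then show "\<bar>mi_power y \<alpha>\<bar> \<le> h ^ mi_size \<alpha> * mi_fact \<alpha> powr t * ?E"
      using mi_power_le[OF t h, of y \<alpha>] by linarith
  qed (use h in auto)
  also have "\<dots> = M * (h ^ mi_size (\<lambda>b. \<alpha> b + \<beta> b) * mi_fact \<alpha> powr t * mi_fact \<beta> powr s)"
    by (simp add: mi_size_add power_add exp_minus)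
  finally show ?thesis
    using h mi_fact_pos[of \<alpha>] mi_fact_pos[of \<beta>]
    by (simp add: z GS_quot_def norm_mult divide_le_eq)
qed

lemma GS_quot_nonneg: "h > 0 \<Longrightarrow> GS_quot t s h f z \<ge> 0"
  by (auto simp: GS_quot_def split: prod.splits)

lemma GS_norm_upper:
  fixes f :: "'a::euclidean_space \<Rightarrow> complex"
  shows "f \<in> GS_banach t s h \<Longrightarrow> GS_quot t s h f z \<le> GS_norm t s h f"
  unfolding GS_banach_def GS_norm_def by (auto intro: cSUP_upper)

lemma GS_norm_least:
  fixes f :: "'a::euclidean_space \<Rightarrow> complex"
  shows "(\<And>z. GS_quot t s h f z \<le> M) \<Longrightarrow> GS_norm t s h f \<le> M"
  unfolding GS_norm_def by (auto intro: cSUP_least)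

lemma GS_norm_nonneg: "f \<in> GS_banach t s h \<Longrightarrow> h > 0 \<Longrightarrow> GS_norm t s h f \<ge> 0"
  using GS_norm_upper[of f t s h] GS_quot_nonneg[of h t s f] order_trans by blast

lemma GSB_imp_norm:
  fixes f :: "'a::euclidean_space \<Rightarrow> complex" and t h :: real
  assumes "t > 0" "h > 0" "f \<in> C_infinity" "GSB t s (t * DIM('a) * h powr (- (1 / t))) h f M"
  shows "f \<in> GS_banach t s h" "GS_norm t s h f \<le> M"
  using GS_quot_le[OF assms(1,2) order_refl assms(4)] assms(3)
  by (auto simp: GS_banach_def bdd_above_def intro: GS_norm_least)

text \<open>
  Conversely, decay against all monomials is tested only on the powers of the largest coordinate.
\<close>

lemma decay_of_mi_powers:
  fixes t r :: real
  assumes t: "t > 0" and r: "r > 0"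
  shows "\<exists>h0>0. \<forall>h X M. \<forall>y :: 'a::euclidean_space. 0 < h \<longrightarrow> h \<le> h0 \<longrightarrow> 0 \<le> X \<longrightarrow> 0 \<le> M \<longrightarrow>
    (\<forall>\<alpha>. \<bar>mi_power y \<alpha>\<bar> * X \<le> M * h ^ mi_size \<alpha> * mi_fact \<alpha> powr t) \<longrightarrow>
    X \<le> M * 2 powr t * exp (- r * norm y powr (1 / t))"
proof -
  define h0 where "h0 = (t / (2 * r)) powr t / DIM('a)"
  have h0: "h0 > 0" using t r by (simp add: h0_def)
  have "X \<le> M * 2 powr t * exp (- r * norm y powr (1 / t))"
    if h: "0 < h" "h \<le> h0" and X: "0 \<le> X" and M: "0 \<le> M"
      and le: "\<And>\<alpha>. \<bar>mi_power y \<alpha>\<bar> * X \<le> M * h ^ mi_size \<alpha> * mi_fact \<alpha> powr t"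
    for h X M and y :: 'a
  proof -
    have h': "DIM('a) * h \<le> (t / (2 * r)) powr t"
      using h by (simp add: h0_def field_simps)
    obtain b where b: "b \<in> Basis" "\<And>c. c \<in> Basis \<Longrightarrow> \<bar>y \<bullet> c\<bar> \<le> \<bar>y \<bullet> b\<bar>"
    proof -
      obtain b where "b \<in> Basis" "Max ((\<lambda>b. \<bar>y \<bullet> b\<bar>) ` Basis) = \<bar>y \<bullet> b\<bar>"
        by (rule obtains_MAX[OF finite_Basis nonempty_Basis])
      then show thesis using that[of b] Max_ge[of "(\<lambda>b. \<bar>y \<bullet> b\<bar>) ` Basis"] by simp
    qed
    have "norm y \<le> (\<Sum>c\<in>Basis. \<bar>y \<bullet> c\<bar>)" by (rule norm_le_l1)
    also have "\<dots> \<le> DIM('a) * \<bar>y \<bullet> b\<bar>" by (rule sum_bounded_above) (rule b(2))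
    finally have yb: "norm y \<le> DIM('a) * \<bar>y \<bullet> b\<bar>" .
    have "X \<le> M * 2 powr t * exp (- (t / 2) * (\<bar>y \<bullet> b\<bar> / h) powr (1 / t))"
    proof (rule decay_of_powers)
      fix n
      define \<alpha> :: "'a \<Rightarrow> nat" where "\<alpha> = (\<lambda>c. if c = b then n else 0)"
      have "mi_power y \<alpha> = (y \<bullet> b) ^ n" "mi_size \<alpha> = n" "mi_fact \<alpha> = fact n"
        using b(1) by (simp_all add: \<alpha>_def mi_power_def mi_size_def mi_fact_def
            prod.remove[of Basis b] sum.remove[of Basis b])
      with le[of \<alpha>] show "\<bar>y \<bullet> b\<bar> ^ n * X \<le> M * h ^ n * fact n powr t"
        by (simp add: power_abs)
    qed (use h t X M in auto)
    also have "\<dots> \<le> M * 2 powr t * exp (- r * norm y powr (1 / t))"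
    proof (intro mult_left_mono)
      have "(norm y / (DIM('a) * h)) powr (1 / t) \<le> (\<bar>y \<bullet> b\<bar> / h) powr (1 / t)"
        using yb h(1) t by (intro powr_mono2) (auto simp: field_simps)
      moreover have "norm y powr (1 / t) * (2 * r / t) \<le> (norm y / (DIM('a) * h)) powr (1 / t)"
      proof -
        have "(DIM('a) * h) powr (1 / t) \<le> ((t / (2 * r)) powr t) powr (1 / t)"
          using h' h t by (intro powr_mono2) auto
        then have "(DIM('a) * h) powr (1 / t) \<le> t / (2 * r)"
          using t r by (simp add: powr_powr)
        moreover have "(DIM('a) * h) powr (1 / t) > 0" using h(1) by simp
        ultimately show ?thesis
          using r t mult_left_mono[of "r * (2 * (h * real DIM('a)) powr (1 / t))" t "norm y powr (1 / t)"]
          by (simp add: powr_divide field_simps)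
      qed
      ultimately have "norm y powr (1 / t) * (2 * r / t) \<le> (\<bar>y \<bullet> b\<bar> / h) powr (1 / t)" by linarith
      then have "(t / 2) * (norm y powr (1 / t) * (2 * r / t)) \<le> (t / 2) * (\<bar>y \<bullet> b\<bar> / h) powr (1 / t)"
        using t by (intro mult_left_mono) auto
      then show "exp (- (t / 2) * (\<bar>y \<bullet> b\<bar> / h) powr (1 / t)) \<le> exp (- r * norm y powr (1 / t))"
        using t by (simp add: field_simps)
    qed (use M in auto)
    finally show ?thesis .
  qed
  with h0 show ?thesis by blast
qed

text \<open>
  For every derivative separately, the bounds against all monomials give decay. The radius \<open>h'\<close> that
  controls the monomials has to be small to reach a large rate \<open>r\<close>.
\<close>

lemma norm_imp_GSB:
  assumes t: "t > 0" and r: "r > 0" and h: "h > 0"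
  shows "\<exists>h'>0. \<exists>C\<ge>0. \<forall>f \<in> GS_banach t s h'.
    GSB t s r h (f :: 'a::euclidean_space \<Rightarrow> complex) (C * GS_norm t s h' f)"
proof -
  obtain h0 where h0: "h0 > 0" "\<And>h X M. \<And>y :: 'a. \<lbrakk>0 < h; h \<le> h0; 0 \<le> X; 0 \<le> M;
      \<And>\<alpha>. \<bar>mi_power y \<alpha>\<bar> * X \<le> M * h ^ mi_size \<alpha> * mi_fact \<alpha> powr t\<rbrakk> \<Longrightarrow>
      X \<le> M * 2 powr t * exp (- r * norm y powr (1 / t))"
    using decay_of_mi_powers[OF t r, where 'a = 'a] by blast
  define h' where "h' = min h h0"
  have h': "h' > 0" "h' \<le> h" "h' \<le> h0" using h h0 by (auto simp: h'_def)
  have "GSB t s r h f (2 powr t * GS_norm t s h' f)" if f: "f \<in> GS_banach t s h'" for f :: "'a \<Rightarrow> complex"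
    unfolding GSB_def
  proof (intro allI)
    fix \<beta> :: "'a \<Rightarrow> nat" and y :: 'a
    let ?N = "GS_norm t s h' f"
    have N: "?N \<ge> 0" by (rule GS_norm_nonneg[OF f h'(1)])
    have "norm (mi_D \<beta> f y) \<le> (?N * h' ^ mi_size \<beta> * mi_fact \<beta> powr s) * 2 powr t * exp (- r * norm y powr (1 / t))"
    proof (rule h0(2))
      fix \<alpha>
      have "GS_quot t s h' f (y, \<alpha>, \<beta>) \<le> ?N" using f by (rule GS_norm_upper)
      then show "\<bar>mi_power y \<alpha>\<bar> * norm (mi_D \<beta> f y)
          \<le> ?N * h' ^ mi_size \<beta> * mi_fact \<beta> powr s * h' ^ mi_size \<alpha> * mi_fact \<alpha> powr t"
        using h'(1) mi_fact_pos[of \<beta>] mi_fact_pos[of \<alpha>]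
        by (simp add: GS_quot_def mi_size_add power_add norm_mult divide_le_eq mult_ac)
    qed (use h' N in auto)
    also have "\<dots> \<le> (?N * h ^ mi_size \<beta> * mi_fact \<beta> powr s) * 2 powr t * exp (- r * norm y powr (1 / t))"
      using h' N by (intro mult_right_mono mult_left_mono power_mono) auto
    finally show "norm (mi_D \<beta> f y) \<le> 2 powr t * ?N * h ^ mi_size \<beta> * mi_fact \<beta> powr s * exp (- r * norm y powr (1 / t))"
      by (simp add: mult_ac)
  qed
  then have "\<forall>f \<in> GS_banach t s h'. GSB t s r h (f :: 'a \<Rightarrow> complex) (2 powr t * GS_norm t s h' f)"
    by blast
  moreover have "(2::real) powr t \<ge> 0" by simp
  ultimately show ?thesis using h'(1) by blast
qed

lemma GS_banach: "f \<in> GS t s \<Longrightarrow> h > 0 \<Longrightarrow> f \<in> GS_banach t s h"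
  by (auto simp: GS_def)

lemma GS_C_infinity: "f \<in> GS t s \<Longrightarrow> f \<in> C_infinity"
  using GS_banach[of f t s 1] by (simp add: GS_banach_def)

text \<open>
  The intersection over all radii is the same for the two kinds of bounds.
\<close>

lemma GS_iff:
  assumes t: "t > 0"
  shows "f \<in> GS t s \<longleftrightarrow> f \<in> C_infinity \<and> (\<forall>r>0. \<forall>h>0. \<exists>M. GSB t s r h f M)"
proof (intro iffI conjI allI impI)
  fix r h :: real assume "f \<in> GS t s" "r > 0" "h > 0"
  then show "\<exists>M. GSB t s r h f M"
    using norm_imp_GSB[OF t, of r h s] GS_banach by blast
next
  assume f: "f \<in> C_infinity \<and> (\<forall>r>0. \<forall>h>0. \<exists>M. GSB t s r h f M)"
  have "f \<in> GS_banach t s h" if h: "h > 0" for h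
  proof -
    have "t * DIM('a) * h powr (- (1 / t)) > 0" using t h by simp
    then show ?thesis using f h GSB_imp_norm(1)[OF t h] by blast
  qed
  then show "f \<in> GS t s" by (auto simp: GS_def)
qed (auto intro: GS_C_infinity)

lemma GS_bounds: "f \<in> GS t s \<Longrightarrow> t > 0 \<Longrightarrow> r > 0 \<Longrightarrow> h > 0 \<Longrightarrow> \<exists>M. GSB t s r h f M"
  using GS_iff by blast

lemma GSB_lincomb:
  assumes "f \<in> C_infinity" "g \<in> C_infinity" "GSB t s r h f M" "GSB t s r h g N"
  shows "GSB t s r h (\<lambda>x. a * f x + b * g x) (norm a * M + norm b * N)"
  unfolding GSB_def
proof (intro allI)
  fix \<beta> y
  have "norm (mi_D \<beta> (\<lambda>x. a * f x + b * g x) y) \<le> norm a * norm (mi_D \<beta> f y) + norm b * norm (mi_D \<beta> g y)"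
    using norm_triangle_ineq by (simp add: mi_D_lincomb[OF assms(1,2)] norm_mult[symmetric])
  also have "\<dots> \<le> norm a * (M * h ^ mi_size \<beta> * mi_fact \<beta> powr s * exp (- r * norm y powr (1 / t)))
    + norm b * (N * h ^ mi_size \<beta> * mi_fact \<beta> powr s * exp (- r * norm y powr (1 / t)))"
    by (intro add_mono mult_left_mono GSB_D[OF assms(3)] GSB_D[OF assms(4)]) auto
  finally show "norm (mi_D \<beta> (\<lambda>x. a * f x + b * g x) y) \<le> (norm a * M + norm b * N) * h ^ mi_size \<beta>
     * mi_fact \<beta> powr s * exp (- r * norm y powr (1 / t))"
    by (simp add: algebra_simps)
qed

lemma GS_lincomb:
  assumes t: "t > 0" and "f \<in> GS t s" "g \<in> GS t s"
  shows "(\<lambda>x. a * f x + b * g x) \<in> GS t s"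
  unfolding GS_iff[OF t]
proof (intro conjI allI impI)
  show "(\<lambda>x. a * f x + b * g x) \<in> C_infinity"
    using assms by (intro mi_D_lincomb GS_C_infinity)
  fix r h :: real assume "r > 0" "h > 0"
  then obtain M N where "GSB t s r h f M" "GSB t s r h g N" using assms GS_bounds by metis
  then show "\<exists>M. GSB t s r h (\<lambda>x. a * f x + b * g x) M"
    using GSB_lincomb assms GS_C_infinity by blast
qed

lemma GS_cmult: "t > 0 \<Longrightarrow> f \<in> GS t s \<Longrightarrow> (\<lambda>x. a * f x) \<in> GS t s"
  using GS_lincomb[of t f s f a 0] by simp

lemma GS_diff: "t > 0 \<Longrightarrow> f \<in> GS t s \<Longrightarrow> g \<in> GS t s \<Longrightarrow> (\<lambda>x. f x - g x) \<in> GS t s"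
  using GS_lincomb[of t f s g 1 "-1"] by simp

lemma GS_zero:
  fixes f :: "'a::euclidean_space \<Rightarrow> complex"
  shows "t > 0 \<Longrightarrow> f \<in> GS t s \<Longrightarrow> (\<lambda>x::'a. 0) \<in> GS t s"
  using GS_cmult[of t f s 0] by simp

lemma GS_sum:
  fixes g :: "'a::euclidean_space \<Rightarrow> complex" and f :: "'i \<Rightarrow> 'a \<Rightarrow> complex"
  assumes "t > 0" "g \<in> GS t s" "\<And>i. i \<in> I \<Longrightarrow> f i \<in> GS t s"
  shows "(\<lambda>x. \<Sum>i\<in>I. c i * f i x) \<in> GS t s"
  using assms(3)
proof (induction I rule: infinite_finite_induct)
  case (insert i I)
  then have "(\<lambda>x. \<Sum>i\<in>I. c i * f i x) \<in> GS t s" by auto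
  from GS_lincomb[OF assms(1) insert(4)[of i] this, of "c i" 1] insert show ?case by simp
qed (use GS_zero[OF assms(1,2)] in auto)

lemma mi_D_sum:
  fixes g :: "'a::euclidean_space \<Rightarrow> complex" and f :: "'i \<Rightarrow> 'a \<Rightarrow> complex"
  assumes "\<And>i. i \<in> I \<Longrightarrow> f i \<in> C_infinity" "g \<in> C_infinity"
  shows "(\<lambda>x. \<Sum>i\<in>I. c i * f i x) \<in> C_infinity \<and>
    mi_D \<beta> (\<lambda>x. \<Sum>i\<in>I. c i * f i x) = (\<lambda>x. \<Sum>i\<in>I. c i * mi_D \<beta> (f i) x)"
proof -
  have 0: "(\<lambda>x::'a. 0) \<in> C_infinity \<and> mi_D \<beta> (\<lambda>x::'a. 0) = (\<lambda>x::'a. 0)"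
    using mi_D_lincomb[OF assms(2,2), where a = 0 and b = 0] by simp
  show ?thesis using assms(1)
  proof (induction I rule: infinite_finite_induct)
    case (insert i I)
    then show ?case
      using mi_D_lincomb[of "f i" "\<lambda>x. \<Sum>i\<in>I. c i * f i x", where a = "c i" and b = 1] by simp
  qed (use 0 in auto)
qed

lemma GS_norm_lincomb:
  fixes f g :: "'a::euclidean_space \<Rightarrow> complex"
  assumes t: "t > 0" and h: "h > 0" and f: "f \<in> GS t s" and g: "g \<in> GS t s"
  shows "GS_norm t s h (\<lambda>x. a * f x + b * g x) \<le> norm a * GS_norm t s h f + norm b * GS_norm t s h g"
proof (rule GS_norm_least)
  fix z :: "'a \<times> ('a \<Rightarrow> nat) \<times> ('a \<Rightarrow> nat)"
  obtain y and \<alpha> \<beta> :: "'a \<Rightarrow> nat" where z: "z = (y, \<alpha>, \<beta>)" by (cases z)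
  let ?d = "h ^ mi_size (\<lambda>b. \<alpha> b + \<beta> b) * mi_fact \<alpha> powr t * mi_fact \<beta> powr s"
  have "GS_quot t s h (\<lambda>x. a * f x + b * g x) z
    = norm (of_real (mi_power y \<alpha>) * (a * mi_D \<beta> f y + b * mi_D \<beta> g y)) / ?d"
    by (simp add: z GS_quot_def mi_D_lincomb[OF GS_C_infinity[OF f] GS_C_infinity[OF g]])
  also have "\<dots> \<le> (norm a * norm (of_real (mi_power y \<alpha>) * mi_D \<beta> f y)
      + norm b * norm (of_real (mi_power y \<alpha>) * mi_D \<beta> g y)) / ?d"
  proof (rule divide_right_mono)
    have "of_real (mi_power y \<alpha>) * (a * mi_D \<beta> f y + b * mi_D \<beta> g y)
      = a * (of_real (mi_power y \<alpha>) * mi_D \<beta> f y) + b * (of_real (mi_power y \<alpha>) * mi_D \<beta> g y)"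
      by (simp add: algebra_simps)
    then show "norm (of_real (mi_power y \<alpha>) * (a * mi_D \<beta> f y + b * mi_D \<beta> g y)) \<le>
      norm a * norm (of_real (mi_power y \<alpha>) * mi_D \<beta> f y)
      + norm b * norm (of_real (mi_power y \<alpha>) * mi_D \<beta> g y)"
      by (metis norm_mult norm_triangle_ineq)
  qed (use h in simp)
  also have "\<dots> = norm a * GS_quot t s h f z + norm b * GS_quot t s h g z"
    by (simp add: z GS_quot_def add_divide_distrib)
  also have "\<dots> \<le> norm a * GS_norm t s h f + norm b * GS_norm t s h g"
    using f g h by (intro add_mono mult_left_mono GS_norm_upper GS_banach) auto
  finally show "GS_quot t s h (\<lambda>x. a * f x + b * g x) z \<le> norm a * GS_norm t s h f + norm b * GS_norm t s h g" .
qed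

lemma GS_norm_antimono:
  fixes f :: "'a::euclidean_space \<Rightarrow> complex"
  assumes "f \<in> GS t s" "0 < h" "h \<le> h'"
  shows "GS_norm t s h' f \<le> GS_norm t s h f"
proof (rule GS_norm_least)
  fix z :: "'a \<times> ('a \<Rightarrow> nat) \<times> ('a \<Rightarrow> nat)"
  have "GS_quot t s h' f z \<le> GS_quot t s h f z"
    using assms
    by (auto simp: GS_quot_def power_mono split: prod.splits intro!: divide_left_mono mult_right_mono mult_pos_pos)
  also have "\<dots> \<le> GS_norm t s h f" using assms by (intro GS_norm_upper GS_banach)
  finally show "GS_quot t s h' f z \<le> GS_norm t s h f" .
qed

lemma GS_cnj_bound:
  assumes "f \<in> C_infinity"
  shows "norm (mi_D \<beta> (\<lambda>x. cnj (f x)) y) = norm (mi_D \<beta> f y)"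
proof -
  have "cnj_related (mi_D \<beta> f) (mi_D \<beta> (\<lambda>x. cnj (f x)))"
    using assms by (intro cnj_related_mi_D) (simp add: cnj_related_def)
  then show ?thesis by (auto simp: cnj_related_def)
qed

lemma GSB_cnj: "f \<in> C_infinity \<Longrightarrow> GSB t s r h f M \<Longrightarrow> GSB t s r h (\<lambda>x. cnj (f x)) M"
  by (simp add: GSB_def GS_cnj_bound)

lemma GS_norm_cnj: "f \<in> GS t s \<Longrightarrow> GS_norm t s h (\<lambda>x. cnj (f x)) = GS_norm t s h f"
  by (auto simp: GS_norm_def GS_quot_def GS_cnj_bound GS_C_infinity norm_mult intro!: SUP_cong)

subsection \<open>Tensor products and products\<close>

lemma GS_tensor:
  fixes f g :: "'a::euclidean_space \<Rightarrow> complex"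
  assumes t: "t > 0" and f: "f \<in> GS t s" and g: "g \<in> GS t s"
  shows "tensor f g \<in> GS t s"
    and "h > 0 \<Longrightarrow> GS_norm t s h (tensor f g) \<le> GS_norm t s h f * GS_norm t s h g"
proof -
  have le: "GS_quot t s h (tensor f g) z \<le> GS_norm t s h f * GS_norm t s h g" if h: "h > 0"
    for z :: "('a \<times> 'a) \<times> ('a \<times> 'a \<Rightarrow> nat) \<times> ('a \<times> 'a \<Rightarrow> nat)" and h
  proof -
    obtain x y and \<alpha> \<beta> :: "'a \<times> 'a \<Rightarrow> nat" where z: "z = ((x, y), \<alpha>, \<beta>)"
      by (metis prod.exhaust)
    have 1: "mi_fst (\<lambda>b::'a \<times> 'a. \<alpha> b + \<beta> b) = (\<lambda>b. mi_fst \<alpha> b + mi_fst \<beta> b)"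
      "mi_snd (\<lambda>b. \<alpha> b + \<beta> b) = (\<lambda>b. mi_snd \<alpha> b + mi_snd \<beta> b)"
      by (simp_all add: mi_fst_def mi_snd_def)
    have "mi_fact (mi_fst \<gamma>) \<ge> 0" "mi_fact (mi_snd \<gamma>) \<ge> 0" for \<gamma> :: "'a \<times> 'a \<Rightarrow> nat"
      using mi_fact_pos less_imp_le by blast+
    moreover have "mi_D \<beta> (tensor f g) (x, y) = mi_D (mi_fst \<beta>) f x * mi_D (mi_snd \<beta>) g y"
      unfolding mi_D_tensor[OF GS_C_infinity[OF f] GS_C_infinity[OF g]] by (simp add: tensor_def)
    ultimately have "GS_quot t s h (tensor f g) z
      = GS_quot t s h f (x, mi_fst \<alpha>, mi_fst \<beta>) * GS_quot t s h g (y, mi_snd \<alpha>, mi_snd \<beta>)"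
      by (simp add: z GS_quot_def abs_mult mult_ac
        mi_prod_split[where \<beta> = \<alpha>] mi_prod_split[where \<beta> = \<beta>] mi_prod_split(1)[of "\<lambda>b. \<alpha> b + \<beta> b"] 1
        norm_mult power_add powr_mult)
    also have "\<dots> \<le> GS_norm t s h f * GS_norm t s h g"
      using f g h by (intro mult_mono GS_norm_upper GS_banach GS_norm_nonneg GS_quot_nonneg)
    finally show ?thesis .
  qed
  show "tensor f g \<in> GS t s"
    using mi_D_tensor(1)[OF GS_C_infinity[OF f] GS_C_infinity[OF g]]
    unfolding GS_def GS_banach_def by (auto intro!: bdd_aboveI2 le)
  show "GS_norm t s h (tensor f g) \<le> GS_norm t s h f * GS_norm t s h g" if "h > 0"
    using le[OF that] by (rule GS_norm_least)
qed

text \<open>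
  The Leibniz rule doubles the radius \<open>h\<close>, which is harmless since all radii are admitted. The two
  decay factors are kept apart: one of them serves for integration in \<open>y\<close>, the other for decay in \<open>x\<close>.
\<close>

lemma GSB_mult:
  assumes "f \<in> C_infinity" "g \<in> C_infinity" "s > 0" "h > 0"
    and f: "GSB t s r1 h f M" and g: "GSB t s r2 h g N"
  shows "norm (mi_D \<beta> (\<lambda>y. f y * g (y - x)) y) \<le> M * N * (2 * h) ^ mi_size \<beta> * mi_fact \<beta> powr s
    * (exp (- r1 * norm y powr (1 / t)) * exp (- r2 * norm (y - x) powr (1 / t)))"
proof -
  let ?E1 = "exp (- r1 * norm y powr (1 / t))" and ?E2 = "exp (- r2 * norm (y - x) powr (1 / t))"
  have "norm (mi_D \<beta> (\<lambda>y. f y * translation x g y) y)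
    \<le> (M * ?E1) * (N * ?E2) * (2 * h) ^ mi_size \<beta> * mi_fact \<beta> powr s"
  proof (rule mi_D_mult_bound)
    show "norm (mi_D \<gamma> f y) \<le> M * ?E1 * h ^ mi_size \<gamma> * mi_fact \<gamma> powr s" for \<gamma>
      using GSB_D[OF f, of \<gamma> y] by (simp add: mult_ac)
    show "norm (mi_D \<gamma> (translation x g) y) \<le> N * ?E2 * h ^ mi_size \<gamma> * mi_fact \<gamma> powr s" for \<gamma>
      using GSB_D[OF g, of \<gamma> "y - x"]
      unfolding mi_D_translation[OF assms(2)] by (simp add: translation_def mult_ac)
  qed (use assms GSB_nonneg[OF f] in \<open>auto simp: mi_D_translation\<close>)
  then show ?thesis by (simp add: translation_def mult_ac)
qed

section \<open>Bounded sequences that converge pointwise\<close>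

lemma C_infinity_lipschitz:
  fixes f :: "'a::euclidean_space \<Rightarrow> complex" and M :: real
  assumes f: "f \<in> C_infinity" and le: "\<And>b y. b \<in> Basis \<Longrightarrow> norm (Dop b f y) \<le> M"
  shows "norm (f x - f y) \<le> DIM('a) * M * norm (x - y)"
proof (rule differentiable_bound[OF convex_UNIV])
  fix z :: 'a
  show "(f has_derivative (\<lambda>v. \<Sum>b\<in>Basis. of_real (v \<bullet> b) * (\<i> * Dop b f z))) (at z within UNIV)"
    using C_infinity_has_derivative[OF f] by simp
  show "onorm (\<lambda>v. \<Sum>b\<in>Basis. of_real (v \<bullet> b) * (\<i> * Dop b f z)) \<le> DIM('a) * M"
  proof (rule onorm_le)
    fix v :: 'a
    have "norm (\<Sum>b\<in>Basis. of_real (v \<bullet> b) * (\<i> * Dop b f z)) \<le> of_nat DIM('a) * (norm v * M)"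
      using le by (intro sum_norm_bound) (auto simp: norm_mult Basis_le_norm intro!: mult_mono)
    then show "norm (\<Sum>b\<in>Basis. of_real (v \<bullet> b) * (\<i> * Dop b f z)) \<le> DIM('a) * M * norm v"
      by (simp add: mult_ac)
  qed
qed auto

lemma C_infinity_taylor:
  fixes f :: "'a::euclidean_space \<Rightarrow> complex" and M :: real
  assumes f: "f \<in> C_infinity"
    and le: "\<And>b c y. b \<in> Basis \<Longrightarrow> c \<in> Basis \<Longrightarrow> norm (Dop c (Dop b f) y) \<le> M"
  shows "norm (f x - f y - (\<Sum>b\<in>Basis. of_real ((x - y) \<bullet> b) * (\<i> * Dop b f y)))
    \<le> (real DIM('a))\<^sup>2 * M * (norm (x - y))\<^sup>2"
proof -
  let ?L = "\<lambda>z v. \<Sum>b\<in>Basis. of_real (v \<bullet> b) * (\<i> * Dop b f z)"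
  have M: "M \<ge> 0" using le norm_ge_zero order_trans SOME_Basis by blast
  have "norm (f x - f y - ?L y (x - y)) \<le> norm (x - y) * (DIM('a) * (DIM('a) * M * norm (x - y)))"
  proof (rule differentiable_bound_linearization[where S = "cball y (norm (x - y))"])
    fix z assume "z \<in> cball y (norm (x - y))"
    then have z: "norm (z - y) \<le> norm (x - y)" by (simp add: dist_norm norm_minus_commute)
    show "(f has_derivative ?L z) (at z within cball y (norm (x - y)))"
      by (rule has_derivative_at_withinI[OF C_infinity_has_derivative[OF f]])
    show "onorm (?L z - ?L y) \<le> DIM('a) * (DIM('a) * M * norm (x - y))"
    proof (rule onorm_le)
      fix v :: 'a
      have "(?L z - ?L y) v = (\<Sum>b\<in>Basis. of_real (v \<bullet> b) * (\<i> * (Dop b f z - Dop b f y)))"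
        by (simp add: sum_subtractf[symmetric] algebra_simps)
      also have "norm \<dots> \<le> of_nat DIM('a) * (norm v * (DIM('a) * M * norm (x - y)))"
      proof (rule sum_norm_bound)
        fix b :: 'a assume b: "b \<in> Basis"
        have "norm (Dop b f z - Dop b f y) \<le> DIM('a) * M * norm (z - y)"
          by (rule C_infinity_lipschitz[OF Dop_C_infinity[OF b f] le[OF b]])
        also have "\<dots> \<le> DIM('a) * M * norm (x - y)" using z M by (intro mult_left_mono) auto
        finally show "norm (of_real (v \<bullet> b) * (\<i> * (Dop b f z - Dop b f y)))
            \<le> norm v * (DIM('a) * M * norm (x - y))"
          using b by (auto simp: norm_mult Basis_le_norm intro!: mult_mono)
      qed
      finally show "norm ((?L z - ?L y) v) \<le> DIM('a) * (DIM('a) * M * norm (x - y)) * norm v"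
        by (simp add: mult_ac)
    qed
  next
    fix u :: real assume "u \<in> {0..1}"
    then show "y + u *\<^sub>R (x - y) \<in> cball y (norm (x - y))"
      by (auto simp: dist_norm intro: mult_left_le_one_le)
  qed auto
  then show ?thesis by (simp add: power2_eq_square mult_ac)
qed

text \<open>
  If second derivatives are bounded uniformly in \<open>n\<close>, difference quotients approximate the first
  derivatives uniformly in \<open>n\<close>, so pointwise convergence is inherited by the derivatives.
\<close>

lemma convergent_Dop:
  fixes F :: "nat \<Rightarrow> 'a::euclidean_space \<Rightarrow> complex"
  assumes F: "\<And>n. F n \<in> C_infinity" and b: "b \<in> Basis"
    and le: "\<And>n a c y. a \<in> Basis \<Longrightarrow> c \<in> Basis \<Longrightarrow> norm (Dop c (Dop a (F n)) y) \<le> M"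
    and conv: "\<And>y. convergent (\<lambda>n. F n y)"
  shows "convergent (\<lambda>n. Dop b (F n) y)"
proof (rule Cauchy_convergent, rule metric_CauchyI)
  fix \<epsilon> :: real assume e: "\<epsilon> > 0"
  define C where "C = (real DIM('a))\<^sup>2 * \<bar>M\<bar> + 1"
  have C: "C > 0" by (simp add: C_def add_nonneg_pos)
  define \<tau> where "\<tau> = \<epsilon> / (4 * C)"
  have \<tau>: "\<tau> > 0" using e C by (simp add: \<tau>_def)
  have "\<exists>N. \<forall>m\<ge>N. \<forall>n\<ge>N. norm (F m y - F n y) < \<tau> * \<epsilon> / 8" for y
    using CauchyD[OF convergent_Cauchy[OF conv[of y]], of "\<tau> * \<epsilon> / 8"] e \<tau> by simp
  then obtain N where N: "\<And>y m n. m \<ge> N y \<Longrightarrow> n \<ge> N y \<Longrightarrow> norm (F m y - F n y) < \<tau> * \<epsilon> / 8"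
    by metis
  show "\<exists>N. \<forall>m\<ge>N. \<forall>n\<ge>N. dist (Dop b (F m) y) (Dop b (F n) y) < \<epsilon>"
  proof (intro exI allI impI)
    fix m n assume mn: "m \<ge> max (N y) (N (y + \<tau> *\<^sub>R b))" "n \<ge> max (N y) (N (y + \<tau> *\<^sub>R b))"
    have T: "norm (F k (y + \<tau> *\<^sub>R b) - F k y - of_real \<tau> * (\<i> * Dop b (F k) y)) \<le> C * \<tau>\<^sup>2" for k
    proof -
      have "norm (F k (y + \<tau> *\<^sub>R b) - F k y
          - (\<Sum>a\<in>Basis. of_real ((y + \<tau> *\<^sub>R b - y) \<bullet> a) * (\<i> * Dop a (F k) y)))
        \<le> (real DIM('a))\<^sup>2 * \<bar>M\<bar> * (norm (y + \<tau> *\<^sub>R b - y))\<^sup>2"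
        using le by (intro C_infinity_taylor[where f = "F k"] F) (meson abs_ge_self order_trans)
      also have "(\<Sum>a\<in>Basis. of_real ((y + \<tau> *\<^sub>R b - y) \<bullet> a) * (\<i> * Dop a (F k) y))
        = of_real \<tau> * (\<Sum>a\<in>Basis. of_real (b \<bullet> a) * (\<i> * Dop a (F k) y))"
        by (simp add: sum_distrib_left mult_ac)
      also have "\<dots> = of_real \<tau> * (\<i> * Dop b (F k) y)"
        by (simp add: sum_Basis_delta[OF b])
      also have "(real DIM('a))\<^sup>2 * \<bar>M\<bar> * (norm (y + \<tau> *\<^sub>R b - y))\<^sup>2 \<le> C * \<tau>\<^sup>2"
        using b \<tau> by (simp add: C_def algebra_simps)
      finally show ?thesis .
    qed
    define A where "A = of_real \<tau> * (\<i> * Dop b (F m) y)"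
    define B where "B = of_real \<tau> * (\<i> * Dop b (F n) y)"
    have tri: "norm (Q - P + R - S) \<le> norm P + norm Q + norm R + norm S" for P Q R S :: complex
      by (smt (verit) norm_triangle_ineq norm_triangle_ineq4)
    have "A - B = (F n (y + \<tau> *\<^sub>R b) - F n y - B) - (F m (y + \<tau> *\<^sub>R b) - F m y - A)
      + (F m (y + \<tau> *\<^sub>R b) - F n (y + \<tau> *\<^sub>R b)) - (F m y - F n y)"
      by (simp add: algebra_simps)
    also have "norm \<dots> \<le> norm (F m (y + \<tau> *\<^sub>R b) - F m y - A) + norm (F n (y + \<tau> *\<^sub>R b) - F n y - B)
      + norm (F m (y + \<tau> *\<^sub>R b) - F n (y + \<tau> *\<^sub>R b)) + norm (F m y - F n y)"
      by (rule tri)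
    also have "\<dots> < C * \<tau>\<^sup>2 + C * \<tau>\<^sup>2 + \<tau> * \<epsilon> / 8 + \<tau> * \<epsilon> / 8"
    proof -
      have "norm (F m (y + \<tau> *\<^sub>R b) - F n (y + \<tau> *\<^sub>R b)) < \<tau> * \<epsilon> / 8" "norm (F m y - F n y) < \<tau> * \<epsilon> / 8"
        using N[where y = "y + \<tau> *\<^sub>R b" and m = m and n = n] N[where y = y and m = m and n = n] mn by auto
      then show ?thesis using T[of m] T[of n] unfolding A_def B_def by linarith
    qed
    also have "\<dots> < \<tau> * \<epsilon>"
      using e C by (simp add: \<tau>_def power2_eq_square field_simps)
    finally have "norm (A - B) < \<tau> * \<epsilon>" .
    moreover have "norm (A - B) = \<tau> * norm (Dop b (F m) y - Dop b (F n) y)"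
    proof -
      have "A - B = of_real \<tau> * (\<i> * (Dop b (F m) y - Dop b (F n) y))"
        by (simp add: A_def B_def algebra_simps)
      then show ?thesis using \<tau> by (simp add: norm_mult)
    qed
    ultimately show "dist (Dop b (F m) y) (Dop b (F n) y) < \<epsilon>"
      using \<tau> by (simp add: dist_norm)
  qed
qed

text \<open>
  By induction all derivatives converge pointwise, and their limits form a jet because the
  Taylor estimate, with a constant that does not depend on \<open>n\<close>, passes to the limit.
\<close>

lemma C_infinity_limit:
  fixes f :: "nat \<Rightarrow> 'a::euclidean_space \<Rightarrow> complex"
  assumes f: "\<And>n. f n \<in> C_infinity"
    and bd: "\<And>\<beta>. \<exists>M. \<forall>n y. norm (mi_D \<beta> (f n) y) \<le> M"
    and conv: "\<And>y. (\<lambda>n. f n y) \<longlonglongrightarrow> F y"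
  shows "F \<in> C_infinity" and "(\<lambda>n. mi_D \<beta> (f n) y) \<longlonglongrightarrow> mi_D \<beta> F y"
proof -
  obtain M where M: "\<And>\<beta> n y. norm (mi_D \<beta> (f n) y) \<le> M \<beta>" using bd by metis
  have second: "\<exists>C. \<forall>n a c y. a \<in> Basis \<longrightarrow> c \<in> Basis \<longrightarrow> norm (Dop c (Dop a (mi_D \<beta> (f n))) y) \<le> C" for \<beta>
  proof (intro exI allI impI)
    fix n y and a c :: 'a assume "a \<in> Basis" "c \<in> Basis"
    then have "norm (Dop c (Dop a (mi_D \<beta> (f n))) y) \<le> M (mi_inc c (mi_inc a \<beta>))"
      using M[of "mi_inc c (mi_inc a \<beta>)" n y] by (simp add: mi_D_inc f)
    also have "\<dots> \<le> (\<Sum>a\<in>Basis. \<Sum>c\<in>Basis. M (mi_inc c (mi_inc a \<beta>)))"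
    proof -
      have "M \<gamma> \<ge> 0" for \<gamma> using order_trans[OF norm_ge_zero M] .
      then show ?thesis
        using \<open>a \<in> Basis\<close> \<open>c \<in> Basis\<close>
        by (intro order_trans[OF _ member_le_sum[of a]] member_le_sum[of c]) (auto intro: sum_nonneg)
    qed
    finally show "norm (Dop c (Dop a (mi_D \<beta> (f n))) y) \<le> (\<Sum>a\<in>Basis. \<Sum>c\<in>Basis. M (mi_inc c (mi_inc a \<beta>)))" .
  qed
  have cv: "\<forall>y. convergent (\<lambda>n. mi_D \<beta> (f n) y)" for \<beta>
  proof (induction \<beta> rule: mi_induct)
    case (zero \<beta>)
    then show ?case using conv by (auto simp: mi_D_zero convergent_def)
  next
    case (inc \<beta> b)
    obtain C where C: "\<And>n a c y. a \<in> Basis \<Longrightarrow> c \<in> Basis \<Longrightarrow> norm (Dop c (Dop a (mi_D \<beta> (f n))) y) \<le> C"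
      using second[of \<beta>] by blast
    have "convergent (\<lambda>n. Dop b (mi_D \<beta> (f n)) y)" for y
      using inc C by (intro convergent_Dop[where M = C]) (auto intro: mi_D_C_infinity f)
    then show ?case using inc by (simp add: mi_D_inc f)
  qed
  define g where "g \<beta> y = lim (\<lambda>n. mi_D \<beta> (f n) y)" for \<beta> y
  have g: "(\<lambda>n. mi_D \<beta> (f n) y) \<longlonglongrightarrow> g \<beta> y" for \<beta> y
    using cv[of \<beta>] unfolding g_def by (simp add: convergent_LIMSEQ_iff)
  have "jet g"
    unfolding jet_def
  proof (intro allI)
    fix \<beta> x
    let ?L = "\<lambda>v. \<Sum>b\<in>Basis. of_real (v \<bullet> b) * (\<i> * g (mi_inc b \<beta>) x)"
    obtain C where C: "\<And>n a c y. a \<in> Basis \<Longrightarrow> c \<in> Basis \<Longrightarrow> norm (Dop c (Dop a (mi_D \<beta> (f n))) y) \<le> C"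
      using second[of \<beta>] by blast
    have T: "norm (g \<beta> y - g \<beta> x - ?L (y - x)) \<le> (real DIM('a))\<^sup>2 * C * (norm (y - x))\<^sup>2" for y
    proof (rule LIMSEQ_le_const2)
      show "(\<lambda>n. norm (mi_D \<beta> (f n) y - mi_D \<beta> (f n) x
          - (\<Sum>b\<in>Basis. of_real ((y - x) \<bullet> b) * (\<i> * mi_D (mi_inc b \<beta>) (f n) x))))
        \<longlonglongrightarrow> norm (g \<beta> y - g \<beta> x - ?L (y - x))"
        by (intro tendsto_intros g)
      have "norm (mi_D \<beta> (f n) y - mi_D \<beta> (f n) x
          - (\<Sum>b\<in>Basis. of_real ((y - x) \<bullet> b) * (\<i> * Dop b (mi_D \<beta> (f n)) x)))
        \<le> (real DIM('a))\<^sup>2 * C * (norm (y - x))\<^sup>2" for n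
        using C by (intro C_infinity_taylor[where f = "mi_D \<beta> (f n)"] mi_D_C_infinity f) auto
      then show "\<exists>N. \<forall>n\<ge>N. norm (mi_D \<beta> (f n) y - mi_D \<beta> (f n) x
          - (\<Sum>b\<in>Basis. of_real ((y - x) \<bullet> b) * (\<i> * mi_D (mi_inc b \<beta>) (f n) x)))
        \<le> (real DIM('a))\<^sup>2 * C * (norm (y - x))\<^sup>2"
        by (simp add: mi_D_inc f)
    qed
    show "(g \<beta> has_derivative ?L) (at x)"
    proof (rule has_derivativeI_sandwich[of 1])
      show "bounded_linear ?L"
        by (intro bounded_linear_sum bounded_linear_mult_const
            bounded_linear_compose[OF bounded_linear_of_real bounded_linear_inner_left])
      show "norm (g \<beta> y - g \<beta> x - ?L (y - x)) / norm (y - x) \<le> (real DIM('a))\<^sup>2 * C * norm (y - x)"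
        if "y \<noteq> x" for y
        using T[of y] that by (simp add: divide_le_eq power2_eq_square mult_ac)
      have "((\<lambda>y. (real DIM('a))\<^sup>2 * C * norm (y - x)) \<longlongrightarrow> (real DIM('a))\<^sup>2 * C * norm (x - x)) (at x)"
        by (intro tendsto_intros)
      then show "((\<lambda>y. (real DIM('a))\<^sup>2 * C * norm (y - x)) \<longlongrightarrow> 0) (at x)" by simp
    qed simp
  qed
  moreover have "g (\<lambda>_. 0) = F"
  proof
    fix y
    have "(\<lambda>n. f n y) \<longlonglongrightarrow> g (\<lambda>_. 0) y" using g[of "\<lambda>_. 0" y] by simp
    then show "g (\<lambda>_. 0) y = F y" using conv by (rule LIMSEQ_unique)
  qed
  ultimately have "F \<in> C_infinity" "mi_D \<beta> F = g (on_Basis \<beta>)"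
    using jet_C_infinity[of g "\<lambda>_. 0"] jet_mi_D[of g \<beta>] by simp_all
  moreover have "(\<lambda>n. mi_D \<beta> (f n) y) \<longlonglongrightarrow> g (on_Basis \<beta>) y"
    using g[of "on_Basis \<beta>" y] by simp
  ultimately show "F \<in> C_infinity" and "(\<lambda>n. mi_D \<beta> (f n) y) \<longlonglongrightarrow> mi_D \<beta> F y"
    by simp_all
qed

lemma equi_lipschitz_tendsto_uniform:
  fixes g :: "nat \<Rightarrow> 'a::metric_space \<Rightarrow> complex" and L :: real
  assumes K: "compact K" and L: "\<And>n x y. norm (g n x - g n y) \<le> L * dist x y"
    and g: "\<And>y. (\<lambda>n. g n y) \<longlonglongrightarrow> 0" and e: "\<epsilon> > 0"
  shows "\<forall>\<^sub>F n in sequentially. \<forall>y\<in>K. norm (g n y) \<le> \<epsilon>"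
proof -
  define \<delta> where "\<delta> = \<epsilon> / (2 * (\<bar>L\<bar> + 1))"
  have \<delta>0: "\<delta> > 0" using e by (simp add: \<delta>_def)
  have "\<bar>L\<bar> * \<delta> \<le> (\<bar>L\<bar> + 1) * \<delta>" using \<delta>0 by simp
  also have "\<dots> = \<epsilon> / 2"
  proof -
    have "\<bar>L\<bar> + 1 \<noteq> 0" by linarith
    then show ?thesis unfolding \<delta>_def by (simp add: divide_simps)
  qed
  finally have \<delta>: "\<delta> > 0" "\<bar>L\<bar> * \<delta> \<le> \<epsilon> / 2" using \<delta>0 by auto
  obtain k where k: "finite k" "K \<subseteq> (\<Union>x\<in>k. ball x \<delta>)"
    using K \<delta>(1) unfolding compact_eq_totally_bounded by blast
  have "\<forall>\<^sub>F n in sequentially. \<forall>x\<in>k. norm (g n x) < \<epsilon> / 2"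
    using k(1) e g by (intro eventually_ball_finite ballI order_tendstoD(2)[OF tendsto_norm_zero]) auto
  then show ?thesis
  proof eventually_elim
    case (elim n)
    show ?case
    proof
      fix y assume "y \<in> K"
      then obtain x where x: "x \<in> k" "dist x y < \<delta>" using k by auto
      have "norm (g n y) \<le> norm (g n y - g n x) + norm (g n x)"
        by (metis diff_add_cancel norm_triangle_ineq)
      also have "norm (g n y - g n x) \<le> \<bar>L\<bar> * \<delta>"
      proof -
        have "L * dist y x \<le> \<bar>L\<bar> * \<delta>"
          using x by (intro mult_mono) (auto simp: dist_commute)
        then show ?thesis using L[of n y x] by linarith
      qed
      finally show "norm (g n y) \<le> \<epsilon>" using elim x \<delta> by fastforce
    qed
  qed
qed

lemma GSB_global_bound:
  assumes "GSB t s r h f M" "r \<ge> 0" "h > 0"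
  shows "norm (mi_D \<beta> f y) \<le> M * h ^ mi_size \<beta> * mi_fact \<beta> powr s"
proof -
  have "norm (mi_D \<beta> f y) \<le> M * h ^ mi_size \<beta> * mi_fact \<beta> powr s * exp (- r * norm y powr (1 / t))"
    by (rule GSB_D[OF assms(1)])
  also have "\<dots> \<le> M * h ^ mi_size \<beta> * mi_fact \<beta> powr s * 1"
    using assms GSB_nonneg[OF assms(1)] by (intro mult_left_mono) auto
  finally show ?thesis by simp
qed

text \<open>
  The bounds with larger \<open>r\<close> and smaller \<open>h\<close> make derivatives of high order and values far out
  negligible; on the remaining finitely many derivatives and the remaining ball, pointwise
  convergence is uniform by equicontinuity.
\<close>

lemma GSB_tendsto_zero:
  fixes f :: "nat \<Rightarrow> 'a::euclidean_space \<Rightarrow> complex"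
  assumes t: "t > 0" and f: "\<And>n. f n \<in> C_infinity"
    and bd: "\<And>r h. r > 0 \<Longrightarrow> h > 0 \<Longrightarrow> \<exists>M. \<forall>n. GSB t s r h (f n) M"
    and f0: "\<And>y. (\<lambda>n. f n y) \<longlonglongrightarrow> 0" and r: "r > 0" and h: "h > 0" and e: "\<epsilon> > 0"
  shows "\<forall>\<^sub>F n in sequentially. GSB t s r h (f n) \<epsilon>"
proof -
  obtain M1 where M1: "\<And>n. GSB t s 1 1 (f n) M1" using bd[of 1 1] by auto
  have bd': "\<exists>M. \<forall>n y. norm (mi_D \<beta> (f n) y) \<le> M" for \<beta>
    using GSB_global_bound[OF M1] by force
  have z: "(\<lambda>x::'a. 0) \<in> C_infinity" "mi_D \<beta> (\<lambda>x::'a. 0) = (\<lambda>x. 0)" for \<beta>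
    using mi_D_lincomb[OF f[of 0] f[of 0], where a = 0 and b = 0] by simp_all
  have lim: "(\<lambda>n. mi_D \<beta> (f n) y) \<longlonglongrightarrow> 0" for \<beta> y
    using C_infinity_limit(2)[of f "\<lambda>x. 0", OF f bd' f0] by (simp add: z)
  obtain M where M: "\<And>n. GSB t s (r + 1) (h / 2) (f n) M" using bd[of "r + 1" "h / 2"] r h by auto
  have M0: "M \<ge> 0" using GSB_nonneg[OF M] .
  obtain B where B: "M * (1 / 2) ^ B \<le> \<epsilon>"
  proof -
    have "(\<lambda>n. M * (1 / 2) ^ n) \<longlonglongrightarrow> M * 0" by (intro tendsto_intros LIMSEQ_realpow_zero) auto
    then have "\<forall>\<^sub>F n in sequentially. M * (1 / 2) ^ n < \<epsilon>" using e by (simp add: order_tendstoD)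
    then obtain N where "\<And>n. n \<ge> N \<Longrightarrow> M * (1 / 2) ^ n < \<epsilon>" unfolding eventually_sequentially by blast
    then show thesis using that[of N] less_imp_le by blast
  qed
  obtain R where R: "R \<ge> 0" "M * exp (- (R powr (1 / t))) \<le> \<epsilon>"
  proof -
    define R where "R = (M / \<epsilon>) powr t"
    have R: "R powr (1 / t) = M / \<epsilon>" using t M0 e by (simp add: R_def powr_powr)
    have "M \<le> \<epsilon> * exp (M / \<epsilon>)"
      using exp_ge_add_one_self[of "M / \<epsilon>"] e by (simp add: field_simps)
    then show thesis using that[of R] R by (simp add: R_def exp_minus field_simps)
  qed
  define \<eta> where "\<eta> \<beta> = \<epsilon> * h ^ mi_size \<beta> * mi_fact \<beta> powr s * exp (- r * R powr (1 / t))" for \<beta> :: "'a \<Rightarrow> nat"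
  define A where "A = {\<beta> :: 'a \<Rightarrow> nat. \<forall>b. (b \<in> Basis \<longrightarrow> \<beta> b \<in> {..B}) \<and> (b \<notin> Basis \<longrightarrow> \<beta> b = 0)}"
  have A: "finite A" unfolding A_def by (intro finite_set_of_finite_funs) auto
  have "\<forall>\<^sub>F n in sequentially. \<forall>\<beta>\<in>A. \<forall>y\<in>cball 0 R. norm (mi_D \<beta> (f n) y) \<le> \<eta> \<beta>"
  proof (rule eventually_ball_finite[OF A], rule ballI)
    fix \<beta> assume "\<beta> \<in> A"
    have "\<exists>C. \<forall>n b y. b \<in> Basis \<longrightarrow> norm (Dop b (mi_D \<beta> (f n)) y) \<le> C"
    proof -
      have "\<forall>b. \<exists>M. \<forall>n y. norm (mi_D (mi_inc b \<beta>) (f n) y) \<le> M" using bd' by blast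
      from choice[OF this] obtain N where "\<forall>b. \<forall>n y. norm (mi_D (mi_inc b \<beta>) (f n) y) \<le> N b" ..
      then have N: "norm (mi_D (mi_inc b \<beta>) (f n) y) \<le> N b" for b n y by simp
      have "norm (Dop b (mi_D \<beta> (f n)) y) \<le> (\<Sum>b\<in>Basis. N b)" if b: "b \<in> Basis" for b n y
      proof -
        have "N c \<ge> 0" for c using order_trans[OF norm_ge_zero N] .
        then have "N b \<le> (\<Sum>b\<in>Basis. N b)" using b by (intro member_le_sum) auto
        then show ?thesis using N[of b n y] b by (simp add: mi_D_inc f)
      qed
      then show ?thesis by blast
    qed
    then obtain C where C: "\<And>n b y. b \<in> Basis \<Longrightarrow> norm (Dop b (mi_D \<beta> (f n)) y) \<le> C" by blast
    show "\<forall>\<^sub>F n in sequentially. \<forall>y\<in>cball 0 R. norm (mi_D \<beta> (f n) y) \<le> \<eta> \<beta>"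
    proof (rule equi_lipschitz_tendsto_uniform[where g = "\<lambda>n. mi_D \<beta> (f n)" and L = "real DIM('a) * C"])
      show "norm (mi_D \<beta> (f n) x - mi_D \<beta> (f n) y) \<le> DIM('a) * C * dist x y" for n x y
        using C_infinity_lipschitz[OF mi_D_C_infinity[OF f] C] by (simp add: dist_norm)
      show "\<eta> \<beta> > 0" using e h by (simp add: \<eta>_def)
    qed (auto intro: lim)
  qed
  then show ?thesis
  proof eventually_elim
    case (elim n)
    show ?case
      unfolding GSB_def
    proof (intro allI)
      fix \<beta> :: "'a \<Rightarrow> nat" and y :: 'a
      let ?b = "h ^ mi_size \<beta> * mi_fact \<beta> powr s * exp (- r * norm y powr (1 / t))"
      have b: "?b \<ge> 0" using h by simp
      have *: "norm (mi_D \<beta> (f n) y) \<le> M * (1 / 2) ^ mi_size \<beta> * exp (- (norm y powr (1 / t))) * ?b"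
        using GSB_D[OF M, of \<beta> n y]
        by (simp add: power_divide algebra_simps flip: exp_add)
      \<comment> \<open>High order, far out, or one of finitely many derivatives on a compact ball.\<close>
      consider "mi_size \<beta> \<ge> B" | "norm y \<ge> R" | "on_Basis \<beta> \<in> A" "norm y \<le> R"
      proof -
        have "\<beta> b \<le> mi_size \<beta>" if "b \<in> Basis" for b
          unfolding mi_size_def using that by (intro member_le_sum) auto
        then have "on_Basis \<beta> \<in> A" if "mi_size \<beta> < B"
          using that unfolding A_def on_Basis_def by force
        then show thesis using that by force
      qed
      then have "norm (mi_D \<beta> (f n) y) \<le> \<epsilon> * ?b"
      proof cases
        case 1
        have "M * (1 / 2) ^ mi_size \<beta> * exp (- (norm y powr (1 / t))) \<le> M * (1 / 2) ^ B * 1"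
          using M0 1 by (intro mult_mono power_decreasing) auto
        also have "\<dots> \<le> \<epsilon>" using B by simp
        finally have "M * (1 / 2) ^ mi_size \<beta> * exp (- (norm y powr (1 / t))) \<le> \<epsilon>" .
        from mult_right_mono[OF this b] * show ?thesis by linarith
      next
        case 2
        have "R powr (1 / t) \<le> norm y powr (1 / t)" using 2 R t by (intro powr_mono2) auto
        then have "M * (1 / 2) ^ mi_size \<beta> * exp (- (norm y powr (1 / t))) \<le> M * 1 * exp (- (R powr (1 / t)))"
          using M0 by (intro mult_mono) (auto simp: power_le_one)
        also have "\<dots> \<le> \<epsilon>" using R by simp
        finally have "M * (1 / 2) ^ mi_size \<beta> * exp (- (norm y powr (1 / t))) \<le> \<epsilon>" .
        from mult_right_mono[OF this b] * show ?thesis by linarith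
      next
        case 3
        have s: "mi_size (on_Basis \<beta>) = mi_size \<beta>" "mi_fact (on_Basis \<beta>) = mi_fact \<beta>"
          by (simp_all add: mi_size_def mi_fact_def on_Basis_def)
        have "norm (mi_D \<beta> (f n) y) \<le> \<eta> (on_Basis \<beta>)"
          using elim 3 by (metis mem_cball_0 mi_D_on_Basis)
        also have "\<dots> \<le> \<epsilon> * ?b"
          unfolding \<eta>_def s using e h r t 3
          by (auto simp: mult.assoc intro!: mult_left_mono powr_mono2)
        finally show ?thesis .
      qed
      then show "norm (mi_D \<beta> (f n) y)
        \<le> \<epsilon> * h ^ mi_size \<beta> * mi_fact \<beta> powr s * exp (- r * norm y powr (1 / t))"
        by (simp add: mult.assoc)
    qed
  qed
qed

text \<open>
  Continuous linear functionals, expressed by a seminorm. In contrast to \<open>GS_dual\<close> the values outside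
  the space are arbitrary, so that composed expressions such as \<open>\<lambda>\<phi>. K (tensor \<phi> f)\<close> qualify as they stand.
\<close>

definition bfun :: "real \<Rightarrow> real \<Rightarrow> (('a::euclidean_space \<Rightarrow> complex) \<Rightarrow> complex) \<Rightarrow> bool" where
  "bfun t s u \<longleftrightarrow> clinear_functional_on (GS t s) u \<and>
     (\<exists>h>0. \<exists>C. \<forall>\<phi>\<in>GS t s. norm (u \<phi>) \<le> C * GS_norm t s h \<phi>)"

lemma bfun_lincomb:
  assumes "bfun t s u" "f \<in> GS t s" "g \<in> GS t s"
  shows "u (\<lambda>x. a * f x + b * g x) = a * u f + b * u g"
proof -
  have "\<forall>f\<in>GS t s. \<forall>g\<in>GS t s. \<forall>a b. u (\<lambda>x. a * f x + b * g x) = a * u f + b * u g"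
    using assms(1) unfolding bfun_def clinear_functional_on_def by (rule conjunct1)
  from this[THEN bspec, OF assms(2), THEN bspec, OF assms(3)] show ?thesis by (elim allE)
qed

lemma bfun_bound: "bfun t s u \<Longrightarrow> \<exists>h>0. \<exists>C\<ge>0. \<forall>\<phi>\<in>GS t s. norm (u \<phi>) \<le> C * GS_norm t s h \<phi>"
proof -
  assume "bfun t s u"
  then obtain h C where h: "h > 0" "\<And>\<phi>. \<phi> \<in> GS t s \<Longrightarrow> norm (u \<phi>) \<le> C * GS_norm t s h \<phi>"
    unfolding bfun_def by blast
  have "norm (u \<phi>) \<le> \<bar>C\<bar> * GS_norm t s h \<phi>" if "\<phi> \<in> GS t s" for \<phi>
    using h(2)[OF that] mult_right_mono[OF abs_ge_self[of C] GS_norm_nonneg[OF GS_banach[OF that h(1)] h(1)]]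
    by linarith
  then have "\<bar>C\<bar> \<ge> 0 \<and> (\<forall>\<phi>\<in>GS t s. norm (u \<phi>) \<le> \<bar>C\<bar> * GS_norm t s h \<phi>)" by simp
  then show ?thesis using h(1) by blast
qed

lemma bfun_GSB:
  fixes u :: "('a::euclidean_space \<Rightarrow> complex) \<Rightarrow> complex"
  assumes t: "t > 0" and u: "bfun t s u"
  shows "\<exists>r>0. \<exists>h>0. \<exists>C\<ge>0. \<forall>\<phi>\<in>GS t s. \<forall>M. GSB t s r h \<phi> M \<longrightarrow> norm (u \<phi>) \<le> C * M"
proof -
  obtain h C where h: "h > 0" "C \<ge> 0" "\<And>\<phi>. \<phi> \<in> GS t s \<Longrightarrow> norm (u \<phi>) \<le> C * GS_norm t s h \<phi>"
    using bfun_bound[OF u] by blast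
  let ?r = "t * DIM('a) * h powr (- (1 / t))"
  have "norm (u \<phi>) \<le> C * M" if "\<phi> \<in> GS t s" "GSB t s ?r h \<phi> M" for \<phi> M
    using h(3)[OF that(1)] mult_left_mono[OF GSB_imp_norm(2)[OF t h(1) GS_C_infinity[OF that(1)] that(2)] h(2)]
    by linarith
  moreover have "?r > 0" using t h by simp
  ultimately show ?thesis using h by blast
qed

lemma GSB_limit:
  assumes t: "t > 0" and f: "\<And>n. f n \<in> C_infinity" and h: "h > 0" "r \<ge> 0"
    and bd: "\<And>n. GSB t s r h (f n) M" and F: "\<And>y. (\<lambda>n. f n y) \<longlonglongrightarrow> F y"
  shows "F \<in> C_infinity" "GSB t s r h F M"
proof -
  have bd': "\<exists>M. \<forall>n y. norm (mi_D \<beta> (f n) y) \<le> M" for \<beta>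
    using GSB_global_bound[OF bd h(2,1)] by blast
  show "F \<in> C_infinity" by (rule C_infinity_limit(1)[OF f bd' F])
  have "(\<lambda>n. mi_D \<beta> (f n) y) \<longlonglongrightarrow> mi_D \<beta> F y" for \<beta> y
    by (rule C_infinity_limit(2)[OF f bd' F])
  then have "norm (mi_D \<beta> F y) \<le> M * h ^ mi_size \<beta> * mi_fact \<beta> powr s * exp (- r * norm y powr (1 / t))" for \<beta> y
    by (rule LIMSEQ_le_const2[OF tendsto_norm]) (use GSB_D[OF bd] in auto)
  then show "GSB t s r h F M" by (simp add: GSB_def)
qed

text \<open>
  The space is a Montel space, and this is a consequence: on bounded sets, pointwise convergence
  implies convergence in the topology of the space.
\<close>

lemma bfun_tendsto:
  assumes t: "t > 0" and u: "bfun t s u" and f: "\<And>n. f n \<in> GS t s"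
    and bd: "\<And>r h. r > 0 \<Longrightarrow> h > 0 \<Longrightarrow> \<exists>M. \<forall>n. GSB t s r h (f n) M"
    and F: "\<And>y. (\<lambda>n. f n y) \<longlonglongrightarrow> F y"
  shows "F \<in> GS t s" and "(\<lambda>n. u (f n)) \<longlonglongrightarrow> u F"
proof -
  have fC: "f n \<in> C_infinity" for n using f GS_C_infinity by blast
  show FG: "F \<in> GS t s"
    unfolding GS_iff[OF t]
  proof (intro conjI allI impI)
    obtain M where "\<And>n. GSB t s 1 1 (f n) M" using bd[of 1 1] by auto
    from GSB_limit(1)[OF t fC _ _ this F] show "F \<in> C_infinity" by auto
    fix r h :: real assume "r > 0" "h > 0"
    moreover from this obtain M where "\<And>n. GSB t s r h (f n) M" using bd[of r h] by auto
    ultimately show "\<exists>M. GSB t s r h F M"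
      using GSB_limit(2)[OF t fC _ _ _ F, of h r s M] by force
  qed
  define g where "g n = (\<lambda>y. 1 * f n y + (- 1) * F y)" for n
  have gG: "g n \<in> GS t s" for n unfolding g_def by (intro GS_lincomb t f FG)
  obtain r h C where C: "r > 0" "h > 0" "C \<ge> 0"
    "\<And>\<phi> M. \<phi> \<in> GS t s \<Longrightarrow> GSB t s r h \<phi> M \<Longrightarrow> norm (u \<phi>) \<le> C * M"
    using bfun_GSB[OF t u] by blast
  have "(\<lambda>n. u (g n)) \<longlonglongrightarrow> 0"
  proof (rule LIMSEQ_I)
    fix \<epsilon> :: real assume e: "\<epsilon> > 0"
    have "\<forall>\<^sub>F n in sequentially. GSB t s r h (g n) (\<epsilon> / (2 * (C + 1)))"
    proof (rule GSB_tendsto_zero[OF t])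
      show "g n \<in> C_infinity" for n using gG GS_C_infinity by blast
      fix r h :: real assume rh: "r > 0" "h > 0"
      then obtain M N where "\<And>n. GSB t s r h (f n) M" "GSB t s r h F N"
        using bd[of r h] GS_bounds[OF FG t] by metis
      then have "GSB t s r h (g n) (norm (1::complex) * M + norm (-1::complex) * N)" for n
        unfolding g_def by (intro GSB_lincomb fC GS_C_infinity[OF FG])
      then show "\<exists>M. \<forall>n. GSB t s r h (g n) M" by blast
    next
      show "(\<lambda>n. g n y) \<longlonglongrightarrow> 0" for y
        using tendsto_diff[OF F[of y] tendsto_const[of "F y"]] by (simp add: g_def)
    qed (use C e in auto)
    then obtain N where N: "\<And>n. n \<ge> N \<Longrightarrow> GSB t s r h (g n) (\<epsilon> / (2 * (C + 1)))"
      unfolding eventually_sequentially by blast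
    have "norm (u (g n) - 0) < \<epsilon>" if "n \<ge> N" for n
    proof -
      have "norm (u (g n)) \<le> C * (\<epsilon> / (2 * (C + 1)))" using C(4)[OF gG N[OF that]] .
      also have "\<dots> < \<epsilon>"
        using C(3) e mult_nonneg_nonneg[of C \<epsilon>] by (simp add: field_simps add_nonneg_pos)
      finally show ?thesis by simp
    qed
    then show "\<exists>N. \<forall>n\<ge>N. norm (u (g n) - 0) < \<epsilon>" by blast
  qed
  then have "(\<lambda>n. u (g n) + u F) \<longlonglongrightarrow> 0 + u F" by (intro tendsto_intros)
  moreover have "(\<lambda>n. u (g n) + u F) = (\<lambda>n. u (f n))"
    unfolding g_def bfun_lincomb[OF u f FG] by simp
  ultimately show "(\<lambda>n. u (f n)) \<longlonglongrightarrow> u F" by (simp only: add_0)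
qed

section \<open>Integration against stretched exponentials\<close>

lemma lborel_integral_Basis_prod:
  fixes f :: "'a::euclidean_space \<Rightarrow> real \<Rightarrow> complex"
  assumes "\<And>b. b \<in> Basis \<Longrightarrow> integrable lborel (f b)"
  shows "integrable lborel (\<lambda>x::'a. \<Prod>b\<in>Basis. f b (x \<bullet> b))"
    and "(LINT x|lborel. (\<Prod>b\<in>Basis. f b (x \<bullet> b))) = (\<Prod>b\<in>Basis. LINT y|lborel. f b y)"
proof -
  interpret product_sigma_finite "\<lambda>_::'a. lborel :: real measure" by standard
  let ?e = "\<lambda>g::'a \<Rightarrow> real. \<Sum>b\<in>Basis. g b *\<^sub>R b"
  have m: "?e \<in> measurable (\<Pi>\<^sub>M b\<in>Basis. lborel) borel"
    by measurable
  have meas: "(\<lambda>x::'a. \<Prod>b\<in>Basis. f b (x \<bullet> b)) \<in> borel_measurable borel"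
  proof (rule borel_measurable_prod)
    fix b :: 'a assume "b \<in> Basis"
    then have "f b \<in> borel_measurable borel"
      using borel_measurable_integrable[OF assms] by simp
    then show "(\<lambda>x. f b (x \<bullet> b)) \<in> borel_measurable borel"
      by (rule measurable_compose[rotated]) simp
  qed
  have e: "(\<Prod>b\<in>Basis. f b (?e g \<bullet> b)) = (\<Prod>b\<in>Basis. f b (g b))" for g :: "'a \<Rightarrow> real"
    by (intro prod.cong refl) simp
  show "integrable lborel (\<lambda>x::'a. \<Prod>b\<in>Basis. f b (x \<bullet> b))"
    unfolding lborel_eq[where 'a = 'a] integrable_distr_eq[OF m meas] e
    by (rule product_integrable_prod) (use assms in auto)
  show "(LINT x|lborel. (\<Prod>b\<in>Basis. f b (x \<bullet> b))) = (\<Prod>b\<in>Basis. LINT y|lborel. f b y)"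
    unfolding lborel_eq[where 'a = 'a] integral_distr[OF m meas] e
    by (rule product_integral_prod) (use assms in auto)
qed

lemma powr_quasi_triangle:
  fixes a b p :: real
  assumes "a \<ge> 0" "b \<ge> 0" "p > 0"
  shows "(a + b) powr p \<le> 2 powr p * (a powr p + b powr p)"
proof -
  have "(a + b) powr p \<le> (2 * max a b) powr p" using assms by (intro powr_mono2) auto
  also have "\<dots> = 2 powr p * max a b powr p" using assms by (simp add: powr_mult)
  also have "\<dots> \<le> 2 powr p * (a powr p + b powr p)"
    using assms by (intro mult_left_mono) (auto simp: max_def)
  finally show ?thesis .
qed

lemma norm_powr_quasi_triangle:
  fixes x y :: "'a::real_normed_vector" and p :: real
  assumes "p > 0"
  shows "norm (x + y) powr p \<le> 2 powr p * (norm x powr p + norm y powr p)"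
proof -
  have "norm (x + y) powr p \<le> (norm x + norm y) powr p"
    using assms by (intro powr_mono2 norm_triangle_ineq) auto
  also have "\<dots> \<le> 2 powr p * (norm x powr p + norm y powr p)"
    using assms by (intro powr_quasi_triangle) auto
  finally show ?thesis .
qed

lemma power_le_stretched_exp:
  fixes t r :: real
  assumes t: "t > 0" and r: "r > 0"
  shows "\<exists>C. \<forall>X\<ge>0. (1 + X) ^ n \<le> C * exp (r * X powr (1 / t))"
proof -
  define \<kappa> where "\<kappa> = (2::real) powr (1 / t)"
  have \<kappa>: "\<kappa> > 0" by (simp add: \<kappa>_def)
  define h where "h = (t * \<kappa> / r) powr t"
  have h: "h > 0" using t r \<kappa> by (simp add: h_def)
  have hp: "h powr (1 / t) = t * \<kappa> / r" using t r \<kappa> by (simp add: h_def powr_powr)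
  have "(1 + X) ^ n \<le> (h ^ n * fact n powr t * exp r) * exp (r * X powr (1 / t))" if X: "X \<ge> 0" for X
  proof -
    have "(1 + X) ^ n \<le> h ^ n * fact n powr t * exp (t * ((1 + X) / h) powr (1 / t))"
      using X h t by (intro power_le_exp_root) auto
    also have "\<dots> \<le> h ^ n * fact n powr t * exp (r + r * X powr (1 / t))"
    proof -
      have "t * ((1 + X) / h) powr (1 / t) = t * (1 + X) powr (1 / t) / (t * \<kappa> / r)"
        using X h by (simp add: powr_divide hp[symmetric])
      also have "\<dots> = r / \<kappa> * (1 + X) powr (1 / t)" using t r \<kappa> by (simp add: field_simps)
      also have "\<dots> \<le> r / \<kappa> * (\<kappa> * (1 powr (1 / t) + X powr (1 / t)))"
        using r \<kappa> X t unfolding \<kappa>_def by (intro mult_left_mono powr_quasi_triangle) auto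
      also have "\<dots> = r + r * X powr (1 / t)" using \<kappa> by (simp add: field_simps)
      finally show ?thesis using h by (intro mult_left_mono) auto
    qed
    finally show ?thesis by (simp add: exp_add mult_ac)
  qed
  then show ?thesis by blast
qed

lemma integrable_stretched_exp:
  fixes t r :: real
  assumes t: "t > 0" and r: "r > 0"
  shows "integrable lborel (\<lambda>x::'a::euclidean_space. exp (- r * norm x powr (1 / t)))"
proof -
  obtain C where C: "\<And>X. X \<ge> 0 \<Longrightarrow> (1 + X) ^ (2 * DIM('a)) \<le> C * exp (r * X powr (1 / t))"
    using power_le_stretched_exp[OF t r] by blast
  have "integrable lborel (\<lambda>y::real. inverse (1 + y\<^sup>2))"
    using integrable_inverse_1_plus_square by (simp add: set_integrable_def einterval_def)
  then have "integrable lborel (\<lambda>y::real. complex_of_real (inverse (1 + y\<^sup>2)))"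
    by (rule integrable_of_real)
  then have "integrable lborel (\<lambda>x::'a. \<Prod>b\<in>Basis. complex_of_real (inverse (1 + (x \<bullet> b)\<^sup>2)))"
    by (intro lborel_integral_Basis_prod) auto
  then have I: "integrable lborel (\<lambda>x::'a. C * norm (\<Prod>b\<in>Basis. complex_of_real (inverse (1 + (x \<bullet> b)\<^sup>2))))"
    by (intro integrable_mult_right integrable_norm)
  show ?thesis
  proof (rule Bochner_Integration.integrable_bound[OF I])
    show "AE x::'a in lborel. norm (exp (- r * norm x powr (1 / t)))
      \<le> norm (C * norm (\<Prod>b\<in>Basis. complex_of_real (inverse (1 + (x \<bullet> b)\<^sup>2))))"
    proof (rule AE_I2)
      fix x :: 'a
      have pos: "0 < 1 + (x \<bullet> b)\<^sup>2" for b by (simp add: add_pos_nonneg)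
      have "(\<Prod>b\<in>Basis. 1 + (x \<bullet> b)\<^sup>2) \<le> (\<Prod>b\<in>(Basis::'a set). (1 + norm x)\<^sup>2)"
      proof (intro prod_mono conjI)
        fix b :: 'a assume "b \<in> Basis"
        then have "(x \<bullet> b)\<^sup>2 \<le> (norm x)\<^sup>2"
          using Basis_le_norm[of b x] by (simp add: abs_le_square_iff[symmetric])
        moreover have "(1 + norm x)\<^sup>2 = 1 + 2 * norm x + (norm x)\<^sup>2" by (simp add: power2_eq_square algebra_simps)
        ultimately show "1 + (x \<bullet> b)\<^sup>2 \<le> (1 + norm x)\<^sup>2" using norm_ge_zero[of x] by linarith
        show "0 \<le> 1 + (x \<bullet> b)\<^sup>2" by simp
      qed
      also have "\<dots> \<le> C * exp (r * norm x powr (1 / t))"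
        using C[of "norm x"] by (simp add: power_mult)
      finally have le: "(\<Prod>b\<in>Basis. 1 + (x \<bullet> b)\<^sup>2) \<le> C * exp (r * norm x powr (1 / t))" .
      have P: "(\<Prod>b\<in>Basis. 1 + (x \<bullet> b)\<^sup>2) > 0" using pos by (intro prod_pos) auto
      have "norm (\<Prod>b\<in>Basis. complex_of_real (inverse (1 + (x \<bullet> b)\<^sup>2)))
          = norm (complex_of_real (\<Prod>b\<in>Basis. inverse (1 + (x \<bullet> b)\<^sup>2)))"
        unfolding of_real_prod ..
      also have "\<dots> = inverse (\<Prod>b\<in>Basis. 1 + (x \<bullet> b)\<^sup>2)"
      proof -
        have "(\<Prod>b\<in>Basis. inverse (1 + (x \<bullet> b)\<^sup>2)) > 0" using pos by (intro prod_pos) auto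
        then show ?thesis unfolding norm_of_real prod_inversef[symmetric] by simp
      qed
      finally have "norm (\<Prod>b\<in>Basis. complex_of_real (inverse (1 + (x \<bullet> b)\<^sup>2))) = inverse (\<Prod>b\<in>Basis. 1 + (x \<bullet> b)\<^sup>2)" .
      moreover have "exp (- r * norm x powr (1 / t)) \<le> C * inverse (\<Prod>b\<in>Basis. 1 + (x \<bullet> b)\<^sup>2)"
        using le P by (simp add: exp_minus field_simps)
      ultimately show "norm (exp (- r * norm x powr (1 / t)))
        \<le> norm (C * norm (\<Prod>b\<in>Basis. complex_of_real (inverse (1 + (x \<bullet> b)\<^sup>2))))"
        by (simp add: order_trans[OF _ abs_ge_self])
    qed
  qed simp
qed

lemma integrable_by_stretched_exp:
  fixes f :: "'a::euclidean_space \<Rightarrow> complex" and t r M :: real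
  assumes "f \<in> borel_measurable borel" "t > 0" "r > 0"
    and "\<And>y. norm (f y) \<le> M * exp (- r * norm y powr (1 / t))"
  shows "integrable lborel f"
proof (rule Bochner_Integration.integrable_bound)
  show "integrable lborel (\<lambda>y::'a. M * exp (- r * norm y powr (1 / t)))"
    using assms by (intro integrable_mult_right integrable_stretched_exp)
  show "AE y in lborel. norm (f y) \<le> norm (M * exp (- r * norm y powr (1 / t)))"
    using assms(4) by (auto intro!: AE_I2 order_trans[OF _ abs_ge_self])
qed (use assms in simp)

lemma integral_norm_le_stretched_exp:
  fixes f :: "'a::euclidean_space \<Rightarrow> complex" and t r M :: real
  assumes "f \<in> borel_measurable borel" "t > 0" "r > 0"
    and le: "\<And>y. norm (f y) \<le> M * exp (- r * norm y powr (1 / t))"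
  shows "norm (LINT y|lborel. f y) \<le> M * (LINT y::'a|lborel. exp (- r * norm y powr (1 / t)))"
proof -
  have "norm (LINT y|lborel. f y) \<le> (LINT y|lborel. norm (f y))" by (rule integral_norm_bound)
  also have "\<dots> \<le> (LINT y::'a|lborel. M * exp (- r * norm y powr (1 / t)))"
    using assms integrable_by_stretched_exp[OF assms]
    by (intro integral_mono integrable_mult_right integrable_stretched_exp integrable_norm)
  finally show ?thesis by simp
qed

lemma C_infinity_measurable [measurable_dest]: "f \<in> C_infinity \<Longrightarrow> f \<in> borel_measurable borel"
  by (intro borel_measurable_continuous_onI C_infinity_continuous)

lemma GS_measurable: "f \<in> GS t s \<Longrightarrow> f \<in> borel_measurable borel"
  by (intro C_infinity_measurable GS_C_infinity)

lemma integral_translate: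
  fixes f :: "'a::euclidean_space \<Rightarrow> complex"
  assumes [measurable]: "f \<in> borel_measurable borel"
  shows "(LINT y|lborel. f (a + y)) = (LINT y|lborel. f y)"
proof -
  have "(LINT y|lborel. f y) = (LINT y|distr lborel borel ((+) a). f y)"
    by (simp add: lborel_distr_plus)
  also have "\<dots> = (LINT y|lborel. f (a + y))" by (rule integral_distr) simp_all
  finally show ?thesis by simp
qed

lemma integrable_translate:
  fixes f :: "'a::euclidean_space \<Rightarrow> complex"
  assumes "integrable lborel f"
  shows "integrable lborel (\<lambda>y. f (a + y))"
proof -
  have "integrable (distr lborel borel ((+) a)) f" using assms by (simp add: lborel_distr_plus)
  then show ?thesis using assms by (subst (asm) integrable_distr_eq) auto
qed

text \<open>
  The integral of a derivative vanishes by translation invariance: it is the limit of integrals of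
  difference quotients, each of which is zero.
\<close>

lemma integral_pderivative_zero:
  fixes F :: "'a::euclidean_space \<Rightarrow> complex" and t r M :: real
  assumes F: "F \<in> C_infinity" and b: "b \<in> Basis" and t: "t > 0" and r: "r > 0"
    and F0: "\<And>y. norm (F y) \<le> M * exp (- r * norm y powr (1 / t))"
    and F1: "\<And>y. norm (pderivative b F y) \<le> M * exp (- r * norm y powr (1 / t))"
  shows "(LINT y|lborel. pderivative b F y) = 0"
proof -
  define \<kappa> where "\<kappa> = (2::real) powr (1 / t)"
  have \<kappa>: "\<kappa> > 0" by (simp add: \<kappa>_def)
  have M: "M \<ge> 0" using order_trans[OF norm_ge_zero F0[of 0]] by (simp add: zero_le_mult_iff)
  have [measurable]: "F \<in> borel_measurable borel" "pderivative b F \<in> borel_measurable borel"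
    using F b by (auto intro: C_infinity_measurable pderivative_C_infinity)
  define \<tau> where "\<tau> n = inverse (real (Suc n))" for n
  have \<tau>: "0 < \<tau> n" "\<tau> n \<le> 1" for n by (auto simp: \<tau>_def inverse_le_1_iff)
  define q where "q n y = (F (y + \<tau> n *\<^sub>R b) - F y) / of_real (\<tau> n)" for n y
  have int: "integrable lborel F" by (rule integrable_by_stretched_exp[OF _ t r F0]) simp
  have "(\<lambda>n. LINT y|lborel. q n y) \<longlonglongrightarrow> (LINT y|lborel. pderivative b F y)"
  proof (rule integral_dominated_convergence)
    let ?w = "\<lambda>y::'a. M * exp r * exp (- (r / \<kappa>) * norm y powr (1 / t))"
    show "integrable lborel ?w"
      using t r \<kappa> by (intro integrable_mult_right integrable_stretched_exp) auto
    show "AE y in lborel. (\<lambda>n. q n y) \<longlonglongrightarrow> pderivative b F y"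
    proof (rule AE_I2)
      fix y
      have "((\<lambda>\<tau>. F (y + \<tau> *\<^sub>R b)) has_vector_derivative pderivative b F (y + 0 *\<^sub>R b)) (at 0)"
        by (rule C_infinity_line_derivative[OF F])
      then have "((\<lambda>h. norm (F (y + h *\<^sub>R b) - F y - h *\<^sub>R pderivative b F y) / norm h) \<longlongrightarrow> 0) (at 0)"
        unfolding has_vector_derivative_def has_derivative_at by simp
      moreover have "filterlim \<tau> (at 0) sequentially"
        unfolding \<tau>_def filterlim_at using LIMSEQ_inverse_real_of_nat by auto
      ultimately have "(\<lambda>n. norm (F (y + \<tau> n *\<^sub>R b) - F y - \<tau> n *\<^sub>R pderivative b F y) / norm (\<tau> n)) \<longlonglongrightarrow> 0"
        by (rule filterlim_compose)
      moreover have "norm (F (y + \<tau> n *\<^sub>R b) - F y - \<tau> n *\<^sub>R pderivative b F y) / norm (\<tau> n)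
          = norm (q n y - pderivative b F y)" for n
      proof -
        have "q n y - pderivative b F y = (F (y + \<tau> n *\<^sub>R b) - F y - \<tau> n *\<^sub>R pderivative b F y) / of_real (\<tau> n)"
          using \<tau>(1)[of n] by (simp add: q_def diff_divide_distrib scaleR_conv_of_real)
        then show ?thesis by (simp add: norm_divide)
      qed
      ultimately have "(\<lambda>n. norm (q n y - pderivative b F y)) \<longlonglongrightarrow> 0" by simp
      then show "(\<lambda>n. q n y) \<longlonglongrightarrow> pderivative b F y"
        by (simp add: tendsto_norm_zero_iff LIM_zero_iff)
    qed
    show "AE y in lborel. norm (q n y) \<le> ?w y" for n
    proof (rule AE_I2)
      fix y
      have "norm (F (y + \<tau> n *\<^sub>R b) - F (y + 0 *\<^sub>R b)) \<le> ?w y * \<tau> n"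
      proof (rule vector_derivative_bound)
        fix \<rho> assume \<rho>: "0 \<le> \<rho>" "\<rho> \<le> \<tau> n"
        show "((\<lambda>\<tau>. F (y + \<tau> *\<^sub>R b)) has_vector_derivative pderivative b F (y + \<rho> *\<^sub>R b)) (at \<rho>)"
          by (rule C_infinity_line_derivative[OF F])
        have "norm y powr (1 / t) \<le> \<kappa> * (norm (y + \<rho> *\<^sub>R b) powr (1 / t) + norm (- (\<rho> *\<^sub>R b)) powr (1 / t))"
          using norm_powr_quasi_triangle[of "1 / t" "y + \<rho> *\<^sub>R b" "- (\<rho> *\<^sub>R b)"] t by (simp add: \<kappa>_def)
        also have "norm (- (\<rho> *\<^sub>R b)) powr (1 / t) \<le> 1"
          using \<rho> b \<tau>[of n] t by (simp add: powr_le1)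
        finally have "norm y powr (1 / t) / \<kappa> \<le> norm (y + \<rho> *\<^sub>R b) powr (1 / t) + 1"
          using \<kappa> by (simp add: field_simps)
        then have "r * (norm y powr (1 / t) / \<kappa>) \<le> r * (norm (y + \<rho> *\<^sub>R b) powr (1 / t) + 1)"
          using r by (intro mult_left_mono) auto
        then have "exp (- r * norm (y + \<rho> *\<^sub>R b) powr (1 / t)) \<le> exp r * exp (- (r / \<kappa>) * norm y powr (1 / t))"
          unfolding exp_add[symmetric] by (simp add: algebra_simps)
        from order_trans[OF F1 mult_left_mono[OF this M]]
        show "norm (pderivative b F (y + \<rho> *\<^sub>R b)) \<le> ?w y" by (simp only: mult.assoc)
      qed (use \<tau>[of n] in auto)
      then show "norm (q n y) \<le> ?w y"
        using \<tau>[of n] by (simp add: q_def norm_divide divide_le_eq)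
    qed
  qed (simp_all add: q_def)
  moreover have "(LINT y|lborel. q n y) = 0" for n
  proof -
    have "(LINT y|lborel. F (\<tau> n *\<^sub>R b + y)) = (LINT y|lborel. F y)" by (rule integral_translate) simp
    moreover have "integrable lborel (\<lambda>y. F (\<tau> n *\<^sub>R b + y))" by (rule integrable_translate[OF int])
    ultimately show ?thesis using int by (simp add: q_def add.commute)
  qed
  ultimately have "(\<lambda>n::nat. 0::complex) \<longlonglongrightarrow> (LINT y|lborel. pderivative b F y)" by simp
  then show ?thesis using LIMSEQ_unique tendsto_const by blast
qed

text \<open>
  Each integration by parts trades a factor \<open>\<xi> \<bullet> b\<close> for a derivative of \<open>G\<close>.
\<close>

lemma integral_by_parts_plane_wave:
  fixes G :: "'a::euclidean_space \<Rightarrow> complex" and t r :: real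
  assumes G: "G \<in> C_infinity" and t: "t > 0" and r: "r > 0"
    and bd: "\<And>\<beta>. \<exists>M. \<forall>y. norm (mi_D \<beta> G y) \<le> M * exp (- r * norm y powr (1 / t))"
  shows "of_real (mi_power \<xi> \<beta>) * (LINT y|lborel. G y * plane_wave (- \<xi>) y)
    = (LINT y|lborel. mi_D \<beta> G y * plane_wave (- \<xi>) y)"
proof (induction \<beta> rule: mi_induct)
  case (zero \<beta>)
  then show ?case by (simp add: mi_D_zero mi_power_def)
next
  case (inc \<beta> b)
  let ?p = "plane_wave (- \<xi>)"
  let ?F = "\<lambda>y::'a. mi_D \<beta> G y * ?p y"
  have pw: "?p \<in> C_infinity" by (rule mi_D_plane_wave)
  have GC: "mi_D \<gamma> G \<in> C_infinity" for \<gamma> using G by (rule mi_D_C_infinity)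
  have FC: "?F \<in> C_infinity" by (rule C_infinity_mult[OF GC pw])
  have Dp: "Dop b ?p = (\<lambda>y. - of_real (\<xi> \<bullet> b) * ?p y)"
    using mi_D_plane_wave(2)[of "mi_inc b (\<lambda>_. 0)" "- \<xi>"] mi_D_inc[OF pw inc(1), of "\<lambda>_. 0"]
    by (simp add: mi_power_inc[OF inc(1)]) (simp add: mi_power_def)
  have DF: "Dop b ?F = (\<lambda>y. - of_real (\<xi> \<bullet> b) * ?F y + mi_D (mi_inc b \<beta>) G y * ?p y)"
    unfolding Dop_mult[OF GC pw] mi_D_inc[OF G inc(1)] Dp by (simp add: mult_ac)
  obtain M N where M: "\<And>y. norm (mi_D \<beta> G y) \<le> M * exp (- r * norm y powr (1 / t))"
    and N: "\<And>y. norm (mi_D (mi_inc b \<beta>) G y) \<le> N * exp (- r * norm y powr (1 / t))"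
    using bd by metis
  have [measurable]: "?p \<in> borel_measurable borel" "mi_D \<gamma> G \<in> borel_measurable borel" for \<gamma>
    using pw GC by (auto intro: C_infinity_measurable)
  have i1: "integrable lborel ?F"
    by (rule integrable_by_stretched_exp[OF _ t r, of _ M]) (use M in \<open>auto simp: norm_mult\<close>)
  have i2: "integrable lborel (\<lambda>y. mi_D (mi_inc b \<beta>) G y * ?p y)"
    by (rule integrable_by_stretched_exp[OF _ t r, of _ N]) (use N in \<open>auto simp: norm_mult\<close>)
  define L where "L = \<bar>\<xi> \<bullet> b\<bar> * M + \<bar>N\<bar> + \<bar>M\<bar>"
  have "(LINT y|lborel. pderivative b ?F y) = 0"
  proof (rule integral_pderivative_zero[OF FC inc(1) t r, of L])
    fix y :: 'a
    let ?E = "exp (- r * norm y powr (1 / t))"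
    have "norm (?F y) \<le> M * ?E" using M[of y] by (simp add: norm_mult)
    also have "\<dots> \<le> L * ?E"
    proof (rule mult_right_mono)
      have "M \<ge> 0" using order_trans[OF norm_ge_zero M[of 0]] by (simp add: zero_le_mult_iff)
      then show "M \<le> L" by (simp add: L_def add_nonneg_nonneg)
    qed simp
    finally show "norm (?F y) \<le> L * ?E" .
    have "norm (pderivative b ?F y) = norm (Dop b ?F y)" by (simp add: Dop_def norm_mult)
    also have "\<dots> \<le> \<bar>\<xi> \<bullet> b\<bar> * norm (?F y) + norm (mi_D (mi_inc b \<beta>) G y)"
      unfolding DF by (rule order_trans[OF norm_triangle_ineq]) (simp add: norm_mult)
    also have "\<dots> \<le> \<bar>\<xi> \<bullet> b\<bar> * (M * ?E) + N * ?E"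
      using M[of y] N[of y] by (intro add_mono mult_left_mono) (auto simp: norm_mult)
    also have "\<dots> \<le> L * ?E"
    proof -
      have "N * ?E \<le> (\<bar>N\<bar> + \<bar>M\<bar>) * ?E" by (intro mult_right_mono) auto
      then show ?thesis by (simp add: L_def algebra_simps)
    qed
    finally show "norm (pderivative b ?F y) \<le> L * ?E" .
  qed
  then have "(LINT y|lborel. Dop b ?F y) = 0" by (simp add: Dop_def)
  then have "(LINT y|lborel. mi_D (mi_inc b \<beta>) G y * ?p y) = of_real (\<xi> \<bullet> b) * (LINT y|lborel. ?F y)"
    unfolding DF using i1 i2 by (simp add: Bochner_Integration.integral_add)
  then show ?case using inc(2) by (simp add: mi_power_inc[OF inc(1)] mult.assoc)
qed

section \<open>Time-frequency atoms\<close>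

definition atom :: "('a::euclidean_space \<Rightarrow> complex) \<Rightarrow> 'a \<times> 'a \<Rightarrow> 'a \<Rightarrow> complex" where
  "atom \<psi> z = modulation (snd z) (translation (fst z) \<psi>)"

lemma atom_eq: "atom \<psi> z y = plane_wave (snd z) y * \<psi> (y - fst z)"
  by (simp add: atom_def modulation_def translation_def plane_wave_def)

lemma cnj_plane_wave: "cnj (plane_wave \<xi> y) = plane_wave (- \<xi>) y"
  by (simp add: plane_wave_def exp_cnj)

text \<open>The phase space weight, homogeneous of degree one under \<open>(x, \<xi>) \<mapsto> (\<lambda>\<^sup>t x, \<lambda>\<^sup>s \<xi>)\<close>.\<close>

definition rho :: "real \<Rightarrow> real \<Rightarrow> 'a::euclidean_space \<times> 'a \<Rightarrow> real" where
  "rho t s z = norm (fst z) powr (1 / t) + norm (snd z) powr (1 / s)"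

lemma rho_nonneg [simp]: "rho t s z \<ge> 0" by (simp add: rho_def)

lemma rho_measurable [measurable]: "rho t s \<in> borel_measurable borel"
proof -
  have "(\<lambda>z. norm (fst z :: 'a) powr (1 / t) + norm (snd z :: 'a) powr (1 / s)) \<in> borel_measurable (borel \<Otimes>\<^sub>M borel)"
    by measurable
  then have "(\<lambda>z. norm (fst z :: 'a) powr (1 / t) + norm (snd z :: 'a) powr (1 / s)) \<in> borel_measurable borel"
    by (simp add: borel_prod)
  then show ?thesis by (simp add: rho_def[abs_def])
qed

lemma rho_quasi_triangle:
  assumes "t > 0" "s > 0"
  shows "\<exists>\<kappa>\<ge>1. \<forall>z w. rho t s (z + w) \<le> \<kappa> * (rho t s z + rho t s w)"
proof -
  define \<kappa> where "\<kappa> = (2::real) powr (1 / t) + 2 powr (1 / s)"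
  have 1: "(2::real) powr (1 / t) \<ge> 1" "(2::real) powr (1 / s) \<ge> 1"
    using assms by (auto intro: ge_one_powr_ge_zero)
  have "rho t s (z + w) \<le> \<kappa> * (rho t s z + rho t s w)" for z w :: "'a \<times> 'a"
  proof -
    have "norm (fst z + fst w) powr (1 / t) \<le> 2 powr (1 / t) * (norm (fst z) powr (1 / t) + norm (fst w) powr (1 / t))"
      "norm (snd z + snd w) powr (1 / s) \<le> 2 powr (1 / s) * (norm (snd z) powr (1 / s) + norm (snd w) powr (1 / s))"
      using assms by (intro norm_powr_quasi_triangle; simp)+
    moreover have "2 powr (1 / t) * (norm (fst z) powr (1 / t) + norm (fst w) powr (1 / t))
        \<le> \<kappa> * (norm (fst z) powr (1 / t) + norm (fst w) powr (1 / t))"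
      "2 powr (1 / s) * (norm (snd z) powr (1 / s) + norm (snd w) powr (1 / s))
        \<le> \<kappa> * (norm (snd z) powr (1 / s) + norm (snd w) powr (1 / s))"
      using 1 by (intro mult_right_mono; simp add: \<kappa>_def)+
    ultimately show ?thesis by (simp add: rho_def algebra_simps)
  qed
  then show ?thesis using 1 by (intro exI[of _ \<kappa>]) (auto simp: \<kappa>_def)
qed

lemma integrable_exp_rho:
  assumes "t > 0" "s > 0" "r > 0"
  shows "integrable lborel (\<lambda>z::'a::euclidean_space \<times> 'a. exp (- r * rho t s z))"
proof -
  have 1: "integrable lborel (\<lambda>x::'a. exp (- r * norm x powr (1 / t)))"
    "integrable lborel (\<lambda>x::'a. exp (- r * norm x powr (1 / s)))"
    using assms by (auto intro: integrable_stretched_exp[simplified])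
  have "integrable (lborel \<Otimes>\<^sub>M lborel) (\<lambda>z::'a \<times> 'a. exp (- r * norm (fst z) powr (1 / t)) * exp (- r * norm (snd z) powr (1 / s)))"
    by (rule lborel_pair.Fubini_integrable) (use 1 in \<open>auto simp: abs_mult\<close>)
  then show ?thesis by (simp add: lborel_prod rho_def algebra_simps exp_add exp_diff exp_minus divide_inverse)
qed

lemma GS_mult_integrable:
  assumes t: "t > 0" and f: "f \<in> GS t s" and g: "g \<in> GS t s"
  shows "integrable lborel (\<lambda>y. f y * g y)"
proof -
  obtain M N where M: "GSB t s 1 1 f M" and N: "GSB t s 1 1 g N"
    using GS_bounds[OF f t] GS_bounds[OF g t] by (meson zero_less_one)
  show ?thesis
  proof (rule integrable_by_stretched_exp[OF _ t zero_less_one])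
    show "(\<lambda>y. f y * g y) \<in> borel_measurable borel"
      using f g by (intro borel_measurable_times GS_measurable)
    fix y
    have "norm (g y) \<le> N * exp (- 1 * norm y powr (1 / t))" by (rule GSB_bound[OF N])
    also have "\<dots> \<le> N * 1" using GSB_nonneg[OF N] by (intro mult_left_mono) auto
    finally have "norm (f y) * norm (g y) \<le> (M * exp (- 1 * norm y powr (1 / t))) * N"
      using GSB_bound[OF M, of y] GSB_nonneg[OF M] by (intro mult_mono) auto
    then show "norm (f y * g y) \<le> (M * N) * exp (- 1 * norm y powr (1 / t))"
      by (simp add: norm_mult mult_ac)
  qed
qed

lemma GS_integrable:
  assumes t: "t > 0" and f: "f \<in> GS t s"
  shows "integrable lborel f"
proof -
  obtain M where M: "GSB t s 1 1 f M" using GS_bounds[OF f t] by (meson zero_less_one)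
  show ?thesis
    by (rule integrable_by_stretched_exp[OF GS_measurable[OF f] t zero_less_one GSB_bound[OF M]])
qed

lemma GS_le_norm:
  fixes f :: "'a::euclidean_space \<Rightarrow> complex"
  assumes "f \<in> GS t s" "h > 0" shows "norm (f y) \<le> GS_norm t s h f"
  using GS_norm_upper[OF GS_banach[OF assms], of "(y, (\<lambda>_. 0), (\<lambda>_. 0))"]
  by (simp add: GS_quot_def mi_size_def mi_fact_def mi_power_def)

lemma bfun_pairing:
  assumes t: "t > 0" and \<phi>: "\<phi> \<in> GS t s"
  shows "bfun t s (\<lambda>g. LINT y|lborel. \<phi> y * g y)"
  unfolding bfun_def clinear_functional_on_def
proof (rule conjI, intro ballI allI)
  fix f g :: "'a \<Rightarrow> complex" and a b assume f: "f \<in> GS t s" and g: "g \<in> GS t s"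
  have "(LINT y|lborel. \<phi> y * (a * f y + b * g y)) = (LINT y|lborel. a * (\<phi> y * f y) + b * (\<phi> y * g y))"
    by (simp add: algebra_simps)
  also have "\<dots> = a * (LINT y|lborel. \<phi> y * f y) + b * (LINT y|lborel. \<phi> y * g y)"
    using GS_mult_integrable[OF t \<phi> f] GS_mult_integrable[OF t \<phi> g] by simp
  finally show "(LINT y|lborel. \<phi> y * (a * f y + b * g y))
    = a * (LINT y|lborel. \<phi> y * f y) + b * (LINT y|lborel. \<phi> y * g y)" .
next
  have "norm (LINT y|lborel. \<phi> y * g y) \<le> (LINT y|lborel. norm (\<phi> y)) * GS_norm t s 1 g"
    if g: "g \<in> GS t s" for g
  proof -
  have "norm (LINT y|lborel. \<phi> y * g y) \<le> (LINT y|lborel. norm (\<phi> y * g y))"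
    by (rule integral_norm_bound)
  also have "\<dots> \<le> (LINT y|lborel. norm (\<phi> y) * GS_norm t s 1 g)"
    using g by (intro integral_mono integrable_norm GS_mult_integrable[OF t \<phi> g] integrable_mult_left
        GS_integrable[OF t \<phi>]) (auto simp: norm_mult intro!: mult_left_mono GS_le_norm)
  finally show ?thesis by simp
  qed
  then show "\<exists>h>0. \<exists>C. \<forall>g\<in>GS t s. norm (LINT y|lborel. \<phi> y * g y) \<le> C * GS_norm t s h g"
    using zero_less_one by blast
qed

subsection \<open>Families of test functions over phase space\<close>

text \<open>
  These two conditions make superpositions \<open>\<integral> w z \<cdot> a z dz\<close> with rapidly decaying weights \<open>w\<close> test
  functions again. Families of atoms and of their conjugates satisfy them.
\<close>

definition GS_family :: "real \<Rightarrow> real \<Rightarrow> ('a::euclidean_space \<times> 'a \<Rightarrow> 'a \<Rightarrow> complex) \<Rightarrow> bool" where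
  "GS_family t s a \<longleftrightarrow> (\<forall>y. continuous_on UNIV (\<lambda>z. a z y)) \<and> (\<forall>z. a z \<in> GS t s) \<and>
     (\<forall>r>0. \<forall>h>0. \<exists>R M. R > 0 \<and> M \<ge> 0 \<and> (\<forall>z. GSB t s r h (a z) (M * exp (R * rho t s z))))"

lemma GS_family_GS: "GS_family t s a \<Longrightarrow> a z \<in> GS t s"
  unfolding GS_family_def by blast

lemma GS_family_bound: "GS_family t s a \<Longrightarrow> r > 0 \<Longrightarrow> h > 0 \<Longrightarrow>
  \<exists>R M. R > 0 \<and> M \<ge> 0 \<and> (\<forall>z. GSB t s r h (a z) (M * exp (R * rho t s z)))"
  by (simp add: GS_family_def)

lemma GS_family_continuous: "GS_family t s a \<Longrightarrow> continuous_on UNIV (\<lambda>z. a z y)"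
  by (simp add: GS_family_def)

lemma GS_family_cnj:
  assumes "GS_family t s a"
  shows "GS_family t s (\<lambda>z y. cnj (a z y))"
  unfolding GS_family_def
proof (intro conjI allI impI)
  show "continuous_on UNIV (\<lambda>z. cnj (a z y))" for y
    using GS_family_continuous[OF assms] by (intro continuous_on_cnj)
  show "(\<lambda>y. cnj (a z y)) \<in> GS t s" for z using GS_family_GS[OF assms] by (rule GS_cnj)
  fix r h :: real assume "r > 0" "h > 0"
  from GS_family_bound[OF assms this] obtain R M where
    "R > 0" "M \<ge> 0" "\<And>z. GSB t s r h (a z) (M * exp (R * rho t s z))" by blast
  then show "\<exists>R M. R > 0 \<and> M \<ge> 0 \<and> (\<forall>z. GSB t s r h (\<lambda>y. cnj (a z y)) (M * exp (R * rho t s z)))"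
    using GSB_cnj[OF GS_C_infinity[OF GS_family_GS[OF assms]]] by blast
qed

lemma rho_le_norm:
  assumes "t > 0" "s > 0" "norm z \<le> B"
  shows "rho t s z \<le> B powr (1 / t) + B powr (1 / s)"
  using assms norm_fst_le[of "fst z" "snd z"] norm_snd_le[of "snd z" "fst z"]
  unfolding rho_def by (intro add_mono powr_mono2) auto

text \<open>
  Near a point of phase space the family is bounded in the space, so pointwise continuity suffices.
\<close>

lemma bfun_family_continuous:
  fixes u :: "('a::euclidean_space \<Rightarrow> complex) \<Rightarrow> complex"
  assumes t: "t > 0" and s: "s > 0" and u: "bfun t s u" and a: "GS_family t s a"
  shows "continuous_on UNIV (\<lambda>z. u (a z))"
proof (rule continuous_on_sequentiallyI)
  fix Z :: "nat \<Rightarrow> 'a \<times> 'a" and z assume Z: "Z \<longlonglongrightarrow> z"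
  obtain B where B: "\<And>n. norm (Z n) \<le> B"
    using convergent_imp_Bseq[OF convergentI[OF Z]] unfolding Bseq_def by blast
  show "(\<lambda>n. u (a (Z n))) \<longlonglongrightarrow> u (a z)"
  proof (rule bfun_tendsto(2)[OF t u])
    show "a (Z n) \<in> GS t s" for n by (rule GS_family_GS[OF a])
    show "(\<lambda>n. a (Z n) y) \<longlonglongrightarrow> a z y" for y
      using continuous_on_tendsto_compose[OF GS_family_continuous[OF a] Z] by simp
    fix r h :: real assume rh: "r > 0" "h > 0"
    from GS_family_bound[OF a this] obtain R M where
      RM: "R > 0" "M \<ge> 0" "\<And>z. GSB t s r h (a z) (M * exp (R * rho t s z))" by blast
    have "GSB t s r h (a (Z n)) (M * exp (R * (B powr (1 / t) + B powr (1 / s))))" for n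
      using RM rh rho_le_norm[OF t s B[of n]]
      by (intro GSB_mono[OF RM(3)[of "Z n"]]) (auto intro!: mult_left_mono)
    then show "\<exists>M. \<forall>n. GSB t s r h (a (Z n)) M" by blast
  qed
qed

lemma bfun_family_bound:
  assumes t: "t > 0" and s: "s > 0" and u: "bfun t s u" and a: "GS_family t s a"
  shows "\<exists>R C. R > 0 \<and> C \<ge> 0 \<and> (\<forall>z. norm (u (a z)) \<le> C * exp (R * rho t s z))"
proof -
  obtain r h C where C: "r > 0" "h > 0" "C \<ge> 0"
    "\<And>\<phi> M. \<phi> \<in> GS t s \<Longrightarrow> GSB t s r h \<phi> M \<Longrightarrow> norm (u \<phi>) \<le> C * M"
    using bfun_GSB[OF t u] by blast
  obtain R M where RM: "R > 0" "M \<ge> 0" "\<And>z. GSB t s r h (a z) (M * exp (R * rho t s z))"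
    using GS_family_bound[OF a C(1,2)] by blast
  have "norm (u (a z)) \<le> (C * M) * exp (R * rho t s z)" for z
    using C(4)[OF GS_family_GS[OF a] RM(3)] by (simp add: mult.assoc)
  moreover have "C * M \<ge> 0" using C(3) RM(2) by simp
  ultimately show ?thesis using RM(1) by blast
qed

lemma atom_eq': "atom \<psi> z = (\<lambda>y. plane_wave (snd z) y * translation (fst z) \<psi> y)"
  by (simp add: fun_eq_iff atom_eq translation_def)

text \<open>
  Translation costs a factor \<open>exp (R |x|\<^sup>1\<^sup>/\<^sup>t)\<close> in the decay, modulation a factor \<open>exp (R |\<xi>|\<^sup>1\<^sup>/\<^sup>s)\<close>
  in the growth of the derivatives.
\<close>

lemma GS_family_atom:
  fixes \<psi> :: "'a::euclidean_space \<Rightarrow> complex" and t s :: real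
  assumes t: "t > 0" and s: "s > 0" and \<psi>: "\<psi> \<in> GS t s"
  shows "GS_family t s (atom \<psi>)"
proof -
  have C: "\<psi> \<in> C_infinity" by (rule GS_C_infinity[OF \<psi>])
  have aC: "atom \<psi> z \<in> C_infinity" for z
    unfolding atom_eq' by (intro C_infinity_mult mi_D_plane_wave mi_D_translation C)
  have bd: "\<exists>R M. R > 0 \<and> M \<ge> 0 \<and> (\<forall>z. GSB t s r h (atom \<psi> z) (M * exp (R * rho t s z)))"
    if r: "r > 0" and h: "h > 0" for r h
  proof -
    define \<kappa> where "\<kappa> = (2::real) powr (1 / t)"
    have \<kappa>: "\<kappa> > 0" by (simp add: \<kappa>_def)
    obtain N where N: "GSB t s (\<kappa> * r) (h / 2) \<psi> N"
      using GS_bounds[OF \<psi> t, of "\<kappa> * r" "h / 2"] \<kappa> r h by auto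
    have N0: "N \<ge> 0" by (rule GSB_nonneg[OF N])
    define R1 where "R1 = s * DIM('a) * (h / 2) powr (- (1 / s))"
    have R1: "R1 \<ge> 0" using s by (simp add: R1_def)
    define R where "R = R1 + \<kappa> * r"
    have "GSB t s r h (atom \<psi> z) (N * exp (R * rho t s z))" for z
      unfolding GSB_def
    proof (intro allI)
      fix \<beta> :: "'a \<Rightarrow> nat" and y :: 'a
      obtain x \<xi> where z: "z = (x, \<xi>)" by (cases z)
      have "norm (mi_D \<beta> (\<lambda>y. plane_wave \<xi> y * translation x \<psi> y) y) \<le>
        exp (R1 * norm \<xi> powr (1 / s)) * (N * exp (- (\<kappa> * r) * norm (y - x) powr (1 / t)))
          * (2 * (h / 2)) ^ mi_size \<beta> * mi_fact \<beta> powr s"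
      proof (rule mi_D_mult_bound)
        show "norm (mi_D \<gamma> (plane_wave \<xi>) y) \<le> exp (R1 * norm \<xi> powr (1 / s)) * (h / 2) ^ mi_size \<gamma> * mi_fact \<gamma> powr s" for \<gamma>
          using mi_power_le[OF s, of "h / 2" \<xi> \<gamma>] h
          by (simp add: mi_D_plane_wave norm_mult R1_def mult_ac)
        show "norm (mi_D \<gamma> (translation x \<psi>) y) \<le> N * exp (- (\<kappa> * r) * norm (y - x) powr (1 / t))
          * (h / 2) ^ mi_size \<gamma> * mi_fact \<gamma> powr s" for \<gamma>
          using GSB_D[OF N, of \<gamma> "y - x"] unfolding mi_D_translation[OF C]
          by (simp add: translation_def mult_ac)
      qed (use h s in \<open>auto intro: mi_D_plane_wave mi_D_translation C\<close>)
      also have "\<dots> = N * (exp (R1 * norm \<xi> powr (1 / s)) * exp (- (\<kappa> * r) * norm (y - x) powr (1 / t)))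
          * (h ^ mi_size \<beta> * mi_fact \<beta> powr s)"
        by (simp add: mult_ac)
      also have "\<dots> \<le> N * (exp (R * rho t s z) * exp (- r * norm y powr (1 / t))) * (h ^ mi_size \<beta> * mi_fact \<beta> powr s)"
      proof (intro mult_right_mono mult_left_mono)
        have "norm y powr (1 / t) \<le> \<kappa> * (norm (y - x) powr (1 / t) + norm x powr (1 / t))"
          using norm_powr_quasi_triangle[of "1 / t" "y - x" x] t by (simp add: \<kappa>_def)
        then have "r * norm y powr (1 / t) \<le> r * (\<kappa> * (norm (y - x) powr (1 / t) + norm x powr (1 / t)))"
          using r by (intro mult_left_mono) auto
        moreover have "R * rho t s z = R1 * norm \<xi> powr (1 / s) + \<kappa> * r * norm x powr (1 / t)
            + (R1 * norm x powr (1 / t) + \<kappa> * r * norm \<xi> powr (1 / s))"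
          by (simp add: R_def rho_def z algebra_simps)
        moreover have "R1 * norm x powr (1 / t) \<ge> 0" "\<kappa> * r * norm \<xi> powr (1 / s) \<ge> 0"
          using R1 \<kappa> r by auto
        ultimately have "R1 * norm \<xi> powr (1 / s) + - (\<kappa> * r) * norm (y - x) powr (1 / t)
            \<le> R * rho t s z + - r * norm y powr (1 / t)"
          by (simp add: algebra_simps)
        then show "exp (R1 * norm \<xi> powr (1 / s)) * exp (- (\<kappa> * r) * norm (y - x) powr (1 / t))
            \<le> exp (R * rho t s z) * exp (- r * norm y powr (1 / t))"
          unfolding exp_add[symmetric] by simp
      qed (use N0 h in auto)
      finally show "norm (mi_D \<beta> (atom \<psi> z) y)
          \<le> N * exp (R * rho t s z) * h ^ mi_size \<beta> * mi_fact \<beta> powr s * exp (- r * norm y powr (1 / t))"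
        by (simp add: atom_eq' z mult_ac)
    qed
    moreover have "R > 0" using R1 \<kappa> r by (simp add: R_def add_nonneg_pos)
    ultimately show ?thesis using N0 by blast
  qed
  show ?thesis
    unfolding GS_family_def
  proof (intro conjI allI impI)
    show "atom \<psi> z \<in> GS t s" for z unfolding GS_iff[OF t] using aC bd by blast
    have "continuous_on UNIV (\<lambda>z::'a \<times> 'a. \<psi> (y - fst z))" for y
      by (rule continuous_on_compose2[OF C_infinity_continuous[OF C]]) (auto intro!: continuous_intros)
    then show "continuous_on UNIV (\<lambda>z. atom \<psi> z y)" for y
      unfolding atom_eq plane_wave_def by (intro continuous_intros) auto
  qed (rule bd)
qed

text \<open>
  Decay of the short-time Fourier transform of a test function: integration by parts gives all
  monomials in \<open>\<xi>\<close>, and \<open>\<phi> \<cdot> cnj (T\<^sub>x \<psi>)\<close> is small when \<open>x\<close> is far out.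
\<close>

lemma atom_decay:
  fixes \<psi> :: "'a::euclidean_space \<Rightarrow> complex" and t s r :: real
  assumes t: "t > 0" and s: "s > 0" and \<psi>: "\<psi> \<in> GS t s" and r: "r > 0"
  shows "\<exists>h>0. \<exists>C\<ge>0. \<forall>\<phi>\<in>GS t s. \<forall>z.
    norm (LINT y|lborel. \<phi> y * cnj (atom \<psi> z y)) \<le> C * GS_norm t s h \<phi> * exp (- r * rho t s z)"
proof -
  define \<kappa> where "\<kappa> = (2::real) powr (1 / t)"
  have \<kappa>: "\<kappa> > 0" by (simp add: \<kappa>_def)
  obtain h0 where h0: "h0 > 0" "\<And>h X M. \<And>y :: 'a. \<lbrakk>0 < h; h \<le> h0; 0 \<le> X; 0 \<le> M;
      \<And>\<alpha>. \<bar>mi_power y \<alpha>\<bar> * X \<le> M * h ^ mi_size \<alpha> * mi_fact \<alpha> powr s\<rbrakk> \<Longrightarrow>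
      X \<le> M * 2 powr s * exp (- r * norm y powr (1 / s))"
    using decay_of_mi_powers[OF s r, where 'a = 'a] by blast
  define R where "R = r * \<kappa> + 1"
  have R: "R > 0" using r \<kappa> by (simp add: R_def add_pos_pos)
  obtain h C1 where h: "h > 0" "C1 \<ge> 0" "\<And>\<phi> :: 'a \<Rightarrow> complex. \<phi> \<in> GS_banach t s h \<Longrightarrow> GSB t s R (h0 / 2) \<phi> (C1 * GS_norm t s h \<phi>)"
    using norm_imp_GSB[OF t R, of "h0 / 2" s, where 'a = 'a] half_gt_zero[OF h0(1)] by blast
  let ?c = "\<lambda>y. cnj (\<psi> y)"
  have c: "?c \<in> GS t s" by (rule GS_cnj[OF \<psi>])
  obtain N where N: "GSB t s R (h0 / 2) ?c N" using GS_bounds[OF c t R, of "h0 / 2"] h0 by auto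
  have N0: "N \<ge> 0" by (rule GSB_nonneg[OF N])
  define I where "I = (LINT y::'a|lborel. exp (- 1 * norm y powr (1 / t)))"
  have I: "I \<ge> 0" unfolding I_def by (intro integral_nonneg_AE) auto
  have "norm (LINT y|lborel. \<phi> y * cnj (atom \<psi> z y)) \<le> (C1 * N * I * 2 powr s) * GS_norm t s h \<phi> * exp (- r * rho t s z)"
    if \<phi>: "\<phi> \<in> GS t s" for \<phi> z
  proof -
    obtain x \<xi> where z: "z = (x, \<xi>)" by (cases z)
    define A where "A = C1 * GS_norm t s h \<phi>"
    have A: "GSB t s R (h0 / 2) \<phi> A" using h(3)[OF GS_banach[OF \<phi> h(1)]] by (simp add: A_def)
    have A0: "A \<ge> 0" by (rule GSB_nonneg[OF A])
    define G where "G = (\<lambda>y. \<phi> y * ?c (y - x))"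
    have GC: "G \<in> C_infinity"
      using C_infinity_mult[OF GS_C_infinity[OF \<phi>] mi_D_translation(1)[OF GS_C_infinity[OF c], of x]]
      by (simp add: G_def translation_def)
    let ?K = "\<lambda>\<beta>. A * N * exp (- r * norm x powr (1 / t)) * h0 ^ mi_size \<beta> * mi_fact \<beta> powr s"
    have GB: "norm (mi_D \<beta> G y) \<le> ?K \<beta> * exp (- 1 * norm y powr (1 / t))" for \<beta> y
    proof -
      have "norm (mi_D \<beta> G y) \<le> A * N * (2 * (h0 / 2)) ^ mi_size \<beta> * mi_fact \<beta> powr s
        * (exp (- R * norm y powr (1 / t)) * exp (- R * norm (y - x) powr (1 / t)))"
        unfolding G_def using h0 s
        by (intro GSB_mult[OF GS_C_infinity[OF \<phi>] GS_C_infinity[OF c] _ _ A N]) auto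
      also have "\<dots> \<le> A * N * (2 * (h0 / 2)) ^ mi_size \<beta> * mi_fact \<beta> powr s
        * (exp (- r * norm x powr (1 / t)) * exp (- 1 * norm y powr (1 / t)))"
      proof (intro mult_left_mono)
        have "norm x powr (1 / t) \<le> \<kappa> * (norm y powr (1 / t) + norm (y - x) powr (1 / t))"
          using norm_powr_quasi_triangle[of "1 / t" y "x - y"] t by (simp add: \<kappa>_def norm_minus_commute)
        then have "r * norm x powr (1 / t) \<le> r * (\<kappa> * (norm y powr (1 / t) + norm (y - x) powr (1 / t)))"
          using r by (intro mult_left_mono) auto
        then have "r * norm x powr (1 / t) \<le> norm (y - x) powr (1 / t)
            + r * (\<kappa> * (norm y powr (1 / t) + norm (y - x) powr (1 / t)))"
          by (intro add_increasing) auto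
        then have "- R * norm y powr (1 / t) + - R * norm (y - x) powr (1 / t)
            \<le> - r * norm x powr (1 / t) + - 1 * norm y powr (1 / t)"
          by (simp add: R_def algebra_simps)
        then show "exp (- R * norm y powr (1 / t)) * exp (- R * norm (y - x) powr (1 / t))
            \<le> exp (- r * norm x powr (1 / t)) * exp (- 1 * norm y powr (1 / t))"
          unfolding exp_add[symmetric] by simp
      qed (use A0 N0 h0 in auto)
      finally show ?thesis by (simp add: mult_ac)
    qed
    have eq: "\<phi> y * cnj (atom \<psi> z y) = G y * plane_wave (- \<xi>) y" for y
      by (simp add: atom_eq z G_def cnj_plane_wave mult_ac)
    define X where "X = norm (LINT y|lborel. G y * plane_wave (- \<xi>) y)"
    have "X \<le> (A * N * exp (- r * norm x powr (1 / t)) * I) * 2 powr s * exp (- r * norm \<xi> powr (1 / s))"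
    proof (rule h0(2)[of h0])
      fix \<alpha> :: "'a \<Rightarrow> nat"
      have "of_real (mi_power \<xi> \<alpha>) * (LINT y|lborel. G y * plane_wave (- \<xi>) y)
          = (LINT y|lborel. mi_D \<alpha> G y * plane_wave (- \<xi>) y)"
        using GB by (intro integral_by_parts_plane_wave[OF GC t zero_less_one]) blast
      then have "\<bar>mi_power \<xi> \<alpha>\<bar> * X = norm (LINT y|lborel. mi_D \<alpha> G y * plane_wave (- \<xi>) y)"
        unfolding X_def by (metis norm_mult norm_of_real)
      also have "\<dots> \<le> ?K \<alpha> * I"
        unfolding I_def
      proof (rule integral_norm_le_stretched_exp[OF _ t zero_less_one])
        show "(\<lambda>y. mi_D \<alpha> G y * plane_wave (- \<xi>) y) \<in> borel_measurable borel"
          by (intro borel_measurable_times C_infinity_measurable mi_D_C_infinity GC mi_D_plane_wave)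
      qed (use GB in \<open>simp add: norm_mult\<close>)
      finally show "\<bar>mi_power \<xi> \<alpha>\<bar> * X \<le> A * N * exp (- r * norm x powr (1 / t)) * I * h0 ^ mi_size \<alpha> * mi_fact \<alpha> powr s"
        by (simp add: mult_ac)
    qed (use h0 A0 N0 I in \<open>auto simp: X_def\<close>)
    also have "\<dots> = (C1 * N * I * 2 powr s) * GS_norm t s h \<phi> * exp (- r * rho t s z)"
      by (simp add: A_def rho_def z algebra_simps exp_add[symmetric] flip: exp_minus)
    finally show ?thesis by (simp add: X_def eq)
  qed
  moreover have "C1 * N * I * 2 powr s \<ge> 0" using h N0 I by simp
  ultimately show ?thesis using h(1) by blast
qed

section \<open>Fourier inversion and the reproducing formula\<close>

lemma integral_affine:
  fixes f :: "'a::euclidean_space \<Rightarrow> complex"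
  assumes [measurable]: "f \<in> borel_measurable borel" and c: "c \<noteq> 0"
  shows "(LINT v|lborel. f v) = of_real (\<bar>c\<bar> ^ DIM('a)) * (LINT w|lborel. f (y + c *\<^sub>R w))"
proof -
  have "(LINT v|lborel. f v) = (LINT v|density (distr lborel borel (\<lambda>x. y + c *\<^sub>R x)) (\<lambda>_. ennreal (\<bar>c\<bar> ^ DIM('a))). f v)"
    using lborel_affine[OF c, of y] by simp
  also have "\<dots> = (LINT v|distr lborel borel (\<lambda>x. y + c *\<^sub>R x). (\<bar>c\<bar> ^ DIM('a)) *\<^sub>R f v)"
    by (rule integral_density) auto
  also have "\<dots> = (LINT w|lborel. (\<bar>c\<bar> ^ DIM('a)) *\<^sub>R f (y + c *\<^sub>R w))"
    by (rule integral_distr) auto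
  finally show ?thesis by (simp add: scaleR_conv_of_real)
qed

lemma gaussian_fourier_real:
  fixes a \<epsilon> :: real
  assumes e: "\<epsilon> > 0"
  shows "integrable lborel (\<lambda>y. exp (\<i> * of_real (y * a)) * of_real (exp (- (\<epsilon> * y)\<^sup>2 / 2)))"
    and "(LINT y|lborel. exp (\<i> * of_real (y * a)) * of_real (exp (- (\<epsilon> * y)\<^sup>2 / 2)))
      = of_real (sqrt (2 * pi) / \<epsilon> * exp (- (a / \<epsilon>)\<^sup>2 / 2))"
proof -
  show int: "integrable lborel (\<lambda>y. exp (\<i> * of_real (y * a)) * of_real (exp (- (\<epsilon> * y)\<^sup>2 / 2)))"
  proof (rule integrable_by_stretched_exp[where t = "1/2" and r = "\<epsilon>\<^sup>2 / 2" and M = 1])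
    fix y :: real
    have "norm y powr (1 / (1/2)) = y\<^sup>2" by simp
    then show "norm (exp (\<i> * of_real (y * a)) * of_real (exp (- (\<epsilon> * y)\<^sup>2 / 2)))
        \<le> 1 * exp (- (\<epsilon>\<^sup>2 / 2) * norm y powr (1 / (1/2)))"
      by (simp add: norm_mult power_mult_distrib)
  qed (use e in auto)
  define c where "c = a / \<epsilon>"
  let ?g = "\<lambda>x::real. exp (\<i> * of_real (c * x)) * of_real (exp (- x\<^sup>2 / 2))"
  have "complex_of_real (exp (- (c\<^sup>2) / 2)) = char std_normal_distribution c"
    by (simp add: char_std_normal_distribution)
  also have "\<dots> = (LINT x|lborel. std_normal_density x *\<^sub>R exp (\<i> * of_real (c * x)))"
    unfolding char_def by (rule integral_density) auto
  also have "\<dots> = (LINT x|lborel. of_real (1 / sqrt (2 * pi)) * ?g x)"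
    by (intro Bochner_Integration.integral_cong refl)
      (simp add: std_normal_density_def scaleR_conv_of_real)
  also have "\<dots> = of_real (1 / sqrt (2 * pi)) * (LINT x|lborel. ?g x)"
    by (rule integral_mult_right_zero)
  also have "(LINT x|lborel. ?g x) = of_real \<epsilon> * (LINT y|lborel. ?g (0 + \<epsilon> *\<^sub>R y))"
    using e by (subst integral_affine[where c = \<epsilon> and y = 0]) (auto simp: abs_of_pos)
  also have "(LINT y|lborel. ?g (0 + \<epsilon> *\<^sub>R y)) = (LINT y|lborel. exp (\<i> * of_real (y * a)) * of_real (exp (- (\<epsilon> * y)\<^sup>2 / 2)))"
    using e by (intro Bochner_Integration.integral_cong refl) (simp add: c_def mult_ac)
  finally show "(LINT y|lborel. exp (\<i> * of_real (y * a)) * of_real (exp (- (\<epsilon> * y)\<^sup>2 / 2)))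
      = of_real (sqrt (2 * pi) / \<epsilon> * exp (- (a / \<epsilon>)\<^sup>2 / 2))"
    using e by (simp add: c_def field_simps)
qed

text \<open>
  The Gaussian and the plane wave both factor over the coordinates, which reduces their Fourier
  integral to the one-dimensional characteristic function.
\<close>

lemma gaussian_prod:
  fixes \<xi> x :: "'a::euclidean_space"
  shows "plane_wave x \<xi> * of_real (exp (- (\<epsilon> * norm \<xi>)\<^sup>2 / 2))
    = (\<Prod>b\<in>Basis. exp (\<i> * of_real ((\<xi> \<bullet> b) * (x \<bullet> b))) * of_real (exp (- (\<epsilon> * (\<xi> \<bullet> b))\<^sup>2 / 2)))"
proof -
  have "(\<Prod>b\<in>Basis. exp (\<i> * of_real ((\<xi> \<bullet> b) * (x \<bullet> b)))) = exp (\<Sum>b\<in>Basis. \<i> * of_real ((\<xi> \<bullet> b) * (x \<bullet> b)))"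
    by (rule exp_sum[symmetric]) simp
  also have "(\<Sum>b\<in>Basis. \<i> * of_real ((\<xi> \<bullet> b) * (x \<bullet> b))) = \<i> * of_real (\<xi> \<bullet> x)"
    unfolding sum_distrib_left[symmetric] of_real_sum[symmetric] by (simp add: euclidean_inner[of \<xi> x])
  finally have 1: "(\<Prod>b\<in>Basis. exp (\<i> * of_real ((\<xi> \<bullet> b) * (x \<bullet> b)))) = plane_wave x \<xi>"
    by (simp add: plane_wave_def)
  have "(\<Prod>b\<in>Basis. exp (- (\<epsilon> * (\<xi> \<bullet> b))\<^sup>2 / 2)) = exp (\<Sum>b\<in>Basis. - (\<epsilon> * (\<xi> \<bullet> b))\<^sup>2 / 2)"
    by (rule exp_sum[symmetric]) simp
  also have "(\<Sum>b\<in>Basis. - (\<epsilon> * (\<xi> \<bullet> b))\<^sup>2 / 2) = - \<epsilon>\<^sup>2 / 2 * (\<Sum>b\<in>Basis. (\<xi> \<bullet> b) * (\<xi> \<bullet> b))"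
    unfolding sum_distrib_left by (intro sum.cong refl) (simp add: power2_eq_square)
  also have "\<dots> = - (\<epsilon> * norm \<xi>)\<^sup>2 / 2"
    unfolding euclidean_inner[of \<xi> \<xi>, symmetric] by (simp add: power_mult_distrib dot_square_norm)
  finally have 2: "(\<Prod>b\<in>Basis. exp (- (\<epsilon> * (\<xi> \<bullet> b))\<^sup>2 / 2)) = exp (- (\<epsilon> * norm \<xi>)\<^sup>2 / 2)" .
  show ?thesis unfolding prod.distrib 1 of_real_prod[symmetric] 2 ..
qed

lemma gaussian_fourier:
  fixes x :: "'a::euclidean_space" and \<epsilon> :: real
  assumes e: "\<epsilon> > 0"
  shows "integrable lborel (\<lambda>\<xi>::'a. plane_wave x \<xi> * of_real (exp (- (\<epsilon> * norm \<xi>)\<^sup>2 / 2)))"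
    and "(LINT \<xi>|lborel. plane_wave x \<xi> * of_real (exp (- (\<epsilon> * norm \<xi>)\<^sup>2 / 2)))
      = of_real ((sqrt (2 * pi) / \<epsilon>) ^ DIM('a) * exp (- (norm x / \<epsilon>)\<^sup>2 / 2))"
proof -
  show "integrable lborel (\<lambda>\<xi>::'a. plane_wave x \<xi> * of_real (exp (- (\<epsilon> * norm \<xi>)\<^sup>2 / 2)))"
    unfolding gaussian_prod by (intro lborel_integral_Basis_prod gaussian_fourier_real e)
  have "(LINT \<xi>|lborel. plane_wave x \<xi> * of_real (exp (- (\<epsilon> * norm \<xi>)\<^sup>2 / 2)))
    = (\<Prod>b\<in>Basis. complex_of_real (sqrt (2 * pi) / \<epsilon> * exp (- ((x \<bullet> b) / \<epsilon>)\<^sup>2 / 2)))"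
    unfolding gaussian_prod lborel_integral_Basis_prod(2)[OF gaussian_fourier_real(1)[OF e]]
      gaussian_fourier_real(2)[OF e] ..
  also have "\<dots> = of_real ((sqrt (2 * pi) / \<epsilon>) ^ DIM('a) * (\<Prod>b\<in>Basis. exp (- ((x \<bullet> b) / \<epsilon>)\<^sup>2 / 2)))"
    unfolding of_real_prod[symmetric] prod.distrib by simp
  also have "(\<Prod>b\<in>Basis. exp (- ((x \<bullet> b) / \<epsilon>)\<^sup>2 / 2)) = exp (\<Sum>b\<in>Basis. - ((x \<bullet> b) / \<epsilon>)\<^sup>2 / 2)"
    by (rule exp_sum[symmetric]) simp
  also have "(\<Sum>b\<in>Basis. - ((x \<bullet> b) / \<epsilon>)\<^sup>2 / 2) = - (1 / \<epsilon>\<^sup>2) / 2 * (\<Sum>b\<in>Basis. (x \<bullet> b) * (x \<bullet> b))"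
    unfolding sum_distrib_left by (intro sum.cong refl) (simp add: power2_eq_square)
  also have "\<dots> = - (norm x / \<epsilon>)\<^sup>2 / 2"
    unfolding euclidean_inner[of x x, symmetric] by (simp add: power_divide dot_square_norm)
  finally show "(LINT \<xi>|lborel. plane_wave x \<xi> * of_real (exp (- (\<epsilon> * norm \<xi>)\<^sup>2 / 2)))
      = of_real ((sqrt (2 * pi) / \<epsilon>) ^ DIM('a) * exp (- (norm x / \<epsilon>)\<^sup>2 / 2))" .
qed

lemma plane_wave_swap: "plane_wave x \<xi> = plane_wave \<xi> x"
  by (simp add: plane_wave_def inner_commute)

lemma plane_wave_minus: "plane_wave (- \<xi>) v = plane_wave \<xi> (- v)"
  by (simp add: plane_wave_def)

lemma plane_wave_add: "plane_wave \<xi> (v + w) = plane_wave \<xi> v * plane_wave \<xi> w"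
  by (simp add: plane_wave_def inner_left_distrib distrib_left exp_add)

lemma plane_wave_measurable [measurable]: "plane_wave \<xi> \<in> borel_measurable borel"
  unfolding plane_wave_def by measurable

text \<open>
  The classical proof by Gaussian summation: after inserting \<open>exp (- |\<epsilon> \<xi>|\<^sup>2 / 2)\<close> the order of
  integration can be changed, and the inner integral is a Gaussian approximate identity.
\<close>

lemma fourier_inversion:
  fixes h :: "'a::euclidean_space \<Rightarrow> complex"
  assumes cont: "continuous_on UNIV h" and int: "integrable lborel h" and B: "\<And>v. norm (h v) \<le> B"
    and H: "H = (\<lambda>\<xi>. LINT v|lborel. h v * plane_wave (- \<xi>) v)" and intH: "integrable lborel H"
  shows "(LINT \<xi>|lborel. H \<xi> * plane_wave \<xi> y) = of_real ((2 * pi) ^ DIM('a)) * h y"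
proof -
  have [measurable]: "h \<in> borel_measurable borel" "H \<in> borel_measurable borel"
    using int intH borel_measurable_integrable by force+
  define \<epsilon> where "\<epsilon> n = inverse (real (Suc n))" for n
  have \<epsilon>: "\<epsilon> n > 0" for n by (simp add: \<epsilon>_def)
  have \<epsilon>0: "\<epsilon> \<longlonglongrightarrow> 0" unfolding \<epsilon>_def using LIMSEQ_inverse_real_of_nat by simp
  define g where "g \<delta> \<xi> = complex_of_real (exp (- (\<delta> * norm \<xi>)\<^sup>2 / 2))" for \<delta> and \<xi> :: 'a
  have [measurable]: "g \<delta> \<in> borel_measurable borel" for \<delta> unfolding g_def by measurable
  have g1: "norm (g \<delta> \<xi>) \<le> 1" for \<delta> \<xi> by (simp add: g_def)
  have gint: "integrable lborel (g (\<epsilon> n))" for n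
    using gaussian_fourier(1)[OF \<epsilon>, of 0 n] by (simp add: g_def[abs_def] plane_wave_def)
  define A where "A n = (LINT \<xi>|lborel. H \<xi> * plane_wave \<xi> y * g (\<epsilon> n) \<xi>)" for n
  have pw2: "(\<lambda>\<xi>. plane_wave \<xi> y) \<in> borel_measurable borel" for y :: 'a
    unfolding plane_wave_swap[of _ y] by simp
  note [measurable] = pw2
  have A1: "A \<longlonglongrightarrow> (LINT \<xi>|lborel. H \<xi> * plane_wave \<xi> y)"
    unfolding A_def
  proof (rule integral_dominated_convergence)
    show "integrable lborel (\<lambda>\<xi>. norm (H \<xi>))" using intH by (rule integrable_norm)
    show "AE \<xi> in lborel. norm (H \<xi> * plane_wave \<xi> y * g (\<epsilon> n) \<xi>) \<le> norm (H \<xi>)" for n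
      using g1 by (auto simp: norm_mult intro!: AE_I2 mult_right_le_one_le)
    show "AE \<xi> in lborel. (\<lambda>n. H \<xi> * plane_wave \<xi> y * g (\<epsilon> n) \<xi>) \<longlonglongrightarrow> H \<xi> * plane_wave \<xi> y"
    proof (rule AE_I2)
      fix \<xi>
      have "(\<lambda>n. H \<xi> * plane_wave \<xi> y * g (\<epsilon> n) \<xi>) \<longlonglongrightarrow> H \<xi> * plane_wave \<xi> y * complex_of_real (exp (- (0 * norm \<xi>)\<^sup>2 / 2))"
        unfolding g_def by (intro tendsto_intros \<epsilon>0) auto
      then show "(\<lambda>n. H \<xi> * plane_wave \<xi> y * g (\<epsilon> n) \<xi>) \<longlonglongrightarrow> H \<xi> * plane_wave \<xi> y" by simp
    qed
  qed measurable
  have A2: "A n = of_real (sqrt (2 * pi) ^ DIM('a)) * (LINT w|lborel. h (y + \<epsilon> n *\<^sub>R w) * g 1 w)" for n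
  proof -
    let ?f = "\<lambda>\<xi> v. h v * plane_wave (- \<xi>) v * plane_wave \<xi> y * g (\<epsilon> n) \<xi>"
    have m: "(\<lambda>(\<xi>, v). ?f \<xi> v) \<in> borel_measurable (lborel \<Otimes>\<^sub>M lborel)"
      unfolding plane_wave_def by measurable
    have i: "integrable (lborel \<Otimes>\<^sub>M lborel) (\<lambda>(\<xi>, v). ?f \<xi> v)"
    proof (rule lborel_pair.Fubini_integrable[OF m])
      show "integrable lborel (\<lambda>\<xi>. LINT v|lborel. norm (case (\<xi>, v) of (\<xi>, v) \<Rightarrow> ?f \<xi> v))"
        using gint[of n] by (simp add: norm_mult)
      show "AE \<xi> in lborel. integrable lborel (\<lambda>v. case (\<xi>, v) of (\<xi>, v) \<Rightarrow> ?f \<xi> v)"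
      proof (rule AE_I2)
        fix \<xi> :: 'a
        have "integrable lborel (\<lambda>v. h v * plane_wave (- \<xi>) v)"
          by (rule Bochner_Integration.integrable_bound[OF int]) (auto simp: norm_mult)
        from integrable_mult_left[OF this, of "plane_wave \<xi> y * g (\<epsilon> n) \<xi>"]
        show "integrable lborel (\<lambda>v. case (\<xi>, v) of (\<xi>, v) \<Rightarrow> ?f \<xi> v)"
          by (simp add: mult.assoc)
      qed
    qed
    have "A n = (LINT \<xi>|lborel. LINT v|lborel. ?f \<xi> v)"
      unfolding A_def H
      by (intro Bochner_Integration.integral_cong refl)
        (simp only: mult.assoc integral_mult_left_zero[symmetric])
    also have "\<dots> = (LINT v|lborel. LINT \<xi>|lborel. ?f \<xi> v)"
      by (rule lborel_pair.Fubini_integral[OF i, symmetric])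
    also have "\<dots> = (LINT v|lborel. h v * of_real ((sqrt (2 * pi) / \<epsilon> n) ^ DIM('a) * exp (- (norm (y - v) / \<epsilon> n)\<^sup>2 / 2)))"
    proof (rule Bochner_Integration.integral_cong[OF refl])
      fix v
      have "?f \<xi> v = h v * (plane_wave (y - v) \<xi> * g (\<epsilon> n) \<xi>)" for \<xi>
        using plane_wave_add[of \<xi> y "- v"]
        by (simp add: plane_wave_minus plane_wave_swap[of "y - v"] mult_ac)
      then have "(LINT \<xi>|lborel. ?f \<xi> v) = h v * (LINT \<xi>|lborel. plane_wave (y - v) \<xi> * g (\<epsilon> n) \<xi>)"
        by (simp only: integral_mult_right_zero)
      then show "(LINT \<xi>|lborel. ?f \<xi> v) = h v * of_real ((sqrt (2 * pi) / \<epsilon> n) ^ DIM('a) * exp (- (norm (y - v) / \<epsilon> n)\<^sup>2 / 2))"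
        unfolding g_def gaussian_fourier(2)[OF \<epsilon>] .
    qed
    also have "\<dots> = of_real (\<bar>\<epsilon> n\<bar> ^ DIM('a)) * (LINT w|lborel. h (y + \<epsilon> n *\<^sub>R w)
        * of_real ((sqrt (2 * pi) / \<epsilon> n) ^ DIM('a) * exp (- (norm (y - (y + \<epsilon> n *\<^sub>R w)) / \<epsilon> n)\<^sup>2 / 2)))"
      using \<epsilon>[of n] by (intro integral_affine) auto
    also have "\<dots> = of_real (\<bar>\<epsilon> n\<bar> ^ DIM('a)) * (LINT w|lborel. of_real ((sqrt (2 * pi) / \<epsilon> n) ^ DIM('a)) * (h (y + \<epsilon> n *\<^sub>R w) * g 1 w))"
      using \<epsilon>[of n] by (simp add: g_def mult_ac)
    also have "\<dots> = of_real (\<bar>\<epsilon> n\<bar> ^ DIM('a)) * (of_real ((sqrt (2 * pi) / \<epsilon> n) ^ DIM('a)) * (LINT w|lborel. h (y + \<epsilon> n *\<^sub>R w) * g 1 w))"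
      by (subst integral_mult_right_zero) (rule refl)
    also have "\<dots> = of_real (sqrt (2 * pi) ^ DIM('a)) * (LINT w|lborel. h (y + \<epsilon> n *\<^sub>R w) * g 1 w)"
      using \<epsilon>[of n] by (simp add: power_divide)
    finally show ?thesis .
  qed
  have lim: "(\<lambda>n. LINT w|lborel. h (y + \<epsilon> n *\<^sub>R w) * g 1 w) \<longlonglongrightarrow> (LINT w|lborel. h y * g 1 w)"
  proof (rule integral_dominated_convergence)
    show "integrable lborel (\<lambda>w::'a. B * norm (g 1 w))"
      using gint[of 0] by (intro integrable_mult_right integrable_norm) (simp add: \<epsilon>_def)
    show "AE w in lborel. norm (h (y + \<epsilon> n *\<^sub>R w) * g 1 w) \<le> B * norm (g 1 w)" for n
      using B by (auto simp: norm_mult intro!: AE_I2 mult_right_mono)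
    show "AE w in lborel. (\<lambda>n. h (y + \<epsilon> n *\<^sub>R w) * g 1 w) \<longlonglongrightarrow> h y * g 1 w"
    proof (rule AE_I2)
      fix w
      have "(\<lambda>n. y + \<epsilon> n *\<^sub>R w) \<longlonglongrightarrow> y + 0 *\<^sub>R w" by (intro tendsto_intros \<epsilon>0)
      then have "(\<lambda>n. h (y + \<epsilon> n *\<^sub>R w)) \<longlonglongrightarrow> h (y + 0 *\<^sub>R w)"
        by (rule continuous_on_tendsto_compose[OF cont]) auto
      then show "(\<lambda>n. h (y + \<epsilon> n *\<^sub>R w) * g 1 w) \<longlonglongrightarrow> h y * g 1 w"
        by (intro tendsto_mult tendsto_const) simp
    qed
  qed measurable
  have eq: "(LINT w|lborel. h y * g 1 w) = h y * of_real (sqrt (2 * pi) ^ DIM('a))"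
    using gaussian_fourier(2)[of 1 "0::'a"] by (simp add: g_def plane_wave_def)
  have "A \<longlonglongrightarrow> of_real (sqrt (2 * pi) ^ DIM('a)) * (h y * of_real (sqrt (2 * pi) ^ DIM('a)))"
    unfolding A2 by (intro tendsto_mult tendsto_const lim[unfolded eq])
  from LIMSEQ_unique[OF A1 this]
  have "(LINT \<xi>|lborel. H \<xi> * plane_wave \<xi> y) = of_real ((sqrt (2 * pi) * sqrt (2 * pi)) ^ DIM('a)) * h y"
    unfolding power_mult_distrib of_real_mult by (simp only: mult_ac)
  then show ?thesis by simp
qed

text \<open>
  For fixed \<open>x\<close> the coefficient is, as a function of \<open>\<xi>\<close>, the Fourier transform of \<open>\<phi> \<cdot> cnj (T\<^sub>x \<psi>)\<close>. Fourier
  inversion in \<open>\<xi>\<close> leaves \<open>\<phi> y |\<psi> (y - x)|\<^sup>2\<close>, and the integral over \<open>x\<close> is the square of the norm of \<open>\<psi>\<close>.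
\<close>

lemma atom_inversion:
  fixes \<psi> \<phi> :: "'a::euclidean_space \<Rightarrow> complex" and t s :: real
  assumes t: "t > 0" and s: "s > 0" and \<psi>: "\<psi> \<in> GS t s" and \<phi>: "\<phi> \<in> GS t s"
  shows "(LINT z|lborel. (LINT v|lborel. \<phi> v * cnj (atom \<psi> z v)) * atom \<psi> z y)
    = of_real ((2 * pi) ^ DIM('a) * (LINT v|lborel. (norm (\<psi> v))\<^sup>2)) * \<phi> y"
proof -
  define a where "a = (\<lambda>z. LINT v|lborel. \<phi> v * cnj (atom \<psi> z v))"
  have fam: "GS_family t s (\<lambda>z v. cnj (atom \<psi> z v))"
    by (intro GS_family_cnj GS_family_atom t s \<psi>)
  have a_cont: "continuous_on UNIV a"
    unfolding a_def by (rule bfun_family_continuous[OF t s bfun_pairing[OF t \<phi>] fam])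
  have am: "a \<in> borel_measurable borel" using a_cont by (rule borel_measurable_continuous_onI)
  obtain C where C: "C \<ge> 0" "\<And>z. norm (a z) \<le> C * exp (- 1 * rho t s z)"
  proof -
    obtain h C where "h > 0" "C \<ge> 0" and le: "\<forall>\<phi>\<in>GS t s. \<forall>z.
        norm (LINT y|lborel. \<phi> y * cnj (atom \<psi> z y)) \<le> C * GS_norm t s h \<phi> * exp (- 1 * rho t s z)"
      using atom_decay[OF t s \<psi> zero_less_one] by blast
    then have "C * GS_norm t s h \<phi> \<ge> 0" using GS_norm_nonneg[OF GS_banach[OF \<phi>]] by simp
    moreover have "norm (a z) \<le> C * GS_norm t s h \<phi> * exp (- 1 * rho t s z)" for z
      unfolding a_def by (rule le[rule_format, OF \<phi>])
    ultimately show thesis by (rule that)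
  qed
  have \<psi>m[measurable]: "\<psi> \<in> borel_measurable borel" and \<phi>m[measurable]: "\<phi> \<in> borel_measurable borel"
    using \<psi> \<phi> by (auto intro: GS_measurable)
  have cont: "continuous_on UNIV \<psi>" "continuous_on UNIV \<phi>"
    using \<psi> \<phi> by (auto intro: C_infinity_continuous GS_C_infinity)
  let ?N = "GS_norm t s 1 \<psi>"
  have N: "norm (\<psi> v) \<le> ?N" for v by (rule GS_le_norm[OF \<psi>]) simp
  have N0: "?N \<ge> 0" using N norm_ge_zero order_trans by blast
  have at: "continuous_on UNIV (\<lambda>z. atom \<psi> z y)"
    by (rule GS_family_continuous[OF GS_family_atom[OF t s \<psi>]])
  have int: "integrable lborel (\<lambda>z. a z * atom \<psi> z y)"
  proof (rule Bochner_Integration.integrable_bound)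
    show "integrable lborel (\<lambda>z::'a \<times> 'a. C * ?N * exp (- 1 * rho t s z))"
      by (intro integrable_mult_right integrable_exp_rho t s) simp
    show "(\<lambda>z. a z * atom \<psi> z y) \<in> borel_measurable lborel"
      using am borel_measurable_continuous_onI[OF at] by simp
    show "AE z in lborel. norm (a z * atom \<psi> z y) \<le> norm (C * ?N * exp (- 1 * rho t s z))"
    proof (rule AE_I2)
      fix z
      have "norm (a z) * norm (atom \<psi> z y) \<le> (C * exp (- 1 * rho t s z)) * ?N"
        using C N by (intro mult_mono) (auto simp: atom_eq norm_mult)
      then show "norm (a z * atom \<psi> z y) \<le> norm (C * ?N * exp (- 1 * rho t s z))"
        using C(1) N0 by (simp add: norm_mult mult_ac)
    qed
  qed
  have inner: "(LINT \<xi>|lborel. a (x, \<xi>) * plane_wave \<xi> y) = of_real ((2 * pi) ^ DIM('a)) * (\<phi> y * cnj (\<psi> (y - x)))" for x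
  proof (rule fourier_inversion)
    show "continuous_on UNIV (\<lambda>v. \<phi> v * cnj (\<psi> (v - x)))"
      by (intro continuous_on_mult continuous_on_cnj cont continuous_on_compose2[OF cont(1)] continuous_intros) auto
    show "integrable lborel (\<lambda>v. \<phi> v * cnj (\<psi> (v - x)))"
      using GS_mult_integrable[OF t \<phi> GS_family_GS[OF fam, of "(x, 0)"]]
      by (simp add: atom_eq plane_wave_def)
    show "norm (\<phi> v * cnj (\<psi> (v - x))) \<le> GS_norm t s 1 \<phi> * ?N" for v
      using N[of "v - x"] GS_le_norm[OF \<phi> zero_less_one, of v] N0
      by (auto simp: norm_mult intro!: mult_mono order_trans[OF norm_ge_zero])
    show "(\<lambda>\<xi>. a (x, \<xi>)) = (\<lambda>\<xi>. LINT v|lborel. \<phi> v * cnj (\<psi> (v - x)) * plane_wave (- \<xi>) v)"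
      by (simp add: a_def atom_eq cnj_plane_wave mult_ac)
    show "integrable lborel (\<lambda>\<xi>. a (x, \<xi>))"
    proof (rule integrable_by_stretched_exp[OF _ s zero_less_one, of _ C])
      have "continuous_on UNIV (\<lambda>\<xi>. a (x, \<xi>))"
        by (rule continuous_on_compose2[OF a_cont]) (auto intro!: continuous_intros)
      then show "(\<lambda>\<xi>. a (x, \<xi>)) \<in> borel_measurable borel" by (rule borel_measurable_continuous_onI)
      fix \<xi> :: 'a
      have "norm (a (x, \<xi>)) \<le> C * exp (- 1 * rho t s (x, \<xi>))" by (rule C(2))
      also have "\<dots> \<le> C * exp (- 1 * norm \<xi> powr (1 / s))"
        using C(1) by (intro mult_left_mono) (auto simp: rho_def)
      finally show "norm (a (x, \<xi>)) \<le> C * exp (- 1 * norm \<xi> powr (1 / s))" .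
    qed
  qed
  have "(LINT z|lborel. a z * atom \<psi> z y) = (LINT x|lborel. LINT \<xi>|lborel. a (x, \<xi>) * atom \<psi> (x, \<xi>) y)"
    using lborel_pair.integral_fst'[where f = "\<lambda>z. a z * atom \<psi> z y"] int by (simp add: lborel_prod)
  also have "\<dots> = (LINT x|lborel. of_real ((2 * pi) ^ DIM('a)) * \<phi> y * of_real ((norm (\<psi> (y - x)))\<^sup>2))"
  proof (rule Bochner_Integration.integral_cong[OF refl])
    fix x
    have "(LINT \<xi>|lborel. a (x, \<xi>) * atom \<psi> (x, \<xi>) y) = (LINT \<xi>|lborel. \<psi> (y - x) * (a (x, \<xi>) * plane_wave \<xi> y))"
      by (simp add: atom_eq mult_ac)
    also have "\<dots> = \<psi> (y - x) * (of_real ((2 * pi) ^ DIM('a)) * (\<phi> y * cnj (\<psi> (y - x))))"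
      by (simp add: inner)
    also have "\<dots> = of_real ((2 * pi) ^ DIM('a)) * \<phi> y * of_real ((norm (\<psi> (y - x)))\<^sup>2)"
      unfolding complex_norm_square by (simp add: mult_ac)
    finally show "(LINT \<xi>|lborel. a (x, \<xi>) * atom \<psi> (x, \<xi>) y) = of_real ((2 * pi) ^ DIM('a)) * \<phi> y * of_real ((norm (\<psi> (y - x)))\<^sup>2)" .
  qed
  also have "\<dots> = of_real ((2 * pi) ^ DIM('a)) * \<phi> y * (LINT x|lborel. complex_of_real ((norm (\<psi> (y - x)))\<^sup>2))"
    by (rule integral_mult_right_zero)
  also have "(LINT x|lborel. complex_of_real ((norm (\<psi> (y - x)))\<^sup>2)) = (LINT v|lborel. complex_of_real ((norm (\<psi> v))\<^sup>2))"
    using integral_affine[of "\<lambda>v. complex_of_real ((norm (\<psi> v))\<^sup>2)" "-1" y] by simp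
  also have "\<dots> = of_real (LINT v|lborel. (norm (\<psi> v))\<^sup>2)" by (rule integral_complex_of_real)
  finally show ?thesis by (simp add: a_def mult_ac)
qed

lemma GS_square_integral_pos:
  assumes t: "t > 0" and \<psi>: "\<psi> \<in> GS t s" and nz: "\<psi> \<noteq> (\<lambda>x. 0)"
  shows "(LINT v|lborel. (norm (\<psi> v))\<^sup>2) > 0"
proof -
  have "integrable lborel (\<lambda>v. \<psi> v * cnj (\<psi> v))" by (intro GS_mult_integrable[OF t \<psi>] GS_cnj \<psi>)
  then have "integrable lborel (\<lambda>v. norm (\<psi> v * cnj (\<psi> v)))" by (rule integrable_norm)
  then have int: "integrable lborel (\<lambda>v. (norm (\<psi> v))\<^sup>2)" by (simp add: norm_mult power2_eq_square)
  have cont: "continuous_on UNIV \<psi>" by (rule C_infinity_continuous[OF GS_C_infinity[OF \<psi>]])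
  obtain x where x: "\<psi> x \<noteq> 0" using nz by auto
  define U where "U = {v. norm (\<psi> v) > norm (\<psi> x) / 2}"
  have "open U" unfolding U_def
    by (intro open_Collect_less continuous_intros) (use cont in auto)
  moreover have "x \<in> U" using x by (simp add: U_def)
  ultimately have U: "U \<notin> null_sets lborel"
    using open_not_negligible[of U] null_sets_completionI[of U lborel]
    by (auto simp: negligible_iff_null_sets)
  have "(LINT v|lborel. (norm (\<psi> v))\<^sup>2) \<noteq> 0"
  proof
    assume "(LINT v|lborel. (norm (\<psi> v))\<^sup>2) = 0"
    then have "AE v in lborel. (norm (\<psi> v))\<^sup>2 = 0"
      using integral_nonneg_eq_0_iff_AE[OF int] by simp
    then have "AE v in lborel. v \<notin> U" by eventually_elim (use x in \<open>simp add: U_def\<close>)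
    then show False using U AE_iff_null_sets[of U lborel] \<open>open U\<close> by auto
  qed
  moreover have "(LINT v|lborel. (norm (\<psi> v))\<^sup>2) \<ge> 0" by (rule integral_nonneg_AE) simp
  ultimately show ?thesis by linarith
qed

section \<open>Synthesis of test functions from atoms\<close>

lemma bfun_zero:
  fixes f :: "'a::euclidean_space \<Rightarrow> complex" and u :: "('a \<Rightarrow> complex) \<Rightarrow> complex"
  assumes "t > 0" "bfun t s u" "f \<in> GS t s" shows "u (\<lambda>x. 0) = 0"
  using bfun_lincomb[OF assms(2,3,3), where a = 0 and b = 0] by simp

lemma bfun_sum:
  fixes g :: "'a::euclidean_space \<Rightarrow> complex" and u :: "('a \<Rightarrow> complex) \<Rightarrow> complex"
  assumes t: "t > 0" and u: "bfun t s u" and f: "\<And>i. i \<in> I \<Longrightarrow> f i \<in> GS t s" and g: "g \<in> GS t s"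
  shows "u (\<lambda>x. \<Sum>i\<in>I. c i * f i x) = (\<Sum>i\<in>I. c i * u (f i))"
  using f
proof (induction I rule: infinite_finite_induct)
  case (insert i I)
  have "(\<lambda>x. \<Sum>i\<in>I. c i * f i x) \<in> GS t s" using insert by (intro GS_sum[OF t g]) auto
  from bfun_lincomb[OF u _ this, where f = "f i" and a = "c i" and b = 1] insert show ?case by simp
qed (simp_all add: bfun_zero[OF t u g])

lemma simple_approximation:
  obtains S :: "nat \<Rightarrow> 'a::euclidean_space \<Rightarrow> 'a"
  where "\<And>n. simple_function borel (S n)" "\<And>x. (\<lambda>n. S n x) \<longlonglongrightarrow> x" "\<And>n x. norm (S n x) \<le> 2 * norm x"
  using borel_measurable_implies_sequence_metric[of "\<lambda>x::'a. x" borel 0] by auto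

lemma integral_finite_range:
  fixes w F :: "_ \<Rightarrow> complex"
  assumes w: "integrable M w" and p: "simple_function M p"
  shows "(LINT z|M. w z * F (p z)) = (\<Sum>q\<in>p ` space M. (LINT z|M. w z * indicator (p -` {q} \<inter> space M) z) * F q)"
proof -
  have fin: "finite (p ` space M)" using p by (rule simple_functionD)
  have int: "integrable M (\<lambda>z. w z * indicator (p -` {q} \<inter> space M) z)" for q
    using integrable_mult_indicator[OF simple_functionD(2)[OF p, of "{q}"] w]
    by (rule Bochner_Integration.integrable_cong[THEN iffD1, OF refl, rotated])
      (simp add: indicator_def)
  have "(LINT z|M. w z * F (p z)) = (LINT z|M. (\<Sum>q\<in>p ` space M. w z * indicator (p -` {q} \<inter> space M) z * F q))"
  proof (rule Bochner_Integration.integral_cong[OF refl])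
    fix z assume z: "z \<in> space M"
    have "(\<Sum>q\<in>p ` space M. w z * indicator (p -` {q} \<inter> space M) z * F q)
        = (\<Sum>q\<in>p ` space M. if q = p z then w z * F q else 0)"
      using z by (intro sum.cong refl) (auto simp: indicator_def)
    then show "w z * F (p z) = (\<Sum>q\<in>p ` space M. w z * indicator (p -` {q} \<inter> space M) z * F q)"
      using fin z by (simp add: sum.delta)
  qed
  also have "\<dots> = (\<Sum>q\<in>p ` space M. (LINT z|M. w z * indicator (p -` {q} \<inter> space M) z * F q))"
    using int by (intro Bochner_Integration.integral_sum) auto
  finally show ?thesis by simp
qed

lemma integral_norm_le:
  fixes f :: "'a \<Rightarrow> complex"
  assumes g: "integrable M g" and le: "\<And>x. norm (f x) \<le> g x"
  shows "norm (LINT x|M. f x) \<le> (LINT x|M. g x)"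
proof (cases "integrable M f")
  case True
  have "norm (LINT x|M. f x) \<le> (LINT x|M. norm (f x))" by (rule integral_norm_bound)
  also have "\<dots> \<le> (LINT x|M. g x)" using True g le by (intro integral_mono) auto
  finally show ?thesis .
next
  case False
  have "(LINT x|M. g x) \<ge> 0" using order_trans[OF norm_ge_zero le] by (intro integral_nonneg_AE) auto
  then show ?thesis using not_integrable_integral_eq[OF False] by simp
qed

text \<open>
  Functionals commute with superpositions of atoms. Replacing the parameter \<open>z\<close> by simple functions
  \<open>p\<^sub>n(z) \<rightarrow> z\<close> turns the superposition into finite linear combinations, for which this is
  linearity. These stay bounded in the space and converge pointwise. Space and frequency variables
  are approximated separately, so that the anisotropic weight of \<open>p\<^sub>n(z)\<close> is controlled by that of \<open>z\<close>.
\<close>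

lemma synthesis:
  fixes a :: "'a::euclidean_space \<times> 'a \<Rightarrow> 'a \<Rightarrow> complex" and w :: "'a \<times> 'a \<Rightarrow> complex" and t s :: real
  assumes t: "t > 0" and s: "s > 0" and a: "GS_family t s a"
    and wm: "w \<in> borel_measurable borel"
    and w: "\<And>r. r > 0 \<Longrightarrow> \<exists>C. \<forall>z. norm (w z) \<le> C * exp (- r * rho t s z)"
  defines "G \<equiv> \<lambda>y. LINT z|lborel. w z * a z y"
    and "I \<equiv> LINT z::'a \<times> 'a|lborel. exp (- 1 * rho t s z)"
    and "\<kappa> \<equiv> (2::real) powr (1 / t) + 2 powr (1 / s)"
  shows "G \<in> GS t s"
    and "bfun t s u \<Longrightarrow> u G = (LINT z|lborel. w z * u (a z))"
    and "r > 0 \<Longrightarrow> h > 0 \<Longrightarrow> R > 0 \<Longrightarrow> (\<And>z. GSB t s r h (a z) (M * exp (R * rho t s z))) \<Longrightarrow>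
      (\<And>z. norm (w z) \<le> C * exp (- (\<kappa> * R + 1) * rho t s z)) \<Longrightarrow> GSB t s r h G (C * M * I)"
proof -
  obtain S :: "nat \<Rightarrow> 'a \<Rightarrow> 'a" where S: "\<And>n. simple_function borel (S n)"
    "\<And>x. (\<lambda>n. S n x) \<longlonglongrightarrow> x" "\<And>n x. norm (S n x) \<le> 2 * norm x"
    using simple_approximation by blast
  define p where "p n z = (S n (fst z), S n (snd z))" for n and z :: "'a \<times> 'a"
  have \<kappa>: "\<kappa> > 0" by (simp add: \<kappa>_def add_pos_pos)
  have p: "simple_function lborel (p n)" for n
  proof -
    have "(fst :: 'a \<times> 'a \<Rightarrow> 'a) \<in> measurable lborel borel" "(snd :: 'a \<times> 'a \<Rightarrow> 'a) \<in> measurable lborel borel"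
      by (auto intro!: borel_measurable_continuous_onI continuous_intros)
    from this[THEN simple_function_comp, OF S(1)[of n]] show ?thesis
      unfolding p_def by (rule simple_function_Pair)
  qed
  have pm: "p n \<in> borel_measurable borel" for n
    using borel_measurable_simple_function[OF p] by simp
  have plim: "(\<lambda>n. p n z) \<longlonglongrightarrow> z" for z
    using tendsto_Pair[OF S(2)[of "fst z"] S(2)[of "snd z"]] by (simp add: p_def)
  have prho: "rho t s (p n z) \<le> \<kappa> * rho t s z" for n z
  proof -
    have "norm (S n x) powr q \<le> 2 powr q * norm x powr q" if "q > 0" for x q
      using powr_mono2[OF _ _ S(3)[of n x], of q] that by (simp add: powr_mult)
    from this[of "1 / t" "fst z"] this[of "1 / s" "snd z"] t s
    have "rho t s (p n z) \<le> 2 powr (1 / t) * norm (fst z) powr (1 / t) + 2 powr (1 / s) * norm (snd z) powr (1 / s)"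
      by (simp add: rho_def p_def)
    also have "\<dots> \<le> \<kappa> * rho t s z"
      by (simp add: rho_def \<kappa>_def algebra_simps)
    finally show ?thesis .
  qed
  have expint: "integrable lborel (\<lambda>z::'a \<times> 'a. exp (- 1 * rho t s z))"
    by (rule integrable_exp_rho[OF t s zero_less_one])
  have wint: "integrable lborel w"
  proof -
    obtain C where C: "\<And>z. norm (w z) \<le> C * exp (- 1 * rho t s z)" using w[OF zero_less_one] by auto
    show ?thesis
      by (rule Bochner_Integration.integrable_bound[OF integrable_mult_right[OF expint, of C]])
        (use wm C in \<open>auto intro!: AE_I2 order_trans[OF _ abs_ge_self]\<close>)
  qed
  define c where "c n q = (LINT z|lborel. w z * indicator (p n -` {q} \<inter> space lborel) z)" for n q
  define Q where "Q n = p n ` space lborel" for n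
  define Gn where "Gn n = (\<lambda>y. LINT z|lborel. w z * a (p n z) y)" for n
  have fin: "(LINT z|lborel. w z * F (p n z)) = (\<Sum>q\<in>Q n. c n q * F q)" for F :: "'a \<times> 'a \<Rightarrow> complex" and n
    using integral_finite_range[OF wint p[of n], where F = F] by (simp add: c_def Q_def)
  have Gn: "Gn n = (\<lambda>y. \<Sum>q\<in>Q n. c n q * a q y)" for n
    unfolding Gn_def by (rule ext) (rule fin)
  have aG: "a z \<in> GS t s" for z by (rule GS_family_GS[OF a])
  have aC: "a z \<in> C_infinity" for z by (rule GS_C_infinity[OF aG])
  have GnG: "Gn n \<in> GS t s" for n unfolding Gn by (intro GS_sum[OF t aG[of 0]] aG)
  \<comment> \<open>One integrable majorant for all approximations, at the price of a factor \<open>\<kappa>\<close> in the rate.\<close>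
  have dom: "norm (w z) * B \<le> C * D * exp (- 1 * rho t s z)"
    if "norm (w z) \<le> C * exp (- (\<kappa> * R + 1) * rho t s z)" "B \<le> D * exp (R * rho t s (p n z))" "B \<ge> 0" "R > 0"
    for z B C D R n
  proof -
    have D: "D \<ge> 0" using order_trans[OF that(3,2)] by (simp add: zero_le_mult_iff)
    have "R * rho t s (p n z) \<le> \<kappa> * R * rho t s z"
      using mult_left_mono[OF prho[of n z], of R] that by (simp add: mult_ac)
    then have "B \<le> D * exp (\<kappa> * R * rho t s z)"
      by (intro order_trans[OF that(2)] mult_left_mono D) simp
    then have "norm (w z) * B \<le> (C * exp (- (\<kappa> * R + 1) * rho t s z)) * (D * exp (\<kappa> * R * rho t s z))"
      using that by (intro mult_mono) (auto intro: order_trans[OF norm_ge_zero])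
    also have "\<dots> = C * D * (exp (- (\<kappa> * R + 1) * rho t s z) * exp (\<kappa> * R * rho t s z))" by (simp add: mult_ac)
    also have "exp (- (\<kappa> * R + 1) * rho t s z) * exp (\<kappa> * R * rho t s z) = exp (- 1 * rho t s z)"
      unfolding exp_add[symmetric] by (simp add: algebra_simps)
    finally show ?thesis .
  qed
  have GnB: "GSB t s r h (Gn n) (C * M * I)"
    if "r > 0" "h > 0" "R > 0" and M: "\<And>z. GSB t s r h (a z) (M * exp (R * rho t s z))"
      and C: "\<And>z. norm (w z) \<le> C * exp (- (\<kappa> * R + 1) * rho t s z)" for r h R M C n
    unfolding GSB_def
  proof (intro allI)
    fix \<beta> :: "'a \<Rightarrow> nat" and y :: 'a
    let ?b = "h ^ mi_size \<beta> * mi_fact \<beta> powr s * exp (- r * norm y powr (1 / t))"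
    have "mi_D \<beta> (Gn n) y = (\<Sum>q\<in>Q n. c n q * mi_D \<beta> (a q) y)"
      unfolding Gn using mi_D_sum[OF aC aC[of 0], where I = "Q n" and \<beta> = \<beta> and c = "c n"] by simp
    also have "\<dots> = (LINT z|lborel. w z * mi_D \<beta> (a (p n z)) y)" by (rule fin[symmetric])
    finally have eq: "mi_D \<beta> (Gn n) y = (LINT z|lborel. w z * mi_D \<beta> (a (p n z)) y)" .
    have "norm (w z * mi_D \<beta> (a (p n z)) y) \<le> (C * M * ?b) * exp (- 1 * rho t s z)" for z
    proof -
      have "norm (mi_D \<beta> (a (p n z)) y) \<le> (M * ?b) * exp (R * rho t s (p n z))"
        using GSB_D[OF M, of \<beta> "p n z" y] by (simp add: mult_ac)
      from dom[OF C this _ that(3)] show ?thesis by (simp add: norm_mult mult_ac)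
    qed
    then have "norm (mi_D \<beta> (Gn n) y) \<le> (LINT z::'a \<times> 'a|lborel. (C * M * ?b) * exp (- 1 * rho t s z))"
      unfolding eq by (intro integral_norm_le integrable_mult_right expint)
    then show "norm (mi_D \<beta> (Gn n) y) \<le> C * M * I * h ^ mi_size \<beta> * mi_fact \<beta> powr s * exp (- r * norm y powr (1 / t))"
      by (simp add: I_def mult_ac)
  qed
  have bdd: "\<exists>M. \<forall>n. GSB t s r h (Gn n) M" if rh: "r > 0" "h > 0" for r h
  proof -
    obtain R M where RM: "R > 0" "M \<ge> 0" "\<And>z. GSB t s r h (a z) (M * exp (R * rho t s z))"
      using GS_family_bound[OF a rh] by blast
    obtain C where "\<And>z. norm (w z) \<le> C * exp (- (\<kappa> * R + 1) * rho t s z)"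
      using w[of "\<kappa> * R + 1"] \<kappa> RM(1) by (auto simp: add_pos_pos)
    from GnB[OF rh RM(1,3) this] show ?thesis by blast
  qed
  have lim: "(\<lambda>n. LINT z|lborel. w z * F (p n z)) \<longlonglongrightarrow> (LINT z|lborel. w z * F z)"
    if F: "continuous_on UNIV F" and R: "R > 0" and le: "\<And>z. norm (F z) \<le> D * exp (R * rho t s z)"
    for F :: "'a \<times> 'a \<Rightarrow> complex" and R D
  proof -
    obtain C where C: "\<And>z. norm (w z) \<le> C * exp (- (\<kappa> * R + 1) * rho t s z)"
      using w[of "\<kappa> * R + 1"] \<kappa> R by (auto simp: add_pos_pos)
    have Fm: "F \<in> borel_measurable borel" using F by (rule borel_measurable_continuous_onI)
    show ?thesis
    proof (rule integral_dominated_convergence)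
      show "integrable lborel (\<lambda>z::'a \<times> 'a. (C * D) * exp (- 1 * rho t s z))"
        by (intro integrable_mult_right expint)
      show "(\<lambda>z. w z * F z) \<in> borel_measurable lborel" using wm Fm by simp
      show "(\<lambda>z. w z * F (p n z)) \<in> borel_measurable lborel" for n
        using wm measurable_compose[OF pm Fm] by simp
      show "AE z in lborel. (\<lambda>n. w z * F (p n z)) \<longlonglongrightarrow> w z * F z"
        by (intro AE_I2 tendsto_mult tendsto_const continuous_on_tendsto_compose[OF F plim]) auto
      show "AE z in lborel. norm (w z * F (p n z)) \<le> (C * D) * exp (- 1 * rho t s z)" for n
        using dom[OF C le[of "p n _"] norm_ge_zero R] by (auto simp: norm_mult)
    qed
  qed
  have Glim: "(\<lambda>n. Gn n y) \<longlonglongrightarrow> G y" for y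
  proof -
    obtain R M where RM: "R > 0" "M \<ge> 0" "\<And>z. GSB t s 1 1 (a z) (M * exp (R * rho t s z))"
      using GS_family_bound[OF a zero_less_one zero_less_one] by blast
    have "norm (a z y) \<le> M * exp (R * rho t s z)" for z
      using GSB_global_bound[OF RM(3), where \<beta> = "\<lambda>_. 0" and y = y] by (simp add: mi_size_def mi_fact_def)
    from lim[OF GS_family_continuous[OF a] RM(1) this] show ?thesis by (simp add: Gn_def G_def)
  qed
  show "G \<in> GS t s"
    by (rule bfun_tendsto(1)[OF t bfun_pairing[OF t aG[of 0]] GnG bdd Glim])
  show "u G = (LINT z|lborel. w z * u (a z))" if u: "bfun t s u"
  proof -
    have "(\<lambda>n. u (Gn n)) \<longlonglongrightarrow> u G" by (rule bfun_tendsto(2)[OF t u GnG bdd Glim])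
    moreover have "u (Gn n) = (LINT z|lborel. w z * u (a (p n z)))" for n
      unfolding Gn fin[of "\<lambda>q. u (a q)"] by (rule bfun_sum[OF t u aG aG[of 0]])
    moreover obtain R D where "R > 0" "D \<ge> 0" "\<And>z. norm (u (a z)) \<le> D * exp (R * rho t s z)"
      using bfun_family_bound[OF t s u a] by blast
    moreover from lim[OF bfun_family_continuous[OF t s u a] this(1,3)]
    have "(\<lambda>n. LINT z|lborel. w z * u (a (p n z))) \<longlonglongrightarrow> (LINT z|lborel. w z * u (a z))" .
    ultimately show ?thesis using LIMSEQ_unique by simp
  qed
  show "GSB t s r h G (C * M * I)"
    if "r > 0" "h > 0" "R > 0" "\<And>z. GSB t s r h (a z) (M * exp (R * rho t s z))"
      "\<And>z. norm (w z) \<le> C * exp (- (\<kappa> * R + 1) * rho t s z)"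
    using GSB_limit(2)[OF t GS_C_infinity[OF GnG] _ _ GnB[OF that] Glim] that(1,2) by simp
qed

section \<open>Frames of atoms and operators\<close>

text \<open>
  The two properties of time-frequency atoms on which everything else rests: the coefficients of
  test functions decay faster than any power of \<open>exp (- rho)\<close>, uniformly in terms of a seminorm, and
  every test function is the superposition of atoms with these coefficients. They are stated for an
  abstract family because they are used for the atoms and for their conjugates; the latter expand the
  functions that a functional, being linear and not conjugate linear, is applied to.
\<close>

definition gframe :: "real \<Rightarrow> real \<Rightarrow> real \<Rightarrow> ('a::euclidean_space \<times> 'a \<Rightarrow> 'a \<Rightarrow> complex) \<Rightarrow> bool" where
  "gframe t s c a \<longleftrightarrow> GS_family t s a \<and>
     (\<forall>r>0. \<exists>h>0. \<exists>C\<ge>0. \<forall>\<phi>\<in>GS t s. \<forall>z.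
        norm (LINT y|lborel. \<phi> y * cnj (a z y)) \<le> C * GS_norm t s h \<phi> * exp (- r * rho t s z)) \<and>
     (\<forall>\<phi>\<in>GS t s. \<forall>y. \<phi> y = (LINT z|lborel. of_real c * (LINT v|lborel. \<phi> v * cnj (a z v)) * a z y))"

lemma gframe_family: "gframe t s c a \<Longrightarrow> GS_family t s a"
  by (simp add: gframe_def)

lemma gframe_decay: "gframe t s c a \<Longrightarrow> r > 0 \<Longrightarrow> \<exists>h>0. \<exists>C\<ge>0. \<forall>\<phi>\<in>GS t s. \<forall>z.
    norm (LINT y|lborel. \<phi> y * cnj (a z y)) \<le> C * GS_norm t s h \<phi> * exp (- r * rho t s z)"
  unfolding gframe_def by blast

lemma gframe_inversion:
  assumes "gframe t s c a" "\<phi> \<in> GS t s"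
  shows "\<phi> = (\<lambda>y. LINT z|lborel. of_real c * (LINT v|lborel. \<phi> v * cnj (a z v)) * a z y)"
  using assms unfolding gframe_def fun_eq_iff by blast

lemma gframe_atom:
  fixes \<psi> :: "'a::euclidean_space \<Rightarrow> complex"
  assumes t: "t > 0" and s: "s > 0" and \<psi>: "\<psi> \<in> GS t s" and nz: "\<psi> \<noteq> (\<lambda>x. 0)"
  shows "\<exists>c. gframe t s c (atom \<psi>)"
proof -
  define k where "k = (2 * pi) ^ DIM('a) * (LINT v|lborel. (norm (\<psi> v))\<^sup>2)"
  have k: "k > 0" using GS_square_integral_pos[OF t \<psi> nz] by (simp add: k_def)
  have "\<phi> y = (LINT z|lborel. of_real (1 / k) * (LINT v|lborel. \<phi> v * cnj (atom \<psi> z v)) * atom \<psi> z y)"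
    if "\<phi> \<in> GS t s" for \<phi> y
  proof -
    have "(LINT z|lborel. of_real (1 / k) * (LINT v|lborel. \<phi> v * cnj (atom \<psi> z v)) * atom \<psi> z y)
      = of_real (1 / k) * (of_real k * \<phi> y)"
      unfolding mult.assoc[of "of_real (1 / k)"] integral_mult_right_zero
        atom_inversion[OF t s \<psi> that] k_def[symmetric] ..
    then show ?thesis using k by simp
  qed
  then have "gframe t s (1 / k) (atom \<psi>)"
    unfolding gframe_def using GS_family_atom[OF t s \<psi>] atom_decay[OF t s \<psi>] by blast
  then show ?thesis ..
qed

lemma gframe_cnj:
  fixes a :: "'a::euclidean_space \<times> 'a \<Rightarrow> 'a \<Rightarrow> complex"
  assumes "gframe t s c a" shows "gframe t s c (\<lambda>z y. cnj (a z y))"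
  unfolding gframe_def
proof (intro conjI allI impI ballI)
  have eq: "(LINT y|lborel. \<phi> y * cnj (cnj (a z y))) = cnj (LINT y|lborel. cnj (\<phi> y) * cnj (a z y))" for \<phi> z
  proof -
    have "(LINT y|lborel. \<phi> y * cnj (cnj (a z y))) = (LINT y|lborel. cnj (cnj (\<phi> y) * cnj (a z y)))"
      by (simp only: complex_cnj_mult complex_cnj_cnj)
    also have "\<dots> = cnj (LINT y|lborel. cnj (\<phi> y) * cnj (a z y))" by (rule Bochner_Integration.integral_cnj)
    finally show ?thesis .
  qed
  show "GS_family t s (\<lambda>z y. cnj (a z y))" by (rule GS_family_cnj[OF gframe_family[OF assms]])
  show "\<exists>h>0. \<exists>C\<ge>0. \<forall>\<phi>\<in>GS t s. \<forall>z. norm (LINT y|lborel. \<phi> y * cnj (cnj (a z y)))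
      \<le> C * GS_norm t s h \<phi> * exp (- r * rho t s z)" if r: "r > 0" for r
  proof -
    obtain h C where h: "h > 0" "C \<ge> 0" and le: "\<forall>\<phi>\<in>GS t s. \<forall>z.
        norm (LINT y|lborel. \<phi> y * cnj (a z y)) \<le> C * GS_norm t s h \<phi> * exp (- r * rho t s z)"
      using gframe_decay[OF assms r] by blast
    have "norm (LINT y|lborel. \<phi> y * cnj (cnj (a z y))) \<le> C * GS_norm t s h \<phi> * exp (- r * rho t s z)"
      if "\<phi> \<in> GS t s" for \<phi> z
      using le[rule_format, OF GS_cnj[OF that], of z] unfolding eq complex_mod_cnj GS_norm_cnj[OF that] .
    with h show ?thesis by blast
  qed
  fix \<phi> :: "'a \<Rightarrow> complex" and y assume \<phi>: "\<phi> \<in> GS t s"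
  have "cnj (\<phi> y) = (LINT z|lborel. of_real c * (LINT v|lborel. cnj (\<phi> v) * cnj (a z v)) * a z y)"
    using fun_cong[OF gframe_inversion[OF assms GS_cnj[OF \<phi>]], of y] .
  then have "cnj (cnj (\<phi> y)) = cnj (LINT z|lborel. of_real c * (LINT v|lborel. cnj (\<phi> v) * cnj (a z v)) * a z y)"
    by (rule arg_cong)
  also have "\<dots> = (LINT z|lborel. cnj (of_real c * (LINT v|lborel. cnj (\<phi> v) * cnj (a z v)) * a z y))"
    by (rule Bochner_Integration.integral_cnj[symmetric])
  also have "\<dots> = (LINT z|lborel. of_real c * (LINT v|lborel. \<phi> v * cnj (cnj (a z v))) * cnj (a z y))"
    unfolding eq by (simp only: complex_cnj_mult complex_cnj_complex_of_real)
  finally show "\<phi> y = (LINT z|lborel. of_real c * (LINT v|lborel. \<phi> v * cnj (cnj (a z v))) * cnj (a z y))"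
    by simp
qed

text \<open>The coefficients of a test function qualify as weights in the lemma \<open>synthesis\<close>.\<close>

lemma gframe_weight:
  assumes t: "t > 0" and s: "s > 0" and a: "gframe t s c a" and \<phi>: "\<phi> \<in> GS t s"
  defines "w \<equiv> \<lambda>z. of_real c * (LINT v|lborel. \<phi> v * cnj (a z v))"
  shows "w \<in> borel_measurable borel" and "r > 0 \<Longrightarrow> \<exists>C. \<forall>z. norm (w z) \<le> C * exp (- r * rho t s z)"
proof -
  have "continuous_on UNIV (\<lambda>z. LINT v|lborel. \<phi> v * cnj (a z v))"
    by (rule bfun_family_continuous[OF t s bfun_pairing[OF t \<phi>] GS_family_cnj[OF gframe_family[OF a]]])
  then show "w \<in> borel_measurable borel"
    unfolding w_def by (intro borel_measurable_continuous_onI continuous_on_mult continuous_on_const)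
  assume "r > 0"
  from gframe_decay[OF a this] obtain h C where le: "\<forall>\<phi>\<in>GS t s. \<forall>z.
      norm (LINT y|lborel. \<phi> y * cnj (a z y)) \<le> C * GS_norm t s h \<phi> * exp (- r * rho t s z)"
    by blast
  have "norm (w z) \<le> \<bar>c\<bar> * (C * GS_norm t s h \<phi>) * exp (- r * rho t s z)" for z
    using mult_left_mono[OF le[rule_format, OF \<phi>, of z], of "\<bar>c\<bar>"]
    by (simp add: w_def norm_mult mult_ac)
  then show "\<exists>C. \<forall>z. norm (w z) \<le> C * exp (- r * rho t s z)" by blast
qed

lemma bfun_gframe_expand:
  assumes t: "t > 0" and s: "s > 0" and a: "gframe t s c a" and \<phi>: "\<phi> \<in> GS t s" and u: "bfun t s u"
  shows "u \<phi> = (LINT z|lborel. of_real c * (LINT v|lborel. \<phi> v * cnj (a z v)) * u (a z))"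
  using synthesis(2)[OF t s gframe_family[OF a] gframe_weight[OF t s a \<phi>] u]
  unfolding gframe_inversion[OF a \<phi>, symmetric] .

text \<open>
  An operator given by a bilinear form \<open>L\<close> is \<open>f \<mapsto> \<integral> L (cnj (a z)) f \<cdot> a z dz\<close>. If the matrix
  \<open>L (cnj (a z)) (a w)\<close> is small where \<open>w\<close> is small compared to \<open>z\<close>, then the coefficients
  \<open>L (cnj (a z)) f\<close> decay for every test function \<open>f\<close>: elsewhere the decay of the coefficients of \<open>f\<close>
  at \<open>w\<close> pays for the decay in \<open>z\<close>.
\<close>

lemma gframe_operator:
  fixes a :: "'a::euclidean_space \<times> 'a \<Rightarrow> 'a \<Rightarrow> complex"
  assumes t: "t > 0" and s: "s > 0" and a: "gframe t s c a"
    and L1: "\<And>f. f \<in> GS t s \<Longrightarrow> bfun t s (\<lambda>\<phi>. L \<phi> f)"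
    and L2: "\<And>\<phi>. \<phi> \<in> GS t s \<Longrightarrow> bfun t s (L \<phi>)"
    and growth: "\<exists>R C. \<forall>z w. norm (L (\<lambda>y. cnj (a z y)) (a w)) \<le> C * exp (R * (rho t s z + rho t s w))"
    and decay: "\<exists>\<epsilon>>0. \<forall>r>0. \<exists>C. \<forall>z w. rho t s w \<le> \<epsilon> * rho t s z \<longrightarrow>
      norm (L (\<lambda>y. cnj (a z y)) (a w)) \<le> C * exp (- r * rho t s z)"
  defines "T \<equiv> \<lambda>f y. LINT z|lborel. of_real c * L (\<lambda>y. cnj (a z y)) f * a z y"
  shows "f \<in> GS t s \<Longrightarrow> T f \<in> GS t s"
    and "f \<in> GS t s \<Longrightarrow> g \<in> GS t s \<Longrightarrow> T (\<lambda>x. \<alpha> * f x + \<beta> * g x) = (\<lambda>y. \<alpha> * T f y + \<beta> * T g y)"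
    and "h > 0 \<Longrightarrow> \<exists>h'>0. \<exists>C. \<forall>f\<in>GS t s. GS_norm t s h (T f) \<le> C * GS_norm t s h' f"
    and "f \<in> GS t s \<Longrightarrow> \<phi> \<in> GS t s \<Longrightarrow> (LINT y|lborel. T f y * \<phi> y) = L \<phi> f"
    and "f \<in> GS t s \<Longrightarrow> bfun t s u \<Longrightarrow> u (T f) = (LINT z|lborel. of_real c * L (\<lambda>y. cnj (a z y)) f * u (a z))"
proof -
  let ?a = "\<lambda>z y. cnj (a z y)"
  have fam: "GS_family t s a" "GS_family t s ?a"
    using gframe_family[OF a] GS_family_cnj by auto
  have aG: "a z \<in> GS t s" "?a z \<in> GS t s" for z
    by (rule GS_family_GS[OF fam(1)], rule GS_family_GS[OF fam(2)])
  define I where "I = (LINT z::'a \<times> 'a|lborel. exp (- 1 * rho t s z))"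
  have I: "I \<ge> 0" unfolding I_def by (intro integral_nonneg_AE) auto
  \<comment> \<open>Decay in \<open>z\<close> at the cost of growth in \<open>w\<close>. Outside the cone, \<open>rho z\<close> is at most \<open>rho w / \<epsilon>\<close>, so that
    a factor \<open>exp (- r rho z)\<close> may be introduced and paid for by growth in \<open>w\<close>.\<close>
  have matrix: "\<exists>R C. R > 0 \<and> C \<ge> 0 \<and> (\<forall>z w. norm (L (?a z) (a w)) \<le> C * (exp (- r * rho t s z) * exp (R * rho t s w)))"
    if r: "r > 0" for r
  proof -
    obtain R0 C0 where 0: "\<And>z w. norm (L (?a z) (a w)) \<le> C0 * exp (R0 * (rho t s z + rho t s w))"
      using growth by blast
    obtain \<epsilon> C1 where e: "\<epsilon> > 0" and 1: "\<And>z w. rho t s w \<le> \<epsilon> * rho t s z \<Longrightarrow>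
        norm (L (?a z) (a w)) \<le> C1 * exp (- r * rho t s z)"
      using decay r by blast
    define R where "R = \<bar>R0\<bar> + (\<bar>R0\<bar> + r) / \<epsilon>"
    have R: "R > 0" using e r by (simp add: R_def add_nonneg_pos add_pos_nonneg)
    have "norm (L (?a z) (a w)) \<le> (\<bar>C0\<bar> + \<bar>C1\<bar>) * (exp (- r * rho t s z) * exp (R * rho t s w))" for z w
    proof (cases "rho t s w \<le> \<epsilon> * rho t s z")
      case True
      have "norm (L (?a z) (a w)) \<le> C1 * (exp (- r * rho t s z) * 1)" using 1[OF True] by simp
      also have "\<dots> \<le> (\<bar>C0\<bar> + \<bar>C1\<bar>) * (exp (- r * rho t s z) * exp (R * rho t s w))"
        using R by (intro mult_mono) auto
      finally show ?thesis .
    next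
      case False
      have "(\<bar>R0\<bar> + r) * rho t s z \<le> (\<bar>R0\<bar> + r) * (rho t s w / \<epsilon>)"
        using False e r by (intro mult_left_mono) (auto simp: field_simps)
      moreover have "R0 * (rho t s z + rho t s w) \<le> \<bar>R0\<bar> * (rho t s z + rho t s w)"
        by (intro mult_right_mono) auto
      ultimately have le: "R0 * (rho t s z + rho t s w) \<le> - r * rho t s z + R * rho t s w"
        by (simp add: R_def algebra_simps)
      have "norm (L (?a z) (a w)) \<le> C0 * exp (R0 * (rho t s z + rho t s w))" by (rule 0)
      also have "\<dots> \<le> (\<bar>C0\<bar> + \<bar>C1\<bar>) * exp (- r * rho t s z + R * rho t s w)"
        using le by (intro mult_mono) auto
      finally show ?thesis by (simp only: exp_add)
    qed
    moreover have "\<bar>C0\<bar> + \<bar>C1\<bar> \<ge> 0" by simp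
    ultimately show ?thesis using R by blast
  qed
  define w where "w f z = of_real c * L (?a z) f" for f z
  have wm: "w f \<in> borel_measurable borel" if f: "f \<in> GS t s" for f
    unfolding w_def
    by (intro borel_measurable_continuous_onI continuous_on_mult continuous_on_const
        bfun_family_continuous[OF t s L1[OF f] fam(2)])
  have wB: "\<exists>h>0. \<exists>C\<ge>0. \<forall>f\<in>GS t s. \<forall>z. norm (w f z) \<le> C * GS_norm t s h f * exp (- r * rho t s z)"
    if r: "r > 0" for r
  proof -
    obtain R C where R: "R > 0" "C \<ge> 0" and le: "\<And>z w. norm (L (?a z) (a w)) \<le> C * (exp (- r * rho t s z) * exp (R * rho t s w))"
      using matrix[OF r] by blast
    have "R + 1 > 0" using R by simp
    from gframe_decay[OF a this] obtain h D where h: "h > 0" "D \<ge> 0" and le2: "\<forall>\<phi>\<in>GS t s. \<forall>z.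
      norm (LINT y|lborel. \<phi> y * cnj (a z y)) \<le> D * GS_norm t s h \<phi> * exp (- (R + 1) * rho t s z)"
      by blast
    have "norm (w f z) \<le> (\<bar>c\<bar> * \<bar>c\<bar> * D * C * I) * GS_norm t s h f * exp (- r * rho t s z)"
      if f: "f \<in> GS t s" for f z
    proof -
      let ?n = "\<bar>c\<bar> * D * GS_norm t s h f * C * exp (- r * rho t s z)"
      have n: "GS_norm t s h f \<ge> 0" by (rule GS_norm_nonneg[OF GS_banach[OF f h(1)] h(1)])
      have "L (?a z) f = (LINT v|lborel. of_real c * (LINT y|lborel. f y * cnj (a v y)) * L (?a z) (a v))"
        by (rule bfun_gframe_expand[OF t s a f L2[OF aG(2)]])
      also have "norm \<dots> \<le> (LINT v::'a \<times> 'a|lborel. ?n * exp (- 1 * rho t s v))"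
      proof (intro integral_norm_le integrable_mult_right integrable_exp_rho t s zero_less_one)
        fix v
        have "norm (LINT y|lborel. f y * cnj (a v y)) * norm (L (?a z) (a v))
          \<le> (D * GS_norm t s h f * exp (- (R + 1) * rho t s v)) * (C * (exp (- r * rho t s z) * exp (R * rho t s v)))"
          using h n by (intro mult_mono le le2[rule_format, OF f]) auto
        also have "\<dots> = D * GS_norm t s h f * C * exp (- r * rho t s z) * (exp (- (R + 1) * rho t s v) * exp (R * rho t s v))"
          by (simp add: mult_ac)
        also have "exp (- (R + 1) * rho t s v) * exp (R * rho t s v) = exp (- 1 * rho t s v)"
          unfolding exp_add[symmetric] by (simp add: algebra_simps)
        finally have "\<bar>c\<bar> * (norm (LINT y|lborel. f y * cnj (a v y)) * norm (L (?a z) (a v)))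
          \<le> \<bar>c\<bar> * (D * GS_norm t s h f * C * exp (- r * rho t s z) * exp (- 1 * rho t s v))"
          by (rule mult_left_mono) simp
        then show "norm (of_real c * (LINT y|lborel. f y * cnj (a v y)) * L (?a z) (a v)) \<le> ?n * exp (- 1 * rho t s v)"
          by (simp add: norm_mult mult_ac)
      qed
      also have "\<dots> = ?n * I" by (simp add: I_def)
      finally have "\<bar>c\<bar> * norm (L (?a z) f) \<le> \<bar>c\<bar> * (?n * I)" by (rule mult_left_mono) simp
      then show ?thesis by (simp add: w_def norm_mult mult_ac)
    qed
    moreover have "\<bar>c\<bar> * \<bar>c\<bar> * D * C * I \<ge> 0" using h R I by simp
    ultimately show ?thesis using h(1) by blast
  qed
  have wD: "\<exists>C. \<forall>z. norm (w f z) \<le> C * exp (- r * rho t s z)" if f: "f \<in> GS t s" and r: "r > 0" for f r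
    using wB[OF r] f by blast
  have T: "T f = (\<lambda>y. LINT z|lborel. w f z * a z y)" for f by (simp add: T_def w_def)
  show TG: "T f \<in> GS t s" if f: "f \<in> GS t s" for f
    unfolding T by (rule synthesis(1)[OF t s fam(1) wm[OF f] wD[OF f]])
  show Tu: "u (T f) = (LINT z|lborel. of_real c * L (?a z) f * u (a z))" if f: "f \<in> GS t s" and u: "bfun t s u" for u f
    using synthesis(2)[OF t s fam(1) wm[OF f] wD[OF f] u] unfolding T by (simp add: w_def)
  show "T (\<lambda>x. \<alpha> * f x + \<beta> * g x) = (\<lambda>y. \<alpha> * T f y + \<beta> * T g y)" if f: "f \<in> GS t s" and g: "g \<in> GS t s"
  proof
    fix y
    have int: "integrable lborel (\<lambda>z. w f z * a z y)" if f: "f \<in> GS t s" for f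
    proof -
      obtain R M where RM: "R > 0" "M \<ge> 0" "\<And>z. GSB t s 1 1 (a z) (M * exp (R * rho t s z))"
        using GS_family_bound[OF fam(1) zero_less_one zero_less_one] by blast
      have ay: "norm (a z y) \<le> M * exp (R * rho t s z)" for z
        using GSB_global_bound[OF RM(3), where \<beta> = "\<lambda>_. 0" and y = y] by (simp add: mi_size_def mi_fact_def)
      obtain C where C: "\<And>z. norm (w f z) \<le> C * exp (- (R + 1) * rho t s z)"
        using wD[OF f, of "R + 1"] RM(1) by auto
      show ?thesis
      proof (rule Bochner_Integration.integrable_bound)
        show "integrable lborel (\<lambda>z::'a \<times> 'a. (C * M) * exp (- 1 * rho t s z))"
          by (intro integrable_mult_right integrable_exp_rho t s zero_less_one)
        show "(\<lambda>z. w f z * a z y) \<in> borel_measurable lborel"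
          using wm[OF f] borel_measurable_continuous_onI[OF GS_family_continuous[OF fam(1), of y]] by simp
        show "AE z in lborel. norm (w f z * a z y) \<le> norm ((C * M) * exp (- 1 * rho t s z))"
        proof (rule AE_I2)
          fix z
          have "norm (w f z) * norm (a z y) \<le> (C * exp (- (R + 1) * rho t s z)) * (M * exp (R * rho t s z))"
            by (rule mult_mono[OF C ay order_trans[OF norm_ge_zero C] norm_ge_zero])
          also have "\<dots> = (C * M) * (exp (- (R + 1) * rho t s z) * exp (R * rho t s z))" by (simp add: mult_ac)
          also have "exp (- (R + 1) * rho t s z) * exp (R * rho t s z) = exp (- 1 * rho t s z)"
            unfolding exp_add[symmetric] by (simp add: algebra_simps)
          finally show "norm (w f z * a z y) \<le> norm ((C * M) * exp (- 1 * rho t s z))"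
            unfolding norm_mult[symmetric] real_norm_def by (rule order_trans[OF _ abs_ge_self])
        qed
      qed
    qed
    have "w (\<lambda>x. \<alpha> * f x + \<beta> * g x) z * a z y = \<alpha> * (w f z * a z y) + \<beta> * (w g z * a z y)" for z
      using bfun_lincomb[OF L2[OF aG(2)[of z]] f g, of \<alpha> \<beta>] by (simp add: w_def algebra_simps)
    then show "T (\<lambda>x. \<alpha> * f x + \<beta> * g x) y = \<alpha> * T f y + \<beta> * T g y"
      unfolding T using int[OF f] int[OF g] by simp
  qed
  show "\<exists>h'>0. \<exists>C. \<forall>f\<in>GS t s. GS_norm t s h (T f) \<le> C * GS_norm t s h' f" if h: "h > 0"
  proof -
    let ?r = "t * DIM('a) * h powr (- (1 / t))"
    let ?\<kappa> = "(2::real) powr (1 / t) + 2 powr (1 / s)"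
    have r: "?r > 0" using t h by simp
    obtain R M where RM: "R > 0" "M \<ge> 0" "\<And>z. GSB t s ?r h (a z) (M * exp (R * rho t s z))"
      using GS_family_bound[OF fam(1) r h] by blast
    have "?\<kappa> * R + 1 > 0" using RM(1) by (simp add: add_pos_pos)
    from wB[OF this] obtain h' C where h': "h' > 0" "C \<ge> 0"
      and le: "\<forall>f\<in>GS t s. \<forall>z. norm (w f z) \<le> C * GS_norm t s h' f * exp (- (?\<kappa> * R + 1) * rho t s z)"
      by blast
    have "GS_norm t s h (T f) \<le> (C * M * I) * GS_norm t s h' f" if f: "f \<in> GS t s" for f
    proof -
      have "GSB t s ?r h (T f) (C * GS_norm t s h' f * M * I)"
        unfolding T I_def using le f
        by (intro synthesis(3)[OF t s fam(1) wm[OF f] wD[OF f] r h RM(1,3)]) auto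
      from GSB_imp_norm(2)[OF t h GS_C_infinity[OF TG[OF f]] this] show ?thesis by (simp add: mult_ac)
    qed
    with h'(1) show ?thesis by blast
  qed
  \<comment> \<open>Expanding \<open>\<phi>\<close> in the conjugate frame produces the same integral as pairing \<open>T f\<close> with \<open>\<phi>\<close>.\<close>
  show "(LINT y|lborel. T f y * \<phi> y) = L \<phi> f" if f: "f \<in> GS t s" and \<phi>: "\<phi> \<in> GS t s"
  proof -
    have "(LINT y|lborel. T f y * \<phi> y) = (LINT y|lborel. \<phi> y * T f y)" by (simp add: mult.commute)
    also have "\<dots> = (LINT z|lborel. of_real c * L (?a z) f * (LINT y|lborel. \<phi> y * a z y))"
      by (rule Tu[OF f bfun_pairing[OF t \<phi>]])
    also have "\<dots> = (LINT z|lborel. of_real c * (LINT v|lborel. \<phi> v * cnj (?a z v)) * L (?a z) f)"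
      by (simp add: mult_ac)
    also have "\<dots> = L \<phi> f"
      by (rule bfun_gframe_expand[OF t s gframe_cnj[OF a] \<phi> L1[OF f], symmetric])
    finally show ?thesis .
  qed
qed

section \<open>Anisotropic cones in phase space\<close>

definition dil :: "real \<Rightarrow> real \<Rightarrow> real \<Rightarrow> 'a::real_normed_vector \<times> 'a \<Rightarrow> 'a \<times> 'a" where
  "dil t s \<mu> z = ((\<mu> powr t) *\<^sub>R fst z, (\<mu> powr s) *\<^sub>R snd z)"

lemma dil_dil: "\<mu> > 0 \<Longrightarrow> \<nu> > 0 \<Longrightarrow> dil t s \<mu> (dil t s \<nu> z) = dil t s (\<mu> * \<nu>) z"
  by (simp add: dil_def powr_mult)

lemma dil_1 [simp]: "dil t s 1 z = z"
  by (simp add: dil_def)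

lemma dil_add: "dil t s \<mu> (z + w) = dil t s \<mu> z + dil t s \<mu> w"
  by (simp add: dil_def scaleR_add_right)

lemma rho_dil:
  assumes "t > 0" "s > 0" "\<mu> > 0"
  shows "rho t s (dil t s \<mu> z) = \<mu> * rho t s z"
  using assms by (simp add: rho_def dil_def powr_mult powr_powr algebra_simps)

lemma rho_zero_iff: "rho t s z = 0 \<longleftrightarrow> z = 0"
  by (auto simp: rho_def prod_eq_iff add_nonneg_eq_0_iff)

lemma continuous_on_rho:
  assumes "t > 0" "s > 0" shows "continuous_on UNIV (rho t s)"
proof -
  have "continuous_on UNIV (\<lambda>z. norm (fst z :: 'a) powr (1 / t) + norm (snd z :: 'a) powr (1 / s))"
    using assms by (intro continuous_on_add continuous_on_powr' continuous_intros) auto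
  then show ?thesis by (simp add: rho_def[abs_def])
qed

lemma norm_le_rho:
  fixes z :: "'a::euclidean_space \<times> 'a"
  assumes t: "t > 0" and s: "s > 0"
  shows "norm z \<le> rho t s z powr t + rho t s z powr s"
proof -
  have "norm z \<le> norm (fst z) + norm (snd z)" using norm_Pair_le[of "fst z" "snd z"] by simp
  also have "norm (fst z) = (norm (fst z) powr (1 / t)) powr t" using t by (simp add: powr_powr)
  also have "norm (snd z) = (norm (snd z) powr (1 / s)) powr s" using s by (simp add: powr_powr)
  also have "(norm (fst z) powr (1 / t)) powr t + (norm (snd z) powr (1 / s)) powr s
      \<le> rho t s z powr t + rho t s z powr s"
    using t s by (intro add_mono powr_mono2) (auto simp: rho_def)
  finally show ?thesis .
qed

lemma compact_rho_sets:
  fixes M :: real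
  assumes t: "t > 0" and s: "s > 0"
  shows "compact {z :: 'a::euclidean_space \<times> 'a. rho t s z \<le> M}" "compact {z :: 'a \<times> 'a. rho t s z = 1}"
proof -
  have bd: "bounded {z :: 'a \<times> 'a. rho t s z \<le> M}" for M
    unfolding bounded_iff
  proof (intro exI[of _ "M powr t + M powr s"] ballI)
    fix z :: "'a \<times> 'a" assume "z \<in> {z. rho t s z \<le> M}"
    then have "rho t s z powr t + rho t s z powr s \<le> M powr t + M powr s"
      using t s by (intro add_mono powr_mono2) auto
    with norm_le_rho[OF t s, of z] show "norm z \<le> M powr t + M powr s" by linarith
  qed
  have c: "continuous_on UNIV (rho t s :: 'a \<times> 'a \<Rightarrow> real)" by (rule continuous_on_rho[OF t s])
  have "closed {z :: 'a \<times> 'a. rho t s z \<le> M}" by (rule closed_Collect_le[OF c continuous_on_const])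
  with bd show "compact {z :: 'a \<times> 'a. rho t s z \<le> M}" by (simp add: compact_eq_bounded_closed)
  have "closed {z :: 'a \<times> 'a. rho t s z = 1}" by (rule closed_Collect_eq[OF c continuous_on_const])
  moreover have "bounded {z :: 'a \<times> 'a. rho t s z = 1}"
    by (rule bounded_subset[OF bd[of 1]]) auto
  ultimately show "compact {z :: 'a \<times> 'a. rho t s z = 1}" by (simp add: compact_eq_bounded_closed)
qed

lemma rho_small:
  fixes \<delta> :: real
  assumes t: "t > 0" and s: "s > 0" and d: "\<delta> > 0"
  shows "\<exists>\<epsilon>>0. \<forall>z :: 'a::euclidean_space \<times> 'a. rho t s z < \<epsilon> \<longrightarrow> norm z < \<delta>"
proof (intro exI[of _ "min ((\<delta> / 2) powr (1 / t)) ((\<delta> / 2) powr (1 / s))"] conjI allI impI)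
  fix z :: "'a \<times> 'a" assume z: "rho t s z < min ((\<delta> / 2) powr (1 / t)) ((\<delta> / 2) powr (1 / s))"
  have "rho t s z powr t < ((\<delta> / 2) powr (1 / t)) powr t" "rho t s z powr s < ((\<delta> / 2) powr (1 / s)) powr s"
    using z t s by (auto intro!: powr_less_mono2)
  then have "rho t s z powr t + rho t s z powr s < \<delta>"
    using t s d by (simp add: powr_powr)
  with norm_le_rho[OF t s, of z] show "norm z < \<delta>" by linarith
qed (use d in auto)

lemma rho_bounded_ball:
  fixes z0 :: "'a::euclidean_space \<times> 'a"
  assumes "t > 0" "s > 0"
  shows "\<exists>M>0. \<forall>z\<in>ball z0 \<delta>. rho t s z \<le> M"
proof -
  let ?B = "norm z0 + \<bar>\<delta>\<bar>"
  have "rho t s z \<le> ?B powr (1 / t) + ?B powr (1 / s) + 1" if "z \<in> ball z0 \<delta>" for z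
  proof -
    have "norm (z - z0) < \<delta>" using that by (simp add: dist_norm norm_minus_commute)
    then have "norm z \<le> ?B" using norm_triangle_sub[of z z0] by linarith
    then show ?thesis using rho_le_norm[OF assms, of z ?B] by linarith
  qed
  moreover have "?B powr (1 / t) + ?B powr (1 / s) + 1 > 0" by (intro add_nonneg_pos add_nonneg_nonneg) auto
  ultimately show ?thesis by blast
qed

text \<open>
  This is the condition in the definition of the wave front set, for an arbitrary function on phase
  space. The set \<open>U\<close> may contain \<open>0\<close>; near \<open>0\<close> the condition means rapid decay in all directions.
\<close>

definition rapid :: "real \<Rightarrow> real \<Rightarrow> ('a::real_normed_vector \<times> 'a \<Rightarrow> complex) \<Rightarrow> ('a \<times> 'a) set \<Rightarrow> bool" where
  "rapid t s V U \<longleftrightarrow> (\<forall>r>0. \<exists>C. \<forall>\<mu>>0. \<forall>z\<in>U. norm (V (dil t s \<mu> z)) \<le> C * exp (- r * \<mu>))"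

definition regular_at :: "real \<Rightarrow> real \<Rightarrow> ('a::real_normed_vector \<times> 'a \<Rightarrow> complex) \<Rightarrow> 'a \<times> 'a \<Rightarrow> bool" where
  "regular_at t s V z \<longleftrightarrow> (\<exists>U. open U \<and> z \<in> U \<and> rapid t s V U)"

lemma rapid_subset: "rapid t s V U \<Longrightarrow> U' \<subseteq> U \<Longrightarrow> rapid t s V U'"
  unfolding rapid_def by (meson subsetD)

lemma rapid_Union:
  assumes "finite \<U>" "\<And>U. U \<in> \<U> \<Longrightarrow> rapid t s V U"
  shows "rapid t s V (\<Union>\<U>)"
  unfolding rapid_def
proof (intro allI impI)
  fix r :: real assume "r > 0"
  then have "\<forall>U\<in>\<U>. \<exists>C. \<forall>\<mu>>0. \<forall>z\<in>U. norm (V (dil t s \<mu> z)) \<le> C * exp (- r * \<mu>)"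
    using assms(2) unfolding rapid_def by simp
  from bchoice[OF this] obtain C where
    C: "\<forall>U\<in>\<U>. \<forall>\<mu>>0. \<forall>z\<in>U. norm (V (dil t s \<mu> z)) \<le> C U * exp (- r * \<mu>)" ..
  have "norm (V (dil t s \<mu> z)) \<le> (\<Sum>U\<in>\<U>. \<bar>C U\<bar>) * exp (- r * \<mu>)" if "\<mu> > 0" "z \<in> \<Union>\<U>" for \<mu> z
  proof -
    obtain U where U: "U \<in> \<U>" "z \<in> U" using \<open>z \<in> \<Union>\<U>\<close> by blast
    have "norm (V (dil t s \<mu> z)) \<le> C U * exp (- r * \<mu>)" using C U that(1) by simp
    also have "C U \<le> (\<Sum>U\<in>\<U>. \<bar>C U\<bar>)"
      using member_le_sum[of U \<U> "\<lambda>U. \<bar>C U\<bar>"] assms(1) U(1) by simp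
    finally show ?thesis by (simp add: mult_right_mono)
  qed
  then show "\<exists>C. \<forall>\<mu>>0. \<forall>z\<in>\<Union>\<U>. norm (V (dil t s \<mu> z)) \<le> C * exp (- r * \<mu>)" by blast
qed

text \<open>
  For a finite union the constants of the finitely many pieces can be combined.
\<close>

lemma rapid_compact:
  assumes "compact K" "\<And>z. z \<in> K \<Longrightarrow> regular_at t s V z"
  shows "\<exists>U. open U \<and> K \<subseteq> U \<and> rapid t s V U"
proof -
  let ?\<C> = "{U. open U \<and> rapid t s V U}"
  have "K \<subseteq> \<Union>?\<C>" using assms(2) unfolding regular_at_def by blast
  then obtain \<U> where \<U>: "\<U> \<subseteq> ?\<C>" "finite \<U>" "K \<subseteq> \<Union>\<U>"
    using compactE[OF assms(1), of ?\<C>] by blast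
  have "rapid t s V (\<Union>\<U>)" using \<U> by (intro rapid_Union) auto
  moreover have "open (\<Union>\<U>)" using \<U> by (intro open_Union) auto
  ultimately show ?thesis using \<U>(3) by blast
qed

lemma STFT_atom: "STFT \<psi> u (fst z) (snd z) = of_real ((2 * pi) powr (- real DIM('a) / 2)) * u (\<lambda>y. cnj (atom \<psi> z y))"
  for \<psi> :: "'a::euclidean_space \<Rightarrow> complex"
  by (simp add: STFT_def GS_pair_def atom_def)

text \<open>
  The constant factor of the transform is immaterial, and the neighbourhood may be shrunk to avoid
  the point \<open>0\<close>.
\<close>

lemma WF_iff:
  fixes \<psi> :: "'a::euclidean_space \<Rightarrow> complex"
  shows "z \<in> WF t s \<psi> u \<longleftrightarrow> z \<noteq> 0 \<and> \<not> regular_at t s (\<lambda>z. u (\<lambda>y. cnj (atom \<psi> z y))) z"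
proof -
  define k where "k = (2 * pi) powr (- real DIM('a) / 2)"
  have k: "k > 0" by (simp add: k_def)
  let ?V = "\<lambda>z. u (\<lambda>y. cnj (atom \<psi> z y))"
  have eq: "norm (STFT \<psi> u ((\<mu> powr t) *\<^sub>R x) ((\<mu> powr s) *\<^sub>R \<xi>)) = k * norm (?V (dil t s \<mu> (x, \<xi>)))" for \<mu> x \<xi>
    using STFT_atom[of \<psi> u "dil t s \<mu> (x, \<xi>)"] k by (simp add: dil_def norm_mult k_def)
  have "(\<forall>r>0. bdd_above {exp (r * \<mu>) * norm (STFT \<psi> u ((\<mu> powr t) *\<^sub>R x) ((\<mu> powr s) *\<^sub>R \<xi>)) | \<mu> x \<xi>.
      \<mu> > 0 \<and> (x, \<xi>) \<in> U}) \<longleftrightarrow> rapid t s ?V U" for U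
    unfolding rapid_def
  proof (intro iff_allI imp_cong refl)
    fix r :: real
    let ?S = "{exp (r * \<mu>) * norm (STFT \<psi> u ((\<mu> powr t) *\<^sub>R x) ((\<mu> powr s) *\<^sub>R \<xi>)) | \<mu> x \<xi>. \<mu> > 0 \<and> (x, \<xi>) \<in> U}"
    have "bdd_above ?S \<longleftrightarrow> (\<exists>C. \<forall>\<mu>>0. \<forall>z\<in>U. exp (r * \<mu>) * (k * norm (?V (dil t s \<mu> z))) \<le> C)"
      unfolding bdd_above_def eq by (intro iff_exI) fastforce
    also have "\<dots> \<longleftrightarrow> (\<exists>C. \<forall>\<mu>>0. \<forall>z\<in>U. norm (?V (dil t s \<mu> z)) \<le> C * exp (- r * \<mu>))"
    proof
      assume "\<exists>C. \<forall>\<mu>>0. \<forall>z\<in>U. exp (r * \<mu>) * (k * norm (?V (dil t s \<mu> z))) \<le> C"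
      then obtain C where "\<forall>\<mu>>0. \<forall>z\<in>U. exp (r * \<mu>) * (k * norm (?V (dil t s \<mu> z))) \<le> C" ..
      then have "\<forall>\<mu>>0. \<forall>z\<in>U. norm (?V (dil t s \<mu> z)) \<le> (C / k) * exp (- r * \<mu>)"
        using k by (simp add: exp_minus field_simps)
      then show "\<exists>C. \<forall>\<mu>>0. \<forall>z\<in>U. norm (?V (dil t s \<mu> z)) \<le> C * exp (- r * \<mu>)" ..
    next
      assume "\<exists>C. \<forall>\<mu>>0. \<forall>z\<in>U. norm (?V (dil t s \<mu> z)) \<le> C * exp (- r * \<mu>)"
      then obtain C where "\<forall>\<mu>>0. \<forall>z\<in>U. norm (?V (dil t s \<mu> z)) \<le> C * exp (- r * \<mu>)" ..
      then have "\<forall>\<mu>>0. \<forall>z\<in>U. exp (r * \<mu>) * (k * norm (?V (dil t s \<mu> z))) \<le> k * C"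
        using k by (simp add: exp_minus field_simps)
      then show "\<exists>C. \<forall>\<mu>>0. \<forall>z\<in>U. exp (r * \<mu>) * (k * norm (?V (dil t s \<mu> z))) \<le> C" ..
    qed
    finally show "bdd_above ?S \<longleftrightarrow> (\<exists>C. \<forall>\<mu>>0. \<forall>z\<in>U. norm (?V (dil t s \<mu> z)) \<le> C * exp (- r * \<mu>))" .
  qed
  then have "z \<in> WF t s \<psi> u \<longleftrightarrow> z \<noteq> 0 \<and> \<not> (\<exists>U. open U \<and> U \<subseteq> - {0} \<and> z \<in> U \<and> rapid t s ?V U)"
    unfolding WF_def by simp
  also have "\<dots> \<longleftrightarrow> z \<noteq> 0 \<and> \<not> regular_at t s ?V z"
  proof -
    have "\<exists>U. open U \<and> U \<subseteq> - {0} \<and> z \<in> U \<and> rapid t s ?V U" if "z \<noteq> 0" "open U" "z \<in> U" "rapid t s ?V U" for U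
      using that by (intro exI[of _ "U - {0}"]) (auto intro: rapid_subset)
    then show ?thesis unfolding regular_at_def by blast
  qed
  finally show ?thesis .
qed

section \<open>Independence of the window\<close>

lemma atom_covariance:
  fixes \<Phi> \<Psi> :: "'a::euclidean_space \<Rightarrow> complex"
  assumes t: "t > 0" and s: "s > 0" and \<Phi>: "\<Phi> \<in> GS t s" and \<Psi>: "\<Psi> \<in> GS t s"
  shows "norm (LINT y|lborel. cnj (atom \<Phi> z y) * atom \<Psi> w y) = norm (LINT y|lborel. \<Phi> y * cnj (atom \<Psi> (w - z) y))"
proof -
  obtain x \<xi> where z: "z = (x, \<xi>)" by (cases z)
  obtain x' \<eta> where w: "w = (x', \<eta>)" by (cases w)
  let ?f = "\<lambda>y. cnj (atom \<Phi> z y) * atom \<Psi> w y"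
  have "?f \<in> borel_measurable borel"
    by (intro borel_measurable_times GS_measurable[OF GS_cnj[OF GS_family_GS[OF GS_family_atom[OF t s \<Phi>]]]]
        GS_measurable[OF GS_family_GS[OF GS_family_atom[OF t s \<Psi>]]])
  from integral_translate[OF this, of x] have "(LINT y|lborel. ?f y) = (LINT v|lborel. ?f (x + v))" ..
  also have "\<dots> = (LINT v|lborel. plane_wave (\<eta> - \<xi>) x * cnj (\<Phi> v * cnj (atom \<Psi> (w - z) v)))"
  proof (rule Bochner_Integration.integral_cong[OF refl])
    fix v
    have "plane_wave (- \<xi>) p * plane_wave \<eta> p = plane_wave (\<eta> - \<xi>) p" for p
      by (simp add: plane_wave_def exp_add[symmetric] inner_diff_right algebra_simps)
    from this[of "x + v"]
    have "plane_wave (- \<xi>) (x + v) * plane_wave \<eta> (x + v) = plane_wave (\<eta> - \<xi>) x * plane_wave (\<eta> - \<xi>) v"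
      by (simp only: plane_wave_add[of "\<eta> - \<xi>"])
    moreover have "x + v - x' = v - (x' - x)" by simp
    moreover have "?f (x + v) = (plane_wave (- \<xi>) (x + v) * plane_wave \<eta> (x + v)) * (cnj (\<Phi> v) * \<Psi> (x + v - x'))"
      by (simp add: atom_eq z w cnj_plane_wave mult_ac)
    ultimately have "?f (x + v) = (plane_wave (\<eta> - \<xi>) x * plane_wave (\<eta> - \<xi>) v) * (cnj (\<Phi> v) * \<Psi> (v - (x' - x)))"
      by (simp only:)
    then show "?f (x + v) = plane_wave (\<eta> - \<xi>) x * cnj (\<Phi> v * cnj (atom \<Psi> (w - z) v))"
      unfolding atom_eq z w by (simp add: mult_ac)
  qed
  also have "\<dots> = plane_wave (\<eta> - \<xi>) x * cnj (LINT v|lborel. \<Phi> v * cnj (atom \<Psi> (w - z) v))"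
    unfolding integral_mult_right_zero Bochner_Integration.integral_cnj ..
  finally show ?thesis by (simp add: norm_mult)
qed

lemma exp_rho_translate:
  fixes z :: "'a::euclidean_space \<times> 'a"
  assumes "t > 0" "s > 0"
  shows "integrable lborel (\<lambda>w. exp (- 1 * rho t s (w - z)))"
    and "(LINT w|lborel. exp (- 1 * rho t s (w - z))) = (LINT w::'a \<times> 'a|lborel. exp (- 1 * rho t s w))"
proof -
  let ?f = "\<lambda>w::'a \<times> 'a. exp (- 1 * rho t s w)"
  have [measurable]: "?f \<in> borel_measurable borel" by measurable
  have d: "distr lborel borel ((+) (- z)) = (lborel :: ('a \<times> 'a) measure)" by (rule lborel_distr_plus)
  have "integrable (distr lborel borel ((+) (- z))) ?f" unfolding d by (rule integrable_exp_rho[OF assms zero_less_one])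
  then have "integrable lborel (\<lambda>w. ?f (- z + w))" by (subst (asm) integrable_distr_eq) auto
  then show "integrable lborel (\<lambda>w. exp (- 1 * rho t s (w - z)))" by simp
  have "(LINT w|lborel. ?f w) = (LINT w|distr lborel borel ((+) (- z)). ?f w)" unfolding d ..
  also have "\<dots> = (LINT w|lborel. ?f (- z + w))" by (rule integral_distr) auto
  finally show "(LINT w|lborel. exp (- 1 * rho t s (w - z))) = (LINT w|lborel. ?f w)" by simp
qed

text \<open>
  The coefficients with respect to one window are obtained from those with respect to another by a
  kernel that decays in \<open>w - z\<close>. After anisotropic scaling only points \<open>w\<close> near \<open>z\<close> matter.
\<close>

lemma regular_at_window:
  fixes \<Phi> \<Psi> :: "'a::euclidean_space \<Rightarrow> complex"
  assumes t: "t > 0" and s: "s > 0" and \<Phi>: "\<Phi> \<in> GS t s" and \<Psi>: "\<Psi> \<in> GS t s" and nz: "\<Psi> \<noteq> (\<lambda>x. 0)"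
    and u: "bfun t s u" and reg: "regular_at t s (\<lambda>z. u (\<lambda>y. cnj (atom \<Psi> z y))) z0"
  shows "regular_at t s (\<lambda>z. u (\<lambda>y. cnj (atom \<Phi> z y))) z0"
proof -
  let ?V = "\<lambda>z. u (\<lambda>y. cnj (atom \<Psi> z y))"
  obtain c where fr: "gframe t s c (atom \<Psi>)" using gframe_atom[OF t s \<Psi> nz] by blast
  note fr' = gframe_cnj[OF fr]
  obtain U where U: "open U" "z0 \<in> U" "rapid t s ?V U" using reg unfolding regular_at_def by blast
  obtain d where d: "d > 0" "ball z0 d \<subseteq> U" using U by (meson openE)
  obtain \<epsilon> where e: "\<epsilon> > 0" "\<And>z :: 'a \<times> 'a. rho t s z < \<epsilon> \<Longrightarrow> norm z < d / 2"
    using rho_small[OF t s, of "d / 2", where 'a = 'a] d(1) by auto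
  obtain M where M: "M > 0" "\<And>z. z \<in> ball z0 (d / 2) \<Longrightarrow> rho t s z \<le> M"
    using rho_bounded_ball[OF t s, of z0 "d / 2"] by blast
  obtain \<kappa> where \<kappa>: "\<kappa> \<ge> 1" "\<And>z w :: 'a \<times> 'a. rho t s (z + w) \<le> \<kappa> * (rho t s z + rho t s w)"
    using rho_quasi_triangle[OF t s, where 'a = 'a] by blast
  obtain R A where R: "R > 0" "A \<ge> 0" "\<And>z. norm (?V z) \<le> A * exp (R * rho t s z)"
    using bfun_family_bound[OF t s u gframe_family[OF fr']] by blast
  define I where "I = (LINT w::'a \<times> 'a|lborel. exp (- 1 * rho t s w))"
  have "rapid t s (\<lambda>z. u (\<lambda>y. cnj (atom \<Phi> z y))) (ball z0 (d / 2))"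
    unfolding rapid_def
  proof (intro allI impI)
    fix r :: real assume r: "r > 0"
    obtain C1 where C1: "\<And>\<mu> z. \<mu> > 0 \<Longrightarrow> z \<in> U \<Longrightarrow> norm (?V (dil t s \<mu> z)) \<le> C1 * exp (- r * \<mu>)"
      using U(3) r unfolding rapid_def by blast
    define q where "q = R * \<kappa> + 1 + (R * \<kappa> * M + r) / \<epsilon>"
    have q: "q \<ge> 1" using R \<kappa> M e r by (simp add: q_def)
    then have "q > 0" by simp
    from atom_decay[OF t s \<Psi> this] obtain h D where h: "h > 0" "D \<ge> 0" and D: "\<forall>\<phi>\<in>GS t s. \<forall>z.
        norm (LINT y|lborel. \<phi> y * cnj (atom \<Psi> z y)) \<le> D * GS_norm t s h \<phi> * exp (- q * rho t s z)"
      by blast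
    define N where "N = D * GS_norm t s h \<Phi>"
    have N: "N \<ge> 0" using h GS_norm_nonneg[OF GS_banach[OF \<Phi> h(1)] h(1)] by (simp add: N_def)
    have G: "norm (LINT y|lborel. cnj (atom \<Phi> z y) * atom \<Psi> w y) \<le> N * exp (- q * rho t s (w - z))" for z w
      unfolding atom_covariance[OF t s \<Phi> \<Psi>] N_def using D \<Phi> by blast
    define B where "B = N * (\<bar>C1\<bar> + A)"
    have key: "norm (LINT y|lborel. cnj (atom \<Phi> (dil t s \<mu> z) y) * atom \<Psi> w y) * norm (?V w)
        \<le> B * exp (- r * \<mu>) * exp (- 1 * rho t s (w - dil t s \<mu> z))"
      if \<mu>: "\<mu> > 0" and z: "z \<in> ball z0 (d / 2)" for \<mu> z w
    proof -
      let ?Z = "dil t s \<mu> z"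
      define v where "v = w - ?Z"
      have le: "norm (LINT y|lborel. cnj (atom \<Phi> ?Z y) * atom \<Psi> w y) * norm (?V w)
          \<le> N * exp (- q * rho t s v) * norm (?V w)"
        unfolding v_def by (intro mult_right_mono G) auto
      show ?thesis
      proof (cases "rho t s v < \<epsilon> * \<mu>")
        case True
        \<comment> \<open>After scaling back, \<open>w\<close> lies in the neighbourhood \<open>U\<close>, where the old coefficients decay.\<close>
        define v' where "v' = dil t s (1 / \<mu>) v"
        have v': "dil t s \<mu> v' = v" using \<mu> by (simp add: v'_def dil_dil)
        have "rho t s v' < \<epsilon>" using True \<mu> t s by (simp add: v'_def rho_dil field_simps)
        then have "norm v' < d / 2" by (rule e(2))
        moreover have "dist z0 (z + v') \<le> dist z0 z + norm v'"
          using dist_triangle[of z0 "z + v'" z] by (simp add: dist_norm)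
        ultimately have "z + v' \<in> U" using d(2) z by auto
        moreover have "w = dil t s \<mu> (z + v')" by (simp add: dil_add v' v_def)
        ultimately have "norm (?V w) \<le> C1 * exp (- r * \<mu>)" using C1 \<mu> by blast
        moreover have "exp (- q * rho t s v) \<le> exp (- 1 * rho t s v)"
          using mult_right_mono[OF q rho_nonneg[of t s v]] by simp
        ultimately have "N * exp (- q * rho t s v) * norm (?V w) \<le> N * exp (- 1 * rho t s v) * (C1 * exp (- r * \<mu>))"
          using N by (intro mult_mono) auto
        also have "\<dots> \<le> N * exp (- 1 * rho t s v) * ((\<bar>C1\<bar> + A) * exp (- r * \<mu>))"
          using N R(2) by (intro mult_left_mono mult_right_mono) auto
        finally show ?thesis using le by (simp add: B_def v_def mult_ac)
      next
        case False
        \<comment> \<open>Here \<open>rho v \<ge> \<epsilon> \<mu>\<close>, so the kernel beats both \<open>exp (r \<mu>)\<close> and the growth of the coefficients.\<close>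
        have "rho t s w \<le> \<kappa> * (rho t s ?Z + rho t s v)" using \<kappa>(2)[of ?Z v] by (simp add: v_def)
        also have "\<dots> \<le> \<kappa> * (\<mu> * M + rho t s v)"
          using \<kappa>(1) M(2)[OF z] \<mu> t s by (intro mult_left_mono add_right_mono) (auto simp: rho_dil)
        finally have "R * rho t s w \<le> R * \<kappa> * M * \<mu> + R * \<kappa> * rho t s v"
          using mult_left_mono[of "rho t s w" "\<kappa> * (\<mu> * M + rho t s v)" R] R(1) by (simp add: algebra_simps)
        moreover have "(R * \<kappa> * M + r) * \<mu> \<le> (R * \<kappa> * M + r) * (rho t s v / \<epsilon>)"
          using False e R \<kappa> M r by (intro mult_left_mono) (auto simp: field_simps)
        ultimately have ex: "- q * rho t s v + R * rho t s w \<le> - r * \<mu> + - 1 * rho t s v"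
          by (simp add: q_def algebra_simps add_divide_distrib)
        have "N * exp (- q * rho t s v) * norm (?V w) \<le> N * exp (- q * rho t s v) * (A * exp (R * rho t s w))"
          using N R(3)[of w] by (intro mult_left_mono) auto
        also have "\<dots> = N * A * exp (- q * rho t s v + R * rho t s w)" by (simp only: exp_add mult_ac)
        also have "\<dots> \<le> N * A * exp (- r * \<mu> + - 1 * rho t s v)"
          using ex N R(2) by (intro mult_left_mono) auto
        also have "\<dots> \<le> B * exp (- r * \<mu> + - 1 * rho t s v)"
          using N by (intro mult_right_mono) (auto simp: B_def algebra_simps)
        finally show ?thesis using le unfolding exp_add v_def by (simp add: mult_ac)
      qed
    qed
    have "norm (u (\<lambda>y. cnj (atom \<Phi> (dil t s \<mu> z) y))) \<le> (\<bar>c\<bar> * B * I) * exp (- r * \<mu>)"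
      if \<mu>: "\<mu> > 0" and z: "z \<in> ball z0 (d / 2)" for \<mu> z
    proof -
      let ?Z = "dil t s \<mu> z"
      have at: "(\<lambda>y. cnj (atom \<Phi> ?Z y)) \<in> GS t s"
        by (intro GS_cnj GS_family_GS[OF GS_family_atom[OF t s \<Phi>]])
      have "u (\<lambda>y. cnj (atom \<Phi> ?Z y)) = (LINT w|lborel. of_real c * (LINT y|lborel. cnj (atom \<Phi> ?Z y) * cnj (cnj (atom \<Psi> w y))) * ?V w)"
        by (rule bfun_gframe_expand[OF t s fr' at u])
      also have "norm \<dots> \<le> (LINT w::'a \<times> 'a|lborel. (\<bar>c\<bar> * B * exp (- r * \<mu>)) * exp (- 1 * rho t s (w - ?Z)))"
      proof (intro integral_norm_le integrable_mult_right exp_rho_translate t s)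
        fix w
        show "norm (of_real c * (LINT y|lborel. cnj (atom \<Phi> ?Z y) * cnj (cnj (atom \<Psi> w y))) * ?V w)
            \<le> (\<bar>c\<bar> * B * exp (- r * \<mu>)) * exp (- 1 * rho t s (w - ?Z))"
          using mult_left_mono[OF key[OF \<mu> z, of w], of "\<bar>c\<bar>"] by (simp add: norm_mult mult_ac)
      qed
      also have "\<dots> = (\<bar>c\<bar> * B * exp (- r * \<mu>)) * I"
        unfolding integral_mult_right_zero exp_rho_translate(2)[OF t s] I_def ..
      finally show ?thesis by (simp add: mult_ac)
    qed
    then show "\<exists>C. \<forall>\<mu>>0. \<forall>z\<in>ball z0 (d / 2). norm (u (\<lambda>y. cnj (atom \<Phi> (dil t s \<mu> z) y))) \<le> C * exp (- r * \<mu>)"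
      by blast
  qed
  then show ?thesis unfolding regular_at_def using d(1) by (intro exI[of _ "ball z0 (d / 2)"]) auto
qed

section \<open>Decay of kernels in cones\<close>

text \<open>
  Below, \<open>Q z w\<close> is the point of the phase space of the kernel that belongs to \<open>z\<close> in the phase space
  of the values and \<open>w\<close> in that of the arguments. Both roles of the two variables are needed, hence
  the abstraction.

  Regularity at the points \<open>Q z 0\<close> with \<open>rho z = 1\<close> extends to a neighbourhood of this compact set, which
  contains \<open>Q z w\<close> for small \<open>w\<close>. Scaling then sweeps out the whole cone.
\<close>

lemma cone_decay:
  fixes Q :: "'a::euclidean_space \<times> 'a \<Rightarrow> 'a \<times> 'a \<Rightarrow> 'b::euclidean_space \<times> 'b" and t s :: real
  assumes t: "t > 0" and s: "s > 0"
    and cont: "continuous_on UNIV (\<lambda>p. Q (fst p) (snd p))"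
    and dilQ: "\<And>\<mu> z w. dil t s \<mu> (Q z w) = Q (dil t s \<mu> z) (dil t s \<mu> w)"
    and reg: "\<And>z. z \<noteq> 0 \<Longrightarrow> regular_at t s V (Q z 0)"
  shows "\<exists>\<epsilon>>0. \<forall>r>0. \<exists>C. \<forall>z w. rho t s w \<le> \<epsilon> * rho t s z \<longrightarrow> norm (V (Q z w)) \<le> C * exp (- r * rho t s z)"
proof -
  let ?S = "{z :: 'a \<times> 'a. rho t s z = 1}"
  have S: "compact ?S" by (rule compact_rho_sets[OF t s])
  have "continuous_on ?S (\<lambda>z. Q (fst (z, 0::'a \<times> 'a)) (snd (z, 0::'a \<times> 'a)))"
    by (rule continuous_on_compose2[OF cont]) (auto intro!: continuous_intros)
  then have K: "compact ((\<lambda>z. Q z 0) ` ?S)" using S by (intro compact_continuous_image) auto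
  have "regular_at t s V z" if "z \<in> (\<lambda>z. Q z 0) ` ?S" for z
    using that rho_zero_iff[of t s "0 :: 'a \<times> 'a"] by (auto intro!: reg)
  from rapid_compact[OF K this] obtain U where U: "open U" "(\<lambda>z. Q z 0) ` ?S \<subseteq> U" "rapid t s V U" by blast
  have W: "open ((\<lambda>p. Q (fst p) (snd p)) -` U)" using cont U(1) by (simp add: open_vimage)
  have "compact (?S \<times> {0 :: 'a \<times> 'a})" using S by (intro compact_Times) auto
  moreover have "?S \<times> {0} \<subseteq> (\<lambda>p. Q (fst p) (snd p)) -` U" using U(2) by auto
  ultimately obtain \<delta> where \<delta>: "\<delta> > 0" "(\<Union>x\<in>?S \<times> {0}. ball x \<delta>) \<subseteq> (\<lambda>p. Q (fst p) (snd p)) -` U"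
    using compact_subset_open_imp_ball_epsilon_subset[OF _ W] by blast
  obtain \<epsilon> where e: "\<epsilon> > 0" "\<And>z :: 'a \<times> 'a. rho t s z < \<epsilon> \<Longrightarrow> norm z < \<delta>"
    using rho_small[OF t s \<delta>(1), where 'a = 'a] by blast
  have inU: "Q z w \<in> U" if "rho t s z = 1" "rho t s w < \<epsilon>" for z w
  proof -
    have "(z, w) \<in> ball (z, 0) \<delta>" using e(2)[OF that(2)] by (simp add: dist_Pair_Pair dist_norm)
    then show ?thesis using \<delta>(2) that(1) by force
  qed
  have "\<exists>C. \<forall>z w. rho t s w \<le> \<epsilon> / 2 * rho t s z \<longrightarrow> norm (V (Q z w)) \<le> C * exp (- r * rho t s z)" if r: "r > 0" for r
  proof -
    obtain C where C: "\<And>\<mu> z. \<mu> > 0 \<Longrightarrow> z \<in> U \<Longrightarrow> norm (V (dil t s \<mu> z)) \<le> C * exp (- r * \<mu>)"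
      using U(3) r unfolding rapid_def by blast
    have "norm (V (Q z w)) \<le> (\<bar>C\<bar> + norm (V (Q 0 0))) * exp (- r * rho t s z)"
      if le: "rho t s w \<le> \<epsilon> / 2 * rho t s z" for z w
    proof (cases "z = 0")
      case True
      then have "rho t s z = 0" by (simp add: rho_zero_iff)
      moreover from this le have "rho t s w = 0" using rho_nonneg[of t s w] by simp
      then have "w = 0" by (simp add: rho_zero_iff)
      ultimately show ?thesis using True by simp
    next
      case False
      define \<mu> where "\<mu> = rho t s z"
      have \<mu>: "\<mu> > 0" using False rho_zero_iff[of t s z] rho_nonneg[of t s z] by (simp add: \<mu>_def less_le)
      have "Q (dil t s (1 / \<mu>) z) (dil t s (1 / \<mu>) w) \<in> U"
      proof (rule inU)
        have "rho t s w < \<epsilon> * \<mu>" using le mult_pos_pos[OF e(1) \<mu>] by (simp add: \<mu>_def)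
        then show "rho t s (dil t s (1 / \<mu>) w) < \<epsilon>" using \<mu> t s by (simp add: rho_dil field_simps)
        show "rho t s (dil t s (1 / \<mu>) z) = 1" using \<mu> t s by (simp add: rho_dil \<mu>_def[symmetric])
      qed
      from C[OF \<mu> this] have "norm (V (Q z w)) \<le> C * exp (- r * \<mu>)"
        using \<mu> by (simp add: dilQ dil_dil)
      also have "\<dots> \<le> (\<bar>C\<bar> + norm (V (Q 0 0))) * exp (- r * \<mu>)"
        by (intro mult_right_mono add_increasing2 norm_ge_zero abs_ge_self) simp
      finally show ?thesis by (simp add: \<mu>_def)
    qed
    then show ?thesis by blast
  qed
  then show ?thesis using e(1) by (intro exI[of _ "\<epsilon> / 2"]) auto
qed

text \<open>
  For the action on wave front sets, split the \<open>w\<close>-integral after scaling by \<open>\<mu>\<close>. On a large compact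
  set, near every point one of the two factors decays rapidly in \<open>\<mu>\<close> while the other one grows at
  most exponentially; outside, the kernel decays because \<open>z\<close> is small compared to \<open>w\<close>.
\<close>

lemma regular_at_composition:
  fixes Q :: "'a::euclidean_space \<times> 'a \<Rightarrow> 'a \<times> 'a \<Rightarrow> 'b::euclidean_space \<times> 'b" and t s :: real
  assumes t: "t > 0" and s: "s > 0"
    and cont: "continuous_on UNIV (\<lambda>p. Q (fst p) (snd p))"
    and dilQ: "\<And>\<mu> z w. dil t s \<mu> (Q z w) = Q (dil t s \<mu> z) (dil t s \<mu> w)"
    and rhoQ: "\<And>z w. rho t s (Q z w) \<le> \<kappa> * (rho t s z + rho t s w)" and \<kappa>: "\<kappa> \<ge> 0"
    and V: "R > 0" "A \<ge> 0" "\<And>Z. norm (V Z) \<le> A * exp (R * rho t s Z)"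
    and B: "S > 0" "D \<ge> 0" "\<And>w. norm (B w) \<le> D * exp (S * rho t s w)"
    and decay: "\<exists>\<epsilon>>0. \<forall>r>0. \<exists>C. \<forall>z w. rho t s z \<le> \<epsilon> * rho t s w \<longrightarrow> norm (V (Q z w)) \<le> C * exp (- r * rho t s w)"
    and reg: "\<And>w. regular_at t s V (Q z0 w) \<or> regular_at t s B w"
  shows "regular_at t s (\<lambda>z. LINT w|lborel. of_real c * V (Q z w) * B w) z0"
proof -
  define G where "G \<delta> N \<longleftrightarrow> (\<forall>r>0. \<exists>C. \<forall>\<mu>>0. \<forall>z\<in>ball z0 \<delta>. \<forall>w\<in>N.
    norm (V (Q (dil t s \<mu> z) (dil t s \<mu> w))) * norm (B (dil t s \<mu> w)) \<le> C * exp (- r * \<mu>))"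
    for \<delta> and N :: "('a \<times> 'a) set"
  \<comment> \<open>One factor is regular at \<open>w0\<close>; its rate is chosen to beat the bounded rate of growth of the other.\<close>
  have local: "\<exists>\<delta>>0. G \<delta> (ball w0 \<delta>)" for w0
  proof -
    obtain M1 where M1: "M1 > 0" "\<And>z. z \<in> ball z0 1 \<Longrightarrow> rho t s z \<le> M1" using rho_bounded_ball[OF t s, of z0 1] by blast
    obtain M2 where M2: "M2 > 0" "\<And>w. w \<in> ball w0 1 \<Longrightarrow> rho t s w \<le> M2" using rho_bounded_ball[OF t s, of w0 1] by blast
    have Bw: "norm (B (dil t s \<mu> w)) \<le> D * exp (S * M2 * \<mu>)" if "\<mu> > 0" "w \<in> ball w0 1" for \<mu> w
    proof -
      have "norm (B (dil t s \<mu> w)) \<le> D * exp (S * (\<mu> * rho t s w))" using B(3)[of "dil t s \<mu> w"] that t s by (simp add: rho_dil)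
      also have "S * (\<mu> * rho t s w) \<le> S * (\<mu> * M2)" using M2(2)[OF that(2)] that B(1) by (intro mult_left_mono) auto
      finally show ?thesis using B(2) by (simp add: mult_left_mono mult_ac)
    qed
    have VQ: "norm (V (Q (dil t s \<mu> z) (dil t s \<mu> w))) \<le> A * exp (R * (\<kappa> * (M1 + M2)) * \<mu>)"
      if "\<mu> > 0" "z \<in> ball z0 1" "w \<in> ball w0 1" for \<mu> z w
    proof -
      have "rho t s (Q z w) \<le> \<kappa> * (M1 + M2)"
        using rhoQ[of z w] mult_left_mono[OF add_mono[OF M1(2)[OF that(2)] M2(2)[OF that(3)]] \<kappa>] by linarith
      then have "R * (\<mu> * rho t s (Q z w)) \<le> R * (\<mu> * (\<kappa> * (M1 + M2)))"
        using that V(1) by (intro mult_left_mono) auto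
      moreover have "norm (V (dil t s \<mu> (Q z w))) \<le> A * exp (R * (\<mu> * rho t s (Q z w)))"
        using V(3)[of "dil t s \<mu> (Q z w)"] that t s by (simp add: rho_dil)
      ultimately show ?thesis
        using mult_left_mono[of "exp (R * (\<mu> * rho t s (Q z w)))" "exp (R * (\<mu> * (\<kappa> * (M1 + M2))))" A] V(2)
        by (simp add: dilQ mult_ac)
    qed
    show ?thesis
    proof (cases "regular_at t s B w0")
      case True
      then obtain U where U: "open U" "w0 \<in> U" "rapid t s B U" unfolding regular_at_def by blast
      obtain d where d: "d > 0" "ball w0 d \<subseteq> U" using U by (meson openE)
      define \<delta> where "\<delta> = min d 1"
      have sub: "ball z0 \<delta> \<subseteq> ball z0 1" "ball w0 \<delta> \<subseteq> ball w0 1" "ball w0 \<delta> \<subseteq> U"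
        using d by (auto simp: \<delta>_def)
      have "G \<delta> (ball w0 \<delta>)"
        unfolding G_def
      proof (intro allI impI)
        fix r :: real assume r: "r > 0"
        let ?m = "R * (\<kappa> * (M1 + M2))"
        have "r + ?m > 0" using r V(1) \<kappa> M1 M2 by (intro add_pos_nonneg) auto
        then obtain C where C: "\<And>\<mu> w. \<mu> > 0 \<Longrightarrow> w \<in> U \<Longrightarrow> norm (B (dil t s \<mu> w)) \<le> C * exp (- (r + ?m) * \<mu>)"
          using U(3) unfolding rapid_def by blast
        have "norm (V (Q (dil t s \<mu> z) (dil t s \<mu> w))) * norm (B (dil t s \<mu> w)) \<le> (A * C) * exp (- r * \<mu>)"
          if "\<mu> > 0" "z \<in> ball z0 \<delta>" "w \<in> ball w0 \<delta>" for \<mu> z w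
        proof -
          have "norm (V (Q (dil t s \<mu> z) (dil t s \<mu> w))) * norm (B (dil t s \<mu> w))
              \<le> (A * exp (?m * \<mu>)) * (C * exp (- (r + ?m) * \<mu>))"
            using that sub V(2) by (intro mult_mono VQ C) auto
          also have "\<dots> = (A * C) * (exp (?m * \<mu>) * exp (- (r + ?m) * \<mu>))" by (simp only: mult_ac)
          also have "exp (?m * \<mu>) * exp (- (r + ?m) * \<mu>) = exp (- r * \<mu>)"
            unfolding exp_add[symmetric] by (simp add: algebra_simps)
          finally show ?thesis .
        qed
        then show "\<exists>C. \<forall>\<mu>>0. \<forall>z\<in>ball z0 \<delta>. \<forall>w\<in>ball w0 \<delta>.
          norm (V (Q (dil t s \<mu> z) (dil t s \<mu> w))) * norm (B (dil t s \<mu> w)) \<le> C * exp (- r * \<mu>)" by blast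
      qed
      then show ?thesis using d by (intro exI[of _ \<delta>]) (simp add: \<delta>_def)
    next
      case False
      then obtain U where U: "open U" "Q z0 w0 \<in> U" "rapid t s V U" using reg unfolding regular_at_def by blast
      have "open ((\<lambda>p. Q (fst p) (snd p)) -` U)" using cont U(1) by (simp add: open_vimage)
      moreover have "(z0, w0) \<in> (\<lambda>p. Q (fst p) (snd p)) -` U" using U(2) by simp
      ultimately obtain N1 N2 where N: "open N1" "open N2" "z0 \<in> N1" "w0 \<in> N2" "N1 \<times> N2 \<subseteq> (\<lambda>p. Q (fst p) (snd p)) -` U"
        by (rule open_prod_elim) auto
      obtain d1 d2 where d: "d1 > 0" "ball z0 d1 \<subseteq> N1" "d2 > 0" "ball w0 d2 \<subseteq> N2" using N by (meson openE)
      define \<delta> where "\<delta> = min (min d1 d2) 1"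
      have sub: "ball w0 \<delta> \<subseteq> ball w0 1" "ball z0 \<delta> \<subseteq> N1" "ball w0 \<delta> \<subseteq> N2"
        using d by (auto simp: \<delta>_def)
      have "G \<delta> (ball w0 \<delta>)"
        unfolding G_def
      proof (intro allI impI)
        fix r :: real assume r: "r > 0"
        let ?m = "S * M2"
        have "r + ?m > 0" using r B(1) M2 by (intro add_pos_nonneg) auto
        then obtain C where C: "\<And>\<mu> Z. \<mu> > 0 \<Longrightarrow> Z \<in> U \<Longrightarrow> norm (V (dil t s \<mu> Z)) \<le> C * exp (- (r + ?m) * \<mu>)"
          using U(3) unfolding rapid_def by blast
        have "norm (V (Q (dil t s \<mu> z) (dil t s \<mu> w))) * norm (B (dil t s \<mu> w)) \<le> (C * D) * exp (- r * \<mu>)"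
          if "\<mu> > 0" "z \<in> ball z0 \<delta>" "w \<in> ball w0 \<delta>" for \<mu> z w
        proof -
          have "(z, w) \<in> N1 \<times> N2" using that sub by blast
          then have "Q z w \<in> U" using N(5) by auto
          then have VC: "norm (V (Q (dil t s \<mu> z) (dil t s \<mu> w))) \<le> C * exp (- (r + ?m) * \<mu>)"
            using C[OF that(1), of "Q z w"] by (simp add: dilQ)
          have "norm (V (Q (dil t s \<mu> z) (dil t s \<mu> w))) * norm (B (dil t s \<mu> w))
              \<le> (C * exp (- (r + ?m) * \<mu>)) * (D * exp (?m * \<mu>))"
            using that sub by (intro mult_mono VC Bw order_trans[OF norm_ge_zero VC]) auto
          also have "\<dots> = (C * D) * (exp (- (r + ?m) * \<mu>) * exp (?m * \<mu>))" by (simp only: mult_ac)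
          also have "exp (- (r + ?m) * \<mu>) * exp (?m * \<mu>) = exp (- r * \<mu>)"
            unfolding exp_add[symmetric] by (simp add: algebra_simps)
          finally show ?thesis .
        qed
        then show "\<exists>C. \<forall>\<mu>>0. \<forall>z\<in>ball z0 \<delta>. \<forall>w\<in>ball w0 \<delta>.
          norm (V (Q (dil t s \<mu> z) (dil t s \<mu> w))) * norm (B (dil t s \<mu> w)) \<le> C * exp (- r * \<mu>)" by blast
      qed
      then show ?thesis using d by (intro exI[of _ \<delta>]) (simp add: \<delta>_def)
    qed
  qed
  obtain \<epsilon> where e: "\<epsilon> > 0" and far: "\<And>r. r > 0 \<Longrightarrow> \<exists>C. \<forall>z w. rho t s z \<le> \<epsilon> * rho t s w \<longrightarrow>
      norm (V (Q z w)) \<le> C * exp (- r * rho t s w)"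
    using decay by blast
  obtain M0 where M0: "M0 > 0" "\<And>z. z \<in> ball z0 1 \<Longrightarrow> rho t s z \<le> M0" using rho_bounded_ball[OF t s, of z0 1] by blast
  \<comment> \<open>If \<open>w\<close> is beyond this radius, \<open>rho z \<le> \<epsilon> rho w\<close> for all \<open>z\<close> in the ball around \<open>z0\<close>.\<close>
  define M where "M = M0 / \<epsilon>"
  have M: "M > 0" "M0 = \<epsilon> * M" using e M0 by (auto simp: M_def)
  let ?K = "{w :: 'a \<times> 'a. rho t s w \<le> M}"
  have "\<forall>w. \<exists>\<delta>. \<delta> > 0 \<and> G \<delta> (ball w \<delta>)" using local by blast
  from choice[OF this] obtain d where d: "\<And>w. d w > 0" "\<And>w. G (d w) (ball w (d w))" by blast
  obtain F where F: "finite F" "?K \<subseteq> (\<Union>w\<in>F. ball w (d w))"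
  proof (rule compactE_image[OF compact_rho_sets(1)[OF t s, of M]])
    show "open (ball w (d w))" for w by simp
    show "?K \<subseteq> (\<Union>w\<in>?K. ball w (d w))" using d(1) by auto
  qed
  define \<delta> where "\<delta> = Min (insert 1 (d ` F))"
  have \<delta>: "\<delta> > 0" "\<delta> \<le> 1" "\<And>w. w \<in> F \<Longrightarrow> \<delta> \<le> d w"
    using F(1) d(1) by (auto simp: \<delta>_def)
  have GK: "G \<delta> ?K"
    unfolding G_def
  proof (intro allI impI)
    fix r :: real assume r: "r > 0"
    have "\<forall>v. \<exists>C. \<forall>\<mu>>0. \<forall>z\<in>ball z0 (d v). \<forall>w\<in>ball v (d v).
      norm (V (Q (dil t s \<mu> z) (dil t s \<mu> w))) * norm (B (dil t s \<mu> w)) \<le> C * exp (- r * \<mu>)"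
      using d(2) r unfolding G_def by blast
    from choice[OF this] obtain C where C: "\<forall>v. \<forall>\<mu>>0. \<forall>z\<in>ball z0 (d v). \<forall>w\<in>ball v (d v).
      norm (V (Q (dil t s \<mu> z) (dil t s \<mu> w))) * norm (B (dil t s \<mu> w)) \<le> C v * exp (- r * \<mu>)" ..
    have "norm (V (Q (dil t s \<mu> z) (dil t s \<mu> w))) * norm (B (dil t s \<mu> w)) \<le> (\<Sum>v\<in>F. \<bar>C v\<bar>) * exp (- r * \<mu>)"
      if \<mu>: "\<mu> > 0" and z: "z \<in> ball z0 \<delta>" and w: "w \<in> ?K" for \<mu> z w
    proof -
      obtain v where v: "v \<in> F" "w \<in> ball v (d v)" using F(2) w by blast
      have "z \<in> ball z0 (d v)" using z \<delta>(3)[OF v(1)] by simp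
      from C[rule_format, OF \<mu> this v(2)]
      have "norm (V (Q (dil t s \<mu> z) (dil t s \<mu> w))) * norm (B (dil t s \<mu> w)) \<le> C v * exp (- r * \<mu>)" .
      also have "C v \<le> (\<Sum>v\<in>F. \<bar>C v\<bar>)" using member_le_sum[of v F "\<lambda>v. \<bar>C v\<bar>"] F(1) v(1) by simp
      finally show ?thesis by (simp add: mult_right_mono)
    qed
    then show "\<exists>C. \<forall>\<mu>>0. \<forall>z\<in>ball z0 \<delta>. \<forall>w\<in>?K.
      norm (V (Q (dil t s \<mu> z) (dil t s \<mu> w))) * norm (B (dil t s \<mu> w)) \<le> C * exp (- r * \<mu>)" by blast
  qed
  define I where "I = (LINT w::'a \<times> 'a|lborel. exp (- 1 * rho t s w))"
  have "rapid t s (\<lambda>z. LINT w|lborel. of_real c * V (Q z w) * B w) (ball z0 \<delta>)"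
    unfolding rapid_def
  proof (intro allI impI)
    fix r :: real assume r: "r > 0"
    have "r + M > 0" using r M by simp
    from GK[unfolded G_def, rule_format, OF this]
    obtain C1 where C1: "\<forall>\<mu>>0. \<forall>z\<in>ball z0 \<delta>. \<forall>w\<in>?K.
        norm (V (Q (dil t s \<mu> z) (dil t s \<mu> w))) * norm (B (dil t s \<mu> w)) \<le> C1 * exp (- (r + M) * \<mu>)" ..
    have "S + 1 + r / M > 0" using B(1) r M by (simp add: add_pos_pos)
    from far[OF this] obtain C2 where C2: "\<And>z w. rho t s z \<le> \<epsilon> * rho t s w \<Longrightarrow>
        norm (V (Q z w)) \<le> C2 * exp (- (S + 1 + r / M) * rho t s w)" by blast
    define C where "C = \<bar>C1\<bar> + \<bar>C2\<bar> * D"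
    have key: "norm (V (Q (dil t s \<mu> z) w)) * norm (B w) \<le> C * (exp (- r * \<mu>) * exp (- 1 * rho t s w))"
      if \<mu>: "\<mu> > 0" and z: "z \<in> ball z0 \<delta>" for \<mu> z w
    proof (cases "rho t s w \<le> M * \<mu>")
      case True
      define w' where "w' = dil t s (1 / \<mu>) w"
      have w': "dil t s \<mu> w' = w" using \<mu> by (simp add: w'_def dil_dil)
      have "w' \<in> ?K" using True \<mu> t s by (simp add: w'_def rho_dil field_simps)
      from C1[rule_format, OF \<mu> z this] have "norm (V (Q (dil t s \<mu> z) w)) * norm (B w) \<le> C1 * exp (- (r + M) * \<mu>)"
        unfolding w' .
      also have "\<dots> \<le> \<bar>C1\<bar> * exp (- r * \<mu> + - 1 * rho t s w)"
        using True by (intro mult_mono) (auto simp: algebra_simps)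
      also have "\<dots> \<le> C * exp (- r * \<mu> + - 1 * rho t s w)"
        using B(2) by (intro mult_right_mono) (auto simp: C_def)
      finally show ?thesis by (simp only: exp_add)
    next
      case False
      have "rho t s z \<le> M0" using M0(2) z \<delta>(2) by auto
      then have "\<mu> * rho t s z \<le> \<mu> * (\<epsilon> * M)" using \<mu> M(2) by (intro mult_left_mono) auto
      also have "\<dots> = \<epsilon> * (M * \<mu>)" by simp
      also have "\<dots> \<le> \<epsilon> * rho t s w" using False e by (intro mult_left_mono) auto
      finally have "rho t s (dil t s \<mu> z) \<le> \<epsilon> * rho t s w" using \<mu> t s by (simp add: rho_dil)
      note V2 = C2[OF this]
      have "norm (V (Q (dil t s \<mu> z) w)) * norm (B w)
          \<le> (C2 * exp (- (S + 1 + r / M) * rho t s w)) * (D * exp (S * rho t s w))"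
        by (intro mult_mono V2 B order_trans[OF norm_ge_zero V2]) auto
      also have "\<dots> = (C2 * D) * (exp (- (S + 1 + r / M) * rho t s w) * exp (S * rho t s w))" by (simp only: mult_ac)
      also have "\<dots> \<le> C * exp (- r * \<mu> + - 1 * rho t s w)"
      proof (rule mult_mono)
        have "C2 * D \<le> \<bar>C2\<bar> * D" using B(2) by (intro mult_right_mono) auto
        then show "C2 * D \<le> C" by (simp add: C_def)
        have "r * \<mu> \<le> r / M * rho t s w" using False r M(1) by (simp add: field_simps)
        then show "exp (- (S + 1 + r / M) * rho t s w) * exp (S * rho t s w) \<le> exp (- r * \<mu> + - 1 * rho t s w)"
          unfolding exp_add[symmetric] by (simp add: algebra_simps)
      qed (use B(2) in \<open>auto simp: C_def\<close>)
      finally show ?thesis by (simp only: exp_add)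
    qed
    have "norm (LINT w|lborel. of_real c * V (Q (dil t s \<mu> z) w) * B w) \<le> (\<bar>c\<bar> * C * I) * exp (- r * \<mu>)"
      if \<mu>: "\<mu> > 0" and z: "z \<in> ball z0 \<delta>" for \<mu> z
    proof -
      have "norm (LINT w|lborel. of_real c * V (Q (dil t s \<mu> z) w) * B w)
        \<le> (LINT w::'a \<times> 'a|lborel. (\<bar>c\<bar> * C * exp (- r * \<mu>)) * exp (- 1 * rho t s w))"
      proof (intro integral_norm_le integrable_mult_right integrable_exp_rho t s zero_less_one)
        fix w
        show "norm (of_real c * V (Q (dil t s \<mu> z) w) * B w) \<le> (\<bar>c\<bar> * C * exp (- r * \<mu>)) * exp (- 1 * rho t s w)"
          using mult_left_mono[OF key[OF \<mu> z, of w], of "\<bar>c\<bar>"] by (simp add: norm_mult mult_ac)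
      qed
      then show ?thesis by (simp add: I_def mult_ac)
    qed
    then show "\<exists>C. \<forall>\<mu>>0. \<forall>z\<in>ball z0 \<delta>. norm (LINT w|lborel. of_real c * V (Q (dil t s \<mu> z) w) * B w) \<le> C * exp (- r * \<mu>)"
      by blast
  qed
  then show ?thesis unfolding regular_at_def using \<delta>(1) by (intro exI[of _ "ball z0 \<delta>"]) auto
qed

section \<open>The matrix of a kernel\<close>

text \<open>
  The sign reflects that the kernel is applied to test functions without complex conjugation, which
  turns the frequency of the argument around. It is the sign in the definition of \<open>twisted_comp\<close>.
\<close>

definition kernel_point :: "'a::euclidean_space \<times> 'a \<Rightarrow> 'a \<times> 'a \<Rightarrow> ('a \<times> 'a) \<times> ('a \<times> 'a)" where
  "kernel_point z w = ((fst z, fst w), (snd z, - snd w))"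

lemma dil_kernel_point: "dil t s \<mu> (kernel_point z w) = kernel_point (dil t s \<mu> z) (dil t s \<mu> w)"
  by (simp add: dil_def kernel_point_def)

lemma kernel_point_continuous:
  "continuous_on UNIV (\<lambda>p. kernel_point (fst p) (snd p))" "continuous_on UNIV (\<lambda>p. kernel_point (snd p) (fst p))"
  unfolding kernel_point_def by (intro continuous_intros)+

lemma rho_kernel_point:
  assumes "t > 0" "s > 0"
  shows "rho t s (kernel_point z w) \<le> (2 powr (1 / t) + 2 powr (1 / s)) * (rho t s z + rho t s w)"
proof -
  have P: "norm (x, y) powr p \<le> 2 powr p * (norm x powr p + norm y powr p)" if "p > 0" for x y :: 'a and p :: real
  proof -
    have "norm (x, y) powr p \<le> (norm x + norm y) powr p" using that by (intro powr_mono2 norm_Pair_le) auto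
    also have "\<dots> \<le> 2 powr p * (norm x powr p + norm y powr p)" using that by (intro powr_quasi_triangle) auto
    finally show ?thesis .
  qed
  have "rho t s (kernel_point z w) \<le> 2 powr (1 / t) * (norm (fst z) powr (1 / t) + norm (fst w) powr (1 / t))
      + 2 powr (1 / s) * (norm (snd z) powr (1 / s) + norm (snd w) powr (1 / s))"
    using P[of "1 / t" "fst z" "fst w"] P[of "1 / s" "snd z" "- snd w"] assms
    unfolding rho_def kernel_point_def by simp
  also have "\<dots> \<le> (2 powr (1 / t) + 2 powr (1 / s)) * (rho t s z + rho t s w)"
    by (simp add: rho_def algebra_simps)
  finally show ?thesis .
qed

text \<open>
  Applying \<open>K\<close> to both sides: the matrix of the operator with kernel \<open>K\<close> with respect to the atoms is, up to
  a constant, the short-time Fourier transform of \<open>K\<close> with a tensor product as window.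
\<close>

lemma tensor_atom:
  "tensor (\<lambda>y. cnj (atom \<psi> z y)) (atom \<psi> w) = (\<lambda>p. cnj (atom (tensor \<psi> (\<lambda>y. cnj (\<psi> y))) (kernel_point z w) p))"
  by (auto simp: fun_eq_iff tensor_def atom_eq kernel_point_def plane_wave_def exp_cnj
      distrib_left exp_add[symmetric] algebra_simps)

lemma tensor_lincomb:
  "tensor (\<lambda>x. a * f x + b * g x) h = (\<lambda>p. a * tensor f h p + b * tensor g h p)"
  "tensor h (\<lambda>x. a * f x + b * g x) = (\<lambda>p. a * tensor h f p + b * tensor h g p)"
  by (auto simp: tensor_def fun_eq_iff algebra_simps)

lemma bfun_tensor:
  fixes K :: "('a::euclidean_space \<times> 'a \<Rightarrow> complex) \<Rightarrow> complex"
  assumes t: "t > 0" and K: "bfun t s K" and f: "f \<in> GS t s"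
  shows "bfun t s (\<lambda>\<phi>. K (tensor \<phi> f))" and "bfun t s (\<lambda>\<phi>. K (tensor f \<phi>))"
proof -
  obtain h C where h: "h > 0" "C \<ge> 0" "\<And>F. F \<in> GS t s \<Longrightarrow> norm (K F) \<le> C * GS_norm t s h F"
    using bfun_bound[OF K] by blast
  have le: "norm (K (tensor \<phi> f)) \<le> (C * GS_norm t s h f) * GS_norm t s h \<phi>"
    "norm (K (tensor f \<phi>)) \<le> (C * GS_norm t s h f) * GS_norm t s h \<phi>" if "\<phi> \<in> GS t s" for \<phi>
    using h(3)[OF GS_tensor(1)[OF t that f]] h(3)[OF GS_tensor(1)[OF t f that]]
      mult_left_mono[OF GS_tensor(2)[OF t that f h(1)] h(2)] mult_left_mono[OF GS_tensor(2)[OF t f that h(1)] h(2)]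
    by (auto simp: mult_ac)
  have "\<exists>h>0. \<exists>C. \<forall>\<phi>\<in>GS t s. norm (K (tensor \<phi> f)) \<le> C * GS_norm t s h \<phi>"
    "\<exists>h>0. \<exists>C. \<forall>\<phi>\<in>GS t s. norm (K (tensor f \<phi>)) \<le> C * GS_norm t s h \<phi>"
    using le h(1) by blast+
  then show "bfun t s (\<lambda>\<phi>. K (tensor \<phi> f))" "bfun t s (\<lambda>\<phi>. K (tensor f \<phi>))"
    unfolding bfun_def clinear_functional_on_def tensor_lincomb
    by (auto intro!: bfun_lincomb[OF K] GS_tensor t f)
qed

section \<open>Topologies\<close>

lemma GS_norm_triangle:
  fixes f g k :: "'a::euclidean_space \<Rightarrow> complex"
  assumes t: "t > 0" and h: "h > 0" and f: "f \<in> GS t s" and g: "g \<in> GS t s" and k: "k \<in> GS t s"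
  shows "GS_norm t s h (\<lambda>x. f x - k x) \<le> GS_norm t s h (\<lambda>x. f x - g x) + GS_norm t s h (\<lambda>x. g x - k x)"
  using GS_norm_lincomb[OF t h GS_diff[OF t f g] GS_diff[OF t g k], of 1 1] by simp

lemma GS_norm_self:
  fixes f :: "'a::euclidean_space \<Rightarrow> complex"
  assumes t: "t > 0" and h: "h > 0" and f: "f \<in> GS t s"
  shows "GS_norm t s h (\<lambda>x. f x - f x) \<le> 0"
  using GS_norm_lincomb[OF t h f f, of 0 0] by simp

lemma openin_GS_ball:
  fixes f :: "'a::euclidean_space \<Rightarrow> complex"
  assumes t: "t > 0" and f: "f \<in> GS t s" and h: "h > 0" and e: "\<epsilon> > 0"
  shows "openin (GS_topology t s) {g \<in> GS t s. GS_norm t s h (\<lambda>x. g x - f x) < \<epsilon>}"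
    and "f \<in> {g \<in> GS t s. GS_norm t s h (\<lambda>x. g x - f x) < \<epsilon>}"
proof -
  show "openin (GS_topology t s) {g \<in> GS t s. GS_norm t s h (\<lambda>x. g x - f x) < \<epsilon>}"
    unfolding GS_topology_def
    by (rule topology_generated_by_Basis, rule CollectI, rule exI[of _ f], rule exI[of _ h], rule exI[of _ \<epsilon>])
      (simp add: f h e)
  show "f \<in> {g \<in> GS t s. GS_norm t s h (\<lambda>x. g x - f x) < \<epsilon>}"
    using f GS_norm_self[OF t h f] e by simp
qed

lemma topspace_GS_topology:
  assumes t: "t > 0" shows "topspace (GS_topology t s) = (GS t s :: ('a::euclidean_space \<Rightarrow> complex) set)"
proof
  show "topspace (GS_topology t s) \<subseteq> GS t s" unfolding GS_topology_def by auto
  show "GS t s \<subseteq> topspace (GS_topology t s)"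
    using openin_subset[OF openin_GS_ball(1)[OF t _ zero_less_one zero_less_one]]
      openin_GS_ball(2)[OF t _ zero_less_one zero_less_one] by fast
qed

text \<open>
  The generating sets form a basis, since the seminorms are directed: they increase as \<open>h\<close> decreases.
\<close>

lemma openin_GS_topology_imp:
  assumes t: "t > 0" and U: "openin (GS_topology t s) U" and f: "f \<in> U"
  shows "\<exists>h>0. \<exists>\<epsilon>>0. {g \<in> GS t s. GS_norm t s h (\<lambda>x. g x - f x) < \<epsilon>} \<subseteq> U"
proof -
  have "\<forall>f\<in>U. \<exists>h>0. \<exists>\<epsilon>>0. {g \<in> GS t s. GS_norm t s h (\<lambda>x. g x - f x) < \<epsilon>} \<subseteq> U"
    using openin_topology_generated_by[OF U[unfolded GS_topology_def]]
  proof (induction rule: generate_topology_on.induct)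
    case Empty
    then show ?case by simp
  next
    case (Int A B)
    show ?case
    proof
      fix f assume f: "f \<in> A \<inter> B"
      have "A \<subseteq> GS t s"
        using topspace_GS_topology[OF t] openin_subset[of "GS_topology t s" A] Int(1)
        unfolding GS_topology_def openin_topology_generated_by_iff by blast
      then have fG: "f \<in> GS t s" using f by blast
      obtain h1 \<epsilon>1 where 1: "h1 > 0" "\<epsilon>1 > 0" "{g \<in> GS t s. GS_norm t s h1 (\<lambda>x. g x - f x) < \<epsilon>1} \<subseteq> A" using Int f by blast
      obtain h2 \<epsilon>2 where 2: "h2 > 0" "\<epsilon>2 > 0" "{g \<in> GS t s. GS_norm t s h2 (\<lambda>x. g x - f x) < \<epsilon>2} \<subseteq> B" using Int f by blast
      have "g \<in> A \<inter> B" if g: "g \<in> GS t s" and n: "GS_norm t s (min h1 h2) (\<lambda>x. g x - f x) < min \<epsilon>1 \<epsilon>2" for g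
      proof -
        have d: "(\<lambda>x. g x - f x) \<in> GS t s" by (rule GS_diff[OF t g fG])
        have "GS_norm t s h1 (\<lambda>x. g x - f x) \<le> GS_norm t s (min h1 h2) (\<lambda>x. g x - f x)"
          "GS_norm t s h2 (\<lambda>x. g x - f x) \<le> GS_norm t s (min h1 h2) (\<lambda>x. g x - f x)"
          using 1(1) 2(1) by (auto intro!: GS_norm_antimono[OF d])
        with n have "GS_norm t s h1 (\<lambda>x. g x - f x) < \<epsilon>1" "GS_norm t s h2 (\<lambda>x. g x - f x) < \<epsilon>2" by auto
        with 1(3) 2(3) g show ?thesis by blast
      qed
      then have "{g \<in> GS t s. GS_norm t s (min h1 h2) (\<lambda>x. g x - f x) < min \<epsilon>1 \<epsilon>2} \<subseteq> A \<inter> B" by blast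
      moreover have "min h1 h2 > 0" "min \<epsilon>1 \<epsilon>2 > 0" using 1 2 by auto
      ultimately show "\<exists>h>0. \<exists>\<epsilon>>0. {g \<in> GS t s. GS_norm t s h (\<lambda>x. g x - f x) < \<epsilon>} \<subseteq> A \<inter> B" by blast
    qed
  next
    case (UN \<K>)
    show ?case
    proof
      fix f assume "f \<in> \<Union>\<K>"
      then obtain A where "A \<in> \<K>" "f \<in> A" by blast
      moreover from this UN obtain h \<epsilon> where "h > 0" "\<epsilon> > 0" "{g \<in> GS t s. GS_norm t s h (\<lambda>x. g x - f x) < \<epsilon>} \<subseteq> A" by blast
      ultimately show "\<exists>h>0. \<exists>\<epsilon>>0. {g \<in> GS t s. GS_norm t s h (\<lambda>x. g x - f x) < \<epsilon>} \<subseteq> \<Union>\<K>" by blast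
    qed
  next
    case (Basis A)
    then obtain f0 h \<epsilon> where A: "A = {g \<in> GS t s. GS_norm t s h (\<lambda>x. g x - f0 x) < \<epsilon>}" "f0 \<in> GS t s" "h > 0" "\<epsilon> > 0"
      unfolding mem_Collect_eq by (elim exE conjE) (rule that)
    show ?case
    proof
      fix f assume f: "f \<in> A"
      let ?\<delta> = "\<epsilon> - GS_norm t s h (\<lambda>x. f x - f0 x)"
      have fG: "f \<in> GS t s" and \<delta>: "?\<delta> > 0" using f A by auto
      have "{g \<in> GS t s. GS_norm t s h (\<lambda>x. g x - f x) < ?\<delta>} \<subseteq> A"
      proof
        fix g assume g: "g \<in> {g \<in> GS t s. GS_norm t s h (\<lambda>x. g x - f x) < ?\<delta>}"
        then have "g \<in> GS t s" by simp
        from GS_norm_triangle[OF t A(3) this fG A(2)] g show "g \<in> A" unfolding A(1) by simp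
      qed
      then show "\<exists>h>0. \<exists>\<epsilon>>0. {g \<in> GS t s. GS_norm t s h (\<lambda>x. g x - f x) < \<epsilon>} \<subseteq> A" using \<delta> A(3) by blast
    qed
  qed
  with f show ?thesis by blast
qed

lemma openin_GS_topologyI:
  assumes t: "t > 0" and sub: "U \<subseteq> GS t s"
    and ball: "\<And>f. f \<in> U \<Longrightarrow> \<exists>h>0. \<exists>\<epsilon>>0. {g \<in> GS t s. GS_norm t s h (\<lambda>x. g x - f x) < \<epsilon>} \<subseteq> U"
  shows "openin (GS_topology t s) U"
proof (subst openin_subopen, intro ballI)
  fix f assume f: "f \<in> U"
  then obtain h \<epsilon> where h: "h > 0" "\<epsilon> > 0" "{g \<in> GS t s. GS_norm t s h (\<lambda>x. g x - f x) < \<epsilon>} \<subseteq> U" using ball by blast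
  have fG: "f \<in> GS t s" using f sub by blast
  from openin_GS_ball[OF t fG h(1,2)] h(3)
  show "\<exists>T. openin (GS_topology t s) T \<and> f \<in> T \<and> T \<subseteq> U" by (intro exI conjI)
qed

text \<open>
  Near \<open>0\<close> the functional is bounded by \<open>1\<close> on a ball of some seminorm; the rest is homogeneity.
\<close>

lemma GS_dual_imp_bfun:
  fixes u :: "('a::euclidean_space \<Rightarrow> complex) \<Rightarrow> complex" and \<psi> :: "'a \<Rightarrow> complex"
  assumes t: "t > 0" and u: "u \<in> GS_dual t s" and ne: "\<psi> \<in> GS t s"
  shows "bfun t s u"
proof -
  have lin: "clinear_functional_on (GS t s) u" and cont: "continuous_map (GS_topology t s) euclidean u"
    using u unfolding GS_dual_def by auto
  have lc: "u (\<lambda>x. a * f x + b * g x) = a * u f + b * u g" if "f \<in> GS t s" "g \<in> GS t s" for a b f g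
    using lin that unfolding clinear_functional_on_def by simp
  have u0: "u (\<lambda>x. 0) = 0" using lc[OF ne ne, where a = 0 and b = 0] by simp
  have "openin (GS_topology t s) {x \<in> topspace (GS_topology t s). u x \<in> ball 0 1}"
    by (rule openin_continuous_map_preimage[OF cont]) simp
  then have op: "openin (GS_topology t s) {x \<in> GS t s. norm (u x) < 1}"
    by (simp add: topspace_GS_topology[OF t])
  have z: "(\<lambda>x. 0) \<in> {x \<in> GS t s. norm (u x) < 1}" using GS_zero[OF t ne] u0 by simp
  from openin_GS_topology_imp[OF t op z] obtain h \<epsilon> where h: "h > 0" "\<epsilon> > 0" "{g \<in> GS t s. GS_norm t s h (\<lambda>x. g x - 0) < \<epsilon>} \<subseteq> {x \<in> GS t s. norm (u x) < 1}"
    by (elim exE conjE) (rule that)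
  have "norm (u \<phi>) \<le> (2 / \<epsilon>) * GS_norm t s h \<phi>" if \<phi>: "\<phi> \<in> GS t s" for \<phi>
  proof (rule field_le_epsilon)
    fix e :: real assume e: "e > 0"
    let ?N = "GS_norm t s h \<phi>"
    have N: "?N \<ge> 0" by (rule GS_norm_nonneg[OF GS_banach[OF \<phi> h(1)] h(1)])
    define b where "b = 2 / \<epsilon> * ?N + e"
    have b: "b > 0" using N e h by (simp add: b_def add_nonneg_pos)
    let ?f = "\<lambda>x. of_real (1 / b) * \<phi> x + 0 * \<phi> x"
    have "GS_norm t s h ?f \<le> norm (complex_of_real (1 / b)) * ?N + norm (0::complex) * ?N"
      by (rule GS_norm_lincomb[OF t h(1) \<phi> \<phi>])
    also have "\<dots> = ?N / b" using b by (simp add: norm_divide)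
    also have "\<dots> < \<epsilon>"
    proof -
      have "\<epsilon> * b = 2 * ?N + \<epsilon> * e" using h(2) by (simp add: b_def field_simps)
      then have "?N < \<epsilon> * b" using N mult_pos_pos[OF h(2) e] by linarith
      then show ?thesis using b by (simp add: field_simps)
    qed
    finally have "GS_norm t s h (\<lambda>x. ?f x - 0) < \<epsilon>" by simp
    moreover have "?f \<in> GS t s" by (rule GS_lincomb[OF t \<phi> \<phi>])
    ultimately have "?f \<in> {g \<in> GS t s. GS_norm t s h (\<lambda>x. g x - 0) < \<epsilon>}" by simp
    then have "norm (u ?f) < 1" using h(3) by blast
    moreover have "u ?f = of_real (1 / b) * u \<phi>" unfolding lc[OF \<phi> \<phi>] by simp
    ultimately have "norm (u \<phi>) < b" using b by (simp add: norm_mult norm_divide)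
    then show "norm (u \<phi>) \<le> 2 / \<epsilon> * ?N + e" unfolding b_def by (rule less_imp_le)
  qed
  then show ?thesis unfolding bfun_def using lin h(1) by blast
qed

lemma bfun_imp_GS_dual:
  fixes u :: "('a::euclidean_space \<Rightarrow> complex) \<Rightarrow> complex"
  assumes t: "t > 0" and u: "bfun t s u"
  shows "(\<lambda>\<phi>. if \<phi> \<in> GS t s then u \<phi> else 0) \<in> GS_dual t s"
proof -
  let ?v = "\<lambda>\<phi>. if \<phi> \<in> GS t s then u \<phi> else 0"
  obtain h C where h: "h > 0" "C \<ge> 0" "\<And>\<phi>. \<phi> \<in> GS t s \<Longrightarrow> norm (u \<phi>) \<le> C * GS_norm t s h \<phi>"
    using bfun_bound[OF u] by blast
  have "clinear_functional_on (GS t s) ?v"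
    unfolding clinear_functional_on_def by (auto simp: GS_lincomb[OF t] bfun_lincomb[OF u])
  moreover have "continuous_map (GS_topology t s) euclidean ?v"
    unfolding continuous_map_def topspace_GS_topology[OF t]
  proof (intro conjI allI impI)
    fix V :: "complex set" assume "openin euclidean V"
    then have V: "open V" by simp
    show "openin (GS_topology t s) {x \<in> GS t s. ?v x \<in> V}"
    proof (rule openin_GS_topologyI[OF t])
      fix f assume f: "f \<in> {x \<in> GS t s. ?v x \<in> V}"
      then have fG: "f \<in> GS t s" and "u f \<in> V" by auto
      then obtain \<epsilon> where e: "\<epsilon> > 0" "ball (u f) \<epsilon> \<subseteq> V" using V by (meson openE)
      have "u g \<in> V" if g: "g \<in> GS t s" and n: "GS_norm t s h (\<lambda>x. g x - f x) < \<epsilon> / (C + 1)" for g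
      proof -
        have "u g - u f = u (\<lambda>x. g x - f x)"
          using bfun_lincomb[OF u g fG, of 1 "-1"] by simp
        then have "norm (u g - u f) \<le> C * GS_norm t s h (\<lambda>x. g x - f x)"
          using h(3)[OF GS_diff[OF t g fG]] by simp
        also have "\<dots> \<le> C * (\<epsilon> / (C + 1))" using n h(2) by (intro mult_left_mono) auto
        also have "\<dots> < \<epsilon>" using e(1) h(2) mult_nonneg_nonneg[of C \<epsilon>] by (simp add: field_simps add_nonneg_pos)
        finally show ?thesis using e(2) by (auto simp: dist_norm norm_minus_commute)
      qed
      then have "{g \<in> GS t s. GS_norm t s h (\<lambda>x. g x - f x) < \<epsilon> / (C + 1)} \<subseteq> {x \<in> GS t s. ?v x \<in> V}" by auto
      moreover have "\<epsilon> / (C + 1) > 0" using e h(2) by simp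
      ultimately show "\<exists>h>0. \<exists>\<epsilon>>0. {g \<in> GS t s. GS_norm t s h (\<lambda>x. g x - f x) < \<epsilon>} \<subseteq> {x \<in> GS t s. ?v x \<in> V}"
        using h(1) by blast
    qed auto
  qed auto
  ultimately show ?thesis unfolding GS_dual_def by simp
qed

lemma GS_embed_dual:
  assumes "t > 0" "f \<in> GS t s" shows "GS_embed t s f \<in> GS_dual t s"
  unfolding GS_embed_def by (rule bfun_imp_GS_dual[OF assms(1) bfun_pairing[OF assms]])

lemma bounded_operator_continuous:
  fixes T :: "('a::euclidean_space \<Rightarrow> complex) \<Rightarrow> 'a \<Rightarrow> complex"
  assumes t: "t > 0" and TG: "\<And>f. f \<in> GS t s \<Longrightarrow> T f \<in> GS t s"
    and lin: "\<And>f g a b. f \<in> GS t s \<Longrightarrow> g \<in> GS t s \<Longrightarrow> T (\<lambda>x. a * f x + b * g x) = (\<lambda>y. a * T f y + b * T g y)"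
    and bd: "\<And>h. h > 0 \<Longrightarrow> \<exists>h'>0. \<exists>C. \<forall>f\<in>GS t s. GS_norm t s h (T f) \<le> C * GS_norm t s h' f"
  shows "continuous_map (GS_topology t s) (GS_topology t s) T"
  unfolding continuous_map_def topspace_GS_topology[OF t]
proof (intro conjI allI impI)
  show "T \<in> GS t s \<rightarrow> GS t s" using TG by auto
  fix V :: "('a \<Rightarrow> complex) set" assume V: "openin (GS_topology t s) V"
  show "openin (GS_topology t s) {x \<in> GS t s. T x \<in> V}"
  proof (rule openin_GS_topologyI[OF t])
    fix f assume f: "f \<in> {x \<in> GS t s. T x \<in> V}"
    then have fG: "f \<in> GS t s" and "T f \<in> V" by auto
    from openin_GS_topology_imp[OF t V this(2)] obtain h \<epsilon> where
      h: "h > 0" "\<epsilon> > 0" "{g \<in> GS t s. GS_norm t s h (\<lambda>x. g x - T f x) < \<epsilon>} \<subseteq> V" by blast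
    obtain h' C where h': "h' > 0" "\<And>f. f \<in> GS t s \<Longrightarrow> GS_norm t s h (T f) \<le> C * GS_norm t s h' f" using bd[OF h(1)] by blast
    have "T g \<in> V" if g: "g \<in> GS t s" and n: "GS_norm t s h' (\<lambda>x. g x - f x) < \<epsilon> / (\<bar>C\<bar> + 1)" for g
    proof -
      have d: "(\<lambda>x. g x - f x) \<in> GS t s" by (rule GS_diff[OF t g fG])
      have n0: "GS_norm t s h' (\<lambda>x. g x - f x) \<ge> 0" by (rule GS_norm_nonneg[OF GS_banach[OF d h'(1)] h'(1)])
      have "T (\<lambda>x. g x - f x) = (\<lambda>x. T g x - T f x)" using lin[OF g fG, of 1 "-1"] by simp
      then have "GS_norm t s h (\<lambda>x. T g x - T f x) \<le> C * GS_norm t s h' (\<lambda>x. g x - f x)" using h'(2)[OF d] by simp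
      also have "\<dots> \<le> \<bar>C\<bar> * (\<epsilon> / (\<bar>C\<bar> + 1))" using n n0 by (intro mult_mono) auto
      also have "\<dots> < \<epsilon>" using h(2) mult_nonneg_nonneg[of "\<bar>C\<bar>" \<epsilon>] by (simp add: field_simps add_nonneg_pos)
      finally show ?thesis using h(3) TG[OF g] by blast
    qed
    then have "{g \<in> GS t s. GS_norm t s h' (\<lambda>x. g x - f x) < \<epsilon> / (\<bar>C\<bar> + 1)} \<subseteq> {x \<in> GS t s. T x \<in> V}" by auto
    moreover have "\<epsilon> / (\<bar>C\<bar> + 1) > 0" using h by simp
    ultimately show "\<exists>h>0. \<exists>\<epsilon>>0. {g \<in> GS t s. GS_norm t s h (\<lambda>x. g x - f x) < \<epsilon>} \<subseteq> {x \<in> GS t s. T x \<in> V}"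
      using h'(1) by blast
  qed auto
qed

subsection \<open>Weak density of test functions\<close>

text \<open>
  A weak neighbourhood only tests finitely many functions \<open>\<phi>\<close>. A functional can be matched on these by
  a test function: Gram--Schmidt for the \<open>L\<^sup>2\<close> inner product. The second conclusion says that \<open>cnj f\<close>
  is in the span of \<open>S\<close>, in the dual form that the induction needs.
\<close>

lemma interpolation:
  fixes S :: "('a::euclidean_space \<Rightarrow> complex) set" and \<psi> :: "'a \<Rightarrow> complex"
  assumes t: "t > 0" and fin: "finite S" and S: "S \<subseteq> GS t s" and ne: "\<psi> \<in> GS t s"
    and u: "clinear_functional_on (GS t s) u"
  shows "\<exists>f\<in>GS t s. (\<forall>\<phi>\<in>S. (LINT y|lborel. f y * \<phi> y) = u \<phi>) \<and>
    (\<forall>v. clinear_functional_on (GS t s) v \<longrightarrow> (\<forall>\<phi>\<in>S. v \<phi> = 0) \<longrightarrow> v (\<lambda>y. cnj (f y)) = 0)"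
  using fin S u
proof (induction S arbitrary: u rule: finite_induct)
  case empty
  have "v (\<lambda>y. cnj 0) = 0" if "clinear_functional_on (GS t s) v" for v :: "('a \<Rightarrow> complex) \<Rightarrow> complex"
  proof -
    have "v (\<lambda>x. 0 * \<psi> x + 0 * \<psi> x) = 0 * v \<psi> + 0 * v \<psi>"
      using that ne unfolding clinear_functional_on_def by blast
    then show ?thesis by simp
  qed
  then show ?case using GS_zero[OF t ne] by (intro bexI[of _ "\<lambda>x. 0"]) auto
next
  case (insert \<phi> S)
  have \<phi>: "\<phi> \<in> GS t s" and S: "S \<subseteq> GS t s" using insert by auto
  have lc: "v (\<lambda>x. a * p x + b * q x) = a * v p + b * v q"
    if "clinear_functional_on (GS t s) v" "p \<in> GS t s" "q \<in> GS t s" for v :: "('a \<Rightarrow> complex) \<Rightarrow> complex" and a b p q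
    using that unfolding clinear_functional_on_def by blast
  have pair: "clinear_functional_on (GS t s) (\<lambda>g. LINT y|lborel. f y * g y)" if "f \<in> GS t s" for f
    using bfun_pairing[OF t that] unfolding bfun_def by blast
  obtain f where f: "f \<in> GS t s" "\<forall>\<theta>\<in>S. (LINT y|lborel. f y * \<theta> y) = u \<theta>"
    "\<And>v. clinear_functional_on (GS t s) v \<Longrightarrow> \<forall>\<theta>\<in>S. v \<theta> = 0 \<Longrightarrow> v (\<lambda>y. cnj (f y)) = 0"
    using insert.IH[OF S insert.prems(2)] by blast
  \<comment> \<open>\<open>cnj p\<close> is the orthogonal projection of \<open>\<phi>\<close> to the span of \<open>S\<close>, and \<open>q\<close> the remainder.\<close>
  obtain p where p: "p \<in> GS t s" "\<forall>\<theta>\<in>S. (LINT y|lborel. p y * \<theta> y) = (LINT y|lborel. cnj (\<phi> y) * \<theta> y)"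
    "\<And>v. clinear_functional_on (GS t s) v \<Longrightarrow> \<forall>\<theta>\<in>S. v \<theta> = 0 \<Longrightarrow> v (\<lambda>y. cnj (p y)) = 0"
    using insert.IH[OF S pair[OF GS_cnj[OF \<phi>]]] by blast
  have cp: "(\<lambda>y. cnj (p y)) \<in> GS t s" by (rule GS_cnj[OF p(1)])
  define q where "q = (\<lambda>y. 1 * \<phi> y + (- 1) * cnj (p y))"
  have q: "q \<in> GS t s" unfolding q_def by (intro GS_lincomb t \<phi> cp)
  have cq: "(\<lambda>y. cnj (q y)) \<in> GS t s" by (rule GS_cnj[OF q])
  have orth: "(LINT y|lborel. cnj (q y) * \<theta> y) = 0" if "\<theta> \<in> S" for \<theta>
  proof -
    have \<theta>: "\<theta> \<in> GS t s" using that S by blast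
    have "(LINT y|lborel. cnj (q y) * \<theta> y) = (LINT y|lborel. cnj (\<phi> y) * \<theta> y - p y * \<theta> y)"
      by (simp add: q_def algebra_simps)
    also have "\<dots> = (LINT y|lborel. cnj (\<phi> y) * \<theta> y) - (LINT y|lborel. p y * \<theta> y)"
      by (intro Bochner_Integration.integral_diff GS_mult_integrable[OF t, where s = s] GS_cnj \<phi> \<theta> p(1))
    finally show ?thesis using p(2) that by simp
  qed
  define w where "w = (\<lambda>g. (LINT y|lborel. f y * g y) - u g)"
  have w: "clinear_functional_on (GS t s) w"
    unfolding clinear_functional_on_def w_def
    using lc[OF pair[OF f(1)]] lc[OF insert.prems(2)] by (auto simp: algebra_simps)
  have wp: "w (\<lambda>y. cnj (p y)) = 0" using f(2) by (intro p(3)[OF w]) (simp add: w_def)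
  have vq: "v q = 0" if v: "clinear_functional_on (GS t s) v" "\<forall>\<theta>\<in>insert \<phi> S. v \<theta> = 0" for v
    unfolding q_def lc[OF v(1) \<phi> cp] using p(3)[OF v(1)] v(2) by simp
  define N where "N = (LINT y|lborel. cnj (q y) * \<phi> y)"
  define c where "c = (if q = (\<lambda>x. 0) then 0 else - w \<phi> / N)"
  define g where "g = (\<lambda>y. 1 * f y + c * cnj (q y))"
  have gG: "g \<in> GS t s" unfolding g_def by (intro GS_lincomb t f(1) cq)
  have g: "(LINT y|lborel. g y * \<theta> y) = (LINT y|lborel. f y * \<theta> y) + c * (LINT y|lborel. cnj (q y) * \<theta> y)"
    if "\<theta> \<in> GS t s" for \<theta>
  proof -
    have "(LINT y|lborel. g y * \<theta> y) = (LINT y|lborel. f y * \<theta> y + c * (cnj (q y) * \<theta> y))"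
      by (simp add: g_def algebra_simps)
    also have "\<dots> = (LINT y|lborel. f y * \<theta> y) + c * (LINT y|lborel. cnj (q y) * \<theta> y)"
      using GS_mult_integrable[OF t f(1) that] GS_mult_integrable[OF t cq that] by simp
    finally show ?thesis .
  qed
  have "(LINT y|lborel. g y * \<phi> y) = u \<phi>"
  proof (cases "q = (\<lambda>x. 0)")
    case True
    then have "\<phi> = (\<lambda>y. cnj (p y))" unfolding q_def by (simp add: fun_eq_iff)
    then have "w \<phi> = 0" using wp by simp
    then show ?thesis unfolding g[OF \<phi>] using True by (simp add: c_def w_def)
  next
    case False
    have "N = (LINT y|lborel. cnj (q y) * q y + cnj (q y) * cnj (p y))"
      unfolding N_def by (simp add: q_def algebra_simps)
    also have "\<dots> = (LINT y|lborel. cnj (q y) * q y) + (LINT y|lborel. cnj (q y) * cnj (p y))"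
      by (intro Bochner_Integration.integral_add GS_mult_integrable[OF t, where s = s] cq q cp)
    also have "(LINT y|lborel. cnj (q y) * cnj (p y)) = 0"
      using p(3)[OF pair[OF cq]] orth by simp
    also have "(LINT y|lborel. cnj (q y) * q y) = (LINT y|lborel. complex_of_real ((norm (q y))\<^sup>2))"
      unfolding complex_norm_square by (simp add: mult.commute)
    also have "\<dots> = of_real (LINT y|lborel. (norm (q y))\<^sup>2)" by (rule integral_complex_of_real)
    finally have "N \<noteq> 0" using GS_square_integral_pos[OF t q False] by simp
    then show ?thesis unfolding g[OF \<phi>] N_def[symmetric] using False by (simp add: c_def w_def)
  qed
  moreover have "(LINT y|lborel. g y * \<theta> y) = u \<theta>" if "\<theta> \<in> S" for \<theta>
  proof -
    have "\<theta> \<in> GS t s" using that S by blast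
    from g[OF this] show ?thesis using orth[OF that] f(2) that by simp
  qed
  moreover have "v (\<lambda>y. cnj (g y)) = 0" if v: "clinear_functional_on (GS t s) v" "\<forall>\<theta>\<in>insert \<phi> S. v \<theta> = 0" for v
  proof -
    have "(\<lambda>y. cnj (g y)) = (\<lambda>y. 1 * cnj (f y) + cnj c * q y)" by (simp add: g_def)
    then have "v (\<lambda>y. cnj (g y)) = 1 * v (\<lambda>y. cnj (f y)) + cnj c * v q"
      by (simp only: lc[OF v(1) GS_cnj[OF f(1)] q])
    then show ?thesis using f(3)[OF v(1)] v(2) vq[OF v] by simp
  qed
  ultimately show ?case using gG by blast
qed

lemma openin_GS_dual_topology_imp:
  fixes U :: "(('a::euclidean_space \<Rightarrow> complex) \<Rightarrow> complex) set"
  assumes U: "openin (GS_dual_topology t s) U" and u: "u \<in> U"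
  shows "\<exists>S. finite S \<and> S \<subseteq> GS t s \<and> (\<forall>v\<in>GS_dual t s. (\<forall>\<phi>\<in>S. v \<phi> = u \<phi>) \<longrightarrow> v \<in> U)"
proof -
  have "\<forall>u\<in>U. \<exists>S. finite S \<and> S \<subseteq> GS t s \<and> (\<forall>v\<in>GS_dual t s. (\<forall>\<phi>\<in>S. v \<phi> = u \<phi>) \<longrightarrow> v \<in> U)"
    using openin_topology_generated_by[OF U[unfolded GS_dual_topology_def]]
  proof (induction rule: generate_topology_on.induct)
    case Empty
    then show ?case by simp
  next
    case (Int A B)
    show ?case
    proof
      fix u assume u: "u \<in> A \<inter> B"
      obtain S1 where 1: "finite S1" "S1 \<subseteq> GS t s" "\<And>v. v \<in> GS_dual t s \<Longrightarrow> \<forall>\<phi>\<in>S1. v \<phi> = u \<phi> \<Longrightarrow> v \<in> A"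
        using bspec[OF Int.IH(1), of u] u by auto
      obtain S2 where 2: "finite S2" "S2 \<subseteq> GS t s" "\<And>v. v \<in> GS_dual t s \<Longrightarrow> \<forall>\<phi>\<in>S2. v \<phi> = u \<phi> \<Longrightarrow> v \<in> B"
        using bspec[OF Int.IH(2), of u] u by auto
      have "v \<in> A \<inter> B" if "v \<in> GS_dual t s" "\<forall>\<phi>\<in>S1 \<union> S2. v \<phi> = u \<phi>" for v
        using 1(3)[OF that(1)] 2(3)[OF that(1)] that(2) by simp
      then show "\<exists>S. finite S \<and> S \<subseteq> GS t s \<and> (\<forall>v\<in>GS_dual t s. (\<forall>\<phi>\<in>S. v \<phi> = u \<phi>) \<longrightarrow> v \<in> A \<inter> B)"
        using 1(1,2) 2(1,2) by (intro exI[of _ "S1 \<union> S2"] conjI) simp_all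
    qed
  next
    case (UN \<K>)
    show ?case
    proof
      fix u assume "u \<in> \<Union>\<K>"
      then obtain A where A: "A \<in> \<K>" "u \<in> A" by blast
      from bspec[OF UN.IH[OF A(1)] A(2)] obtain S where S: "finite S" "S \<subseteq> GS t s"
        "\<forall>v\<in>GS_dual t s. (\<forall>\<phi>\<in>S. v \<phi> = u \<phi>) \<longrightarrow> v \<in> A" by (elim exE conjE) (rule that)
      show "\<exists>S. finite S \<and> S \<subseteq> GS t s \<and> (\<forall>v\<in>GS_dual t s. (\<forall>\<phi>\<in>S. v \<phi> = u \<phi>) \<longrightarrow> v \<in> \<Union>\<K>)"
        using S A(1) by (intro exI[of _ S] conjI) auto
    qed
  next
    case (Basis A)
    then obtain u0 \<phi> \<epsilon> where A: "A = {v \<in> GS_dual t s. norm (v \<phi> - u0 \<phi>) < \<epsilon>}" "\<phi> \<in> GS t s"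
      unfolding mem_Collect_eq by (elim exE conjE) (rule that)
    show ?case
      unfolding A(1) using A(2) by (intro ballI exI[of _ "{\<phi>}"] conjI) simp_all
  qed
  with u show ?thesis by blast
qed

lemma openin_GS_dual_evaluation:
  fixes \<phi> :: "'a::euclidean_space \<Rightarrow> complex"
  assumes \<phi>: "\<phi> \<in> GS t s"
  shows "openin (GS_dual_topology t s) {v \<in> GS_dual t s. norm (v \<phi> - a) < \<epsilon>}"
proof (subst openin_subopen, intro ballI)
  fix u assume u: "u \<in> {v \<in> GS_dual t s. norm (v \<phi> - a) < \<epsilon>}"
  let ?\<delta> = "\<epsilon> - norm (u \<phi> - a)"
  let ?B = "{v \<in> GS_dual t s. norm (v \<phi> - u \<phi>) < ?\<delta>}"
  have "openin (GS_dual_topology t s) ?B"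
    unfolding GS_dual_topology_def
    by (rule topology_generated_by_Basis, rule CollectI, rule exI[of _ u], rule exI[of _ \<phi>], rule exI[of _ ?\<delta>])
      (use u \<phi> in simp)
  moreover have "?B \<subseteq> {v \<in> GS_dual t s. norm (v \<phi> - a) < \<epsilon>}"
  proof
    fix v assume "v \<in> ?B"
    then show "v \<in> {v \<in> GS_dual t s. norm (v \<phi> - a) < \<epsilon>}"
      using norm_triangle_ineq[of "v \<phi> - u \<phi>" "u \<phi> - a"] by simp
  qed
  ultimately show "\<exists>T. openin (GS_dual_topology t s) T \<and> u \<in> T \<and> T \<subseteq> {v \<in> GS_dual t s. norm (v \<phi> - a) < \<epsilon>}"
    using u by (intro exI[of _ ?B]) auto
qed

lemma topspace_GS_dual_topology:
  fixes \<psi> :: "'a::euclidean_space \<Rightarrow> complex"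
  assumes "\<psi> \<in> GS t s"
  shows "topspace (GS_dual_topology t s) = (GS_dual t s :: (('a \<Rightarrow> complex) \<Rightarrow> complex) set)"
proof
  show "topspace (GS_dual_topology t s) \<subseteq> (GS_dual t s :: (('a \<Rightarrow> complex) \<Rightarrow> complex) set)"
    unfolding GS_dual_topology_def by auto
  show "(GS_dual t s :: (('a \<Rightarrow> complex) \<Rightarrow> complex) set) \<subseteq> topspace (GS_dual_topology t s)"
  proof
    fix u :: "('a \<Rightarrow> complex) \<Rightarrow> complex" assume "u \<in> GS_dual t s"
    then have "u \<in> {v \<in> GS_dual t s. norm (v \<psi> - u \<psi>) < 1}" by simp
    then show "u \<in> topspace (GS_dual_topology t s)"
      using openin_subset[OF openin_GS_dual_evaluation[OF assms]] by (rule subsetD[rotated])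
  qed
qed

text \<open>
  Every weak neighbourhood of \<open>u\<close> contains a test function, and two continuous operators that agree
  on test functions therefore have arbitrarily close values at \<open>u\<close>.
\<close>

lemma continuous_dual_extension_unique:
  fixes \<psi> :: "'a::euclidean_space \<Rightarrow> complex" and u :: "('a \<Rightarrow> complex) \<Rightarrow> complex"
  assumes t: "t > 0" and ne: "\<psi> \<in> GS t s"
    and E: "continuous_dual_extension t s T E" and E': "continuous_dual_extension t s T E'" and u: "u \<in> GS_dual t s"
  shows "E' u = E u"
proof
  fix \<phi> :: "'a \<Rightarrow> complex"
  have top: "topspace (GS_dual_topology t s) = (GS_dual t s :: (('a \<Rightarrow> complex) \<Rightarrow> complex) set)"
    by (rule topspace_GS_dual_topology[OF ne])
  have cont: "continuous_map (GS_dual_topology t s) (GS_dual_topology t s) E"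
    "continuous_map (GS_dual_topology t s) (GS_dual_topology t s) E'"
    and ext: "\<And>f. f \<in> GS t s \<Longrightarrow> E (GS_embed t s f) = T f" "\<And>f. f \<in> GS t s \<Longrightarrow> E' (GS_embed t s f) = T f"
    using E E' unfolding continuous_dual_extension_def by auto
  have in_dual: "F u \<in> GS_dual t s" if "continuous_map (GS_dual_topology t s) (GS_dual_topology t s) F"
    for F :: "(('a \<Rightarrow> complex) \<Rightarrow> complex) \<Rightarrow> ('a \<Rightarrow> complex) \<Rightarrow> complex"
    using that u unfolding continuous_map_def top by auto
  show "E' u \<phi> = E u \<phi>"
  proof (cases "\<phi> \<in> GS t s")
    case False
    then show ?thesis using in_dual[OF cont(1)] in_dual[OF cont(2)] unfolding GS_dual_def by simp
  next
    case \<phi>: True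
    have "norm (E' u \<phi> - E u \<phi>) \<le> 0 + \<epsilon>" if e: "\<epsilon> > 0" for \<epsilon>
    proof -
      define W where "W F = {v \<in> GS_dual t s. F v \<in> {w \<in> GS_dual t s. norm (w \<phi> - F u \<phi>) < \<epsilon> / 2}}"
        for F :: "(('a \<Rightarrow> complex) \<Rightarrow> complex) \<Rightarrow> ('a \<Rightarrow> complex) \<Rightarrow> complex"
      have W: "openin (GS_dual_topology t s) (W F)" "u \<in> W F"
        if F: "continuous_map (GS_dual_topology t s) (GS_dual_topology t s) F"
        for F :: "(('a \<Rightarrow> complex) \<Rightarrow> complex) \<Rightarrow> ('a \<Rightarrow> complex) \<Rightarrow> complex"
        using openin_continuous_map_preimage[OF F openin_GS_dual_evaluation[OF \<phi>, of "F u \<phi>" "\<epsilon> / 2"]]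
          u in_dual[OF F] e unfolding W_def top by auto
      have "openin (GS_dual_topology t s) (W E \<inter> W E')" using W(1)[OF cont(1)] W(1)[OF cont(2)] by (rule openin_Int)
      moreover have "u \<in> W E \<inter> W E'" using W(2)[OF cont(1)] W(2)[OF cont(2)] by blast
      ultimately have "\<exists>S. finite S \<and> S \<subseteq> GS t s \<and> (\<forall>v\<in>GS_dual t s. (\<forall>\<phi>\<in>S. v \<phi> = u \<phi>) \<longrightarrow> v \<in> W E \<inter> W E')"
        by (rule openin_GS_dual_topology_imp)
      then obtain S where S: "finite S" "S \<subseteq> GS t s" "\<And>v. v \<in> GS_dual t s \<Longrightarrow> \<forall>\<phi>\<in>S. v \<phi> = u \<phi> \<Longrightarrow> v \<in> W E \<inter> W E'"
        by blast
      have "clinear_functional_on (GS t s) u" using u unfolding GS_dual_def by simp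
      from interpolation[OF t S(1,2) ne this] obtain f where f: "f \<in> GS t s" "\<forall>\<theta>\<in>S. (LINT y|lborel. f y * \<theta> y) = u \<theta>"
        by blast
      have "\<forall>\<theta>\<in>S. GS_embed t s f \<theta> = u \<theta>" using f(2) S(2) by (auto simp: GS_embed_def)
      from S(3)[OF GS_embed_dual[OF t f(1)] this] have "norm (T f \<phi> - E u \<phi>) < \<epsilon> / 2" "norm (T f \<phi> - E' u \<phi>) < \<epsilon> / 2"
        unfolding W_def using ext[OF f(1)] by auto
      then have "norm ((T f \<phi> - E u \<phi>) - (T f \<phi> - E' u \<phi>)) < \<epsilon>"
        by (intro order_le_less_trans[OF norm_triangle_ineq4]) simp
      then show ?thesis by simp
    qed
    then have "norm (E' u \<phi> - E u \<phi>) \<le> 0" by (rule field_le_epsilon)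
    then show ?thesis by simp
  qed
qed

section \<open>The operator and its transpose\<close>

text \<open>
  Composition with a continuous operator \<open>T\<close> on test functions is weakly continuous, because evaluation of
  \<open>u \<circ> T\<close> at \<open>\<phi>\<close> is evaluation of \<open>u\<close> at \<open>T \<phi>\<close>. This extends to the dual the operator whose transpose is \<open>T\<close>.
\<close>

lemma transpose_continuous:
  fixes T :: "('a::euclidean_space \<Rightarrow> complex) \<Rightarrow> 'a \<Rightarrow> complex" and \<psi> :: "'a \<Rightarrow> complex"
  assumes t: "t > 0" and \<psi>: "\<psi> \<in> GS t s" and T_GS: "\<And>f. f \<in> GS t s \<Longrightarrow> T f \<in> GS t s"
    and T_linear: "\<And>f g a b. f \<in> GS t s \<Longrightarrow> g \<in> GS t s \<Longrightarrow> T (\<lambda>x. a * f x + b * g x) = (\<lambda>y. a * T f y + b * T g y)"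
    and T_bound: "\<And>h. h > 0 \<Longrightarrow> \<exists>h'>0. \<exists>C. \<forall>f\<in>GS t s. GS_norm t s h (T f) \<le> C * GS_norm t s h' f"
  defines "E \<equiv> \<lambda>u \<phi>. if \<phi> \<in> GS t s then u (T \<phi>) else 0"
  shows "clinear_on (GS_dual t s) E"
    and "continuous_map (GS_dual_topology t s) (GS_dual_topology t s) E"
proof -
  have T_cont: "continuous_map (GS_topology t s) (GS_topology t s) T"
    by (rule bounded_operator_continuous[OF t T_GS T_linear T_bound])
  have E_dual: "E u \<in> GS_dual t s" if u: "u \<in> GS_dual t s" for u
  proof -
    have "clinear_functional_on (GS t s) (E u)"
      unfolding clinear_functional_on_def E_def
      by (simp add: GS_lincomb[OF t] T_linear bfun_lincomb[OF GS_dual_imp_bfun[OF t u \<psi>]] T_GS)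
    moreover have "continuous_map (GS_topology t s) euclidean (u \<circ> T)"
      using T_cont u unfolding GS_dual_def by (intro continuous_map_compose) auto
    then have "continuous_map (GS_topology t s) euclidean (E u)"
      by (rule continuous_map_eq) (simp add: topspace_GS_topology[OF t] E_def)
    ultimately show ?thesis unfolding GS_dual_def by (simp add: E_def)
  qed
  show "clinear_on (GS_dual t s) E"
    unfolding clinear_on_def E_def by (auto simp: fun_eq_iff)
  show "continuous_map (GS_dual_topology t s) (GS_dual_topology t s) E"
    unfolding GS_dual_topology_def[where 'a = 'a]
  proof (rule continuous_on_generated_topo, unfold GS_dual_topology_def[where 'a = 'a, symmetric])
    fix U assume "U \<in> {{v \<in> GS_dual t s. norm (v \<phi> - u \<phi>) < \<epsilon>} | (u :: ('a \<Rightarrow> complex) \<Rightarrow> complex) \<phi> \<epsilon>.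
      u \<in> GS_dual t s \<and> \<phi> \<in> GS t s \<and> \<epsilon> > 0}"
    then obtain u \<phi> \<epsilon> where U: "U = {v \<in> GS_dual t s. norm (v \<phi> - u \<phi>) < \<epsilon>}" "\<phi> \<in> GS t s"
      unfolding mem_Collect_eq by (elim exE conjE) (rule that)
    have "E -` U \<inter> topspace (GS_dual_topology t s) = {v \<in> GS_dual t s. norm (v (T \<phi>) - u \<phi>) < \<epsilon>}"
      unfolding topspace_GS_dual_topology[OF \<psi>] U(1) using E_dual U(2) by (auto simp: E_def)
    then show "openin (GS_dual_topology t s) (E -` U \<inter> topspace (GS_dual_topology t s))"
      using openin_GS_dual_evaluation[OF T_GS[OF U(2)], of "u \<phi>" \<epsilon>] by simp
  next
    have "E ` topspace (GS_dual_topology t s) \<subseteq> topspace (GS_dual_topology t s)"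
      unfolding topspace_GS_dual_topology[OF \<psi>] using E_dual by blast
    then show "E ` topspace (GS_dual_topology t s) \<subseteq> \<Union> {{v \<in> GS_dual t s. norm (v \<phi> - u \<phi>) < \<epsilon>} | (u :: ('a \<Rightarrow> complex) \<Rightarrow> complex) \<phi> \<epsilon>.
      u \<in> GS_dual t s \<and> \<phi> \<in> GS t s \<and> \<epsilon> > 0}"
      unfolding GS_dual_topology_def topology_generated_by_topspace .
  qed
qed

text \<open>
  The matrix of the operator grows at most exponentially. The two hypotheses on the wave front set say
  that it is regular at the points \<open>(z, 0)\<close> and \<open>(0, w)\<close>, hence small where one variable is small compared to the
  other one. In one of these cones this makes the operator act on test functions, in the other one its transpose.
  The coefficients of \<open>\<K> u\<close> are obtained from those of \<open>u\<close> by integration against the matrix, and if \<open>z0\<close> is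
  not in the composed wave front set, at every \<open>w\<close> the matrix is regular at \<open>(z0, w)\<close> or the coefficients of \<open>u\<close> are.
\<close>

lemma kernel_operator_extension:
  fixes t s :: real
    and K :: "('a::euclidean_space \<times> 'a \<Rightarrow> complex) \<Rightarrow> complex"
    and \<psi> :: "'a \<Rightarrow> complex" and \<Psi> :: "'a \<times> 'a \<Rightarrow> complex"
  assumes t: "t > 0" and s: "s > 0" and \<psi>: "\<psi> \<in> GS t s" and \<psi>0: "\<psi> \<noteq> (\<lambda>x. 0)"
    and \<Psi>: "\<Psi> \<in> GS t s" and \<Psi>0: "\<Psi> \<noteq> (\<lambda>z. 0)" and KD: "K \<in> GS_dual t s"
    and WF1: "WF1 t s \<Psi> K = {}" and WF2: "WF2 t s \<Psi> K = {}"
  shows "continuous_operator_on_GS t s (kernel_op t s K) \<and>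
    (\<exists>E. continuous_dual_extension t s (kernel_op t s K) E \<and>
      (\<forall>u\<in>GS_dual t s. WF t s \<psi> (E u) \<subseteq> twisted_comp (WF t s \<Psi> K) (WF t s \<psi> u)))"
proof -
  have K: "bfun t s K" by (rule GS_dual_imp_bfun[OF t KD \<Psi>])
  obtain c where a: "gframe t s c (atom \<psi>)" using gframe_atom[OF t s \<psi> \<psi>0] by blast
  note ca = gframe_cnj[OF a]
  define L where "L \<phi> f = K (tensor \<phi> f)" for \<phi> f
  define \<Phi> where "\<Phi> = tensor \<psi> (\<lambda>y. cnj (\<psi> y))"
  have \<Phi>: "\<Phi> \<in> GS t s" unfolding \<Phi>_def by (rule GS_tensor(1)[OF t \<psi> GS_cnj[OF \<psi>]])
  define V where "V Z = K (\<lambda>p. cnj (atom \<Phi> Z p))" for Z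
  have L1: "bfun t s (\<lambda>\<phi>. L \<phi> f)" and L2: "bfun t s (L f)" if "f \<in> GS t s" for f
    unfolding L_def[abs_def] using bfun_tensor[OF t K that] by auto
  have LV: "L (\<lambda>y. cnj (atom \<psi> z y)) (atom \<psi> w) = V (kernel_point z w)" for z w
    unfolding L_def V_def \<Phi>_def tensor_atom ..
  \<comment> \<open>The wave front set of \<open>K\<close> may be computed with the tensor window \<open>\<Phi>\<close> instead of \<open>\<Psi>\<close>.\<close>
  have reg: "regular_at t s V Z" if "Z \<notin> WF t s \<Psi> K" "Z \<noteq> 0" for Z
    unfolding V_def[abs_def]
    by (rule regular_at_window[OF t s \<Phi> \<Psi> \<Psi>0 K]) (use that in \<open>simp add: WF_iff\<close>)
  have reg1: "regular_at t s V (kernel_point z 0)" if "z \<noteq> 0" for z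
  proof (rule reg)
    have "z \<notin> WF1 t s \<Psi> K" using WF1 by simp
    then show "kernel_point z 0 \<notin> WF t s \<Psi> K" by (simp add: WF1_def kernel_point_def case_prod_beta)
    show "kernel_point z 0 \<noteq> 0" using that by (simp add: kernel_point_def prod_eq_iff)
  qed
  have reg2: "regular_at t s V (kernel_point 0 w)" if "w \<noteq> 0" for w
  proof (rule reg)
    have "w \<notin> WF2 t s \<Psi> K" using WF2 by simp
    then show "kernel_point 0 w \<notin> WF t s \<Psi> K" by (simp add: WF2_def kernel_point_def case_prod_beta)
    show "kernel_point 0 w \<noteq> 0" using that by (simp add: kernel_point_def prod_eq_iff)
  qed
  define \<kappa> where "\<kappa> = (2::real) powr (1 / t) + 2 powr (1 / s)"
  have \<kappa>: "\<kappa> \<ge> 0" by (simp add: \<kappa>_def)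
  have rhoP: "rho t s (kernel_point z w) \<le> \<kappa> * (rho t s z + rho t s w)" for z w :: "'a \<times> 'a"
    unfolding \<kappa>_def by (rule rho_kernel_point[OF t s])
  obtain R A where R: "R > 0" "A \<ge> 0" "\<And>Z. norm (V Z) \<le> A * exp (R * rho t s Z)"
    using bfun_family_bound[OF t s K GS_family_cnj[OF GS_family_atom[OF t s \<Phi>]]] unfolding V_def by blast
  have growth: "norm (V (kernel_point z w)) \<le> A * exp (R * \<kappa> * (rho t s z + rho t s w))" for z w
  proof -
    have "R * rho t s (kernel_point z w) \<le> R * (\<kappa> * (rho t s z + rho t s w))"
      using rhoP R(1) by (intro mult_left_mono) auto
    then have "exp (R * rho t s (kernel_point z w)) \<le> exp (R * \<kappa> * (rho t s z + rho t s w))" by (simp add: mult.assoc)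
    from order_trans[OF R(3) mult_left_mono[OF this R(2)]] show ?thesis .
  qed
  have decay1: "\<exists>\<epsilon>>0. \<forall>r>0. \<exists>C. \<forall>z w. rho t s w \<le> \<epsilon> * rho t s z \<longrightarrow>
      norm (V (kernel_point z w)) \<le> C * exp (- r * rho t s z)"
    by (rule cone_decay[OF t s kernel_point_continuous(1) dil_kernel_point reg1])
  have decay2: "\<exists>\<epsilon>>0. \<forall>r>0. \<exists>C. \<forall>z w. rho t s w \<le> \<epsilon> * rho t s z \<longrightarrow>
      norm (V (kernel_point w z)) \<le> C * exp (- r * rho t s z)"
    by (rule cone_decay[OF t s kernel_point_continuous(2) dil_kernel_point reg2])
  have decay3: "\<exists>\<epsilon>>0. \<forall>r>0. \<exists>C. \<forall>z w. rho t s z \<le> \<epsilon> * rho t s w \<longrightarrow>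
      norm (V (kernel_point z w)) \<le> C * exp (- r * rho t s w)"
  proof -
    from decay2 obtain \<epsilon> where "\<epsilon> > 0" and \<epsilon>: "\<And>r. r > 0 \<Longrightarrow> \<exists>C. \<forall>z w. rho t s w \<le> \<epsilon> * rho t s z \<longrightarrow>
        norm (V (kernel_point w z)) \<le> C * exp (- r * rho t s z)"
      by blast
    have "\<exists>C. \<forall>z w. rho t s z \<le> \<epsilon> * rho t s w \<longrightarrow> norm (V (kernel_point z w)) \<le> C * exp (- r * rho t s w)"
      if "r > 0" for r
      using \<epsilon>[OF that] by blast
    with \<open>\<epsilon> > 0\<close> show ?thesis by blast
  qed
  define T where "T f = (\<lambda>y. LINT z|lborel. of_real c * L (\<lambda>y. cnj (atom \<psi> z y)) f * atom \<psi> z y)" for f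
  have g1: "\<exists>R C. \<forall>z w. norm (L (\<lambda>y. cnj (atom \<psi> z y)) (atom \<psi> w)) \<le> C * exp (R * (rho t s z + rho t s w))"
    unfolding LV using growth by blast
  note frame1 = t s a L1 L2 g1 decay1[folded LV]
  have T_GS: "T f \<in> GS t s" if "f \<in> GS t s" for f
    unfolding T_def by (rule gframe_operator(1)[OF frame1]) (use that in simp_all)
  have T_linear: "T (\<lambda>x. \<alpha> * f x + \<beta> * g x) = (\<lambda>y. \<alpha> * T f y + \<beta> * T g y)"
    if "f \<in> GS t s" "g \<in> GS t s" for f g \<alpha> \<beta>
    unfolding T_def by (rule gframe_operator(2)[OF frame1]) (use that in simp_all)
  have T_bound: "\<exists>h'>0. \<exists>C. \<forall>f\<in>GS t s. GS_norm t s h (T f) \<le> C * GS_norm t s h' f" if "h > 0" for h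
    unfolding T_def by (rule gframe_operator(3)[OF frame1]) (use that in simp_all)
  have T_pairing: "(LINT y|lborel. T f y * \<phi> y) = L \<phi> f" if "f \<in> GS t s" "\<phi> \<in> GS t s" for f \<phi>
    unfolding T_def by (rule gframe_operator(4)[OF frame1]) (use that in simp_all)
  \<comment> \<open>The transposed operator. The roles of atoms and conjugate atoms are exchanged, so that its matrix
    is the transposed matrix \<open>V (kernel_point w z)\<close>.\<close>
  define T' where "T' \<phi> = (\<lambda>y. LINT w|lborel. of_real c * L \<phi> (\<lambda>y. cnj (cnj (atom \<psi> w y))) * cnj (atom \<psi> w y))" for \<phi>
  have LV': "L (\<lambda>y. cnj (atom \<psi> w y)) (\<lambda>y. cnj (cnj (atom \<psi> z y))) = V (kernel_point w z)" for z w
    using LV[of w z] by simp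
  have g2: "\<exists>R C. \<forall>z w. norm (L (\<lambda>y. cnj (atom \<psi> w y)) (\<lambda>y. cnj (cnj (atom \<psi> z y)))) \<le> C * exp (R * (rho t s z + rho t s w))"
    unfolding LV' using growth by (metis add.commute)
  note frame2 = t s ca L2 L1 g2 decay2[folded LV']
  have T'_GS: "T' \<phi> \<in> GS t s" if "\<phi> \<in> GS t s" for \<phi>
    unfolding T'_def by (rule gframe_operator(1)[where L = "\<lambda>f \<phi>. L \<phi> f", OF frame2]) (use that in simp_all)
  have T'_linear: "T' (\<lambda>x. \<alpha> * f x + \<beta> * g x) = (\<lambda>y. \<alpha> * T' f y + \<beta> * T' g y)"
    if "f \<in> GS t s" "g \<in> GS t s" for f g \<alpha> \<beta>
    unfolding T'_def by (rule gframe_operator(2)[where L = "\<lambda>f \<phi>. L \<phi> f", OF frame2]) (use that in simp_all)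
  have T'_bound: "\<exists>h'>0. \<exists>C. \<forall>\<phi>\<in>GS t s. GS_norm t s h (T' \<phi>) \<le> C * GS_norm t s h' \<phi>" if "h > 0" for h
    unfolding T'_def by (rule gframe_operator(3)[where L = "\<lambda>f \<phi>. L \<phi> f", OF frame2]) (use that in simp_all)
  have T'_pairing: "(LINT y|lborel. T' \<phi> y * f y) = L \<phi> f" if "\<phi> \<in> GS t s" "f \<in> GS t s" for f \<phi>
    unfolding T'_def by (rule gframe_operator(4)[where L = "\<lambda>f \<phi>. L \<phi> f", OF frame2]) (use that in simp_all)
  have T'_dual: "u (T' \<phi>) = (LINT w|lborel. of_real c * L \<phi> (\<lambda>y. cnj (cnj (atom \<psi> w y))) * u (\<lambda>y. cnj (atom \<psi> w y)))"
    if "\<phi> \<in> GS t s" "bfun t s u" for u \<phi>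
    unfolding T'_def by (rule gframe_operator(5)[where L = "\<lambda>f \<phi>. L \<phi> f", OF frame2]) (use that in simp_all)
  have TK: "kernel_op t s K f = GS_embed t s (T f)" if f: "f \<in> GS t s" for f
  proof
    fix \<phi>
    show "kernel_op t s K f \<phi> = GS_embed t s (T f) \<phi>"
      using T_pairing[OF f, of \<phi>] by (simp add: kernel_op_def GS_embed_def GS_pair_def L_def tensor_def split_def)
  qed
  have cont: "continuous_operator_on_GS t s (kernel_op t s K)"
    unfolding continuous_operator_on_GS_def clinear_on_def
    by (intro exI[of _ T] conjI ballI allI T_linear TK bounded_operator_continuous[OF t T_GS T_linear T_bound])
  define E where "E u = (\<lambda>\<phi>. if \<phi> \<in> GS t s then u (T' \<phi>) else 0)" for u :: "('a \<Rightarrow> complex) \<Rightarrow> complex"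
  have bu: "bfun t s u" if "u \<in> GS_dual t s" for u :: "('a \<Rightarrow> complex) \<Rightarrow> complex"
    by (rule GS_dual_imp_bfun[OF t that \<psi>])
  note Edual = transpose_continuous[OF t \<psi> T'_GS T'_linear T'_bound, folded E_def[abs_def]]
  have Eext: "E (GS_embed t s f) = kernel_op t s K f" if f: "f \<in> GS t s" for f
  proof
    fix \<phi>
    show "E (GS_embed t s f) \<phi> = kernel_op t s K f \<phi>"
    proof (cases "\<phi> \<in> GS t s")
      case True
      have "(LINT y|lborel. f y * T' \<phi> y) = L \<phi> f" using T'_pairing[OF True f] by (simp add: mult.commute)
      then show ?thesis
        using True T'_GS[OF True]
        by (simp add: E_def kernel_op_def GS_embed_def GS_pair_def L_def tensor_def split_def)
    qed (simp add: E_def kernel_op_def)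
  qed
  have "WF t s \<psi> (E u) \<subseteq> twisted_comp (WF t s \<Psi> K) (WF t s \<psi> u)" if u: "u \<in> GS_dual t s" for u
  proof (rule subsetI, rule ccontr)
    fix z0 assume z0: "z0 \<in> WF t s \<psi> (E u)" and out: "z0 \<notin> twisted_comp (WF t s \<Psi> K) (WF t s \<psi> u)"
    have nz: "z0 \<noteq> 0" using z0 by (simp add: WF_iff)
    define B where "B w = u (\<lambda>y. cnj (atom \<psi> w y))" for w
    obtain S D where S: "S > 0" "D \<ge> 0" "\<And>w. norm (B w) \<le> D * exp (S * rho t s w)"
      using bfun_family_bound[OF t s bu[OF u] gframe_family[OF ca]] unfolding B_def by blast
    have "regular_at t s V (kernel_point z0 w) \<or> regular_at t s B w" for w
    \<comment> \<open>The point \<open>w = 0\<close> belongs to no wave front set; there the hypothesis on \<open>WF1\<close> is used.\<close>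
    proof (cases "w = 0 \<or> w \<in> WF t s \<psi> u")
      case True
      then show ?thesis
      proof
        assume w: "w \<in> WF t s \<psi> u"
        have "kernel_point z0 w \<notin> WF t s \<Psi> K"
        proof
          assume "kernel_point z0 w \<in> WF t s \<Psi> K"
          with w have "z0 \<in> twisted_comp (WF t s \<Psi> K) (WF t s \<psi> u)"
            unfolding twisted_comp_def kernel_point_def by (cases z0, cases w) auto
          with out show False ..
        qed
        moreover have "kernel_point z0 w \<noteq> 0" using nz by (auto simp: kernel_point_def prod_eq_iff)
        ultimately show ?thesis using reg by blast
      qed (use reg1[OF nz] in simp)
    next
      case False
      then show ?thesis unfolding B_def[abs_def] by (auto simp add: WF_iff)
    qed
    then have "regular_at t s (\<lambda>z. LINT w|lborel. of_real c * V (kernel_point z w) * B w) z0"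
      by (rule regular_at_composition[OF t s kernel_point_continuous(1) dil_kernel_point rhoP \<kappa> R S decay3])
    moreover have "E u (\<lambda>y. cnj (atom \<psi> z y)) = (LINT w|lborel. of_real c * V (kernel_point z w) * B w)" for z
    proof -
      have at: "(\<lambda>y. cnj (atom \<psi> z y)) \<in> GS t s" by (rule GS_family_GS[OF gframe_family[OF ca]])
      then have "E u (\<lambda>y. cnj (atom \<psi> z y)) = u (T' (\<lambda>y. cnj (atom \<psi> z y)))" by (simp add: E_def)
      also have "\<dots> = (LINT w|lborel. of_real c * L (\<lambda>y. cnj (atom \<psi> z y)) (\<lambda>y. cnj (cnj (atom \<psi> w y))) * u (\<lambda>y. cnj (atom \<psi> w y)))"
        by (rule T'_dual[OF at bu[OF u]])
      finally show ?thesis unfolding LV' B_def .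
    qed
    ultimately show False using z0 by (simp add: WF_iff)
  qed
  then show ?thesis
    using cont Edual Eext unfolding continuous_dual_extension_def by blast
qed

theorem theorem5p5:
  fixes t s :: real
    and K :: "('a::euclidean_space \<times> 'a \<Rightarrow> complex) \<Rightarrow> complex"
    and \<psi> :: "'a \<Rightarrow> complex"
    and \<Psi> :: "'a \<times> 'a \<Rightarrow> complex"
  assumes "t > 0" and "s > 0" and "t + s > 1"
    and "K \<in> GS_dual t s"
    and "\<psi> \<in> GS t s - {\<lambda>x. 0}" and "\<Psi> \<in> GS t s - {\<lambda>z. 0}"
    and "WF1 t s \<Psi> K = {}" and "WF2 t s \<Psi> K = {}"
  shows "continuous_operator_on_GS t s (kernel_op t s K) \<and>
    (\<exists>E. continuous_dual_extension t s (kernel_op t s K) E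
       \<and> (\<forall>E'. continuous_dual_extension t s (kernel_op t s K) E'
              \<longrightarrow> (\<forall>u\<in>GS_dual t s. E' u = E u))
       \<and> (\<forall>u\<in>GS_dual t s.
            WF t s \<psi> (E u) \<subseteq> twisted_comp (WF t s \<Psi> K) (WF t s \<psi> u)))"
proof -
  have \<psi>: "\<psi> \<in> GS t s" and \<psi>0: "\<psi> \<noteq> (\<lambda>x. 0)" and \<Psi>: "\<Psi> \<in> GS t s" and \<Psi>0: "\<Psi> \<noteq> (\<lambda>z. 0)"
    using assms(5,6) by auto
  from kernel_operator_extension[OF assms(1,2) \<psi> \<psi>0 \<Psi> \<Psi>0 assms(4,7,8)]
  obtain E where "continuous_operator_on_GS t s (kernel_op t s K)"
    and E: "continuous_dual_extension t s (kernel_op t s K) E"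
    and "\<And>u. u \<in> GS_dual t s \<Longrightarrow> WF t s \<psi> (E u) \<subseteq> twisted_comp (WF t s \<Psi> K) (WF t s \<psi> u)"
    by blast
  moreover have "E' u = E u" if "continuous_dual_extension t s (kernel_op t s K) E'" "u \<in> GS_dual t s" for E' u
    by (rule continuous_dual_extension_unique[OF assms(1) \<psi> E that])
  ultimately show ?thesis by blast
qed

end
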